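(* Let $i\in\{0,1\}$ and let $\lambda$ be a non-negative integer. With the graded space $M^{(i)}_\lambda=\bigoplus_{n\equiv i \bmod 2,\ n-2\ell=\lambda}M_{n,\ell}$ (sum over integers $n,\ell\ge 0$) defined in the context, graded by $\deg_2$, one has $$\operatorname{ch} M^{(i)}_\lambda=\sum_{n-2\ell=\lambda,\ n\equiv i \bmod 2}\frac{q^{n^2/4}}{(q)_n}\left(\begin{bmatrix} n\\ \ell\end{bmatrix}_q-\begin{bmatrix} n\\ \ell-1\end{bmatrix}_q\right),$$ where the sum runs over integers $n,\ell\ge0$.
   Context: Notation: $(q)_n=\prod_{j=1}^n(1-q^j)$, $\begin{bmatrix} n\\ \ell\end{bmatrix}_q=\frac{(q)_n}{(q)_\ell (q)_{n-\ell}}$ for $0\le\ell\le n$ and $0$ otherwise. For a graded vector space $W=\bigoplus_k W(k)$ with finite dimensional pieces, $\operatorname{ch}W=\sum_k q^k\dim W(k)$ (here $k$ may run over $\frac14\mathbb Z$). $R_n$ is the ring of symmetric polynomials in $x_1,\dots,x_n$ over $\mathbb C$, and $H^{(n)}=\bigoplus_{k=0}^{n-1}R_nX^k$. The exterior power $\wedge^\ell H^{(n)}$ (over $R_n$) is identified with the space of anti-symmetric polynomials $P(X_1,\dots,X_\ell|x_1,\dots,x_n)$ in $X_1,\dots,X_\ell$ of degree less than $n$ in each $X_a$ with coefficients in $R_n$, via $X^{i_1}\wedge\cdots\wedge X^{i_\ell}\mapsto\sum_{\sigma\in S_\ell}\operatorname{sgn}\sigma\,X_{\sigma(1)}^{i_1}\cdots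 X_{\sigma(\ell)}^{i_\ell}$. For $\ell\ge1$, $n\ge 2$, $U_{n,\ell}$ is the $R_n$-submodule of all $P\in\wedge^\ell H^{(n)}$ such that $P(X_1,\dots,X_{\ell-1},x^{-1}|x_1,\dots,x_{n-2},x,-x)=0$ and $P(X_1,\dots,X_{\ell-1},-x^{-1}|x_1,\dots,x_{n-2},x,-x)=0$ identically. Set $U_{n,0}=R_n$ and $U_{n,\ell}=0$ for $\ell<0$. Let $\Theta_\pm^{(n)}(X)=\prod_{j=1}^n(1\pm Xx_j)$ and $$2\,\Xi_1(X)=\Theta^{(n)}_+(X)+(-1)^{n-1}\Theta^{(n)}_-(X),$$ $$2\,\Xi_2(X_1,X_2)=\big(\Theta^{(n)}_+(X_1)\Theta^{(n)}_+(X_2)-\Theta^{(n)}_-(X_1)\Theta^{(n)}_-(X_2)\big)\frac{X_1-X_2}{X_1+X_2}+(-1)^n\big(\Theta^{(n)}_+(X_1)\Theta^{(n)}_-(X_2)-\Theta^{(n)}_+(X_2)\Theta^{(n)}_-(X_1)\big).$$ One has $\Xi_1\in U_{n,1}$ and $\Xi_2\in U_{n,2}$. Put $$M_{n,\ell}=\frac{U_{n,\ell}}{U_{n,\ell-1}\wedge\Xi_1+U_{n,\ell-2}\wedge\Xi_2}.$$ Grading: $\deg_1$ is defined by $\deg_1X_a=-1$, $\deg_1x_j=1$, and for $P\in U_{n,\ell}$ homogeneous for $\deg_1$, $\deg_2P=\frac{n^2}{4}+\deg_1P$. This induces the grading by $\deg_2$ on $M_{n,\ell}$ and on $M^{(i)}_\lambda$.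 *)

theory Defs
  imports
    "HOL-Library.Poly_Mapping"
    "HOL-Combinatorics.Permutations"
    "HOL-Computational_Algebra.Formal_Laurent_Series"
    "HOL-Analysis.Infinite_Sum"
    "HOL-Algebra.AbelCoset"
    "Jordan_Normal_Form.VS_Connect"
begin

section \<open>Polynomials in two families of variables\<close>

text \<open>The variables are $X_1, X_2, \dots$ (\<open>VX 1\<close>, \<open>VX 2\<close>, \dots) and
  $x_1, x_2, \dots$ (\<open>Vx 1\<close>, \<open>Vx 2\<close>, \dots); the index 0 is never used.\<close>

datatype var = VX nat | Vx nat

type_synonym mpoly = "(var \<Rightarrow>\<^sub>0 nat) \<Rightarrow>\<^sub>0 complex"
type_synonym laurent = "(var \<Rightarrow>\<^sub>0 int) \<Rightarrow>\<^sub>0 complex"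

text \<open>An arbitrary linear order on the variables, whose only purpose is to make \<^typ>\<open>mpoly\<close> an
  instance of \<^class>\<open>idom\<close>.\<close>

fun var_code :: "var \<Rightarrow> nat" where
  "var_code (VX a) = 2 * a"
| "var_code (Vx j) = 2 * j + 1"

lemma var_code_inject: "var_code v = var_code w \<Longrightarrow> v = w"
  by (cases v; cases w) (simp_all, presburger+)

instantiation var :: linorder
begin

definition less_eq_var :: "var \<Rightarrow> var \<Rightarrow> bool" where
  "less_eq_var v w \<longleftrightarrow> var_code v \<le> var_code w"

definition less_var :: "var \<Rightarrow> var \<Rightarrow> bool" where
  "less_var v w \<longleftrightarrow> var_code v < var_code w"

instance
  by standard (auto simp: less_eq_var_def less_var_def intro: var_code_inject)

end

definition const :: "complex \<Rightarrow> ('k::zero \<Rightarrow>\<^sub>0 complex)" where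
  "const c = Poly_Mapping.single 0 c"

definition Var :: "var \<Rightarrow> mpoly" where
  "Var v = Poly_Mapping.single (Poly_Mapping.single v 1) 1"

text \<open>The Laurent monomial $v^k$.\<close>

definition lvar :: "var \<Rightarrow> int \<Rightarrow> laurent" where
  "lvar v k = Poly_Mapping.single (Poly_Mapping.single v k) 1"

text \<open>Substitution of (ordinary or Laurent) polynomials for the variables of a polynomial.\<close>

definition poly_subst ::
    "(var \<Rightarrow> ('k::comm_monoid_add \<Rightarrow>\<^sub>0 complex)) \<Rightarrow> mpoly \<Rightarrow> ('k \<Rightarrow>\<^sub>0 complex)" where
  "poly_subst f P =
     (\<Sum>m\<in>Poly_Mapping.keys P. const (Poly_Mapping.lookup P m) *
        (\<Prod>v\<in>Poly_Mapping.keys m. f v ^ Poly_Mapping.lookup m v))"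

definition rename_X :: "(nat \<Rightarrow> nat) \<Rightarrow> mpoly \<Rightarrow> mpoly" where
  "rename_X \<sigma> = poly_subst (\<lambda>v. case v of VX a \<Rightarrow> Var (VX (\<sigma> a)) | Vx j \<Rightarrow> Var (Vx j))"

definition rename_x :: "(nat \<Rightarrow> nat) \<Rightarrow> mpoly \<Rightarrow> mpoly" where
  "rename_x \<pi> = poly_subst (\<lambda>v. case v of VX a \<Rightarrow> Var (VX a) | Vx j \<Rightarrow> Var (Vx (\<pi> j)))"

definition poly_vars :: "mpoly \<Rightarrow> var set" where
  "poly_vars P = (\<Union>m\<in>Poly_Mapping.keys P. Poly_Mapping.keys m)"

section \<open>The modules $U_{n,\ell}$\<close>

definition sym_polys :: "nat \<Rightarrow> mpoly set" where
  "sym_polys n = {P. poly_vars P \<subseteq> Vx ` {1..n} \<and> (\<forall>\<pi>. \<pi> permutes {1..n} \<longrightarrow> rename_x \<pi> P = P)}"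

text \<open>$\wedge^\ell H^{(n)}$, realised as anti-symmetric polynomials. That the coefficients with
  respect to the $X_a$ lie in $R_n$ means that the polynomial involves no $x_j$ with $j > n$ and is
  invariant under permutations of $x_1, \dots, x_n$.\<close>

definition ext_power :: "nat \<Rightarrow> nat \<Rightarrow> mpoly set" where
  "ext_power n l = {P.
     poly_vars P \<subseteq> VX ` {1..l} \<union> Vx ` {1..n} \<and>
     (\<forall>m\<in>Poly_Mapping.keys P. \<forall>a\<in>{1..l}. Poly_Mapping.lookup m (VX a) < n) \<and>
     (\<forall>\<pi>. \<pi> permutes {1..n} \<longrightarrow> rename_x \<pi> P = P) \<and>
     (\<forall>\<sigma>. \<sigma> permutes {1..l} \<longrightarrow> rename_X \<sigma> P = of_int (sign \<sigma>) * P)}"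

text \<open>The Laurent polynomial $P(X_1,\dots,X_{\ell-1}, s x^{-1} | x_1,\dots,x_{n-2}, x, -x)$, where
  $x_{n-1}$ plays the role of $x$.\<close>

definition specialize :: "complex \<Rightarrow> nat \<Rightarrow> nat \<Rightarrow> mpoly \<Rightarrow> laurent" where
  "specialize s n l =
     poly_subst ((\<lambda>v. lvar v 1)
       (VX l := const s * lvar (Vx (n - 1)) (-1), Vx n := - lvar (Vx (n - 1)) 1))"

text \<open>For $n < 2$ and $\ell \ge 1$ (a case that never contributes below) no vanishing
  condition is imposed.\<close>

definition U :: "nat \<Rightarrow> int \<Rightarrow> mpoly set" where
  "U n l =
     (if l < 0 then {0}
      else if l = 0 then sym_polys n
      else {P \<in> ext_power n (nat l).
              2 \<le> n \<longrightarrow> specialize 1 n (nat l) P = 0 \<and> specialize (-1) n (nat l) P = 0})"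

text \<open>The exterior product $\wedge^p H^{(n)} \times \wedge^q H^{(n)} \to \wedge^{p+q} H^{(n)}$ in
  terms of anti-symmetric polynomials. With the factor $1/(p!\,q!)$ the product of (the images of)
  $X^{i_1} \wedge \dots \wedge X^{i_p}$ and $X^{j_1} \wedge \dots \wedge X^{j_q}$ is
  (the image of) $X^{i_1} \wedge \dots \wedge X^{i_p} \wedge X^{j_1} \wedge \dots \wedge X^{j_q}$.\<close>

definition wedge :: "nat \<Rightarrow> nat \<Rightarrow> mpoly \<Rightarrow> mpoly \<Rightarrow> mpoly" where
  "wedge p q P Q = const (1 / (fact p * fact q)) *
     (\<Sum>\<sigma> | \<sigma> permutes {1..p + q}.
        of_int (sign \<sigma>) * rename_X \<sigma> P * rename_X (\<lambda>a. \<sigma> (p + a)) Q)"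

definition Theta_plus :: "nat \<Rightarrow> mpoly \<Rightarrow> mpoly" where
  "Theta_plus n Y = (\<Prod>j=1..n. 1 + Y * Var (Vx j))"

definition Theta_minus :: "nat \<Rightarrow> mpoly \<Rightarrow> mpoly" where
  "Theta_minus n Y = (\<Prod>j=1..n. 1 - Y * Var (Vx j))"

definition exact_quotient :: "mpoly \<Rightarrow> mpoly \<Rightarrow> mpoly" where
  "exact_quotient A B = (THE C. B * C = A)"

text \<open>The sign $(-1)^{n-1}$ is written $(-1)^{n+1}$ to avoid truncated subtraction.\<close>

definition Xi1 :: "nat \<Rightarrow> mpoly" where
  "Xi1 n = const (1/2) *
     (Theta_plus n (Var (VX 1)) + (-1) ^ (n + 1) * Theta_minus n (Var (VX 1)))"

definition Xi2 :: "nat \<Rightarrow> mpoly" where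
  "Xi2 n = (let X1 = Var (VX 1); X2 = Var (VX 2) in const (1/2) *
     (exact_quotient
        ((Theta_plus n X1 * Theta_plus n X2 - Theta_minus n X1 * Theta_minus n X2) * (X1 - X2))
        (X1 + X2)
      + (-1) ^ n * (Theta_plus n X1 * Theta_minus n X2 - Theta_plus n X2 * Theta_minus n X1)))"

lemma exact_quotient_eq:
  assumes "B dvd A" "B \<noteq> 0"
  shows "B * exact_quotient A B = A"
proof -
  from assms(1) obtain C where C: "B * C = A"
    by (auto elim: dvdE)
  have "\<exists>!C. B * C = A"
  proof (rule ex1I[of _ C])
    fix C' assume "B * C' = A"
    with C have "B * C' = B * C"
      by simp
    thus "C' = C"
      by (rule mult_left_cancel[OF assms(2), THEN iffD1])
  qed (rule C)
  thus ?thesis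
    unfolding exact_quotient_def by (rule theI')
qed

lemma Theta_step:
  fixes A B y z t :: "'a::comm_ring_1"
  shows "A * ((1 + y * t) * (1 + z * t)) - B * ((1 - y * t) * (1 - z * t)) =
    (A - B) * (1 + y * z * t * t) + (y + z) * ((A + B) * t)"
  by (simp add: algebra_simps)

lemma Theta_dvd: "Y + Z dvd Theta_plus n Y * Theta_plus n Z - Theta_minus n Y * Theta_minus n Z"
proof (induction n)
  case 0
  show ?case by (simp add: Theta_plus_def Theta_minus_def)
next
  case (Suc n)
  define t where "t = Var (Vx (Suc n))"
  define A where "A = Theta_plus n Y * Theta_plus n Z"
  define B where "B = Theta_minus n Y * Theta_minus n Z"
  have "Theta_plus (Suc n) Y * Theta_plus (Suc n) Z - Theta_minus (Suc n) Y * Theta_minus (Suc n) Z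
      = A * ((1 + Y * t) * (1 + Z * t)) - B * ((1 - Y * t) * (1 - Z * t))"
    by (simp add: Theta_plus_def Theta_minus_def A_def B_def t_def mult_ac)
  also have "\<dots> = (A - B) * (1 + Y * Z * t * t) + (Y + Z) * ((A + B) * t)"
    by (rule Theta_step)
  finally show ?case
    using Suc by (auto simp: A_def B_def)
qed

lemma Var_sum_nonzero: "Var (VX 1) + Var (VX 2) \<noteq> 0"
proof
  assume "Var (VX 1) + Var (VX 2) = 0"
  hence "Poly_Mapping.lookup (Var (VX 1) + Var (VX 2)) (Poly_Mapping.single (VX 1) 1) = 0"
    by simp
  moreover have "Poly_Mapping.single (VX 2) (1::nat) \<noteq> Poly_Mapping.single (VX 1) 1"
  proof
    assume "Poly_Mapping.single (VX 2) (1::nat) = Poly_Mapping.single (VX 1) 1"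
    hence "Poly_Mapping.keys (Poly_Mapping.single (VX 2) (1::nat)) =
           Poly_Mapping.keys (Poly_Mapping.single (VX 1) (1::nat))"
      by (rule arg_cong)
    thus False
      by simp
  qed
  ultimately show False
    by (simp add: Var_def lookup_add lookup_single)
qed

text \<open>The quotient in the definition of $\Xi_2$ exists and is unique.\<close>

lemma Xi2_spec:
  fixes n defines "X1 \<equiv> Var (VX 1)" and "X2 \<equiv> Var (VX 2)"
  shows "(X1 + X2) * (2 * Xi2 n) =
    (Theta_plus n X1 * Theta_plus n X2 - Theta_minus n X1 * Theta_minus n X2) * (X1 - X2)
    + (X1 + X2) * ((-1) ^ n *
        (Theta_plus n X1 * Theta_minus n X2 - Theta_plus n X2 * Theta_minus n X1))"
proof -
  define A where
    "A = (Theta_plus n X1 * Theta_plus n X2 - Theta_minus n X1 * Theta_minus n X2) * (X1 - X2)"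
  define B where
    "B = (-1) ^ n * (Theta_plus n X1 * Theta_minus n X2 - Theta_plus n X2 * Theta_minus n X1)"
  have half: "2 * (const (1/2) * P) = P" for P :: mpoly
  proof -
    have "const (1/2) + const (1/2) = (1 :: mpoly)"
      by (simp add: const_def single_add[symmetric])
    hence "(const (1/2) + const (1/2)) * P = P"
      by simp
    thus ?thesis
      by (simp only: mult_2 distrib_right)
  qed
  have "(X1 + X2) * exact_quotient A (X1 + X2) = A"
    unfolding A_def X1_def X2_def
    by (intro exact_quotient_eq dvd_mult2 Theta_dvd Var_sum_nonzero)
  moreover have "2 * Xi2 n = exact_quotient A (X1 + X2) + B"
    unfolding Xi2_def Let_def A_def B_def X1_def X2_def by (rule half)
  ultimately show ?thesis
    by (simp add: A_def[symmetric] B_def[symmetric] distrib_left)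
qed

section \<open>Quotients and direct sums of vector spaces\<close>

text \<open>The \<open>mult\<close> and \<open>one\<close> fields of the module records are inherited from the ring
  record and carry no meaning.\<close>

definition poly_space :: "mpoly set \<Rightarrow> (complex, mpoly) module" where
  "poly_space A = \<lparr>carrier = A, mult = (*), one = 1, zero = 0, add = (+),
     smult = (\<lambda>c P. const c * P)\<rparr>"

definition quotient_space :: "('a, 'b) module \<Rightarrow> 'b set \<Rightarrow> ('a, 'b set) module" where
  "quotient_space V D = \<lparr>carrier = a_rcosets\<^bsub>V\<^esub> D, mult = (\<lambda>_ _. D), one = D, zero = D,
     add = set_add V, smult = (\<lambda>c A. \<Union>P\<in>A. D +>\<^bsub>V\<^esub> (c \<odot>\<^bsub>V\<^esub> P))\<rparr>"

definition direct_sum_space :: "'i set \<Rightarrow> ('i \<Rightarrow> ('a, 'b) module) \<Rightarrow> ('a, 'i \<Rightarrow> 'b) module" where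
  "direct_sum_space I V =
     \<lparr>carrier = {f \<in> (\<Pi>\<^sub>E j\<in>I. carrier (V j)). finite {j\<in>I. f j \<noteq> \<zero>\<^bsub>V j\<^esub>}},
      mult = (\<lambda>_ _. \<lambda>j\<in>I. \<zero>\<^bsub>V j\<^esub>), one = (\<lambda>j\<in>I. \<zero>\<^bsub>V j\<^esub>),
      zero = (\<lambda>j\<in>I. \<zero>\<^bsub>V j\<^esub>),
      add = (\<lambda>f g. \<lambda>j\<in>I. f j \<oplus>\<^bsub>V j\<^esub> g j),
      smult = (\<lambda>c f. \<lambda>j\<in>I. c \<odot>\<^bsub>V j\<^esub> f j)\<rparr>"

section \<open>The spaces $M_{n,\ell}$ and $M^{(i)}_\lambda$\<close>

text \<open>$U_{n,\ell-1} \wedge \Xi_1 + U_{n,\ell-2} \wedge \Xi_2$\<close>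

definition Xi_span :: "nat \<Rightarrow> int \<Rightarrow> mpoly set" where
  "Xi_span n l = {wedge (nat (l - 1)) 1 P (Xi1 n) + wedge (nat (l - 2)) 2 Q (Xi2 n) | P Q.
     P \<in> U n (l - 1) \<and> Q \<in> U n (l - 2)}"

definition M_quot :: "nat \<Rightarrow> nat \<Rightarrow> (complex, mpoly set) module" where
  "M_quot n l = quotient_space (poly_space (U n (int l))) (Xi_span n (int l))"

definition weight_indices :: "nat \<Rightarrow> nat \<Rightarrow> (nat \<times> nat) set" where
  "weight_indices i lam = {(n, l). n mod 2 = i mod 2 \<and> int n - 2 * int l = int lam}"

definition M_space :: "nat \<Rightarrow> nat \<Rightarrow> (complex, nat \<times> nat \<Rightarrow> mpoly set) module" where
  "M_space i lam = direct_sum_space (weight_indices i lam) (\<lambda>(n, l). M_quot n l)"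

definition deg1_monom :: "(var \<Rightarrow>\<^sub>0 nat) \<Rightarrow> int" where
  "deg1_monom m = (\<Sum>v\<in>Poly_Mapping.keys m.
     (case v of VX _ \<Rightarrow> -1 | Vx _ \<Rightarrow> 1) * int (Poly_Mapping.lookup m v))"

definition deg2_homogeneous :: "nat \<Rightarrow> rat \<Rightarrow> mpoly \<Rightarrow> bool" where
  "deg2_homogeneous n d P \<longleftrightarrow>
     (\<forall>m\<in>Poly_Mapping.keys P. of_nat (n\<^sup>2) / 4 + of_int (deg1_monom m) = d)"

text \<open>The homogeneous component of $M^{(i)}_\lambda$ of degree $d$ with respect to $\deg_2$.\<close>

definition M_graded :: "nat \<Rightarrow> nat \<Rightarrow> rat \<Rightarrow> (complex, nat \<times> nat \<Rightarrow> mpoly set) module" where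
  "M_graded i lam d = (M_space i lam)\<lparr>carrier :=
     {f \<in> carrier (M_space i lam). \<forall>(n, l)\<in>weight_indices i lam.
        \<exists>P\<in>U n (int l). deg2_homogeneous n d P \<and>
          f (n, l) = Xi_span n (int l) +>\<^bsub>poly_space (U n (int l))\<^esub> P}\<rparr>"

section \<open>Characters\<close>

text \<open>Characters are Laurent series in the variable \<^term>\<open>fls_X\<close> $= q^{1/4}$: the homogeneous
  component of degree $k/4$ contributes to the coefficient of \<^term>\<open>fls_X ^ k\<close>.
  A family of components has a character if they are all finite dimensional and vanish
  in sufficiently negative degrees.\<close>

definition has_character :: "(rat \<Rightarrow> (complex, 'v) module) \<Rightarrow> bool" where
  "has_character W \<longleftrightarrow>
     (\<forall>d. vectorspace class_ring (W d) \<and> vectorspace.fin_dim class_ring (W d)) \<and>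
     (\<forall>\<^sub>\<infinity>k::nat. vectorspace.dim class_ring (W (of_int (- int k) / 4)) = 0)"

definition character :: "(rat \<Rightarrow> (complex, 'v) module) \<Rightarrow> rat fls" where
  "character W = Abs_fls (\<lambda>k::int. of_nat (vectorspace.dim class_ring (W (of_int k / 4))))"

definition qvar :: "rat fls" where
  "qvar = fls_X ^ 4"

definition qpoch :: "nat \<Rightarrow> rat fls" where
  "qpoch n = (\<Prod>j=1..n. 1 - qvar ^ j)"

definition qbinom :: "nat \<Rightarrow> int \<Rightarrow> rat fls" where
  "qbinom n l = (if 0 \<le> l \<and> l \<le> int n then qpoch n / (qpoch (nat l) * qpoch (n - nat l)) else 0)"

end

theory Submission
 imports Defs
  "HOL-Computational_Algebra.Fundamental_Theorem_Algebra"
begin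

text \<open>
  Evaluating at \<open>X\<^sub>a = 1 / x\<^sub>a\<close> identifies \<open>U\<^bsub>n,\<ell>\<^esub>\<close> with polynomials that are symmetric in
  \<open>x\<^sub>1, \<dots>, x\<^sub>\<ell>\<close> and in \<open>x\<^bsub>\<ell>+1\<^esub>, \<dots>, x\<^sub>n\<close>, which gives its character \<open>1 / ((q)\<^sub>\<ell> (q)\<^bsub>n-\<ell>\<^esub>)\<close> up to
  a power of \<open>q\<close>. The wedge products with \<open>\<Xi>\<^sub>1\<close> and \<open>\<Xi>\<^sub>2\<close> become operators \<open>E\<^sub>1\<close>, \<open>E\<^sub>2\<close> on functions of
  subsets. For odd \<open>k\<close> there are homotopies with \<open>{E\<^sub>1, h\<^sub>k} = e\<^sub>k\<close>, and since the \<open>e\<^sub>k\<close> form a regular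
  sequence, \<open>E\<^sub>1\<close> is exact in the relevant range; a Clifford algebra and the representation theory of
  \<open>sl\<^sub>2\<close> show that \<open>E\<^sub>2\<close> is injective modulo the image of \<open>E\<^sub>1\<close>. Hence the submodule that is divided
  out has the character of \<open>U\<^bsub>n,\<ell>-1\<^esub>\<close>.
\<close>

text \<open>A polynomial of degree less than n in each X_a is determined by its values at the n
  nodes 1 / x_j, and antisymmetry makes it vanish at repeated nodes; so it becomes a function of
  l-element subsets. Antisymmetry forces the factors x_a - x_b into these values, the vanishing
  condition the factors x_a + x_b. Dividing by them (\<open>den\<close>) leaves an arbitrary
  equivariant family of polynomials, and \<open>den\<close> has degree 0, so the grading survives.
  The denominators fail to be multiplicative by factors (x_a + x_b) / (x_a - x_b); these are the
  weights in the operators. For odd n the commutator of \<open>E2\<close> with its adjoint partner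
  \<open>F2\<close> has an extra term with \<open>E1\<close>, which is controlled on the kernel of
  \<open>E1\<close>. That suffices: with W1, W2 the two multiplications and V_l a graded piece,
  apply W1 to W1 V_{l-1} + W2 V_{l-2}. The kernel is W1 V_{l-1}, and the image W2 W1 V_{l-2} is
  isomorphic to W1 V_{l-2}. By exactness these dimensions add up to that of V_{l-1}. Both exactness
  and injectivity are available for 2 l \<le> n, that is, for \<lambda> \<ge> 0.\<close>

abbreviation (input) "pkeys \<equiv> Poly_Mapping.keys"
abbreviation (input) "coef \<equiv> Poly_Mapping.lookup"

section \<open>Evaluation of polynomials\<close>

definition ppow :: "('a => 'r::comm_semiring_1) => ('a \<Rightarrow>\<^sub>0 nat) => 'r" where
 "ppow f m = (\<Prod>w\<in>pkeys m. f w ^ coef m w)"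

lemma ppow_superset:
 assumes "finite A" "pkeys m \<subseteq> A"
 shows "ppow f m = (\<Prod>w\<in>A. f w ^ coef m w)"
 unfolding ppow_def by (rule prod.mono_neutral_left) (use assms in \<open>auto simp: in_keys_iff\<close>)

lemma ppow_0 [simp]: "ppow f 0 = 1"
 by (simp add: ppow_def)

lemma ppow_add: "ppow f (m + m') = ppow f m * ppow f m'"
proof -
 let ?A = "pkeys m \<union> pkeys m'"
 have "pkeys (m + m') \<subseteq> ?A" by (rule Poly_Mapping.keys_add)
 thus ?thesis by (simp add: ppow_superset[of ?A] lookup_add power_add prod.distrib)
qed

lemma ppow_single [simp]: "ppow f (Poly_Mapping.single w k) = f w ^ k"
 by (simp add: ppow_def)

definition ppowi :: "('a => complex) => ('a \<Rightarrow>\<^sub>0 int) => complex" where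
 "ppowi f m = (\<Prod>w\<in>pkeys m. f w powi coef m w)"

lemma ppowi_superset:
 assumes "finite A" "pkeys m \<subseteq> A"
 shows "ppowi f m = (\<Prod>w\<in>A. f w powi coef m w)"
 unfolding ppowi_def by (rule prod.mono_neutral_left) (use assms in \<open>auto simp: in_keys_iff\<close>)

lemma ppowi_0 [simp]: "ppowi f 0 = 1"
 by (simp add: ppowi_def)

lemma ppowi_add:
 assumes "!!w. f w ~= 0"
 shows "ppowi f (m + m') = ppowi f m * ppowi f m'"
proof -
 let ?A = "pkeys m \<union> pkeys m'"
 have "pkeys (m + m') \<subseteq> ?A" by (rule Poly_Mapping.keys_add)
 thus ?thesis using assms by (simp add: ppowi_superset[of ?A] lookup_add power_int_add prod.distrib)
qed

lemma ppowi_single [simp]: "ppowi f (Poly_Mapping.single w k) = f w powi k"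
 by (simp add: ppowi_def)

definition geval :: "(complex => 'r::comm_ring_1) => ('k => 'r) => ('k \<Rightarrow>\<^sub>0 complex) => 'r" where
 "geval \<kappa> \<chi> P = (\<Sum>m\<in>pkeys P. \<kappa> (coef P m) * \<chi> m)"

lemma poly_mapping_sum_single:
 "P = (\<Sum>m\<in>pkeys P. Poly_Mapping.single m (coef P m))"
 by (rule poly_mapping_eqI) (simp add: lookup_sum lookup_single when_def sum.If_cases in_keys_iff)

text \<open>Evaluation at a point, substitution of polynomials and restriction to one variable
  differ only in the ring that receives the values, so their homomorphism laws are proved
  together.\<close>

locale eval_hom =
 fixes \<kappa> :: "complex => 'r::comm_ring_1" and \<chi> :: "'k::comm_monoid_add => 'r"
 assumes \<kappa>_add: "\<kappa> (a + b) = \<kappa> a + \<kappa> b" and \<kappa>_mult: "\<kappa> (a * b) = \<kappa> a * \<kappa> b"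
  and \<kappa>_1: "\<kappa> 1 = 1" and \<chi>_0: "\<chi> 0 = 1" and \<chi>_add: "\<chi> (m + m') = \<chi> m * \<chi> m'"
begin

lemma \<kappa>_0: "\<kappa> 0 = 0"
 using \<kappa>_add[of 0 0] by simp

lemma superset:
 assumes "finite A" "pkeys P \<subseteq> A"
 shows "geval \<kappa> \<chi> P = (\<Sum>m\<in>A. \<kappa> (coef P m) * \<chi> m)"
 unfolding geval_def by (rule sum.mono_neutral_left) (use assms in \<open>auto simp: in_keys_iff \<kappa>_0\<close>)

lemma geval_add: "geval \<kappa> \<chi> (P + Q) = geval \<kappa> \<chi> P + geval \<kappa> \<chi> Q"
proof -
 let ?A = "pkeys P \<union> pkeys Q"
 have "pkeys (P + Q) \<subseteq> ?A" by (rule Poly_Mapping.keys_add)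
 thus ?thesis by (simp add: superset[of ?A] lookup_add \<kappa>_add distrib_right sum.distrib)
qed

lemma geval_0: "geval \<kappa> \<chi> 0 = 0"
 by (simp add: geval_def)

lemma geval_single: "geval \<kappa> \<chi> (Poly_Mapping.single m c) = \<kappa> c * \<chi> m"
 by (simp add: geval_def \<kappa>_0)

lemma geval_sum: "geval \<kappa> \<chi> (\<Sum>i\<in>I. P i) = (\<Sum>i\<in>I. geval \<kappa> \<chi> (P i))"
 by (induction I rule: infinite_finite_induct) (auto simp: geval_0 geval_add)

lemma geval_mult: "geval \<kappa> \<chi> (P * Q) = geval \<kappa> \<chi> P * geval \<kappa> \<chi> Q"
proof -
 let ?s = "%P m. Poly_Mapping.single m (coef P m)"
 have "P * Q = (\<Sum>m\<in>pkeys P. ?s P m) * (\<Sum>m\<in>pkeys Q. ?s Q m)"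
  by (simp add: poly_mapping_sum_single[symmetric])
 hence "geval \<kappa> \<chi> (P * Q) = (\<Sum>m\<in>pkeys P. \<Sum>m'\<in>pkeys Q.
   (\<kappa> (coef P m) * \<chi> m) * (\<kappa> (coef Q m') * \<chi> m'))"
  by (simp add: sum_product geval_sum mult_single geval_single \<kappa>_mult \<chi>_add mult_ac)
 thus ?thesis by (simp add: geval_def sum_product)
qed

lemma geval_1: "geval \<kappa> \<chi> 1 = 1"
 using geval_single[of 0 1] by (simp add: \<kappa>_1 \<chi>_0)

lemma geval_const: "geval \<kappa> \<chi> (const c) = \<kappa> c"
 unfolding const_def by (simp add: geval_single \<chi>_0)

lemma geval_uminus: "geval \<kappa> \<chi> (- P) = - geval \<kappa> \<chi> P"
 using geval_add[of P "- P"] by (simp add: geval_0 eq_neg_iff_add_eq_0 add.commute)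

lemma geval_diff: "geval \<kappa> \<chi> (P - Q) = geval \<kappa> \<chi> P - geval \<kappa> \<chi> Q"
 using geval_add[of P "- Q"] by (simp add: geval_uminus)

lemma geval_prod: "geval \<kappa> \<chi> (\<Prod>i\<in>I. P i) = (\<Prod>i\<in>I. geval \<kappa> \<chi> (P i))"
 by (induction I rule: infinite_finite_induct) (auto simp: geval_1 geval_mult)

lemma geval_power: "geval \<kappa> \<chi> (P ^ k) = geval \<kappa> \<chi> P ^ k"
 by (induction k) (auto simp: geval_1 geval_mult)

end

lemma const_add: "const (a + b) = const a + const b"
 by (simp add: const_def single_add)

lemma const_mult: "const (a * b) = (const a * const b :: 'k::comm_monoid_add \<Rightarrow>\<^sub>0 complex)"
 by (simp add: const_def mult_single)

lemma const_1 [simp]: "const 1 = 1"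
 by (simp add: const_def)

lemma const_0 [simp]: "const 0 = 0"
 by (simp add: const_def)

definition ev :: "(var => complex) => mpoly => complex" where
 "ev v = geval (%c. c) (ppow v)"

definition lev :: "(var => complex) => laurent => complex" where
 "lev v = geval (%c. c) (ppowi v)"

interpretation ev: eval_hom "%c. c" "ppow v"
 rewrites "geval (%c. c) (ppow v) = ev v"
 for v :: "var => complex" by unfold_locales (auto simp: ppow_add ev_def)

lemma poly_subst_geval: "poly_subst f = geval const (ppow f)"
 by (rule ext) (simp add: poly_subst_def geval_def ppow_def)

interpretation ps: eval_hom const "ppow f"
 rewrites "geval const (ppow f) = poly_subst f"
 for f :: "var => ('k::comm_monoid_add \<Rightarrow>\<^sub>0 complex)"
 by unfold_locales (auto simp: ppow_add const_add const_mult poly_subst_geval)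

text \<open>Negative exponents make \<open>ppowi\<close> multiplicative at points with non-zero
  coordinates, so this stays conditional where \<open>ev\<close> and \<open>poly_subst\<close> are
  global interpretations.\<close>

lemma lev_hom: "(!!w. v w ~= 0) ==> eval_hom (%c. c) (ppowi v)"
 by unfold_locales (auto simp: ppowi_add)

lemmas ev_simps [simp] = ev.geval_add ev.geval_0 ev.geval_sum ev.geval_mult ev.geval_1
 ev.geval_const ev.geval_uminus ev.geval_diff ev.geval_prod ev.geval_power

lemma ev_Var [simp]: "ev v (Var w) = v w"
 by (simp add: Var_def ev.geval_single)

lemma ev_of_int [simp]: "ev v (of_int k) = of_int k"
proof -
 have "(of_int k :: mpoly) = const (of_int k)" by (simp add: const_def)
 thus ?thesis by simp
qed

lemma ev_numeral [simp]: "ev v (numeral k) = numeral k"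
 using ev_of_int[of v "numeral k"] by simp

lemma ev_poly_subst: "ev v (poly_subst f P) = ev (%w. ev v (f w)) P"
 unfolding poly_subst_def ev_def[of "%w. ev v (f w)"] geval_def ppow_def by simp

lemma lev_poly_subst:
 assumes v: "!!w. v w ~= 0"
 shows "lev v (poly_subst f P) = ev (%w. lev v (f w)) P"
proof -
 interpret eval_hom "%c. c" "ppowi v" rewrites "geval (%c. c) (ppowi v) = lev v"
  using lev_hom[OF v] by (auto simp: lev_def)
 show ?thesis unfolding poly_subst_def ev_def[of "%w. lev v (f w)"] geval_def ppow_def
  by (simp add: geval_sum geval_mult geval_const geval_prod geval_power)
qed

text \<open>Dedekind's argument on the independence of characters.\<close>

lemma characters_independent:
 fixes \<chi> :: "'k => ('a => complex) => complex"
 assumes "finite A" and mult: "!!m u v. \<chi> m (%w. u w * v w) = \<chi> m u * \<chi> m v"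
  and one: "!!m. \<chi> m (%w. 1) = 1"
  and sep: "!!m m'. m ~= m' ==> \<exists>v. (\<forall>w. v w ~= 0) \<and> \<chi> m v ~= \<chi> m' v"
  and zero: "!!v. (\<forall>w. v w ~= 0) ==> (\<Sum>m\<in>A. c m * \<chi> m v) = 0"
 shows "\<forall>m\<in>A. c m = 0"
 using \<open>finite A\<close> zero
proof (induction A arbitrary: c rule: finite_induct)
 case (insert a A)
 have "c m = 0" if "m \<in> A" for m
 proof -
  have "m ~= a" using that insert by auto
  then obtain u where u: "\<forall>w. u w ~= 0" "\<chi> m u ~= \<chi> a u" using sep by blast
  have "\<forall>m\<in>A. c m * (\<chi> m u - \<chi> a u) = 0"
  proof (rule insert.IH)
   fix v :: "'a => complex" assume v: "\<forall>w. v w ~= 0"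
   have 1: "c a * \<chi> a v + (\<Sum>m\<in>A. c m * \<chi> m v) = 0" using insert.prems[OF v] insert.hyps by simp
   have "(\<Sum>m\<in>insert a A. c m * \<chi> m (%w. u w * v w)) = 0" using u v by (intro insert.prems) auto
   hence 2: "c a * (\<chi> a u * \<chi> a v) + (\<Sum>m\<in>A. c m * (\<chi> m u * \<chi> m v)) = 0"
    using insert.hyps by (simp add: mult)
   have "(\<Sum>m\<in>A. c m * (\<chi> m u - \<chi> a u) * \<chi> m v) =
     (\<Sum>m\<in>A. c m * (\<chi> m u * \<chi> m v)) - \<chi> a u * (\<Sum>m\<in>A. c m * \<chi> m v)"
    by (simp add: sum_distrib_left sum_subtractf[symmetric] algebra_simps)
   also have "... = (c a * (\<chi> a u * \<chi> a v) + (\<Sum>m\<in>A. c m * (\<chi> m u * \<chi> m v)))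
     - \<chi> a u * (c a * \<chi> a v + (\<Sum>m\<in>A. c m * \<chi> m v))" by (simp add: algebra_simps)
   finally show "(\<Sum>m\<in>A. c m * (\<chi> m u - \<chi> a u) * \<chi> m v) = 0" using 1 2 by simp
  qed
  thus ?thesis using that u by auto
 qed
 moreover from this have "c a = 0" using insert.prems[of "%_. 1"] insert.hyps by (simp add: one)
 ultimately show ?case by simp
qed simp

lemma ppow_mult: "ppow (%w. u w * v w) m = ppow u m * ppow v m"
 by (simp add: ppow_def power_mult_distrib prod.distrib)

lemma ppowi_mult: "ppowi (%w. u w * v w) m = ppowi u m * ppowi v m"
 by (simp add: ppowi_def power_int_mult_distrib prod.distrib)

text \<open>Supplies the separating points for \<open>characters_independent\<close>: powers of 2
  with distinct exponents are distinct, so this point reads off the exponent of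
  \<open>w\<close>.\<close>

lemma ppow_update:
 "ppow ((%_. 1)(w := 2)) m = (2::complex) ^ coef m w"
proof -
 have "ppow ((%_. 1)(w := 2)) m =
   (\<Prod>x\<in>insert w (pkeys m). ((%_. 1)(w := (2::complex))) x ^ coef m x)"
  by (rule ppow_superset) auto
 also have "... = (\<Prod>x\<in>{w}. ((%_. 1)(w := (2::complex))) x ^ coef m x)"
  by (rule prod.mono_neutral_right) auto
 finally show ?thesis by simp
qed

lemma ppowi_update:
 "ppowi ((%_. 1)(w := 2)) m = (2::complex) powi coef m w"
proof -
 have "ppowi ((%_. 1)(w := 2)) m =
   (\<Prod>x\<in>insert w (pkeys m). ((%_. 1)(w := (2::complex))) x powi coef m x)"
  by (rule ppowi_superset) auto
 also have "... = (\<Prod>x\<in>{w}. ((%_. 1)(w := (2::complex))) x powi coef m x)"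
  by (rule prod.mono_neutral_right) auto
 finally show ?thesis by simp
qed

lemma two_powi_inject: "(2::complex) powi a = 2 powi b \<longleftrightarrow> a = b"
proof
 assume "(2::complex) powi a = 2 powi b"
 hence "norm ((2::complex) powi a) = norm ((2::complex) powi b)" by simp
 hence "(2::real) powi a = 2 powi b" by (simp add: norm_power_int)
 thus "a = b" by (metis less_irrefl linorder_less_linear one_less_numeral_iff power_int_strict_increasing semiring_norm(76))
qed simp


text \<open>Monomials are distinct characters of the torus of points with non-zero coordinates, so
  testing there suffices. Inverses of the variables can then be substituted freely.\<close>

lemma ev_eq_0I:
 assumes "!!v. (!!w. v w ~= 0) ==> ev v P = 0"
 shows "P = 0"
proof -
 have "\<forall>m\<in>pkeys P. coef P m = 0"
 proof (rule characters_independent[where \<chi> = "%m v. ppow v m"])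
  fix m m' :: "var \<Rightarrow>\<^sub>0 nat" assume "m ~= m'"
  then obtain w where "coef m w ~= coef m' w" by (meson poly_mapping_eqI)
  hence "(\<forall>x. ((%_. 1)(w := (2::complex))) x ~= 0) \<and>
    ppow ((%_. 1)(w := (2::complex))) m ~= ppow ((%_. 1)(w := 2)) m'" unfolding ppow_update
   using two_powi_inject[of "int (coef m w)" "int (coef m' w)"] by simp
  thus "\<exists>v. (\<forall>x. v x ~= 0) \<and> ppow v m ~= (ppow v m' :: complex)" by blast
 qed (use assms in \<open>auto simp: ppow_mult ev_def geval_def ppow_def\<close>)
 thus ?thesis by (metis in_keys_iff keys_zero poly_mapping_eqI lookup_zero)
qed

lemma lev_eq_0I:
 assumes "!!v. (!!w. v w ~= 0) ==> lev v P = 0"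
 shows "P = 0"
proof -
 have "\<forall>m\<in>pkeys P. coef P m = 0"
 proof (rule characters_independent[where \<chi> = "%m v. ppowi v m"])
  fix m m' :: "var \<Rightarrow>\<^sub>0 int" assume "m ~= m'"
  then obtain w where "coef m w ~= coef m' w" by (meson poly_mapping_eqI)
  hence "(\<forall>x. ((%_. 1)(w := (2::complex))) x ~= 0) \<and>
    ppowi ((%_. 1)(w := (2::complex))) m ~= ppowi ((%_. 1)(w := 2)) m'"
   unfolding ppowi_update by (simp add: two_powi_inject)
  thus "\<exists>v. (\<forall>x. v x ~= 0) \<and> ppowi v m ~= ppowi v m'" by blast
 qed (use assms in \<open>auto simp: ppowi_mult lev_def geval_def ppowi_def\<close>)
 thus ?thesis by (metis in_keys_iff keys_zero poly_mapping_eqI lookup_zero)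
qed

lemma ev_eqI:
 assumes "!!v. (!!w. v w ~= 0) ==> ev v P = ev v Q"
 shows "P = Q"
 using ev_eq_0I[of "P - Q"] assms by simp

text \<open>The polynomial ring is a domain, so points off the hypersurface of \<open>D\<close>
  suffice.\<close>

lemma ev_eqI_dense:
 assumes "D ~= 0" and "!!v. (!!w. v w ~= 0) ==> ev v D ~= 0 ==> ev v P = ev v Q"
 shows "P = Q"
proof -
 have "D * (P - Q) = 0"
 proof (rule ev_eq_0I)
  fix v :: "var => complex" assume "!!w. v w ~= 0"
  thus "ev v (D * (P - Q)) = 0" using assms(2)[of v] by (cases "ev v D = 0") auto
 qed
 thus ?thesis using assms(1) by simp
qed

lemma ev_rename_X: "ev v (rename_X \<sigma> P) = ev (%w. case w of VX a => v (VX (\<sigma> a)) | Vx j => v (Vx j)) P"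
 unfolding rename_X_def ev_poly_subst by (intro arg_cong[of _ _ "%u. ev u P"] ext) (auto split: var.split)

lemma ev_rename_x: "ev v (rename_x \<pi> P) = ev (%w. case w of VX a => v (VX a) | Vx j => v (Vx (\<pi> j))) P"
 unfolding rename_x_def ev_poly_subst by (intro arg_cong[of _ _ "%u. ev u P"] ext) (auto split: var.split)


section \<open>Degrees in a single variable, read off from values\<close>

definition uni :: "(var => complex) => var => mpoly => complex poly" where
 "uni v w P = geval (%c. [:c:]) (ppow ((%u. [:v u:])(w := [:0, 1:]))) P"

definition slice :: "var => nat => mpoly => mpoly" where
 "slice w k P = (\<Sum>m | m \<in> pkeys P \<and> coef m w = k.
   Poly_Mapping.single m (coef P m))"

interpretation uni: eval_hom "%c. [:c:]" "ppow ((%u. [:v u:])(w := [:0, 1:]))"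
 rewrites "geval (%c. [:c:]) (ppow ((%u. [:v u:])(w := [:0, 1:]))) = uni v w"
 for v :: "var => complex" and w by unfold_locales (auto simp: ppow_add uni_def pCons_one)

lemma ppow_hom:
 fixes h :: "'r::comm_semiring_1 => 's::comm_semiring_1" and f :: "'a => 'r"
 assumes "!!a b. h (a * b) = h a * h b" "h 1 = 1"
 shows "h (ppow f m) = ppow (%w. h (f w)) m"
proof -
 have "h (x ^ k) = h x ^ k" for x k by (induction k) (auto simp: assms)
 moreover have "h (prod g A) = prod (%x. h (g x)) A" for g and A :: "'a set"
  by (induction A rule: infinite_finite_induct) (auto simp: assms)
 ultimately show ?thesis by (simp add: ppow_def)
qed

lemma poly_uni: "poly (uni v w P) t = ev (v(w := t)) P"
proof -
 have "(%u. poly (((%u. [:v u:])(w := [:0, 1:])) u) t) = v(w := t)" by (auto simp: fun_eq_iff)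
 thus ?thesis unfolding uni_def ev_def geval_def by (simp add: poly_sum ppow_hom[of "%p. poly p t"])
qed

text \<open>Setting \<open>w\<close> to 1 strips the power of \<open>w\<close> that all terms of the
  slice share.\<close>

lemma coeff_uni: "poly.coeff (uni v w P) k = ev (v(w := 1)) (slice w k P)"
proof -
 have mon: "ppow ((%u. [:v u:])(w := [:0, 1:])) m =
   monom (ppow (v(w := 1)) m) (coef m w)" for m
 proof -
  let ?A = "insert w (pkeys m)"
  have c: "[:x:] ^ i = [:x ^ i:]" for x :: complex and i by (induction i) (auto simp: one_pCons)
  have cp: "(\<Prod>x\<in>B. [:g x:]) = [:prod g B:]" for g :: "var => complex" and B
   by (induction B rule: infinite_finite_induct) (auto simp: one_pCons)
  have "ppow ((%u. [:v u:])(w := [:0, 1:])) m =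
    (\<Prod>x\<in>?A. ((%u. [:v u:])(w := [:0, 1:])) x ^ coef m x)"
   by (rule ppow_superset) auto
  also have "... = [:0, 1:] ^ coef m w * (\<Prod>x\<in>?A - {w}. [:v x:] ^ coef m x)"
   by (subst prod.remove[of _ w]) auto
  also have "... = monom (\<Prod>x\<in>?A - {w}. v x ^ coef m x) (coef m w)"
   by (simp add: c cp monom_altdef)
  also have "(\<Prod>x\<in>?A - {w}. v x ^ coef m x) =
    (\<Prod>x\<in>?A. (v(w := 1)) x ^ coef m x)" by (subst (2) prod.remove[of _ w]) auto
  also have "... = ppow (v(w := 1)) m" by (rule ppow_superset[symmetric]) auto
  finally show ?thesis .
 qed
 have "poly.coeff (uni v w P) k = (\<Sum>m\<in>pkeys P.
   if coef m w = k then coef P m * ppow (v(w := 1)) m else 0)"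
  unfolding uni_def geval_def by (auto simp: coeff_sum mon intro!: sum.cong)
 also have "... = (\<Sum>m | m \<in> pkeys P \<and> coef m w = k.
   coef P m * ppow (v(w := 1)) m)" by (simp add: sum.inter_filter)
 finally show ?thesis by (simp add: slice_def ev.geval_single)
qed

lemma slice_eq_0: "slice w k P = 0 ==> m \<in> pkeys P ==> coef m w ~= k"
proof
 assume s: "slice w k P = 0" and m: "m \<in> pkeys P" "coef m w = k"
 have "coef (slice w k P) m = coef P m"
  using m by (auto simp: slice_def lookup_sum lookup_single when_def sum.If_cases sum.delta)
 thus False using s m by (simp add: in_keys_iff)
qed

lemma ev_slice: "ev v (slice w k P) = v w ^ k * ev (v(w := 1)) (slice w k P)"
proof -
 have "ppow v m = v w ^ coef m w * ppow (v(w := 1)) m" for m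
 proof -
  let ?A = "insert w (pkeys m)"
  have "ppow v m = (\<Prod>x\<in>?A. v x ^ coef m x)" by (rule ppow_superset) auto
  also have "... = v w ^ coef m w * (\<Prod>x\<in>?A - {w}. v x ^ coef m x)"
   by (subst prod.remove[of _ w]) auto
  also have "(\<Prod>x\<in>?A - {w}. v x ^ coef m x) =
    (\<Prod>x\<in>?A. (v(w := 1)) x ^ coef m x)" by (subst (2) prod.remove[of _ w]) auto
  also have "... = ppow (v(w := 1)) m" by (rule ppow_superset[symmetric]) auto
  finally show ?thesis .
 qed
 thus ?thesis by (auto simp: slice_def ev.geval_single sum_distrib_left intro!: sum.cong)
qed


text \<open>Replaces bounds on exponents by a statement about values, so that degree bounds for
  renamings and wedge products follow by evaluation. Backwards, \<open>q\<close> must be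
  \<open>uni v w P\<close>, so every slice of degree at least \<open>n\<close> in \<open>w\<close>
  vanishes at all points.\<close>

lemma lookup_less_iff:
 assumes "0 < n"
 shows "(\<forall>m\<in>pkeys P. coef m w < n) \<longleftrightarrow>
  (\<forall>v. \<exists>q. degree q < n \<and> (\<forall>t. ev (v(w := t)) P = poly q t))" (is "?L \<longleftrightarrow> ?R")
proof
 assume L: ?L
 have "degree (uni v w P) < n" for v
 proof -
  have "poly.coeff (uni v w P) k = 0" if "k > n - 1" for k
  proof -
   have "slice w k P = 0" using L that by (auto simp: slice_def intro!: sum.neutral)
   thus ?thesis by (simp add: coeff_uni)
  qed
  thus ?thesis using assms by (metis Suc_pred' degree_le le_imp_less_Suc)
 qed
 thus ?R by (metis poly_uni)
next
 assume R: ?R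
 have "slice w k P = 0" if "k \<ge> n" for k
 proof (rule ev_eq_0I)
  fix v
  obtain q where q: "degree q < n" "!!t. ev (v(w := t)) P = poly q t" using R by blast
  hence "uni v w P = q" by (simp add: poly_uni poly_eq_poly_eq_iff[symmetric] fun_eq_iff)
  hence "poly.coeff (uni v w P) k = 0" using q that by (simp add: coeff_eq_0)
  thus "ev v (slice w k P) = 0" by (subst ev_slice) (simp add: coeff_uni)
 qed
 thus ?L using slice_eq_0[of w _ P] by (intro ballI) (metis not_less)
qed

text \<open>Absence of the variable \<open>w\<close>, expressed through values;
  \<open>notin_poly_vars_iff\<close> links it to the monomials.\<close>

definition indep :: "var => mpoly => bool" where
 "indep w P \<longleftrightarrow> (\<forall>v t. ev (v(w := t)) P = ev v P)"

lemma notin_poly_vars_iff: "w \<notin> poly_vars P \<longleftrightarrow> indep w P"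
proof -
 have "w \<notin> poly_vars P \<longleftrightarrow> (\<forall>m\<in>pkeys P. coef m w < 1)"
  by (auto simp: poly_vars_def in_keys_iff)
 also have "... \<longleftrightarrow> (\<forall>v. \<exists>q. degree q < 1 \<and> (\<forall>t. ev (v(w := t)) P = poly q t))"
  by (rule lookup_less_iff) simp
 also have "... \<longleftrightarrow> indep w P"
 proof
  assume *: "\<forall>v. \<exists>q. degree q < 1 \<and> (\<forall>t. ev (v(w := t)) P = poly q t)"
  show "indep w P" unfolding indep_def
  proof (intro allI)
   fix v t
   obtain q where q: "degree q < 1" "!!t. ev (v(w := t)) P = poly q t" using * by blast
   then obtain c where "q = [:c:]" using degree_eq_zeroE by (metis less_one)
   thus "ev (v(w := t)) P = ev v P" using q(2)[of t] q(2)[of "v w"] by simp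
  qed
 next
  assume "indep w P"
  thus "\<forall>v. \<exists>q. degree q < 1 \<and> (\<forall>t. ev (v(w := t)) P = poly q t)"
   unfolding indep_def by (intro allI exI[of _ "[:ev _ P:]"]) simp
 qed
 finally show ?thesis .
qed

lemma poly_vars_subset_iff: "poly_vars P \<subseteq> W \<longleftrightarrow> (\<forall>w. w \<notin> W --> indep w P)"
 using notin_poly_vars_iff by blast

lemma indep_agree:
 assumes "poly_vars P \<subseteq> W" "!!w. w \<in> W ==> u w = v w"
 shows "ev u P = ev v P"
proof -
 have "ppow u m = ppow v m" if "m \<in> pkeys P" for m
  unfolding ppow_def using that assms by (intro prod.cong) (auto simp: poly_vars_def)
 thus ?thesis unfolding ev_def geval_def by (intro sum.cong) auto
qed

section \<open>A Clifford algebra acting on functions of subsets\<close>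


text \<open>Equal coefficients at \<open>n\<close> push the degree of \<open>p - q\<close> below
  \<open>n\<close>, so \<open>n\<close> common values suffice instead of n + 1.\<close>

lemma poly_eqI_leading:
 fixes p q :: "complex poly"
 assumes "degree p \<le> n" "degree q \<le> n" "poly.coeff p n = poly.coeff q n"
  and "finite A" "card A = n" "!!x. x \<in> A ==> poly p x = poly q x"
 shows "p = q"
proof -
 have "p - q = 0"
 proof (rule ccontr)
  assume "p - q ~= 0"
  moreover have "degree (p - q) \<le> n" using assms by (simp add: degree_diff_le)
  ultimately have "degree (p - q) < n" using eq_zero_or_degree_less[of "p - q" n] assms(3) by auto
  moreover have "card A \<le> card {x. poly (p - q) x = 0}"
   using assms poly_roots_finite[OF \<open>p - q ~= 0\<close>] by (intro card_mono) auto
  ultimately show False using card_poly_roots_bound[OF \<open>p - q ~= 0\<close>] assms(5) by simp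
 qed
 thus ?thesis by simp
qed

lemma degree_prod_linear: "degree (\<Prod>b\<in>S. [:y b, 1:] :: complex poly) \<le> card S"
proof (cases "finite S")
 case True
 thus ?thesis using degree_prod_sum_le[of S "%b. [:y b, 1:]"] by simp
qed simp

lemma coeff_prod_linear: "finite S ==> poly.coeff (\<Prod>b\<in>S. [:y b, 1:] :: complex poly) (card S) = 1"
proof (induction S rule: finite_induct)
 case (insert a S)
 thus ?case using degree_prod_linear[of y S] by (simp add: coeff_eq_0)
qed simp

lemma sum_swap3: "(\<Sum>c\<in>A. \<Sum>a\<in>B. \<Sum>b\<in>C. X c a b) = (\<Sum>a\<in>B. \<Sum>b\<in>C. \<Sum>c\<in>A. X c a b)"
proof -
 have "(\<Sum>c\<in>A. \<Sum>a\<in>B. \<Sum>b\<in>C. X c a b) = (\<Sum>a\<in>B. \<Sum>c\<in>A. \<Sum>b\<in>C. X c a b)" by (rule sum.swap)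
 also have "... = (\<Sum>a\<in>B. \<Sum>b\<in>C. \<Sum>c\<in>A. X c a b)" by (intro sum.cong refl sum.swap)
 finally show ?thesis .
qed

locale generic_point =
 fixes N :: "nat set" and x :: "nat => complex"
 assumes finite_N [simp]: "finite N"
  and nz: "a \<in> N ==> x a ~= 0"
  and sum_nz: "a \<in> N ==> b \<in> N ==> a ~= b ==> x a + x b ~= 0"
  and diff_nz: "a \<in> N ==> b \<in> N ==> a ~= b ==> x a ~= x b"
begin

text \<open>The factor by which \<open>den\<close> fails to be multiplicative, see
  \<open>den_split\<close>; it governs how wedge products act on families.\<close>

definition f :: "nat => nat => complex" where "f a b = (x a + x b) / (x a - x b)"
definition w :: "nat => nat set => complex" where "w a C = (\<Prod>c\<in>C. f a c)"
text \<open>The inverse of \<open>f\<close> off the diagonal and 0 on it, so that double sums may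
  run over all pairs.\<close>

definition \<theta> :: "nat => nat => complex" where "\<theta> a b = (x a - x b) / (x a + x b)"
text \<open>The scalar in the Clifford relation \<open>eps_phi\<close>.\<close>

definition \<gamma> :: "nat => complex" where "\<gamma> a = w a (N - {a})"
text \<open>This turns out to be the parity of \<open>card S\<close>, see
  \<open>cc_eq\<close>.\<close>

definition cc :: "nat set => complex" where "cc S = (\<Sum>a\<in>S. w a (S - {a}))"

lemma inj_x: "inj_on x N"
 using diff_nz by (auto simp: inj_on_def)

lemma f_antisym: "f b a = - f a b"
 by (simp add: f_def minus_divide_right add.commute)

lemma f_\<theta>: "a \<in> N ==> b \<in> N ==> a ~= b ==> f a b * \<theta> a b = 1"
 using sum_nz diff_nz by (simp add: f_def \<theta>_def)

lemma \<theta>_antisym: "\<theta> b a = - \<theta> a b"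
 by (simp add: \<theta>_def minus_divide_left add.commute)

lemma \<theta>_self [simp]: "\<theta> a a = 0"
 by (simp add: \<theta>_def)

lemma f_nz: "a \<in> N ==> b \<in> N ==> a ~= b ==> f a b ~= 0"
 using sum_nz diff_nz by (simp add: f_def)

lemma w_remove: "finite C ==> b \<in> C ==> w a C = f a b * w a (C - {b})"
 unfolding w_def by (rule prod.remove)

lemma w_nz: "a \<in> N ==> C \<subseteq> N ==> a \<notin> C ==> w a C ~= 0"
 using f_nz[of a] finite_subset[of C, OF _ finite_N] by (auto simp: w_def subset_iff)

lemma w_mult_diff:
 assumes "a \<in> N" "C \<subseteq> N" "a \<notin> C"
 shows "w a C * (\<Prod>b\<in>C. x a - x b) = (\<Prod>b\<in>C. x a + x b)"
 unfolding w_def prod.distrib[symmetric] f_def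
proof (intro prod.cong refl)
 fix b assume "b \<in> C"
 hence "x a - x b ~= 0" using assms diff_nz[of a b] by auto
 thus "(x a + x b) / (x a - x b) * (x a - x b) = x a + x b" by simp
qed

lemma \<gamma>_nz: "a \<in> N ==> \<gamma> a ~= 0"
 unfolding \<gamma>_def by (rule w_nz) auto


text \<open>Partial fractions of the product of (X + x_b) / (X - x_b), with denominators cleared.
  The coefficient at \<open>a\<close> is the residue; both sides are monic of degree
  \<open>card S\<close> and agree at every x_d with d in \<open>S\<close>.\<close>

lemma partial_fractions:
 assumes S: "S \<subseteq> N"
 shows "(\<Prod>b\<in>S. [:x b, 1:]) =
  (\<Prod>b\<in>S. [:- x b, 1:]) + (\<Sum>a\<in>S. Polynomial.smult (2 * x a * w a (S - {a})) (\<Prod>b\<in>S - {a}. [:- x b, 1:]))"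
proof -
 have fin: "finite S" using S finite_N by (rule finite_subset)
 let ?R = "\<Sum>a\<in>S. Polynomial.smult (2 * x a * w a (S - {a})) (\<Prod>b\<in>S - {a}. [:- x b, 1:])"
 have dR: "degree (Polynomial.smult (2 * x a * w a (S - {a})) (\<Prod>b\<in>S - {a}. [:- x b, 1:])) < card S"
  if "a \<in> S" for a
 proof -
  have "degree (Polynomial.smult (2 * x a * w a (S - {a})) (\<Prod>b\<in>S - {a}. [:- x b, 1:])) \<le> card (S - {a})"
   by (rule order.trans[OF degree_smult_le degree_prod_linear])
  also have "... < card S" using that fin by (rule card_Diff1_less[rotated])
  finally show ?thesis .
 qed
 show ?thesis
 proof (rule poly_eqI_leading)
  show "degree (\<Prod>b\<in>S. [:x b, 1:]) \<le> card S" by (rule degree_prod_linear)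
  show "degree ((\<Prod>b\<in>S. [:- x b, 1:]) + ?R) \<le> card S"
   by (intro degree_add_le degree_prod_linear degree_sum_le fin less_imp_le[OF dR])
  have "poly.coeff ?R (card S) = 0" using dR by (auto simp: coeff_sum coeff_eq_0 simp del: coeff_smult)
  thus "poly.coeff (\<Prod>b\<in>S. [:x b, 1:]) (card S) = poly.coeff ((\<Prod>b\<in>S. [:- x b, 1:]) + ?R) (card S)"
   by (simp add: coeff_prod_linear fin)
  show "finite (x ` S)" "card (x ` S) = card S" using fin inj_on_subset[OF inj_x S] by (auto intro: card_image)
  fix y assume "y \<in> x ` S"
  then obtain d where d: "d \<in> S" "y = x d" by auto
  have "poly ?R y = (\<Sum>a\<in>S. 2 * x a * w a (S - {a}) * (\<Prod>b\<in>S - {a}. y - x b))"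
   by (simp add: poly_sum poly_prod)
  also have "... = (\<Sum>a\<in>{d}. 2 * x a * w a (S - {a}) * (\<Prod>b\<in>S - {a}. y - x b))"
   using d fin by (intro sum.mono_neutral_right) (auto simp: prod_zero_iff)
  also have "... = 2 * x d * (\<Prod>b\<in>S - {d}. x d + x b)" using d S w_mult_diff[of d "S - {d}"] by auto
  finally show "poly (\<Prod>b\<in>S. [:x b, 1:]) y = poly ((\<Prod>b\<in>S. [:- x b, 1:]) + ?R) y"
   using d fin by (simp add: poly_prod prod.remove[of S d] add.commute[of "x d"])
 qed
qed

text \<open>The constant terms in \<open>partial_fractions\<close>, divided by the product of the
  x_b, give 1 - (-1)^k + 2 (-1)^k cc S = 0 with k = card S.\<close>

lemma cc_eq:
 assumes S: "S \<subseteq> N"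
 shows "cc S = of_bool (odd (card S))"
proof -
 have fin: "finite S" using S finite_N by (rule finite_subset)
 have nzp: "(\<Prod>b\<in>S. x b) ~= 0" using S nz fin by (auto simp: prod_zero_iff)
 have neg: "(\<Prod>b\<in>A. - x b) = (-1) ^ card A * (\<Prod>b\<in>A. x b)" for A
  by (induction A rule: infinite_finite_induct) auto
 have "(\<Prod>b\<in>S. x b) = (-1) ^ card S * (\<Prod>b\<in>S. x b) +
   (\<Sum>a\<in>S. 2 * x a * w a (S - {a}) * ((-1) ^ (card S - 1) * (\<Prod>b\<in>S - {a}. x b)))"
  using arg_cong[OF partial_fractions[OF S], of "%p. poly p 0"] fin by (simp add: poly_sum poly_prod neg)
 also have "(\<Sum>a\<in>S. 2 * x a * w a (S - {a}) * ((-1) ^ (card S - 1) * (\<Prod>b\<in>S - {a}. x b))) =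
   (\<Sum>a\<in>S. - 2 * (-1) ^ card S * w a (S - {a}) * (\<Prod>b\<in>S. x b))"
 proof (rule sum.cong)
  fix a assume a: "a \<in> S"
  then obtain k where "card S = Suc k" using fin by (metis card_Suc_Diff1)
  thus "2 * x a * w a (S - {a}) * ((-1) ^ (card S - 1) * (\<Prod>b\<in>S - {a}. x b)) =
    - 2 * (-1) ^ card S * w a (S - {a}) * (\<Prod>b\<in>S. x b)" using a fin by (simp add: prod.remove[of S a])
 qed simp
 also have "... = - 2 * (-1) ^ card S * cc S * (\<Prod>b\<in>S. x b)"
  by (simp add: cc_def sum_distrib_left sum_distrib_right mult_ac)
 finally have "(1 - (-1) ^ card S + 2 * (-1) ^ card S * cc S) * (\<Prod>b\<in>S. x b) = 0"
  by (simp add: algebra_simps)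
 hence "1 - (-1) ^ card S + 2 * (-1) ^ card S * cc S = 0" using nzp by simp
 thus ?thesis by (cases "odd (card S)") auto
qed

text \<open>Expands the product of (Y - x_c) / (Y + x_c) in partial fractions and sets Y = x_a.
  Comparing leading coefficients fixes the constant 1 - cc S.\<close>

lemma sum_v:
 assumes S: "S \<subseteq> N" and a: "a \<in> N" "a \<notin> S"
 shows "(\<Sum>j\<in>S. w j (S - {j}) * \<theta> a j) * w a S = 1 - (1 - cc S) * w a S"
proof -
 have fin: "finite S" using S finite_N by (rule finite_subset)
 let ?L = "\<Sum>j\<in>S. Polynomial.smult (w j (S - {j})) ([:- x j, 1:] * (\<Prod>c\<in>S - {j}. [:x c, 1:]))"
 let ?R = "(\<Prod>c\<in>S. [:- x c, 1:]) - Polynomial.smult (1 - cc S) (\<Prod>c\<in>S. [:x c, 1:])"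
 have L: "[:- x j, 1:] * (\<Prod>c\<in>S - {j}. [:x c, 1:]) = (\<Prod>c\<in>S. [:(if c = j then - x c else x c), 1:])"
  if "j \<in> S" for j using that fin by (subst (2) prod.remove[of _ j]) auto
 have "?L = ?R"
 proof (rule poly_eqI_leading)
  show "degree ?L \<le> card S"
   by (intro degree_sum_le fin order.trans[OF degree_smult_le]) (simp only: L degree_prod_linear)
  show "degree ?R \<le> card S" by (intro degree_diff_le order.trans[OF degree_smult_le] degree_prod_linear)
  have "poly.coeff ?L (card S) = cc S"
   unfolding cc_def coeff_sum by (rule sum.cong) (simp_all only: L coeff_smult coeff_prod_linear[OF fin] mult_1_right)
  thus "poly.coeff ?L (card S) = poly.coeff ?R (card S)" by (simp add: coeff_prod_linear[OF fin])
  show "finite ((%a. - x a) ` S)" "card ((%a. - x a) ` S) = card S"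
   using fin inj_on_subset[OF inj_x S] by (auto intro!: card_image simp: inj_on_def)
  fix y assume "y \<in> (%a. - x a) ` S"
  then obtain d where d: "d \<in> S" "y = - x d" by auto
  have neg: "(\<Prod>b\<in>A. - x d - x b) = (-1) ^ card A * (\<Prod>b\<in>A. x d + x b)" for A
   by (induction A rule: infinite_finite_induct) (auto simp: algebra_simps)
  have neg': "(\<Prod>b\<in>A. - x d + x b) = (-1) ^ card A * (\<Prod>b\<in>A. x d - x b)" for A
   by (induction A rule: infinite_finite_induct) (auto simp: algebra_simps)
  have "poly ?L y = (\<Sum>j\<in>S. w j (S - {j}) * ((y - x j) * (\<Prod>c\<in>S - {j}. x c + y)))"
   unfolding poly_sum poly_smult poly_mult poly_prod by simp
  also have "... = (\<Sum>j\<in>{d}. w j (S - {j}) * ((y - x j) * (\<Prod>c\<in>S - {j}. x c + y)))"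
   using d fin by (intro sum.mono_neutral_right) (auto simp: prod_zero_iff)
  also have "... = (-1) ^ (card S - 1) * (- 2 * x d) * (w d (S - {d}) * (\<Prod>c\<in>S - {d}. x d - x c))"
   using d fin neg'[of "S - {d}"] by (simp add: add.commute)
  also have "... = (-1) ^ (card S - 1) * (- 2 * x d) * (\<Prod>c\<in>S - {d}. x d + x c)"
   using d S by (subst w_mult_diff) auto
  finally have 1: "poly ?L y = (-1) ^ (card S - 1) * (- 2 * x d) * (\<Prod>c\<in>S - {d}. x d + x c)" .
  have "poly (\<Prod>c\<in>S. [:x c, 1:]) y = 0" using d fin by (auto simp: poly_prod prod_zero_iff)
  hence "poly ?R y = (\<Prod>c\<in>S. poly [:- x c, 1:] y)"
   by (simp only: poly_diff poly_smult poly_prod mult_zero_right diff_zero)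
  also have "... = (\<Prod>c\<in>S. - x d - x c)" using d by (intro prod.cong refl) simp
  also have "... = (- 2 * x d) * (\<Prod>c\<in>S - {d}. - x d - x c)"
   using d fin by (simp add: prod.remove[of S d])
  also have "... = poly ?L y" unfolding 1 neg using d fin by simp
  finally show "poly ?L y = poly ?R y" by simp
 qed
 from arg_cong[OF this, of "%p. poly p (x a)"]
 have *: "(\<Sum>j\<in>S. w j (S - {j}) * ((x a - x j) * (\<Prod>c\<in>S - {j}. x a + x c))) =
   (\<Prod>c\<in>S. x a - x c) - (1 - cc S) * (\<Prod>c\<in>S. x a + x c)"
  unfolding poly_sum poly_smult poly_mult poly_prod poly_diff by (simp add: add.commute)
 let ?D = "\<Prod>c\<in>S. x a - x c"
 have D: "?D ~= 0" using a S diff_nz fin by (auto simp: prod_zero_iff)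
 have wa: "w a S * ?D = (\<Prod>c\<in>S. x a + x c)" using w_mult_diff[of a S] a S by auto
 have "(\<Sum>j\<in>S. w j (S - {j}) * \<theta> a j) * w a S * ?D =
   (\<Sum>j\<in>S. w j (S - {j}) * ((x a - x j) * (\<Prod>c\<in>S - {j}. x a + x c)))"
  unfolding mult.assoc wa sum_distrib_right
 proof (rule sum.cong)
  fix j assume j: "j \<in> S"
  hence "x a + x j ~= 0" using sum_nz a S by auto
  thus "w j (S - {j}) * (\<theta> a j * (\<Prod>c\<in>S. x a + x c)) =
    w j (S - {j}) * ((x a - x j) * (\<Prod>c\<in>S - {j}. x a + x c))"
   using j fin by (simp add: prod.remove[of S j] \<theta>_def)
 qed simp
 also have "... = (1 - (1 - cc S) * w a S) * ?D" unfolding * by (simp add: wa algebra_simps)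
 finally show ?thesis using D by simp
qed

lemma \<gamma>_\<theta>: "j \<in> N ==> k \<in> N ==> j ~= k ==> \<gamma> j * \<theta> j k = w j (N - {k} - {j})"
proof -
 assume jk: "j \<in> N" "k \<in> N" "j ~= k"
 hence "\<gamma> j = f j k * w j (N - {j} - {k})" unfolding \<gamma>_def by (intro w_remove) auto
 moreover have "N - {j} - {k} = N - {k} - {j}" by auto
 ultimately show ?thesis using f_\<theta>[OF jk] by (simp add: mult.commute mult.left_commute)
qed

lemma cc_N: "(\<Sum>a\<in>N. \<gamma> a) = cc N"
 by (simp add: \<gamma>_def cc_def)

lemma cc_remove: "a \<in> N ==> cc (N - {a}) = 1 - cc N"
 by (subst (1 2) cc_eq) (auto simp: card_gt_0_iff)

lemma sum_\<gamma>_\<theta>: "k \<in> N ==> (\<Sum>j\<in>N. \<gamma> j * \<theta> j k) = 1 - cc N"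
proof -
 assume k: "k \<in> N"
 hence "(\<Sum>j\<in>N. \<gamma> j * \<theta> j k) = (\<Sum>j\<in>N - {k}. \<gamma> j * \<theta> j k)"
  by (simp add: sum.remove[of N k])
 also have "... = cc (N - {k})" unfolding cc_def using k by (intro sum.cong) (auto simp: \<gamma>_\<theta>)
 finally show ?thesis using cc_remove k by simp
qed

text \<open>In matrix form, \<theta> diag(\<gamma>) \<theta> = diag(1 / \<gamma>) - cc N J with J
  the all-ones matrix. The diagonal produces the grading operator in \<open>E2_F2\<close>, and J the
  correction there.\<close>

lemma sum_\<theta>_\<gamma>_\<theta>:
 assumes a: "a \<in> N" and k: "k \<in> N"
 shows "(\<Sum>j\<in>N. \<theta> a j * \<gamma> j * \<theta> j k) = of_bool (a = k) / \<gamma> a - cc N"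
proof (cases "a = k")
 case True
 have "(\<Sum>j\<in>N. \<theta> a j * \<gamma> j * \<theta> j k) = (\<Sum>j\<in>N - {a}. \<theta> a j * \<gamma> j * \<theta> j k)"
  using a by (simp add: sum.remove[of N a])
 also have "... = (\<Sum>j\<in>N - {a}. w j (N - {a} - {j}) * \<theta> a j)"
  using True a by (intro sum.cong) (auto simp: \<gamma>_\<theta> mult.assoc)
 also have "... = (1 - cc N * \<gamma> a) / \<gamma> a"
  using sum_v[of "N - {a}" a] a \<gamma>_nz[of a] cc_remove[of a] unfolding \<gamma>_def by (simp add: field_simps)
 finally show ?thesis using True \<gamma>_nz[of a] a by (simp add: diff_divide_distrib)
next
 case False
 have "(\<Sum>j\<in>N. \<theta> a j * \<gamma> j * \<theta> j k) = (\<Sum>j\<in>N - {a, k}. \<theta> a j * \<gamma> j * \<theta> j k)"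
  by (intro sum.mono_neutral_right) auto
 \<comment> \<open>Taking \<open>a\<close> out of the weight costs the factor f j a, which \<theta>
   a j turns into -1.\<close>
 also have "... = (\<Sum>j\<in>N - {a, k}. - w j (N - {a, k} - {j}))"
 proof (intro sum.cong)
  fix j assume j: "j \<in> N - {a, k}"
  have "\<theta> a j * \<gamma> j * \<theta> j k = \<theta> a j * w j (N - {k} - {j})"
   using j k \<gamma>_\<theta>[of j k] by (simp add: mult.assoc)
  also have "w j (N - {k} - {j}) = f j a * w j (N - {k} - {j} - {a})" using j a False by (intro w_remove) auto
  also have "N - {k} - {j} - {a} = N - {a, k} - {j}" by auto
  also have "\<theta> a j * (f j a * w j (N - {a, k} - {j})) = - w j (N - {a, k} - {j})"
   using f_\<theta>[of j a] j a \<theta>_antisym[of a j] by (simp add: mult_ac)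
  finally show "\<theta> a j * \<gamma> j * \<theta> j k = - w j (N - {a, k} - {j})" .
 qed simp
 also have "... = - cc (N - {a, k})" by (simp add: cc_def sum_negf)
 also have "cc (N - {a, k}) = cc N"
 proof -
  have "card N = Suc (card (N - {a}))" using a by (subst card_Suc_Diff1) auto
  also have "card (N - {a}) = Suc (card (N - {a} - {k}))" using k False by (subst card_Suc_Diff1) auto
  also have "N - {a} - {k} = N - {a, k}" by auto
  finally have "card N = Suc (Suc (card (N - {a, k})))" .
  thus ?thesis by (subst (1 2) cc_eq) auto
 qed
 finally show ?thesis using False by simp
qed

section \<open>Creation and annihilation operators and their commutators\<close>

definition eps :: "nat => (nat set => complex) => nat set => complex" where
 "eps a g I = (if a \<in> I \<and> I \<subseteq> N then w a (I - {a}) * g (I - {a}) else 0)"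

text \<open>Weighted over the complement of \<open>I\<close>, so that the weights of
  \<open>eps a\<close> and \<open>phi a\<close> together make up \<open>\<gamma> a\<close>.\<close>

definition phi :: "nat => (nat set => complex) => nat set => complex" where
 "phi a g I = (if a \<in> N \<and> a \<notin> I \<and> I \<subseteq> N then w a (N - I - {a}) * g (insert a I) else 0)"

lemma eps_alt: "eps a g I = (if a \<in> I \<and> I \<subseteq> N then w a (I - {a}) else 0) * g (I - {a})"
 by (simp add: eps_def)

lemma phi_alt: "phi a g I =
  (if a \<in> N \<and> a \<notin> I \<and> I \<subseteq> N then w a (N - I - {a}) else 0) * g (insert a I)"
 by (simp add: phi_def)

lemma eps_lin:
 "eps a (%I. g I + h I) = (%I. eps a g I + eps a h I)"
 "eps a (%I. g I - h I) = (%I. eps a g I - eps a h I)"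
 "eps a (%I. - h I) = (%I. - eps a h I)"
 "eps a (%I. c * h I) = (%I. c * eps a h I)"
 "eps a (%I. \<Sum>i\<in>A. F i I) = (%I. \<Sum>i\<in>A. eps a (F i) I)"
 "eps a (%I. 0) = (%I. 0)"
 unfolding eps_alt by (auto simp only: fun_eq_iff sum_distrib_left distrib_left right_diff_distrib
   mult_minus_right mult_zero_right mult.left_commute)

lemma phi_lin:
 "phi a (%I. g I + h I) = (%I. phi a g I + phi a h I)"
 "phi a (%I. g I - h I) = (%I. phi a g I - phi a h I)"
 "phi a (%I. - h I) = (%I. - phi a h I)"
 "phi a (%I. c * h I) = (%I. c * phi a h I)"
 "phi a (%I. \<Sum>i\<in>A. F i I) = (%I. \<Sum>i\<in>A. phi a (F i) I)"
 "phi a (%I. 0) = (%I. 0)"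
 unfolding phi_alt by (auto simp only: fun_eq_iff sum_distrib_left distrib_left right_diff_distrib
   mult_minus_right mult_zero_right mult.left_commute)

text \<open>Since \<open>f\<close> is antisymmetric, the weights themselves anticommute; no sign
  from an ordering of the indices enters.\<close>

lemma eps_eps: "eps a (eps b g) = (%I. - eps b (eps a g) I)"
proof
 fix I
 show "eps a (eps b g) I = - eps b (eps a g) I"
 proof (cases "a \<in> I \<and> b \<in> I \<and> a ~= b \<and> I \<subseteq> N")
  case True
  hence "finite I" using finite_N finite_subset by blast
  hence "w a (I - {a}) = f a b * w a (I - {a} - {b})" "w b (I - {b}) = f b a * w b (I - {b} - {a})"
   using True by (auto intro!: w_remove)
  moreover have "I - {b} - {a} = I - {a} - {b}" by auto
  ultimately show ?thesis using True f_antisym[of a b] by (auto simp: eps_def)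
 qed (auto simp: eps_def)
qed

text \<open>The Clifford relation. For equal indices the two weights run over complementary parts of
  \<open>N - {a}\<close>; for distinct ones the mixed factors f a b and f b a differ in
  sign.\<close>

lemma eps_phi:
 assumes "a \<in> N" "b \<in> N"
 shows "eps a (phi b g) = (%I. (if a = b \<and> I \<subseteq> N then \<gamma> a * g I else 0) - phi b (eps a g) I)"
proof
 fix I
 show "eps a (phi b g) I = (if a = b \<and> I \<subseteq> N then \<gamma> a * g I else 0) - phi b (eps a g) I"
 proof (cases "I \<subseteq> N")
  case True
  hence fin: "finite I" using finite_N finite_subset by blast
  show ?thesis
  proof (cases "a = b")
   case ab: True
   show ?thesis
   proof (cases "a \<in> I")
    case aI: True
    have "N - {a} = (I - {a}) \<union> (N - (I - {a}) - {a})" using aI True by auto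
    hence "\<gamma> a = w a ((I - {a}) \<union> (N - (I - {a}) - {a}))" by (simp add: \<gamma>_def)
    also have "... = w a (I - {a}) * w a (N - (I - {a}) - {a})"
     unfolding w_def using fin by (intro prod.union_disjoint) auto
    finally show ?thesis using aI ab True assms insert_absorb[OF aI] by (auto simp: eps_def phi_def)
   next
    case aI: False
    have "N - {a} = I \<union> (N - I - {a})" using aI True by auto
    hence "\<gamma> a = w a (I \<union> (N - I - {a}))" by (simp add: \<gamma>_def)
    also have "... = w a I * w a (N - I - {a})" unfolding w_def using fin by (intro prod.union_disjoint) auto
    finally show ?thesis using aI ab True assms by (auto simp: eps_def phi_def)
   qed
  next
   case ab: False
   show ?thesis
   proof (cases "a \<in> I \<and> b \<notin> I")
    case 1: True
    have "w a (insert b I - {a}) = f a b * w a (I - {a})"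
     using fin 1 ab by (subst w_remove[of _ b]) (auto intro!: arg_cong[of _ _ "w a"])
    moreover have "w b (N - (I - {a}) - {b}) = f b a * w b (N - I - {b})"
     using fin 1 ab True by (subst w_remove[of _ a]) (auto intro!: arg_cong[of _ _ "w b"])
    moreover have "insert b (I - {a}) = insert b I - {a}" using ab by auto
    ultimately show ?thesis using 1 ab True assms f_antisym[of a b] by (auto simp: eps_def phi_def)
   qed (use ab in \<open>auto simp: eps_def phi_def\<close>)
  qed
 qed (auto simp: eps_def phi_def)
qed

definition opE :: "(nat => complex) => (nat set => complex) => nat set => complex" where
 "opE K g I = (\<Sum>a\<in>N. K a * eps a g I)"
definition opF :: "(nat => complex) => (nat set => complex) => nat set => complex" where
 "opF K g I = (\<Sum>a\<in>N. K a * phi a g I)"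
text \<open>The division by 2 compensates that each unordered pair occurs twice: \<theta> and the
  product of two \<open>eps\<close> both change sign under exchange.\<close>

definition E2 :: "(nat set => complex) => nat set => complex" where
 "E2 g I = (\<Sum>a\<in>N. \<Sum>b\<in>N. \<theta> a b * eps a (eps b g) I) / 2"
definition F2 :: "(nat set => complex) => nat set => complex" where
 "F2 g I = (\<Sum>a\<in>N. \<Sum>b\<in>N. \<theta> a b * phi a (phi b g) I) / 2"

abbreviation "E1 \<equiv> opE (%_. 1)"
abbreviation "F1 \<equiv> opF (%_. 1)"

definition supported :: "(nat set => complex) => bool" where
 "supported g \<longleftrightarrow> (\<forall>I. \<not> I \<subseteq> N --> g I = 0)"

lemma supported_eps: "supported (eps a g)" and supported_phi: "supported (phi a g)"
 by (auto simp: supported_def eps_def phi_def)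

lemma E1_E1: "E1 (E1 g) I = 0"
proof -
 have "E1 (E1 g) I = (\<Sum>a\<in>N. \<Sum>b\<in>N. eps a (eps b g) I)" by (simp add: opE_def[abs_def] eps_lin)
 also have "... = (\<Sum>a\<in>N. \<Sum>b\<in>N. eps b (eps a g) I)" by (rule sum.swap)
 also have "... = - (\<Sum>a\<in>N. \<Sum>b\<in>N. eps a (eps b g) I)"
  unfolding sum_negf[symmetric] by (intro sum.cong refl, subst eps_eps, simp)
 also have "(\<Sum>a\<in>N. \<Sum>b\<in>N. eps a (eps b g) I) = E1 (E1 g) I" by (simp add: opE_def[abs_def] eps_lin)
 finally show ?thesis by simp
qed

text \<open>A single creation operator passes two others with two sign changes.\<close>

lemma E1_E2: "E1 (E2 g) = E2 (E1 g)"
proof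
 fix I
 have "E1 (E2 g) I = (\<Sum>c\<in>N. \<Sum>a\<in>N. \<Sum>b\<in>N. \<theta> a b * eps c (eps a (eps b g)) I) / 2"
  unfolding opE_def E2_def[abs_def] eps_lin divide_inverse mult.commute[of _ "inverse 2"]
  by (simp add: sum_distrib_left)
 also have "... = (\<Sum>a\<in>N. \<Sum>b\<in>N. \<Sum>c\<in>N. \<theta> a b * eps c (eps a (eps b g)) I) / 2"
  by (subst sum_swap3) simp
 also have "... = (\<Sum>a\<in>N. \<Sum>b\<in>N. \<Sum>c\<in>N. \<theta> a b * eps a (eps b (eps c g)) I) / 2"
 proof -
  have "eps c (eps a (eps b g)) = eps a (eps b (eps c g))" for a b c
   by (subst eps_eps, subst eps_eps[of c b]) (simp add: eps_lin)
  thus ?thesis by simp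
 qed
 also have "... = E2 (E1 g) I" by (simp add: opE_def[abs_def] E2_def eps_lin sum_distrib_left)
 finally show "E1 (E2 g) I = E2 (E1 g) I" .
qed

text \<open>The coefficients \<open>K\<close> stay free because the homotopies for the various e_k
  arise from different choices of them.\<close>

lemma E1_opF:
 assumes "supported g"
 shows "E1 (opF K g) I = (\<Sum>a\<in>N. K a * \<gamma> a) * g I - opF K (E1 g) I"
proof -
 have "E1 (opF K g) I = (\<Sum>a\<in>N. \<Sum>b\<in>N. K b * eps a (phi b g) I)"
  by (simp add: opE_def opF_def[abs_def] eps_lin)
 also have "... = (\<Sum>a\<in>N. \<Sum>b\<in>N. (if a = b then K b * \<gamma> a * g I else 0) - K b * phi b (eps a g) I)"
  using assms by (intro sum.cong refl) (auto simp: eps_phi algebra_simps supported_def)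
 also have "... = (\<Sum>a\<in>N. K a * \<gamma> a * g I) - (\<Sum>b\<in>N. \<Sum>a\<in>N. K b * phi b (eps a g) I)"
  by (simp add: sum_subtractf) (rule sum.swap)
 also have "(\<Sum>b\<in>N. \<Sum>a\<in>N. K b * phi b (eps a g) I) = opF K (E1 g) I"
  by (simp add: opE_def[abs_def] opF_def phi_lin sum_distrib_left)
 finally show ?thesis by (simp add: sum_distrib_right)
qed

lemma E1_F1: "supported g ==> E1 (F1 g) I = cc N * g I - F1 (E1 g) I"
 by (simp add: E1_opF cc_N)

text \<open>For odd \<open>card N\<close> the last term disappears, so \<open>F2\<close> preserves
  the kernel of \<open>E1\<close>; \<open>E2_injective\<close> relies on this.\<close>

lemma E1_F2:
 assumes g: "supported g"
 shows "E1 (F2 g) I = F2 (E1 g) I + (1 - cc N) * F1 g I"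
proof -
 have *: "eps a (phi j (phi k g)) I = (if a = j then \<gamma> a * phi k g I else 0)
   - (if a = k then \<gamma> a * phi j g I else 0) + phi j (phi k (eps a g)) I"
  if "a \<in> N" "j \<in> N" "k \<in> N" for a j k
 proof -
  have "eps a (phi k g) = (%I. (if a = k then \<gamma> a else 0) * g I - phi k (eps a g) I)"
   using g that by (subst eps_phi) (auto simp: supported_def fun_eq_iff)
  hence "phi j (eps a (phi k g)) I =
    (if a = k then \<gamma> a else 0) * phi j g I - phi j (phi k (eps a g)) I" by (simp add: phi_lin)
  moreover have "eps a (phi j (phi k g)) I =
    (if a = j then \<gamma> a * phi k g I else 0) - phi j (eps a (phi k g)) I"
   using that supported_phi[of k g] by (subst eps_phi) (auto simp: supported_def)
  ultimately show ?thesis by auto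
 qed
 have "E1 (F2 g) I = (\<Sum>a\<in>N. \<Sum>j\<in>N. \<Sum>k\<in>N. \<theta> j k * eps a (phi j (phi k g)) I) / 2"
  unfolding opE_def F2_def[abs_def] eps_lin divide_inverse mult.commute[of _ "inverse 2"]
  by (simp add: sum_distrib_left)
 also have "... = (\<Sum>a\<in>N. \<Sum>j\<in>N. \<Sum>k\<in>N. (if a = j then \<theta> j k * \<gamma> a * phi k g I else 0)
   - (if a = k then \<theta> j k * \<gamma> a * phi j g I else 0) + \<theta> j k * phi j (phi k (eps a g)) I) / 2"
  by (intro arg_cong[of _ _ "%z. z / 2"] sum.cong refl) (auto simp: * algebra_simps)
 also have "... = ((\<Sum>a\<in>N. \<Sum>j\<in>N. \<Sum>k\<in>N. (if a = j then \<theta> j k * \<gamma> a * phi k g I else 0))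
   - (\<Sum>a\<in>N. \<Sum>j\<in>N. \<Sum>k\<in>N. (if a = k then \<theta> j k * \<gamma> a * phi j g I else 0))
   + (\<Sum>a\<in>N. \<Sum>j\<in>N. \<Sum>k\<in>N. \<theta> j k * phi j (phi k (eps a g)) I)) / 2"
  by (simp add: sum.distrib sum_subtractf)
 also have "(\<Sum>a\<in>N. \<Sum>j\<in>N. \<Sum>k\<in>N. (if a = k then \<theta> j k * \<gamma> a * phi j g I else 0)) =
   (\<Sum>j\<in>N. \<Sum>a\<in>N. \<theta> j a * \<gamma> a * phi j g I)" by (subst sum.swap) simp
 also have "... = - (\<Sum>k\<in>N. (\<Sum>j\<in>N. \<gamma> j * \<theta> j k) * phi k g I)"
  unfolding sum_negf[symmetric] sum_distrib_right by (intro sum.cong refl, subst \<theta>_antisym) simp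
 also have "(\<Sum>a\<in>N. \<Sum>j\<in>N. \<Sum>k\<in>N. (if a = j then \<theta> j k * \<gamma> a * phi k g I else 0)) =
   (\<Sum>k\<in>N. (\<Sum>j\<in>N. \<gamma> j * \<theta> j k) * phi k g I)"
 proof -
  have "(\<Sum>j\<in>N. \<Sum>k\<in>N. (if a = j then \<theta> j k * \<gamma> a * phi k g I else 0)) =
    (if a \<in> N then \<Sum>k\<in>N. \<theta> a k * \<gamma> a * phi k g I else 0)" for a
   by (subst sum.swap) (auto simp: sum.delta)
  hence "(\<Sum>a\<in>N. \<Sum>j\<in>N. \<Sum>k\<in>N. (if a = j then \<theta> j k * \<gamma> a * phi k g I else 0)) =
    (\<Sum>a\<in>N. \<Sum>k\<in>N. \<theta> a k * \<gamma> a * phi k g I)" by simp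
  also have "... = (\<Sum>k\<in>N. (\<Sum>j\<in>N. \<gamma> j * \<theta> j k) * phi k g I)"
   by (subst sum.swap) (simp add: sum_distrib_right sum_distrib_left mult_ac)
  finally show ?thesis .
 qed
 also have "(\<Sum>a\<in>N. \<Sum>j\<in>N. \<Sum>k\<in>N. \<theta> j k * phi j (phi k (eps a g)) I) = 2 * F2 (E1 g) I"
 proof -
  have "2 * F2 (E1 g) I = (\<Sum>j\<in>N. \<Sum>k\<in>N. \<Sum>a\<in>N. \<theta> j k * phi j (phi k (eps a g)) I)"
  proof -
   have "2 * F2 (E1 g) I = (\<Sum>j\<in>N. \<Sum>k\<in>N. \<theta> j k * phi j (phi k (E1 g)) I)"
    by (simp add: F2_def)
   thus ?thesis by (simp add: opE_def[abs_def] phi_lin sum_distrib_left)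
  qed
  thus ?thesis by (rule trans[OF sum_swap3 sym])
 qed
 also have "(\<Sum>k\<in>N. (\<Sum>j\<in>N. \<gamma> j * \<theta> j k) * phi k g I) = (1 - cc N) * F1 g I"
  unfolding opF_def sum_distrib_left by (intro sum.cong refl) (simp add: sum_\<gamma>_\<theta>)
 finally have "E1 (F2 g) I = ((1 - cc N) * F1 g I - - ((1 - cc N) * F1 g I) + 2 * F2 (E1 g) I) / 2" .
 also have "(u - - u + 2 * t) / 2 = t + u" for u t :: complex by (simp add: field_simps)
 finally show ?thesis .
qed

lemma E2_phi:
 assumes g: "supported g" and j: "j \<in> N"
 shows "E2 (phi j g) = (%I. phi j (E2 g) I + \<gamma> j * (\<Sum>a\<in>N. \<theta> a j * eps a g I))"
proof
 fix I
 have *: "eps a (eps b (phi j g)) I = (if b = j then \<gamma> j * eps a g I else 0)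
   - (if a = j then \<gamma> j * eps b g I else 0) + phi j (eps a (eps b g)) I"
  if "a \<in> N" "b \<in> N" for a b
 proof -
  have "eps b (phi j g) = (%I. (if b = j then \<gamma> j else 0) * g I - phi j (eps b g) I)"
   using g that j by (subst eps_phi) (auto simp: supported_def fun_eq_iff)
  hence "eps a (eps b (phi j g)) I =
    (if b = j then \<gamma> j else 0) * eps a g I - eps a (phi j (eps b g)) I" by (simp add: eps_lin)
  moreover have "eps a (phi j (eps b g)) I =
    (if a = j then \<gamma> j * eps b g I else 0) - phi j (eps a (eps b g)) I"
   using that j supported_eps[of b g] by (subst eps_phi) (auto simp: supported_def)
  ultimately show ?thesis by auto
 qed
 have "2 * E2 (phi j g) I = (\<Sum>a\<in>N. \<Sum>b\<in>N. \<theta> a b * eps a (eps b (phi j g)) I)"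
  by (simp add: E2_def)
 also have "... = (\<Sum>a\<in>N. \<Sum>b\<in>N. (if b = j then \<theta> a b * \<gamma> j * eps a g I else 0)
   - (if a = j then \<theta> a b * \<gamma> j * eps b g I else 0) + \<theta> a b * phi j (eps a (eps b g)) I)"
  by (intro sum.cong refl) (auto simp: * algebra_simps)
 also have "... = (\<Sum>a\<in>N. \<theta> a j * \<gamma> j * eps a g I)
   - (\<Sum>b\<in>N. \<theta> j b * \<gamma> j * eps b g I) + (\<Sum>a\<in>N. \<Sum>b\<in>N. \<theta> a b * phi j (eps a (eps b g)) I)"
 proof -
  have "(\<Sum>a\<in>N. \<Sum>b\<in>N. (if a = j then \<theta> a b * \<gamma> j * eps b g I else 0)) =
    (\<Sum>b\<in>N. \<theta> j b * \<gamma> j * eps b g I)" using j by (subst sum.swap) simp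
  thus ?thesis using j by (simp add: sum.distrib sum_subtractf)
 qed
 also have "(\<Sum>b\<in>N. \<theta> j b * \<gamma> j * eps b g I) = - (\<Sum>a\<in>N. \<theta> a j * \<gamma> j * eps a g I)"
  unfolding sum_negf[symmetric] by (intro sum.cong refl) (subst \<theta>_antisym, simp)
 also have "(\<Sum>a\<in>N. \<Sum>b\<in>N. \<theta> a b * phi j (eps a (eps b g)) I) = 2 * phi j (E2 g) I"
  unfolding E2_def[abs_def] phi_lin divide_inverse mult.commute[of _ "inverse 2"] by (simp add: sum_distrib_left)
 finally have "2 * E2 (phi j g) I = 2 * (\<Sum>a\<in>N. \<theta> a j * \<gamma> j * eps a g I) + 2 * phi j (E2 g) I"
  by simp
 hence "E2 (phi j g) I = (\<Sum>a\<in>N. \<theta> a j * \<gamma> j * eps a g I) + phi j (E2 g) I"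
  by (simp only: distrib_left[symmetric] mult_cancel_left) simp
 thus "E2 (phi j g) I = phi j (E2 g) I + \<gamma> j * (\<Sum>a\<in>N. \<theta> a j * eps a g I)"
  by (simp add: sum_distrib_left mult_ac)
qed


lemma eps_phi_self:
 assumes "supported g" "a \<in> N"
 shows "eps a (phi a g) I = (if a \<in> I then \<gamma> a * g I else 0)"
proof (cases "a \<in> I")
 case True
 hence "phi a (eps a g) I = 0" by (simp add: phi_def)
 thus ?thesis using True assms by (auto simp: eps_phi supported_def)
qed (simp add: eps_def)

text \<open>Up to sign this is the trace of \<open>sum_\<theta>_\<gamma>_\<theta>\<close> weighted
  by \<gamma>, where each diagonal entry 1 / \<gamma> contributes 1.\<close>

lemma sum_u: "(\<Sum>j\<in>N. \<Sum>k\<in>N. \<theta> j k * \<theta> j k * \<gamma> k * \<gamma> j) = cc N * cc N - of_nat (card N)"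
proof -
 have "(\<Sum>j\<in>N. \<Sum>k\<in>N. \<theta> j k * \<theta> j k * \<gamma> k * \<gamma> j) =
   (\<Sum>j\<in>N. (- (\<Sum>k\<in>N. \<theta> j k * \<gamma> k * \<theta> k j)) * \<gamma> j)"
  unfolding sum_distrib_right sum_negf[symmetric]
  by (intro sum.cong refl) (subst (3) \<theta>_antisym, simp add: mult_ac)
 also have "... = (\<Sum>j\<in>N. cc N * \<gamma> j - 1)"
 proof (intro sum.cong refl)
  fix j assume j: "j \<in> N"
  thus "(- (\<Sum>k\<in>N. \<theta> j k * \<gamma> k * \<theta> k j)) * \<gamma> j = cc N * \<gamma> j - 1"
   using sum_\<theta>_\<gamma>_\<theta>[OF j j] \<gamma>_nz[OF j] by (simp add: field_simps)
 qed
 finally show ?thesis by (simp add: sum_subtractf sum_distrib_left[symmetric] cc_N)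
qed

text \<open>As in sl2 the commutator is the grading operator up to a shift, except for the term with
  \<open>E1\<close> and \<open>F1\<close>, which comes from the all-ones part of
  \<open>sum_\<theta>_\<gamma>_\<theta>\<close> and is present for odd
  \<open>card N\<close>.\<close>

lemma E2_F2:
 assumes g: "supported g"
 shows "E2 (F2 g) I = F2 (E2 g) I
  + (of_nat (card I) - (of_nat (card N) - cc N) / 2) * g I - cc N * E1 (F1 g) I"
proof (cases "I \<subseteq> N")
 case False
 have "E2 h I = 0" "F2 h I = 0" "E1 h I = 0" "g I = 0" for h
  using False g by (auto simp: E2_def F2_def opE_def supported_def eps_def phi_def)
 thus ?thesis by simp
next
 case I: True
 have lin: "E2 (%I. (\<Sum>j\<in>N. \<Sum>k\<in>N. c j k * h j k I) / 2) J = (\<Sum>j\<in>N. \<Sum>k\<in>N. c j k * E2 (h j k) J) / 2"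
  for c h J
 proof -
  have "E2 (%I. (\<Sum>j\<in>N. \<Sum>k\<in>N. c j k * h j k I) / 2) J =
    (\<Sum>a\<in>N. \<Sum>b\<in>N. \<Sum>j\<in>N. \<Sum>k\<in>N. c j k * (\<theta> a b * eps a (eps b (h j k)) J)) / 2 / 2"
   unfolding E2_def eps_lin divide_inverse mult.commute[of _ "inverse 2"] by (simp add: sum_distrib_left mult_ac)
  also have "(\<Sum>a\<in>N. \<Sum>b\<in>N. \<Sum>j\<in>N. \<Sum>k\<in>N. c j k * (\<theta> a b * eps a (eps b (h j k)) J)) =
    (\<Sum>j\<in>N. \<Sum>k\<in>N. \<Sum>a\<in>N. \<Sum>b\<in>N. c j k * (\<theta> a b * eps a (eps b (h j k)) J))"
   by (rule trans[OF sum.cong[OF refl sum_swap3] sum_swap3])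
  finally show ?thesis by (simp add: E2_def sum_distrib_left sum_divide_distrib)
 qed
 have "E2 (F2 g) I = (\<Sum>j\<in>N. \<Sum>k\<in>N. \<theta> j k * E2 (phi j (phi k g)) I) / 2"
  unfolding F2_def[abs_def] by (rule lin)
 also have "... = (\<Sum>j\<in>N. \<Sum>k\<in>N. \<theta> j k * phi j (phi k (E2 g)) I
   + (\<Sum>a\<in>N. \<theta> a j * \<gamma> j * \<theta> j k * eps a (phi k g) I)
   + (\<Sum>a\<in>N. \<theta> j k * \<gamma> k * \<theta> a k * phi j (eps a g) I)) / 2" using g supported_phi
  by (intro arg_cong[of _ _ "%z. z / 2"] sum.cong refl)
   (simp add: E2_phi phi_lin distrib_left sum_distrib_left mult_ac)
 also have "... = F2 (E2 g) I
   + ((\<Sum>j\<in>N. \<Sum>k\<in>N. \<Sum>a\<in>N. \<theta> a j * \<gamma> j * \<theta> j k * eps a (phi k g) I)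
   + (\<Sum>j\<in>N. \<Sum>k\<in>N. \<Sum>a\<in>N. \<theta> j k * \<gamma> k * \<theta> a k * phi j (eps a g) I)) / 2"
  by (simp add: sum.distrib F2_def add_divide_distrib)
 also have "(\<Sum>j\<in>N. \<Sum>k\<in>N. \<Sum>a\<in>N. \<theta> j k * \<gamma> k * \<theta> a k * phi j (eps a g) I) =
   (\<Sum>j\<in>N. \<Sum>k\<in>N. \<Sum>a\<in>N. (if a = j then \<theta> j k * \<gamma> k * \<theta> j k * \<gamma> j * g I else 0)
    - \<theta> j k * \<gamma> k * \<theta> a k * eps a (phi j g) I)"
  using I by (intro sum.cong refl) (auto simp: eps_phi algebra_simps)
 also have "... = (\<Sum>j\<in>N. \<Sum>k\<in>N. \<theta> j k * \<theta> j k * \<gamma> k * \<gamma> j) * g I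
   - (\<Sum>j\<in>N. \<Sum>k\<in>N. \<Sum>a\<in>N. \<theta> j k * \<gamma> k * \<theta> a k * eps a (phi j g) I)"
  by (simp add: sum_subtractf sum_distrib_right sum_distrib_left mult_ac)
 also have "(\<Sum>j\<in>N. \<Sum>k\<in>N. \<Sum>a\<in>N. \<theta> j k * \<gamma> k * \<theta> a k * eps a (phi j g) I) =
   - (\<Sum>j\<in>N. \<Sum>k\<in>N. \<Sum>a\<in>N. \<theta> a j * \<gamma> j * \<theta> j k * eps a (phi k g) I)"
 proof -
  have "(\<Sum>j\<in>N. \<Sum>k\<in>N. \<Sum>a\<in>N. \<theta> j k * \<gamma> k * \<theta> a k * eps a (phi j g) I) =
    (\<Sum>k\<in>N. \<Sum>j\<in>N. \<Sum>a\<in>N. \<theta> j k * \<gamma> k * \<theta> a k * eps a (phi j g) I)" by (rule sum.swap)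
  also have "... = - (\<Sum>j\<in>N. \<Sum>k\<in>N. \<Sum>a\<in>N. \<theta> a j * \<gamma> j * \<theta> j k * eps a (phi k g) I)"
   unfolding sum_negf[symmetric] by (intro sum.cong refl) (subst \<theta>_antisym, simp)
  finally show ?thesis .
 qed
 also have "(\<Sum>j\<in>N. \<Sum>k\<in>N. \<Sum>a\<in>N. \<theta> a j * \<gamma> j * \<theta> j k * eps a (phi k g) I) =
   (\<Sum>a\<in>N. \<Sum>k\<in>N. (\<Sum>j\<in>N. \<theta> a j * \<gamma> j * \<theta> j k) * eps a (phi k g) I)"
 proof -
  have "(\<Sum>j\<in>N. \<Sum>k\<in>N. \<Sum>a\<in>N. \<theta> a j * \<gamma> j * \<theta> j k * eps a (phi k g) I) =
    (\<Sum>k\<in>N. \<Sum>a\<in>N. \<Sum>j\<in>N. \<theta> a j * \<gamma> j * \<theta> j k * eps a (phi k g) I)"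
   by (rule sum_swap3)
  also have "... = (\<Sum>a\<in>N. \<Sum>k\<in>N. \<Sum>j\<in>N. \<theta> a j * \<gamma> j * \<theta> j k * eps a (phi k g) I)"
   by (rule sum.swap)
  finally show ?thesis by (simp add: sum_distrib_right)
 qed
 also have "... = (\<Sum>a\<in>N. \<Sum>k\<in>N. (if a = k then (if a \<in> I then g I else 0) else 0) - cc N * eps a (phi k g) I)"
 proof (intro sum.cong refl)
  fix a k assume "a \<in> N" "k \<in> N"
  thus "(\<Sum>j\<in>N. \<theta> a j * \<gamma> j * \<theta> j k) * eps a (phi k g) I =
    (if a = k then (if a \<in> I then g I else 0) else 0) - cc N * eps a (phi k g) I"
   using \<gamma>_nz[of a] eps_phi_self[OF g, of a I] by (auto simp: sum_\<theta>_\<gamma>_\<theta> left_diff_distrib)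
 qed
 also have "... = (\<Sum>a\<in>N. if a \<in> I then g I else 0) - cc N * E1 (F1 g) I"
  by (simp add: sum_subtractf opE_def opF_def[abs_def] eps_lin sum_distrib_left)
 also have "(\<Sum>a\<in>N. if a \<in> I then g I else 0) = of_nat (card I) * g I"
  using I by (simp add: sum.If_cases Int_absorb1)
 finally have "E2 (F2 g) I = F2 (E2 g) I + (of_nat (card I) * g I - cc N * E1 (F1 g) I) +
   (cc N * cc N - of_nat (card N)) / 2 * g I"
  unfolding sum_u by (simp add: algebra_simps add_divide_distrib diff_divide_distrib)
 moreover have "cc N * cc N = cc N" by (simp add: cc_eq)
 ultimately show ?thesis by (simp add: algebra_simps add_divide_distrib diff_divide_distrib)
qed

text \<open>In the representation theory of \<open>sl\<^sub>2\<close>, a lowering operator is injective on positive weights.\<close>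

lemma E2_injective:
 assumes g: "!!I. g I ~= 0 ==> I \<subseteq> N \<and> card I = m"
  and m: "2 * m + 2 \<le> card N" and E2: "!!I. E2 g I = 0"
  and E1: "odd (card N) ==> \<forall>I. E1 g I = 0"
 shows "g I = 0"
proof -
 define h where "h k = (F2 ^^ k) g" for k
 \<comment> \<open>On the kernel of \<open>E1\<close>, the operator \<open>F1\<close> followed by
   \<open>E1\<close> acts as \<open>cc N\<close>. So for odd n the correction in
   \<open>E2_F2\<close> raises the shift from (n - 1) / 2 to (n + 1) / 2; for even n it is n /
   2.\<close>
 define \<mu> :: real where "\<mu> = (real (card N) + of_bool (odd (card N))) / 2"
 have h_Suc: "h (Suc k) = F2 (h k)" for k by (simp add: h_def)
 have supp: "I \<subseteq> N \<and> card I + 2 * k = m" if "h k I ~= 0" for k I using that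
 proof (induction k arbitrary: I)
  case (Suc k)
  then obtain a b where ab: "phi a (phi b (h k)) I ~= 0"
   unfolding h_Suc F2_def by (metis (no_types, lifting) div_0 mult_zero_right sum.neutral)
  hence "h k (insert b (insert a I)) ~= 0" "a \<notin> I" "b \<notin> insert a I" "I \<subseteq> N"
   unfolding phi_def by (auto split: if_splits)
  thus ?case using Suc.IH[of "insert b (insert a I)"] finite_subset[OF _ finite_N, of I] by auto
 qed (use g in \<open>auto simp: h_def\<close>)
 have supp': "supported (h k)" for k using supp unfolding supported_def by blast
 have E1h: "odd (card N) ==> E1 (h k) = (%_. 0)" for k
 proof (induction k)
  case 0
  thus ?case using E1 by (auto simp: h_def)
 next
  case (Suc k)
  hence "F2 (E1 (h k)) = (%_. 0)" by (simp add: F2_def[abs_def] phi_lin)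
  thus ?case using Suc.prems by (auto simp: h_Suc E1_F2[OF supp'] cc_eq)
 qed
 have comm: "E2 (h (Suc k)) I = F2 (E2 (h k)) I + of_real (real m - 2 * real k - \<mu>) * h k I" for k I
 \<comment> \<open>The value of \<open>card I\<close> is known only where \<open>h k I\<close> does
   not vanish.\<close>
 proof (cases "h k I = 0")
  case True
  have "cc N * E1 (F1 (h k)) I = 0"
  proof (cases "odd (card N)")
   case o: True
   have "F1 (E1 (h k)) = (%_. 0)" using E1h[OF o, of k] by (simp add: opF_def[abs_def] phi_lin)
   thus ?thesis using True by (simp add: E1_F1[OF supp'])
  qed (simp add: cc_eq)
  thus ?thesis using True by (simp add: h_Suc E2_F2[OF supp'])
 next
  case False
  have c: "real (card I) = real m - 2 * real k" using supp[OF False] by linarith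
  have c': "(of_nat (card I) :: complex) = of_real (real m - 2 * real k)" using c by (metis of_real_of_nat_eq)
  show ?thesis
  proof (cases "odd (card N)")
   case o: True
   have "F1 (E1 (h k)) = (%_. 0)" using E1h[OF o, of k] by (simp add: opF_def[abs_def] phi_lin)
   hence "E1 (F1 (h k)) I = h k I" using o by (simp add: E1_F1[OF supp'] cc_eq)
   thus ?thesis using o by (simp add: h_Suc E2_F2[OF supp'] c' cc_eq \<mu>_def field_simps)
  next
   case e: False
   thus ?thesis by (simp add: h_Suc E2_F2[OF supp'] c' cc_eq \<mu>_def field_simps)
  qed
 qed
 \<comment> \<open>The commutator scalars add up along the chain h 0, h 1, ...; each of them is
   negative because 2 m + 2 \<le> card N.\<close>
 define \<beta> :: "nat => real" where "\<beta> k = (\<Sum>i\<le>k. real m - 2 * real i - \<mu>)" for k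
 have \<beta>: "\<beta> k < 0" for k
  unfolding \<beta>_def using m by (intro sum_strict_mono[where g = "%_. 0", simplified]) (auto simp: \<mu>_def)
 have step: "E2 (h (Suc k)) = (%I. of_real (\<beta> k) * h k I)" for k
 proof (induction k)
  case 0
  have "E2 (h 0) = (%_. 0)" using E2 by (auto simp: h_def)
  hence "F2 (E2 (h 0)) = (%_. 0)" by (simp add: F2_def[abs_def] phi_lin)
  thus ?case by (auto simp: comm \<beta>_def)
 next
  case (Suc k)
  have "F2 (E2 (h (Suc k))) I = of_real (\<beta> k) * h (Suc k) I" for I
   unfolding Suc by (simp add: h_Suc F2_def phi_lin sum_distrib_left mult_ac)
  thus ?case by (auto simp: comm[of "Suc k"] \<beta>_def algebra_simps)
 qed
 \<comment> \<open>Each \<open>F2\<close> lowers the cardinality by 2, so the chain ends; the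
   non-zero \<open>\<beta> k\<close> then carry the vanishing back to \<open>g\<close>.\<close>
 have last: "h (Suc m) = (%_. 0)" using supp[of "Suc m"] by fastforce
 have step': "h k = (%_. 0)" if "h (Suc k) = (%_. 0)" for k
 proof
  fix I
  have "of_real (\<beta> k) * h k I = E2 (h (Suc k)) I" by (simp add: step)
  also have "... = 0" unfolding that by (simp add: E2_def eps_lin)
  finally show "h k I = 0" using \<beta>[of k] by simp
 qed
 have "h k = (%_. 0)" if "k \<le> Suc m" for k
  by (rule inc_induct[where P = "%k. h k = (%_. 0)", OF that last]) (rule step')
 hence "h 0 = (%_. 0)" by blast
 thus ?thesis by (simp add: h_def)
qed

end

declare One_nat_def [simp del]

section \<open>Divisibility by linear forms\<close>

lemma ev_of_nat [simp]: "ev v (of_nat k) = of_nat k"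
 using ev_of_int[of v "int k"] by simp

lemma indep_Var [simp]: "indep w (Var w') \<longleftrightarrow> w ~= w'"
proof
 assume "indep w (Var w')"
 hence "ev ((%_. 0)(w := 1)) (Var w') = ev (%_. 0) (Var w')" unfolding indep_def by blast
 thus "w ~= w'" by auto
qed (auto simp: indep_def)

lemma indep_simps [simp]:
 "indep w P ==> indep w Q ==> indep w (P + Q)"
 "indep w P ==> indep w Q ==> indep w (P - Q)"
 "indep w P ==> indep w Q ==> indep w (P * Q)"
 "indep w P ==> indep w (- P)"
 "indep w P ==> indep w (P ^ e)"
 "(!!i. i \<in> I ==> indep w (F i)) ==> indep w (\<Sum>i\<in>I. F i)"
 "(!!i. i \<in> I ==> indep w (F i)) ==> indep w (\<Prod>i\<in>I. F i)"
 "indep w (const c)" "indep w 1" "indep w 0" "indep w (of_int k)" "indep w (of_nat i)"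
 by (auto simp: indep_def)

definition xpoly :: "nat => mpoly => bool" where
 "xpoly n P \<longleftrightarrow> poly_vars P \<subseteq> Vx ` {1..n}"

lemma xpoly_iff: "xpoly n P \<longleftrightarrow> (\<forall>w. w \<notin> Vx ` {1..n} --> indep w P)"
 unfolding xpoly_def by (rule poly_vars_subset_iff)

lemma xpoly_simps [simp]:
 "xpoly n P ==> xpoly n Q ==> xpoly n (P + Q)"
 "xpoly n P ==> xpoly n Q ==> xpoly n (P - Q)"
 "xpoly n P ==> xpoly n Q ==> xpoly n (P * Q)"
 "xpoly n P ==> xpoly n (- P)"
 "xpoly n P ==> xpoly n (P ^ e)"
 "(!!i. i \<in> I ==> xpoly n (F i)) ==> xpoly n (\<Sum>i\<in>I. F i)"
 "(!!i. i \<in> I ==> xpoly n (F i)) ==> xpoly n (\<Prod>i\<in>I. F i)"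
 "xpoly n (const c)" "xpoly n 1" "xpoly n 0" "xpoly n (of_int k)" "xpoly n (of_nat i)"
 "j \<in> {1..n} ==> xpoly n (Var (Vx j))"
 by (auto simp: xpoly_iff)

lemma xpoly_ev_cong:
 assumes "xpoly n P" "!!j. j \<in> {1..n} ==> u (Vx j) = v (Vx j)"
 shows "ev u P = ev v P"
 by (rule indep_agree[of P "Vx ` {1..n}"]) (use assms in \<open>auto simp: xpoly_def\<close>)

text \<open>Substituting a value for \<open>w\<close> in \<open>P * Q\<close> affects only
  \<open>Q\<close>, and \<open>P\<close> may be cancelled in a domain.\<close>

lemma indep_cancel:
 assumes "indep w P" "P ~= 0" "indep w (P * Q)"
 shows "indep w Q"
 unfolding indep_def
proof (intro allI)
 fix v t
 let ?S = "%P. poly_subst (Var(w := const t)) P"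
 have ev: "ev u (?S R) = ev (u(w := t)) R" for u R
  unfolding ev_poly_subst by (rule arg_cong[of _ _ "%f. ev f R"]) (auto simp: fun_eq_iff)
 have "P * (?S Q - Q) = 0"
 proof (rule ev_eq_0I)
  fix u
  have "ev (u(w := t)) (P * Q) = ev u (P * Q)" "ev (u(w := t)) P = ev u P"
   using assms by (auto simp: indep_def simp del: ev_simps)
  thus "ev u (P * (?S Q - Q)) = 0" by (simp add: ev algebra_simps)
 qed
 hence "?S Q = Q" using assms(2) by simp
 thus "ev (v(w := t)) Q = ev v Q" by (metis ev)
qed

lemma xpoly_cancel: "xpoly n P ==> P ~= 0 ==> xpoly n (P * Q) ==> xpoly n Q"
 unfolding xpoly_iff using indep_cancel by blast

definition lin :: "complex => nat => nat => mpoly" where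
 "lin c a b = Var (Vx a) - const c * Var (Vx b)"

lemma ev_lin [simp]: "ev v (lin c a b) = v (Vx a) - c * v (Vx b)"
 by (simp add: lin_def)

lemma xpoly_lin [simp]: "a \<in> {1..n} ==> b \<in> {1..n} ==> xpoly n (lin c a b)"
 by (simp add: lin_def)

lemma dvd_mult_diff:
 fixes x y :: "'r::comm_ring_1"
 assumes "d dvd x - y" "d dvd x' - y'"
 shows "d dvd x * x' - y * y'"
proof -
 have "x * x' - y * y' = (x - y) * x' + y * (x' - y')" by (simp add: algebra_simps)
 thus ?thesis using assms by simp
qed

lemma poly_subst_Var: "poly_subst Var P = P"
 by (rule ev_eqI) (simp add: ev_poly_subst)

text \<open>Congruence modulo \<open>d\<close> is compatible with sums and products, hence with
  substitution.\<close>

lemma dvd_subst_diff: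
 assumes "!!w. d dvd f w - g w"
 shows "d dvd poly_subst f P - (poly_subst g P :: mpoly)"
proof -
 have pow: "d dvd f w ^ k - g w ^ k" for w k using assms by (induction k) (auto intro: dvd_mult_diff)
 have "d dvd (\<Prod>w\<in>A. f w ^ h w) - (\<Prod>w\<in>A. g w ^ h w)" for A and h :: "var => nat"
  by (induction A rule: infinite_finite_induct) (auto intro!: dvd_mult_diff pow)
 thus ?thesis unfolding poly_subst_def sum_subtractf[symmetric] right_diff_distrib[symmetric]
  by (intro dvd_sum dvd_mult)
qed

text \<open>Modulo x_a - c x_b, the polynomial is congruent to its substitution x_a = c x_b, which
  vanishes.\<close>

lemma lin_dvdI:
 assumes "c ~= 0"
  and "!!v. (!!w. v w ~= 0) ==> v (Vx a) = c * v (Vx b) ==> ev v P = 0" and "a ~= b"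
 shows "lin c a b dvd P"
proof -
 let ?g = "Var(Vx a := const c * Var (Vx b))"
 have "poly_subst ?g P = 0"
 proof (rule ev_eq_0I)
  fix v :: "var => complex" assume v: "!!w. v w ~= 0"
  have "(%w. ev v (?g w)) = v(Vx a := c * v (Vx b))" by (auto simp: fun_eq_iff)
  thus "ev v (poly_subst ?g P) = 0" unfolding ev_poly_subst using v assms by (auto intro!: assms(2))
 qed
 moreover have "lin c a b dvd poly_subst Var P - poly_subst ?g P" by (rule dvd_subst_diff) (auto simp: lin_def)
 ultimately show ?thesis by (simp add: poly_subst_Var)
qed

text \<open>The order a < b makes the forms pairwise non-proportional. Hence the product of the
  earlier ones does not vanish identically on the hyperplane of the next one, and the cofactor
  inherits the zeros of \<open>P\<close> there.\<close>

lemma lin_prod_dvdI: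
 assumes "finite B" and B: "!!a b c. (a, b, c) \<in> B ==> a < b \<and> c \<in> {1, -1}"
  and van: "!!a b c v. (a, b, c) \<in> B ==> (!!w. v w ~= 0) ==> v (Vx a) = c * v (Vx b) ==> ev v P = 0"
 shows "(\<Prod>(a, b, c)\<in>B. lin c a b) dvd P"
 using assms
proof (induction B rule: finite_induct)
 case (insert t B)
 obtain a b c where t: "t = (a, b, c)" by (cases t)
 have abc: "a < b" "c \<in> {1, -1}" using insert.prems(1)[of a b c] t by auto
 have "(\<Prod>(a, b, c)\<in>B. lin c a b) dvd P" using insert.prems by (intro insert.IH) blast+
 then obtain Q where Q: "P = (\<Prod>(a, b, c)\<in>B. lin c a b) * Q" by (auto elim: dvdE)
 let ?R = "\<Prod>(a, b, c)\<in>B. lin c a b"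
 have "lin c a b dvd Q"
 proof (rule lin_dvdI)
  let ?g = "Var(Vx a := const c * Var (Vx b))"
  have g: "ev v (poly_subst ?g S) = ev (v(Vx a := c * v (Vx b))) S" for v S
   unfolding ev_poly_subst by (rule arg_cong[of _ _ "%f. ev f S"]) (auto simp: fun_eq_iff)
  have "poly_subst ?g ?R * poly_subst ?g Q = 0"
  proof (rule ev_eq_0I)
   fix v :: "var => complex" assume "!!w. v w ~= 0"
   hence "ev (v(Vx a := c * v (Vx b))) P = 0" using abc by (intro insert.prems(2)[of a b c]) (auto simp: t)
   thus "ev v (poly_subst ?g ?R * poly_subst ?g Q) = 0" by (simp add: g Q)
  qed
  moreover have "poly_subst ?g ?R ~= 0"
  proof
   \<comment> \<open>Moved to the hyperplane of \<open>t\<close>, this point has coordinates of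
     distinct absolute value except for the pair a, b; so an earlier form that vanishes there would
     be \<open>t\<close> itself.\<close>
   define v :: "var => complex" where "v = (%w. case w of VX j => 1 | Vx j => of_nat (j + 2))"
   define u where "u = v(Vx a := c * v (Vx b))"
   assume "poly_subst ?g ?R = 0"
   hence "ev u ?R = 0" using g[of v ?R] by (simp add: u_def)
   then obtain a' b' c' where t': "(a', b', c') \<in> B" "u (Vx a') = c' * u (Vx b')"
    using insert.hyps(1) by (auto simp: case_prod_unfold)
   have c': "a' < b'" "c' \<in> {1, -1}" using insert.prems(1)[of a' b' c'] t' by auto
   have nu: "norm (u (Vx j)) = real (if j = a then b + 2 else j + 2)" for j
    using abc unfolding u_def v_def by (auto simp: norm_mult simp flip: of_nat_add of_nat_Suc)
   have "norm (u (Vx a')) = norm (u (Vx b'))" using t' c' by (auto simp: norm_mult)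
   hence "a' = a \<and> b' = b" using nu[of a'] nu[of b'] c' abc by (auto split: if_splits)
   moreover from this have "c' = c" using t' abc by (auto simp: u_def v_def simp flip: of_nat_add of_nat_Suc)
   ultimately show False using t' insert.hyps t by auto
  qed
  ultimately have *: "poly_subst ?g Q = 0" by simp
  fix v :: "var => complex" assume "v (Vx a) = c * v (Vx b)"
  hence "v(Vx a := c * v (Vx b)) = v" by auto
  thus "ev v Q = 0" using g[of v Q] * by simp
 qed (use abc in auto)
 thus ?case using insert.hyps by (simp add: Q t mult_dvd_mono mult.commute)
qed simp

lemma eq_uminus_complex: "(x::complex) = - x ==> x = 0"
 by (metis add.right_inverse mult_2 mult_eq_0_iff zero_neq_numeral)

section \<open>Vandermonde products\<close>

definition vdm :: "nat set => (nat => 'r::comm_ring_1) => 'r" where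
 "vdm S y = (\<Prod>(a, b)\<in>{(a, b). a \<in> S \<and> b \<in> S \<and> a < b}. y a - y b)"

lemma finite_pairs [simp]: "finite S ==> finite {(a, b). a \<in> S \<and> b \<in> S \<and> a < (b::nat)}"
 by (rule finite_subset[of _ "S \<times> S"]) auto

lemma vdm_cong: "(!!a. a \<in> S ==> y a = y' a) ==> vdm S y = vdm S y'"
 unfolding vdm_def by (rule prod.cong) auto

text \<open>The sign counts the members of \<open>S\<close> below \<open>a\<close>. Its independence
  of \<open>y\<close> is what \<open>vdm_swap\<close> uses.\<close>

lemma vdm_insert:
 assumes "finite S" "a \<notin> S"
 shows "\<exists>k. \<forall>y. vdm (insert a S) y = (-1) ^ k * (\<Prod>b\<in>S. y a - y b) * vdm S (y :: nat => 'r::comm_ring_1)"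
proof (intro exI allI)
 fix y :: "nat => 'r"
 let ?P = "%S. {(a, b). a \<in> S \<and> b \<in> S \<and> a < (b::nat)}"
 let ?L = "{b \<in> S. b < a}" and ?G = "{b \<in> S. a < b}"
 have S: "S = ?L \<union> ?G" using assms by (auto, metis linorder_cases)
 have "?P (insert a S) = ?P S \<union> ((%b. (a, b)) ` ?G \<union> (%b. (b, a)) ` ?L)" by auto
 hence "vdm (insert a S) y = (\<Prod>(a, b)\<in>?P S \<union> ((%b. (a, b)) ` ?G \<union> (%b. (b, a)) ` ?L). y a - y b)"
  unfolding vdm_def by (rule arg_cong)
 also have "... = vdm S y * (\<Prod>(a, b)\<in>(%b. (a, b)) ` ?G \<union> (%b. (b, a)) ` ?L. y a - y b)"
  unfolding vdm_def by (rule prod.union_disjoint) (use assms in auto)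
 also have "(\<Prod>(a, b)\<in>(%b. (a, b)) ` ?G \<union> (%b. (b, a)) ` ?L. y a - y b) =
   (\<Prod>(a, b)\<in>(%b. (a, b)) ` ?G. y a - y b) * (\<Prod>(a, b)\<in>(%b. (b, a)) ` ?L. y a - y b)"
  by (rule prod.union_disjoint) (use assms in auto)
 also have "(\<Prod>(a, b)\<in>(%b. (a, b)) ` ?G. y a - y b) = (\<Prod>b\<in>?G. y a - y b)"
  by (subst prod.reindex) (auto simp: inj_on_def)
 also have "(\<Prod>(a, b)\<in>(%b. (b, a)) ` ?L. y a - y b) = (\<Prod>b\<in>?L. - 1 * (y a - y b))"
  by (subst prod.reindex) (auto simp: inj_on_def)
 also have "... = (-1) ^ card ?L * (\<Prod>b\<in>?L. y a - y b)" by (simp only: prod.distrib prod_constant)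
 also have "(\<Prod>b\<in>?G. y a - y b) * ((-1) ^ card ?L * (\<Prod>b\<in>?L. y a - y b)) =
   (-1) ^ card ?L * (\<Prod>b\<in>S. y a - y b)"
  using assms by (subst (3) S, subst prod.union_disjoint) (auto simp: mult_ac)
 finally show "vdm (insert a S) y = (-1) ^ card ?L * (\<Prod>b\<in>S. y a - y b) * vdm S y" by (simp add: mult_ac)
qed

text \<open>With \<open>i\<close> and \<open>k\<close> split off, exchanging them swaps the factors
  towards the remaining elements and negates y_i - y_k.\<close>

lemma vdm_swap:
 assumes "finite S" "i \<in> S" "k \<in> S" "i ~= k"
 shows "vdm S (y \<circ> transpose i k) = - vdm S (y :: nat => 'r::comm_ring_1)"
proof -
 define C where "C = S - {i, k}"
 have S: "S = insert i (insert k C)" and C: "finite C" "i \<notin> insert k C" "k \<notin> C"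
  using assms by (auto simp: C_def)
 obtain p where p: "!!y :: nat => 'r. vdm (insert i (insert k C)) y =
   (-1) ^ p * (\<Prod>b\<in>insert k C. y i - y b) * vdm (insert k C) y"
  using vdm_insert[of "insert k C" i] C by blast
 obtain q where q: "!!y :: nat => 'r. vdm (insert k C) y = (-1) ^ q * (\<Prod>b\<in>C. y k - y b) * vdm C y"
  using vdm_insert[of C k] C by blast
 have t: "transpose i k c = c" if "c \<in> C" for c using C that by (auto simp: transpose_def)
 hence "vdm C (y \<circ> transpose i k) = vdm C y" by (intro vdm_cong) auto
 thus ?thesis using C t by (simp add: S p q) (simp add: algebra_simps cong: prod.cong)
qed

lemma vdm_permutes:
 assumes "\<pi> permutes S" "finite S"
 shows "vdm S (y \<circ> \<pi>) = of_int (sign \<pi>) * vdm S (y :: nat => 'r::comm_ring_1)"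
 using assms
proof (induction arbitrary: y rule: permutes_induct)
 case id
 thus ?case by (simp add: sign_id)
next
 case (swap a b p)
 show ?case
 proof (cases "a = b")
  case False
  have "permutation p" using swap assms(2) permutation_permutes by blast
  hence "sign (transpose a b \<circ> p) = - sign p"
   using False by (simp add: sign_compose permutation_swap_id sign_swap_id)
  moreover have "vdm S (y \<circ> (transpose a b \<circ> p)) = vdm S ((y \<circ> transpose a b) \<circ> p)"
   by (simp add: comp_assoc)
  moreover have "vdm S ((y \<circ> transpose a b) \<circ> p) = of_int (sign p) * vdm S (y \<circ> transpose a b)"
   by (rule swap.IH)
  moreover have "vdm S (y \<circ> transpose a b) = - vdm S y" using swap False assms(2) by (intro vdm_swap) auto
  ultimately show ?thesis by (simp only:) simp
 qed (use swap in simp)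
qed

lemma vdm_nz: "finite S ==> inj_on y S ==> vdm S y ~= (0 :: 'r::idom)"
 unfolding vdm_def by (subst prod_zero_iff) (auto simp: inj_on_def)

lemma ev_vdm: "ev v (vdm S Y) = vdm S (%j. ev v (Y j))"
 by (simp add: vdm_def case_prod_unfold)

section \<open>Generic points\<close>

definition gen :: "nat => (var => complex) => bool" where
 "gen n v \<longleftrightarrow> (\<forall>w. v w ~= 0) \<and>
   (\<forall>a\<in>{1..n}. \<forall>b\<in>{1..n}. a ~= b --> v (Vx a) + v (Vx b) ~= 0 \<and> v (Vx a) ~= v (Vx b))"

abbreviation (input) pt :: "(var => complex) => nat => complex" where
 "pt v \<equiv> %j. v (Vx j)"

lemma gen_point: "gen n v ==> generic_point {1..n} (pt v)"
 by unfold_locales (auto simp: gen_def)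

lemma gen_nonzero: "gen n v ==> v w ~= 0"
 by (simp add: gen_def)

definition disc :: "nat => mpoly" where
 "disc n = (\<Prod>a\<in>{1..n}. \<Prod>b\<in>{1..n} - {a}. (Var (Vx a) + Var (Vx b)) * (Var (Vx a) - Var (Vx b)))"

lemma gen_iff: "(!!w. v w ~= 0) ==> gen n v \<longleftrightarrow> ev v (disc n) ~= 0"
 by (auto simp: gen_def disc_def)

lemma disc_nz: "disc n ~= 0"
proof
 define v :: "var => complex" where "v = (%w. of_nat (Suc (var_code w)))"
 have v: "v w ~= 0" for w by (simp add: v_def del: of_nat_Suc)
 assume "disc n = 0"
 hence "\<not> gen n v" using gen_iff[of v n] v by simp
 thus False using v by (auto simp: gen_def) (auto simp: v_def simp del: of_nat_Suc simp flip: of_nat_add)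
qed

lemma ev_eqI_gen:
 assumes "!!v. gen n v ==> ev v P = ev v Q"
 shows "P = Q"
 using ev_eqI_dense[OF disc_nz, of n P Q] assms gen_iff by blast

definition vp :: "(nat => nat) => (var => complex) => var => complex" where
 "vp \<pi> v = (%w. case w of VX a => v (VX a) | Vx j => v (Vx (\<pi> j)))"

lemma vp_simps [simp]: "vp \<pi> v (VX a) = v (VX a)" "vp \<pi> v (Vx j) = v (Vx (\<pi> j))"
 by (simp_all add: vp_def)

lemma ev_rename_x_vp [simp]: "ev v (rename_x \<pi> P) = ev (vp \<pi> v) P"
 by (simp add: ev_rename_x vp_def)

lemma vp_vp: "vp \<rho> (vp \<pi> v) = vp (\<pi> \<circ> \<rho>) v"
 by (auto simp: vp_def fun_eq_iff split: var.split)

lemma vp_transpose: "v (Vx a) = v (Vx b) ==> vp (transpose a b) v = v"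
proof (rule ext)
 fix w assume "v (Vx a) = v (Vx b)"
 thus "vp (transpose a b) v w = v w" by (cases w) (simp_all add: transpose_def)
qed

lemma rename_x_comp: "rename_x \<pi> (rename_x \<rho> P) = rename_x (\<pi> \<circ> \<rho>) P"
 by (rule ev_eqI) (simp add: vp_vp)

lemma vp_id: "vp id v = v"
 by (auto simp: vp_def fun_eq_iff split: var.split)

lemma rename_x_id [simp]: "rename_x id P = P"
 by (rule ev_eqI) (simp add: vp_id)

lemma gen_vp: "gen n v ==> \<pi> permutes {1..n} ==> gen n (vp \<pi> v)"
 unfolding gen_def
proof (intro conjI ballI allI impI)
 fix w assume "(\<forall>w. v w ~= 0) \<and> (\<forall>a\<in>{1..n}. \<forall>b\<in>{1..n}. a ~= b --> v (Vx a) + v (Vx b) ~= 0 \<and> v (Vx a) ~= v (Vx b))"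
 thus "vp \<pi> v w ~= 0" by (cases w) auto
next
 fix a b assume *: "(\<forall>w. v w ~= 0) \<and> (\<forall>a\<in>{1..n}. \<forall>b\<in>{1..n}. a ~= b --> v (Vx a) + v (Vx b) ~= 0 \<and> v (Vx a) ~= v (Vx b))"
  and p: "\<pi> permutes {1..n}" and ab: "a \<in> {1..n}" "b \<in> {1..n}" "a ~= b"
 have "\<pi> a \<in> {1..n}" "\<pi> b \<in> {1..n}" "\<pi> a ~= \<pi> b"
  using p ab permutes_in_image[OF p] permutes_inj[OF p] by (auto simp: inj_def)
 thus "vp \<pi> v (Vx a) + vp \<pi> v (Vx b) ~= 0" "vp \<pi> v (Vx a) ~= vp \<pi> v (Vx b)" using * by auto
qed

lemma xpoly_rename:
 assumes "xpoly n P" "\<pi> permutes {1..n}"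
 shows "xpoly n (rename_x \<pi> P)"
 unfolding xpoly_iff indep_def
proof (intro allI impI)
 fix w v t assume w: "w \<notin> Vx ` {1..n}"
 have "ev (vp \<pi> (v(w := t))) P = ev (vp \<pi> v) P"
 proof (rule xpoly_ev_cong[OF assms(1)])
  fix j assume "j \<in> {1..n}"
  hence "\<pi> j \<in> {1..n}" using permutes_in_image[OF assms(2)] by simp
  thus "vp \<pi> (v(w := t)) (Vx j) = vp \<pi> v (Vx j)" using w by auto
 qed
 thus "ev (v(w := t)) (rename_x \<pi> P) = ev v (rename_x \<pi> P)" by simp
qed

text \<open>Lets statements about arbitrary arrangements \<open>s\<close> be reduced by symmetry to
  the first \<open>l\<close> indices.\<close>

lemma permutes_extend:
 fixes l n :: nat
 assumes "inj_on s {1..l}" "s ` {1..l} \<subseteq> {1..n}"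
 shows "\<exists>\<pi>. \<pi> permutes {1..n} \<and> (\<forall>a\<in>{1..l}. \<pi> a = s a)"
proof -
 have "card (s ` {1..l}) \<le> card {1..n}" using assms(2) by (intro card_mono) auto
 hence "l \<le> n" using card_image[OF assms(1)] by simp
 hence sub: "{1..l} \<subseteq> {1..n}" by auto
 have "card ({1..n} - {1..l}) = card ({1..n} - s ` {1..l})" using assms sub by (simp add: card_Diff_subset card_image)
 then obtain g where g: "bij_betw g ({1..n} - {1..l}) ({1..n} - s ` {1..l})"
  using finite_same_card_bij[of "{1..n} - {1..l}" "{1..n} - s ` {1..l}"] by auto
 define \<pi> where "\<pi> a = (if a \<in> {1..l} then s a else if a \<in> {1..n} then g a else a)" for a
 have "bij_betw \<pi> {1..l} (s ` {1..l}) \<longleftrightarrow> bij_betw s {1..l} (s ` {1..l})"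
  by (rule bij_betw_cong) (simp add: \<pi>_def)
 hence "bij_betw \<pi> {1..l} (s ` {1..l})" using assms(1) by (simp add: bij_betw_def)
 moreover have "bij_betw \<pi> ({1..n} - {1..l}) ({1..n} - s ` {1..l}) \<longleftrightarrow>
   bij_betw g ({1..n} - {1..l}) ({1..n} - s ` {1..l})" by (rule bij_betw_cong) (simp add: \<pi>_def)
 hence "bij_betw \<pi> ({1..n} - {1..l}) ({1..n} - s ` {1..l})" using g by simp
 ultimately have "bij_betw \<pi> ({1..l} \<union> ({1..n} - {1..l})) (s ` {1..l} \<union> ({1..n} - s ` {1..l}))"
  by (rule bij_betw_combine) auto
 moreover have "{1..l} \<union> ({1..n} - {1..l}) = {1..n}" "s ` {1..l} \<union> ({1..n} - s ` {1..l}) = {1..n}"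
  using sub assms by auto
 ultimately have "bij_betw \<pi> {1..n} {1..n}" by simp
 hence "\<pi> permutes {1..n}" by (rule bij_imp_permutes) (use sub in \<open>auto simp: \<pi>_def\<close>)
 thus ?thesis by (auto simp: \<pi>_def)
qed

lemma permutes_image_ex:
 fixes l n :: nat
 assumes "I \<subseteq> {1..n}" "card I = l"
 shows "\<exists>\<pi>. \<pi> permutes {1..n} \<and> \<pi> ` {1..l} = I"
proof -
 have "finite I" using assms(1) finite_subset by blast
 then obtain s where s: "bij_betw s {1..l} I" using finite_same_card_bij[of "{1..l}" I] assms by auto
 then obtain \<pi> where "\<pi> permutes {1..n}" "\<forall>a\<in>{1..l}. \<pi> a = s a"
  using permutes_extend[of s l n] assms by (auto simp: bij_betw_def)
 moreover from this have "\<pi> ` {1..l} = s ` {1..l}" by (intro image_cong) auto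
 ultimately show ?thesis using s by (auto simp: bij_betw_def)
qed

section \<open>Equivariant families of polynomials\<close>

definition Inv :: "nat => nat => mpoly => bool" where
 "Inv n l P \<longleftrightarrow> xpoly n P \<and>
   (\<forall>\<pi>. \<pi> permutes {1..n} --> \<pi> ` {1..l} = {1..l} --> rename_x \<pi> P = P)"

text \<open>By equivariance such a family is determined by its value at \<open>{1..l}\<close>, and
  by \<open>Fam_ex\<close> every polynomial satisfying \<open>Inv\<close> occurs as that value (for
  l \<le> n). Keeping all subsets lets the Clifford operators act without a choice of order.\<close>

definition Fam :: "nat => nat => (nat set => mpoly) => bool" where
 "Fam n l G \<longleftrightarrow> (\<forall>I. \<not> (I \<subseteq> {1..n} \<and> card I = l) --> G I = 0) \<and> (\<forall>I. xpoly n (G I)) \<and>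
   (\<forall>\<pi> I. \<pi> permutes {1..n} --> I \<subseteq> {1..n} --> rename_x \<pi> (G I) = G (\<pi> ` I))"

lemma FamD:
 assumes "Fam n l G"
 shows "\<not> (I \<subseteq> {1..n} \<and> card I = l) ==> G I = 0" "xpoly n (G I)"
  "\<pi> permutes {1..n} ==> I \<subseteq> {1..n} ==> rename_x \<pi> (G I) = G (\<pi> ` I)"
 using assms by (auto simp: Fam_def)

lemma Fam_ev: "Fam n l G ==> \<pi> permutes {1..n} ==> I \<subseteq> {1..n} ==> ev v (G (\<pi> ` I)) = ev (vp \<pi> v) (G I)"
 using FamD(3)[of n l G \<pi> I] by (metis ev_rename_x_vp)

lemma Fam_Inv: "Fam n l G ==> l \<le> n ==> Inv n l (G {1..l})"
 unfolding Inv_def using FamD[of n l G] by auto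

lemma Fam_eqI:
 assumes "Fam n l G" "Fam n l H" "G {1..l} = H {1..l}"
 shows "G = H"
proof
 fix I show "G I = H I"
 proof (cases "I \<subseteq> {1..n} \<and> card I = l")
  case True
  then obtain \<pi> where p: "\<pi> permutes {1..n}" "\<pi> ` {1..l} = I" using permutes_image_ex by blast
  have "l \<le> n" using True card_mono[of "{1..n}" I] by simp
  hence "rename_x \<pi> (G {1..l}) = G I" "rename_x \<pi> (H {1..l}) = H I"
   using p FamD(3)[OF assms(1) p(1), of "{1..l}"] FamD(3)[OF assms(2) p(1), of "{1..l}"] by auto
  thus ?thesis using assms(3) by simp
 qed (simp add: FamD(1)[OF assms(1)] FamD(1)[OF assms(2)])
qed

text \<open>\<open>P\<close> is transported by any permutation that sends \<open>{1..l}\<close> to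
  \<open>I\<close>; two of these differ by an element of the stabiliser, which fixes
  \<open>P\<close>.\<close>

lemma Fam_ex:
 assumes P: "Inv n l P" and l: "l \<le> n"
 shows "\<exists>G. Fam n l G \<and> G {1..l} = P"
proof -
 let ?ok = "%I \<pi>. \<pi> permutes {1..n} \<and> \<pi> ` {1..l} = I"
 define G where "G I = (if I \<subseteq> {1..n} \<and> card I = l then rename_x (SOME \<pi>. ?ok I \<pi>) P else 0)" for I
 have uniq: "rename_x \<pi> P = rename_x \<rho> P" if "?ok I \<pi>" "?ok I \<rho>" for \<pi> \<rho> I
 proof -
  have p: "(inv_into UNIV \<rho> \<circ> \<pi>) permutes {1..n}" using that by (simp add: permutes_compose permutes_inv)
  have "(inv_into UNIV \<rho> \<circ> \<pi>) ` {1..l} = inv_into UNIV \<rho> ` I"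
   using that by (simp only: image_comp[symmetric])
  also have "... = {1..l}" using that permutes_inj[of \<rho>] by (metis inv_f_f image_inv_f_f)
  finally have "rename_x (inv_into UNIV \<rho> \<circ> \<pi>) P = P" using P p by (simp add: Inv_def)
  hence "rename_x \<rho> P = rename_x (\<rho> \<circ> (inv_into UNIV \<rho> \<circ> \<pi>)) P" by (metis rename_x_comp)
  also have "\<rho> \<circ> (inv_into UNIV \<rho> \<circ> \<pi>) = \<pi>" using that permutes_inv_o(1)[of \<rho> "{1..n}"] by (simp add: comp_assoc[symmetric])
  finally show ?thesis by simp
 qed
 have G: "G I = rename_x \<pi> P" if "?ok I \<pi>" for I \<pi>
 proof -
  have "?ok I (SOME \<pi>. ?ok I \<pi>)" using that by (rule someI[where P = "?ok I"])
  moreover have "I \<subseteq> {1..n}" "card I = l"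
   using that l permutes_in_image[of \<pi> "{1..n}"] card_image[of \<pi> "{1..l}"] permutes_inj_on[of \<pi>] by fastforce+
  ultimately show ?thesis using uniq[OF _ that] by (simp add: G_def)
 qed
 have "Fam n l G" unfolding Fam_def
 proof (intro conjI allI impI)
  fix I show "xpoly n (G I)"
  proof (cases "I \<subseteq> {1..n} \<and> card I = l")
   case True
   then obtain \<pi> where "?ok I \<pi>" using permutes_image_ex by blast
   thus ?thesis using G P by (auto simp: Inv_def intro: xpoly_rename)
  qed (simp only: G_def if_False xpoly_simps)
 next
  fix \<pi> I assume p: "\<pi> permutes {1..n}" and I: "I \<subseteq> {1..n}"
  have c: "card (\<pi> ` I) = card I" "\<pi> ` I \<subseteq> {1..n}"
   using p I card_image[of \<pi> I] permutes_inj_on[OF p] permutes_image[OF p] by auto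
  show "rename_x \<pi> (G I) = G (\<pi> ` I)"
  proof (cases "card I = l")
   case True
   then obtain \<rho> where r: "?ok I \<rho>" using permutes_image_ex I by blast
   hence "?ok (\<pi> ` I) (\<pi> \<circ> \<rho>)" using p by (auto simp: permutes_compose image_comp[symmetric])
   hence "G (\<pi> ` I) = rename_x (\<pi> \<circ> \<rho>) P" by (rule G)
   thus ?thesis using G[OF r] rename_x_comp[of \<pi> \<rho> P] by simp
  next
   case False
   have "rename_x \<pi> 0 = 0" by (rule ev_eqI) simp
   thus ?thesis using False c by (simp add: G_def)
  qed
 qed (auto simp: G_def)
 moreover have "G {1..l} = P" using G[of id "{1..l}"] by (simp add: permutes_id)
 ultimately show ?thesis by blast
qed

text \<open>A symmetric family of rational functions whose denominators divide the
 Vandermonde product consists of polynomials.\<close>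

lemma Fam_rational:
 fixes T :: "(var => complex) => nat set => complex"
 assumes num: "xpoly n Nm" "!!v. gen n v ==> ev v Nm = vdm {1..l} (pt v) * T v {1..l}"
  and eq: "!!v \<pi> I. gen n v ==> \<pi> permutes {1..n} ==> I \<subseteq> {1..n} ==> T v (\<pi> ` I) = T (vp \<pi> v) I"
  and zero: "!!v I. gen n v ==> \<not> (I \<subseteq> {1..n} \<and> card I = l) ==> T v I = 0"
 shows "\<exists>H. Fam n l H \<and> (\<forall>v I. gen n v --> ev v (H I) = T v I)"
proof (cases "l \<le> n")
 case False
 have "\<not> (I \<subseteq> {1..n} \<and> card I = l)" for I using False card_mono[of "{1..n}" I] by auto
 hence "T v I = 0" if "gen n v" for v I using zero that by blast
 moreover have "Fam n l (%_. 0)" by (auto simp: Fam_def intro: ev_eqI)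
 ultimately show ?thesis by (intro exI[of _ "%_. 0"]) auto
next
 case l: True
 define V :: mpoly where "V = vdm {1..l} (%j. Var (Vx j))"
 have evV: "ev v V = vdm {1..l} (pt v)" for v by (simp add: V_def ev_vdm)
 have V0: "vdm {1..l} (pt v) ~= 0" if "gen n v" for v
  using inj_on_subset[OF generic_point.inj_x[OF gen_point[OF that]], of "{1..l}"] l by (intro vdm_nz) auto
 have Vnz: "V ~= 0"
 proof
  assume "V = 0"
  hence "ev v V = 0" for v by simp
  hence "\<not> gen n v" for v using V0 evV by metis
  thus False using disc_nz[of n] ev_eqI_gen[of n "disc n" 0] by blast
 qed
 let ?pr = "{(a, b). a \<in> {1..l} \<and> b \<in> {1..l} \<and> a < b}"
 \<comment> \<open>\<open>Nm\<close> changes sign under transpositions within \<open>{1..l}\<close>,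
   because the Vandermonde product does and \<open>T\<close> does not; so it vanishes where two of
   these variables coincide.\<close>
 have "(\<Prod>(a, b, c)\<in>(%(a, b). (a, b, 1)) ` ?pr. lin c a b) dvd Nm"
 proof (rule lin_prod_dvdI)
  fix a b :: nat and c :: complex and v :: "var => complex"
  assume abc: "(a, b, c) \<in> (%(a, b). (a, b, 1)) ` ?pr" and v: "v (Vx a) = c * v (Vx b)"
  let ?t = "transpose a b"
  have t: "?t permutes {1..l}" "?t permutes {1..n}" using abc l by (auto intro!: permutes_swap_id)
  have "rename_x ?t Nm = - Nm"
  proof (rule ev_eqI_gen[of n])
   fix u assume u: "gen n u"
   have "ev u (rename_x ?t Nm) = vdm {1..l} (pt u \<circ> ?t) * T (vp ?t u) {1..l}"
    using gen_vp[OF u t(2)] num(2) by (simp add: comp_def)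
   also have "T (vp ?t u) {1..l} = T u {1..l}" using eq[OF u t(2), of "{1..l}"] l permutes_image[OF t(1)] by simp
   also have "vdm {1..l} (pt u \<circ> ?t) = - vdm {1..l} (pt u)" using abc by (intro vdm_swap) auto
   finally show "ev u (rename_x ?t Nm) = ev u (- Nm)" using num(2)[OF u] by simp
  qed
  hence "ev (vp ?t v) Nm = - ev v Nm" using ev_rename_x_vp[of v ?t Nm] by simp
  moreover have "c = 1" using abc by auto
  hence "vp ?t v = v" using v by (intro vp_transpose) simp
  ultimately show "ev v Nm = 0" by (metis eq_uminus_complex)
 qed (simp only: finite_imageI finite_pairs finite_atLeastAtMost, auto)
 moreover have "(\<Prod>(a, b, c)\<in>(%(a, b). (a, b, 1)) ` ?pr. lin c a b) = V"
  unfolding V_def vdm_def by (subst prod.reindex) (auto simp: inj_on_def lin_def intro!: prod.cong)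
 ultimately obtain Q where Q: "Nm = V * Q" by (auto elim: dvdE)
 have evQ: "ev v Q = T v {1..l}" if "gen n v" for v using num(2)[OF that] V0[OF that] by (simp add: Q evV)
 have "xpoly n V" unfolding V_def vdm_def case_prod_unfold using l by (intro xpoly_simps) auto
 hence "xpoly n Q" using num(1) Vnz xpoly_cancel unfolding Q by blast
 moreover have "rename_x \<pi> Q = Q" if p: "\<pi> permutes {1..n}" "\<pi> ` {1..l} = {1..l}" for \<pi>
 proof (rule ev_eqI_gen[of n])
  fix v assume v: "gen n v"
  have "ev (vp \<pi> v) Q = T (vp \<pi> v) {1..l}" using evQ gen_vp[OF v p(1)] by blast
  also have "... = T v {1..l}" using eq[OF v p(1), of "{1..l}"] p l by simp
  finally show "ev v (rename_x \<pi> Q) = ev v Q" using evQ[OF v] by simp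
 qed
 ultimately have "Inv n l Q" by (simp add: Inv_def)
 then obtain H where H: "Fam n l H" "H {1..l} = Q" using Fam_ex l by blast
 have "ev v (H I) = T v I" if v: "gen n v" for v I
 proof (cases "I \<subseteq> {1..n} \<and> card I = l")
  case True
  then obtain \<pi> where p: "\<pi> permutes {1..n}" "\<pi> ` {1..l} = I" using permutes_image_ex by blast
  have "ev v (H I) = ev (vp \<pi> v) (H {1..l})" using Fam_ev[OF H(1) p(1), of "{1..l}" v] l p(2) by simp
  also have "... = T (vp \<pi> v) {1..l}" using evQ gen_vp[OF v p(1)] H by simp
  also have "... = T v I" using eq[OF v p(1), of "{1..l}"] l p(2) by simp
  finally show ?thesis .
 qed (simp add: FamD(1)[OF H(1)] zero[OF v])
 thus ?thesis using H by blast
qed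

lemma eps_equivariant:
 assumes "gen n v" "\<pi> permutes {1..n}"
 shows "generic_point.eps {1..n} (pt v) (\<pi> a) g (\<pi> ` I) =
  generic_point.eps {1..n} (pt (vp \<pi> v)) a (%J. g (\<pi> ` J)) I"
proof -
 interpret A: generic_point "{1..n}" "pt v" using gen_point assms by blast
 interpret B: generic_point "{1..n}" "pt (vp \<pi> v)" using gen_point[OF gen_vp] assms by blast
 have inj: "inj \<pi>" using assms(2) by (rule permutes_inj)
 have "A.w (\<pi> a) (\<pi> ` C) = B.w a C" for C
  unfolding A.w_def B.w_def A.f_def B.f_def using inj by (subst prod.reindex) (auto simp: inj_on_def inj_def)
 moreover have "\<pi> ` I - {\<pi> a} = \<pi> ` (I - {a})" using inj by (auto simp: inj_def)
 moreover have "\<pi> ` I \<subseteq> {1..n} \<longleftrightarrow> I \<subseteq> {1..n}"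
  using assms(2) by (metis inj inj_image_subset_iff permutes_image)
 moreover have "\<pi> a \<in> \<pi> ` I \<longleftrightarrow> a \<in> I" using inj by (auto simp: inj_def)
 ultimately show ?thesis unfolding A.eps_def B.eps_def by simp
qed

lemma opE_Fam:
 assumes G: "Fam n l G" and K: "!!a. a \<in> {1..n} ==> xpoly n (K a)"
  "!!\<pi> a. \<pi> permutes {1..n} ==> a \<in> {1..n} ==> rename_x \<pi> (K a) = K (\<pi> a)"
 shows "\<exists>H. Fam n (Suc l) H \<and> (\<forall>v I. gen n v -->
  ev v (H I) = generic_point.opE {1..n} (pt v) (%a. ev v (K a)) (%I. ev v (G I)) I)"
proof -
 let ?T = "%v. generic_point.opE {1..n} (pt v) (%a. ev v (K a)) (%I. ev v (G I))"
 let ?I = "{1..Suc l}"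
 have "\<exists>k. \<forall>y. vdm ?I y = (-1) ^ k * (\<Prod>b\<in>?I - {a}. y a - y b) * vdm (?I - {a}) (y :: nat => complex)"
  if "a \<in> ?I" for a using vdm_insert[of "?I - {a}" a, where ?'r = complex] insert_Diff[OF that] by simp
 then obtain k where k: "!!a y. a \<in> ?I ==>
   vdm ?I y = (-1) ^ k a * (\<Prod>b\<in>?I - {a}. y a - y b) * vdm (?I - {a}) (y :: nat => complex)"
  by metis
 \<comment> \<open>Multiplied by the Vandermonde product of \<open>?I\<close>, the summand at
   \<open>a\<close> loses the denominators x_a - x_b of its weight and keeps, up to sign, the
   Vandermonde product of the other indices.\<close>
 define Nm where "Nm = (if Suc l \<le> n then \<Sum>a\<in>?I. (-1) ^ k a * K a *
   (\<Prod>b\<in>?I - {a}. Var (Vx a) + Var (Vx b)) * vdm (?I - {a}) (%j. Var (Vx j)) * G (?I - {a}) else 0)"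
 show ?thesis
 proof (rule Fam_rational)
  have "xpoly n (vdm (?I - {a}) (%j. Var (Vx j)))" if "Suc l \<le> n" for a
   unfolding vdm_def case_prod_unfold using that by (intro xpoly_simps) auto
  thus "xpoly n Nm" unfolding Nm_def using K(1) FamD(2)[OF G]
   by (cases "Suc l \<le> n") (simp_all only: if_True if_False xpoly_simps, intro xpoly_simps, auto)
 next
  fix v assume v: "gen n v"
  interpret generic_point "{1..n}" "pt v" using gen_point v by blast
  show "ev v Nm = vdm ?I (pt v) * ?T v ?I"
  proof (cases "Suc l \<le> n")
   case True
   have "vdm ?I (pt v) * ?T v ?I = (\<Sum>a\<in>{1..n}. vdm ?I (pt v) * (ev v (K a) * eps a (%I. ev v (G I)) ?I))"
    unfolding opE_def by (rule sum_distrib_left)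
   also have "... = (\<Sum>a\<in>?I. vdm ?I (pt v) * (ev v (K a) * eps a (%I. ev v (G I)) ?I))"
    by (intro sum.mono_neutral_right) (use True in \<open>auto simp: eps_def\<close>)
   also have "... = (\<Sum>a\<in>?I. ev v ((-1) ^ k a * K a *
     (\<Prod>b\<in>?I - {a}. Var (Vx a) + Var (Vx b)) * vdm (?I - {a}) (%j. Var (Vx j)) * G (?I - {a})))"
   proof (intro sum.cong refl)
    fix a assume a: "a \<in> ?I"
    have 1: "eps a (%I. ev v (G I)) ?I = w a (?I - {a}) * ev v (G (?I - {a}))"
     using a True by (simp add: eps_def)
    have 2: "w a (?I - {a}) * (\<Prod>b\<in>?I - {a}. v (Vx a) - v (Vx b)) = (\<Prod>b\<in>?I - {a}. v (Vx a) + v (Vx b))"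
     by (rule w_mult_diff) (use a True in auto)
    show "vdm ?I (pt v) * (ev v (K a) * eps a (%I. ev v (G I)) ?I) =
     ev v ((-1) ^ k a * K a * (\<Prod>b\<in>?I - {a}. Var (Vx a) + Var (Vx b)) *
      vdm (?I - {a}) (%j. Var (Vx j)) * G (?I - {a}))" unfolding k[OF a] 1 by (simp add: ev_vdm 2[symmetric])
   qed
   also have "... = ev v Nm" by (simp add: Nm_def True)
   finally show ?thesis by simp
  next
   case False
   hence "?T v ?I = 0" unfolding opE_def eps_def by (intro sum.neutral) auto
   thus ?thesis using False by (simp add: Nm_def)
  qed
 next
  fix v \<pi> I assume v: "gen n v" and p: "\<pi> permutes {1..n}" and I: "I \<subseteq> {1..n}"
  interpret A: generic_point "{1..n}" "pt v" using gen_point v by blast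
  interpret B: generic_point "{1..n}" "pt (vp \<pi> v)" using gen_point[OF gen_vp] v p by blast
  have "?T v (\<pi> ` I) = (\<Sum>a\<in>\<pi> ` {1..n}. ev v (K a) * A.eps a (%I. ev v (G I)) (\<pi> ` I))"
   unfolding A.opE_def permutes_image[OF p] ..
  also have "... = (\<Sum>a\<in>{1..n}. ev v (K (\<pi> a)) * A.eps (\<pi> a) (%I. ev v (G I)) (\<pi> ` I))"
   using permutes_inj_on[OF p] by (subst sum.reindex) auto
  also have "... = ?T (vp \<pi> v) I" unfolding B.opE_def
  proof (intro sum.cong refl)
   fix a assume a: "a \<in> {1..n}"
   have "A.eps (\<pi> a) (%I. ev v (G I)) (\<pi> ` I) = B.eps a (%J. ev v (G (\<pi> ` J))) I"
    by (rule eps_equivariant[OF v p])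
   also have "... = B.eps a (%J. ev (vp \<pi> v) (G J)) I"
    unfolding B.eps_def using Fam_ev[OF G p, of "I - {a}" v] I by auto
   finally show "ev v (K (\<pi> a)) * A.eps (\<pi> a) (%I. ev v (G I)) (\<pi> ` I) =
     ev (vp \<pi> v) (K a) * B.eps a (%I. ev (vp \<pi> v) (G I)) I"
    using K(2)[OF p a] by (metis ev_rename_x_vp)
  qed
  finally show "?T v (\<pi> ` I) = ?T (vp \<pi> v) I" .
 next
  fix v I assume v: "gen n v" and I: "\<not> (I \<subseteq> {1..n} \<and> card I = Suc l)"
  interpret A: generic_point "{1..n}" "pt v" using gen_point v by blast
  have "A.eps a (%I. ev v (G I)) I = 0" for a
  proof (cases "a \<in> I \<and> I \<subseteq> {1..n}")
   case True
   hence "card (I - {a}) ~= l" using I finite_subset[of I "{1..n}"] card_Suc_Diff1[of I a] by auto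
   thus ?thesis using FamD(1)[OF G, of "I - {a}"] by (simp add: A.eps_def)
  qed (simp only: A.eps_def if_False)
  thus "?T v I = 0" by (simp add: A.opE_def)
 qed
qed

definition fcompl :: "nat => (nat set => 'b::zero) => nat set => 'b" where
 "fcompl n g I = (if I \<subseteq> {1..n} then g ({1..n} - I) else 0)"

lemma Fam_fcompl:
 assumes G: "Fam n l G" and l: "l \<le> n"
 shows "Fam n (n - l) (fcompl n G)"
 unfolding Fam_def
proof (intro conjI allI impI)
 fix I assume "\<not> (I \<subseteq> {1..n} \<and> card I = n - l)"
 hence "\<not> I \<subseteq> {1..n} \<or> card ({1..n} - I) ~= l"
  using l by (auto simp: card_Diff_subset finite_subset)
    (metis atLeastAtMost_iff card_Diff_subset card_atLeastAtMost card_mono diff_Suc_1 diff_diff_cancel finite_atLeastAtMost finite_subset subsetI subset_iff)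
 thus "fcompl n G I = 0" using FamD(1)[OF G] by (auto simp: fcompl_def)
next
 fix I show "xpoly n (fcompl n G I)" using FamD(2)[OF G] by (simp add: fcompl_def)
next
 fix \<pi> I assume p: "\<pi> permutes {1..n}" and I: "I \<subseteq> {1..n}"
 have "{1..n} - \<pi> ` I = \<pi> ` ({1..n} - I)" using p by (simp add: image_set_diff permutes_inj permutes_image)
 moreover have "\<pi> ` I \<subseteq> {1..n}" using p I permutes_image by blast
 ultimately show "rename_x \<pi> (fcompl n G I) = fcompl n G (\<pi> ` I)"
  using FamD(3)[OF G p] I by (simp add: fcompl_def)
qed

text \<open>Passing to complements of index sets turns \<open>phi\<close> into \<open>eps\<close>,
  so polynomiality is inherited from \<open>opE_Fam\<close>.\<close>

lemma opF_Fam: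
 assumes G: "Fam n (Suc l) G" and K: "!!a. a \<in> {1..n} ==> xpoly n (K a)"
  "!!\<pi> a. \<pi> permutes {1..n} ==> a \<in> {1..n} ==> rename_x \<pi> (K a) = K (\<pi> a)"
 shows "\<exists>H. Fam n l H \<and> (\<forall>v I. gen n v -->
  ev v (H I) = generic_point.opF {1..n} (pt v) (%a. ev v (K a)) (%I. ev v (G I)) I)"
proof (cases "Suc l \<le> n")
 case True
 have "Fam n (n - Suc l) (fcompl n G)" using Fam_fcompl[OF G True] .
 from opE_Fam[OF this K] obtain H where H: "Fam n (Suc (n - Suc l)) H"
  "!!v I. gen n v ==> ev v (H I) =
   generic_point.opE {1..n} (pt v) (%a. ev v (K a)) (%I. ev v (fcompl n G I)) I" by blast
 have "Fam n (n - Suc (n - Suc l)) (fcompl n H)" using H(1) True by (intro Fam_fcompl) auto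
 hence "Fam n l (fcompl n H)" using True by (simp add: Suc_diff_Suc)
 moreover have "ev v (fcompl n H I) = generic_point.opF {1..n} (pt v) (%a. ev v (K a)) (%I. ev v (G I)) I"
  if v: "gen n v" for v I
 proof -
  interpret generic_point "{1..n}" "pt v" using gen_point v by blast
  have "eps a (%I. ev v (fcompl n G I)) ({1..n} - I) = phi a (%I. ev v (G I)) I"
   if a: "a \<in> {1..n}" "I \<subseteq> {1..n}" for a
  proof -
   have "{1..n} - ({1..n} - I - {a}) = insert a I" using a by auto
   thus ?thesis using a by (auto simp: eps_def phi_def fcompl_def)
  qed
  thus ?thesis using H(2)[OF v]
   by (cases "I \<subseteq> {1..n}") (auto simp: fcompl_def opE_def opF_def phi_def intro!: sum.neutral[symmetric] sum.cong)
 qed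
 ultimately show ?thesis by blast
next
 case False
 have "G I = 0" for I using FamD(1)[OF G, of I] False card_mono[of "{1..n}" I] by fastforce
 moreover have "Fam n l (%_. 0)" by (auto simp: Fam_def intro: ev_eqI)
 moreover have "generic_point.opF {1..n} (pt v) K' (%_. 0) I = 0" if v: "gen n v" for v K' I
 proof -
  interpret generic_point "{1..n}" "pt v" using gen_point v by blast
  show ?thesis by (simp add: opF_def phi_def)
 qed
 ultimately show ?thesis by (intro exI[of _ "%_. 0"]) auto
qed

section \<open>The exterior power in terms of evaluations\<close>

definition degX :: "nat => var => mpoly => bool" where
 "degX n w P \<longleftrightarrow> (\<forall>m\<in>pkeys P. coef m w < n)"

lemma degX_iff: "0 < n ==> degX n w P \<longleftrightarrow> (\<forall>v. \<exists>q. degree q < n \<and> (\<forall>t. ev (v(w := t)) P = poly q t))"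
 unfolding degX_def by (rule lookup_less_iff)

lemma degX_add:
 assumes "0 < n" "degX n w P" "degX n w Q"
 shows "degX n w (P + Q)"
 unfolding degX_iff[OF assms(1)]
proof
 fix v
 obtain p q where "degree p < n" "!!t. ev (v(w := t)) P = poly p t" "degree q < n" "!!t. ev (v(w := t)) Q = poly q t"
  using assms by (metis degX_iff)
 thus "\<exists>q. degree q < n \<and> (\<forall>t. ev (v(w := t)) (P + Q) = poly q t)"
  by (intro exI[of _ "p + q"]) (auto intro: degree_add_less)
qed

lemma degX_0 [simp]: "degX n w 0"
 by (simp add: degX_def)

lemma degX_sum: "0 < n ==> (!!i. i \<in> I ==> degX n w (F i)) ==> degX n w (\<Sum>i\<in>I. F i)"
 by (induction I rule: infinite_finite_induct) (auto intro: degX_add)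

lemma degX_mult_indep:
 assumes "0 < n" "degX n w P" "indep w Q"
 shows "degX n w (P * Q)"
 unfolding degX_iff[OF assms(1)]
proof
 fix v
 obtain p where p: "degree p < n" "!!t. ev (v(w := t)) P = poly p t" using assms by (metis degX_iff)
 have "degree (Polynomial.smult (ev v Q) p) < n" using p(1) by (rule le_less_trans[OF degree_smult_le])
 thus "\<exists>q. degree q < n \<and> (\<forall>t. ev (v(w := t)) (P * Q) = poly q t)"
  using p(2) assms(3) by (intro exI[of _ "Polynomial.smult (ev v Q) p"]) (auto simp: indep_def)
qed

definition evars :: "nat => nat => var set" where
 "evars n l = VX ` {1..l} \<union> Vx ` {1..n}"

lemma ext_power_iff:
 "P \<in> ext_power n l \<longleftrightarrow> (\<forall>w. w \<notin> evars n l --> indep w P) \<and> (\<forall>a\<in>{1..l}. degX n (VX a) P) \<and>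
   (\<forall>\<pi>. \<pi> permutes {1..n} --> rename_x \<pi> P = P) \<and>
   (\<forall>\<sigma>. \<sigma> permutes {1..l} --> rename_X \<sigma> P = of_int (sign \<sigma>) * P)"
proof -
 have "(\<forall>m\<in>pkeys P. \<forall>a\<in>{1..l}. coef m (VX a) < n) \<longleftrightarrow>
   (\<forall>a\<in>{1..l}. degX n (VX a) P)" unfolding degX_def by blast
 thus ?thesis unfolding ext_power_def evars_def mem_Collect_eq poly_vars_subset_iff by (simp only:)
qed

lemma ext_ev_cong:
 assumes "P \<in> ext_power n l" "!!w. w \<in> evars n l ==> u w = v w"
 shows "ev u P = ev v P"
proof (rule indep_agree[of P "evars n l"])
 show "poly_vars P \<subseteq> evars n l" using assms(1) unfolding ext_power_def evars_def by blast
qed (rule assms(2))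

definition rX :: "(nat => nat) => (var => complex) => var => complex" where
 "rX f v = (%w. case w of VX a => v (VX (f a)) | Vx j => v (Vx j))"

lemma rX_simps [simp]: "rX f v (VX a) = v (VX (f a))" "rX f v (Vx j) = v (Vx j)"
 by (simp_all add: rX_def)

lemma ev_rename_X_rX [simp]: "ev v (rename_X f P) = ev (rX f v) P"
 by (simp add: ev_rename_X rX_def)

lemma var_fun_eqI: "(!!a. u (VX a) = v (VX a)) ==> (!!j. u (Vx j) = v (Vx j)) ==> u = v"
proof (rule ext)
 fix w assume "!!a. u (VX a) = v (VX a)" "!!j. u (Vx j) = v (Vx j)"
 thus "u w = v w" by (cases w) auto
qed

lemma rX_rX: "rX f (rX g v) = rX (g \<circ> f) v"
 by (rule var_fun_eqI) auto

lemma ext_antisym: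
 assumes "P \<in> ext_power n l" "\<sigma> permutes {1..l}"
 shows "ev (rX \<sigma> v) P = of_int (sign \<sigma>) * ev v P"
proof -
 have "rename_X \<sigma> P = of_int (sign \<sigma>) * P" using assms by (auto simp: ext_power_iff)
 thus ?thesis by (metis ev_rename_X_rX ev.geval_mult ev_of_int)
qed

lemma ext_sym:
 assumes "P \<in> ext_power n l" "\<pi> permutes {1..n}"
 shows "ev (vp \<pi> v) P = ev v P"
proof -
 have "rename_x \<pi> P = P" using assms by (auto simp: ext_power_iff)
 thus ?thesis by (metis ev_rename_x_vp)
qed

lemma ext_repeated:
 assumes P: "P \<in> ext_power n l" and ab: "a \<in> {1..l}" "b \<in> {1..l}" "a ~= b" and v: "v (VX a) = v (VX b)"
 shows "ev v P = 0"
proof -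
 have "rX (transpose a b) v = v" by (rule var_fun_eqI) (use v in \<open>auto simp: transpose_def\<close>)
 moreover have "ev (rX (transpose a b) v) P = - ev v P"
  using ab by (subst ext_antisym[OF P]) (auto simp: sign_swap_id intro: permutes_swap_id)
 ultimately show ?thesis by (metis eq_uminus_complex)
qed

lemma indep_rename_X:
 assumes P: "P \<in> ext_power n p" and w: "w \<notin> VX ` f ` {1..p} \<union> Vx ` {1..n}"
 shows "indep w (rename_X f P)"
 unfolding indep_def
proof (intro allI)
 fix v t
 have "ev (rX f (v(w := t))) P = ev (rX f v) P" using w by (intro ext_ev_cong[OF P]) (auto simp: evars_def)
 thus "ev (v(w := t)) (rename_X f P) = ev v (rename_X f P)" by simp
qed

lemma degX_rename_X:
 assumes P: "P \<in> ext_power n p" and n: "0 < n" and a: "a \<in> {1..p}"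
  and f: "inj_on f {1..p}"
 shows "degX n (VX (f a)) (rename_X f P)"
 unfolding degX_iff[OF n]
proof
 fix v
 have "degX n (VX a) P" using P a by (auto simp: ext_power_iff)
 then obtain q where q: "degree q < n" "!!t. ev ((rX f v)(VX a := t)) P = poly q t" using degX_iff[OF n] by blast
 have "ev (rX f (v(VX (f a) := t))) P = ev ((rX f v)(VX a := t)) P" for t
 proof (rule ext_ev_cong[OF P])
  fix w assume w: "w \<in> evars n p"
  show "rX f (v(VX (f a) := t)) w = ((rX f v)(VX a := t)) w"
  proof (cases w)
   case (VX b)
   hence "f b = f a \<longleftrightarrow> b = a" using w a inj_on_eq_iff[OF f, of b a] by (auto simp: evars_def)
   thus ?thesis using VX by simp
  qed simp
 qed
 thus "\<exists>q. degree q < n \<and> (\<forall>t. ev (v(VX (f a) := t)) (rename_X f P) = poly q t)" using q by auto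
qed

lemma rename_X_sum: "rename_X f (\<Sum>i\<in>I. F i) = (\<Sum>i\<in>I. rename_X f (F i))"
 by (rule ev_eqI) simp

lemma rename_X_mult: "rename_X f (P * Q) = rename_X f P * rename_X f Q"
 by (rule ev_eqI) simp

lemma rename_X_comp: "rename_X f (rename_X g P) = rename_X (f \<circ> g) P"
 by (rule ev_eqI) (simp add: rX_rX)

lemma rename_X_const [simp]: "rename_X f (const c) = const c"
 by (rule ev_eqI) simp

lemma rename_X_of_int [simp]: "rename_X f (of_int k) = of_int k"
 by (rule ev_eqI) simp

text \<open>In each summand a variable X_b occurs in exactly one of the two factors, so the degree
  bound carries over without adding degrees.\<close>

lemma wedge_ext_power:
 assumes n: "0 < n" and P: "P \<in> ext_power n p" and Q: "Q \<in> ext_power n q"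
 shows "wedge p q P Q \<in> ext_power n (p + q)"
proof -
 let ?t = "%\<sigma>. of_int (sign \<sigma>) * rename_X \<sigma> P * rename_X (%a. \<sigma> (p + a)) Q"
 have img: "\<sigma> ` {1..p} \<subseteq> {1..p+q}" "(%a. \<sigma> (p + a)) ` {1..q} \<subseteq> {1..p+q}"
   "inj_on \<sigma> {1..p}" "inj_on (%a. \<sigma> (p + a)) {1..q}"
  if "\<sigma> permutes {1..p+q}" for \<sigma>
 proof -
  have "\<sigma> a \<in> {1..p+q}" if "a \<in> {1..p+q}" for a
   using that permutes_in_image[OF \<open>\<sigma> permutes {1..p+q}\<close>] by simp
  thus "\<sigma> ` {1..p} \<subseteq> {1..p+q}" "(%a. \<sigma> (p + a)) ` {1..q} \<subseteq> {1..p+q}" by fastforce+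
  show "inj_on \<sigma> {1..p}" "inj_on (%a. \<sigma> (p + a)) {1..q}"
   by (auto intro!: inj_onI dest!: injD[OF permutes_inj[OF that]])
 qed
 have "indep w (wedge p q P Q)" if w: "w \<notin> evars n (p + q)" for w
 proof -
  have "indep w (?t \<sigma>)" if s: "\<sigma> permutes {1..p+q}" for \<sigma>
  proof -
   have "indep w (rename_X \<sigma> P)" using w img(1)[OF s] unfolding evars_def by (intro indep_rename_X[OF P]) blast
   moreover have "indep w (rename_X (%a. \<sigma> (p + a)) Q)"
    using w img(2)[OF s] unfolding evars_def by (intro indep_rename_X[OF Q]) blast
   ultimately show ?thesis by (rule indep_simps(3)[OF indep_simps(3)[OF indep_simps(11)]])
  qed
  hence "indep w (\<Sum>\<sigma> | \<sigma> permutes {1..p + q}. ?t \<sigma>)" by (intro indep_simps(6)) simp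
  thus ?thesis unfolding wedge_def by (rule indep_simps(3)[OF indep_simps(8)])
 qed
 moreover have "degX n (VX b) (wedge p q P Q)" if b: "b \<in> {1..p+q}" for b
 proof -
  have "degX n (VX b) (?t \<sigma>)" if s: "\<sigma> permutes {1..p+q}" for \<sigma>
  proof -
   have inj: "\<sigma> x = \<sigma> y \<longleftrightarrow> x = y" for x y using permutes_inj[OF s] by (auto dest: injD)
   obtain c where c: "b = \<sigma> c" "c \<in> {1..p+q}" using b permutes_image[OF s] by blast
   show ?thesis
   proof (cases "c \<le> p")
    case True
    have 1: "degX n (VX b) (rename_X \<sigma> P)"
     unfolding c(1) using c True img(3)[OF s] by (intro degX_rename_X[OF P n]) auto
    have 2: "indep (VX b) (rename_X (%a. \<sigma> (p + a)) Q)"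
     using c True by (intro indep_rename_X[OF Q]) (auto simp: inj)
    have "?t \<sigma> = rename_X \<sigma> P * (of_int (sign \<sigma>) * rename_X (%a. \<sigma> (p + a)) Q)"
     by (simp only: mult_ac)
    thus ?thesis using degX_mult_indep[OF n 1, of "of_int (sign \<sigma>) * rename_X (%a. \<sigma> (p + a)) Q"]
     indep_simps(3)[OF indep_simps(11) 2] by (simp only:)
   next
    case False
    hence c': "b = (%a. \<sigma> (p + a)) (c - p)" "c - p \<in> {1..q}" using c by auto
    have 1: "degX n (VX b) (rename_X (%a. \<sigma> (p + a)) Q)"
     unfolding c'(1) using c' img(4)[OF s] by (intro degX_rename_X[OF Q n]) auto
    have 2: "indep (VX b) (rename_X \<sigma> P)" using c False by (intro indep_rename_X[OF P]) (auto simp: inj)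
    have "?t \<sigma> = rename_X (%a. \<sigma> (p + a)) Q * (of_int (sign \<sigma>) * rename_X \<sigma> P)"
     by (simp only: mult_ac)
    thus ?thesis using degX_mult_indep[OF n 1, of "of_int (sign \<sigma>) * rename_X \<sigma> P"]
     indep_simps(3)[OF indep_simps(11) 2] by (simp only:)
   qed
  qed
  hence "degX n (VX b) (\<Sum>\<sigma> | \<sigma> permutes {1..p + q}. ?t \<sigma>)" by (intro degX_sum[OF n]) simp
  from degX_mult_indep[OF n this indep_simps(8)] show ?thesis unfolding wedge_def by (subst mult.commute)
 qed
 moreover have "rename_x \<pi> (wedge p q P Q) = wedge p q P Q" if "\<pi> permutes {1..n}" for \<pi>
 proof (rule ev_eqI)
  fix v
  have "rX f (vp \<pi> v) = vp \<pi> (rX f v)" for f by (rule var_fun_eqI) auto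
  thus "ev v (rename_x \<pi> (wedge p q P Q)) = ev v (wedge p q P Q)"
   by (simp add: wedge_def ext_sym[OF P that] ext_sym[OF Q that])
 qed
 moreover have "rename_X \<tau> (wedge p q P Q) = of_int (sign \<tau>) * wedge p q P Q" if t: "\<tau> permutes {1..p+q}" for \<tau>
 proof -
  have pt: "permutation \<tau>" using t permutation_permutes by blast
  have comp: "rename_X \<tau> (rename_X (%a. \<sigma> (p + a)) Q) = rename_X (%a. (\<tau> \<circ> \<sigma>) (p + a)) Q" for \<sigma>
   by (simp add: rename_X_comp comp_def)
  have "rename_X \<tau> (wedge p q P Q) = const (1 / (fact p * fact q)) *
    (\<Sum>\<sigma> | \<sigma> permutes {1..p + q}. of_int (sign \<sigma>) * rename_X (\<tau> \<circ> \<sigma>) P * rename_X (%a. (\<tau> \<circ> \<sigma>) (p + a)) Q)"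
   by (simp only: wedge_def rename_X_mult rename_X_sum rename_X_const rename_X_of_int rename_X_comp[of _ _ P] comp)
  also have "(\<Sum>\<sigma> | \<sigma> permutes {1..p + q}. of_int (sign \<sigma>) * rename_X (\<tau> \<circ> \<sigma>) P * rename_X (%a. (\<tau> \<circ> \<sigma>) (p + a)) Q) =
    (\<Sum>\<sigma> | \<sigma> permutes {1..p + q}. of_int (sign \<tau>) * ?t (\<tau> \<circ> \<sigma>))"
  proof (intro sum.cong refl)
   fix \<sigma> assume "\<sigma> \<in> {\<sigma>. \<sigma> permutes {1..p + q}}"
   hence "permutation \<sigma>" using permutation_permutes by blast
   hence "sign \<tau> * sign (\<tau> \<circ> \<sigma>) = sign \<sigma>"
    using pt by (simp add: sign_compose mult.assoc[symmetric] sign_idempotent)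
   hence "of_int (sign \<sigma>) = (of_int (sign \<tau>) * of_int (sign (\<tau> \<circ> \<sigma>)) :: mpoly)"
    by (metis of_int_mult)
   thus "of_int (sign \<sigma>) * rename_X (\<tau> \<circ> \<sigma>) P * rename_X (%a. (\<tau> \<circ> \<sigma>) (p + a)) Q =
     of_int (sign \<tau>) * ?t (\<tau> \<circ> \<sigma>)" by (simp only: mult.assoc)
  qed
  also have "... = of_int (sign \<tau>) * (\<Sum>\<sigma> | \<sigma> permutes {1..p + q}. ?t (\<tau> \<circ> \<sigma>))"
   by (rule sum_distrib_left[symmetric])
  also have "(\<Sum>\<sigma> | \<sigma> permutes {1..p + q}. ?t (\<tau> \<circ> \<sigma>)) = (\<Sum>\<sigma> | \<sigma> permutes {1..p + q}. ?t \<sigma>)"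
   by (rule setum_permutations_compose_left[OF t, symmetric])
  finally show ?thesis by (simp add: wedge_def mult_ac)
 qed
 ultimately show ?thesis unfolding ext_power_iff by blast
qed

lemma ext_power_lin:
 assumes n: "0 < n \<or> l = 0" and P: "P \<in> ext_power n l" and Q: "Q \<in> ext_power n l"
 shows "P + Q \<in> ext_power n l" "const c * P \<in> ext_power n l" "P - Q \<in> ext_power n l" "0 \<in> ext_power n l"
proof -
 have c: "const c * P \<in> ext_power n l" if P: "P \<in> ext_power n l" for c P
 proof -
  have "degX n w (const c * P)" if "degX n w P" "n > 0" for w
   using degX_mult_indep[OF that(2,1), of "const c"] by (simp add: mult.commute)
  moreover have "rename_x \<pi> (const c * P) = const c * rename_x \<pi> P"
   "rename_X \<pi> (const c * P) = const c * rename_X \<pi> P" for \<pi> by (rule ev_eqI; simp)+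
  ultimately show ?thesis using P n unfolding ext_power_iff by (auto simp: mult_ac)
 qed
 thus "const c * P \<in> ext_power n l" using P by blast
 have a: "P + Q \<in> ext_power n l" if P: "P \<in> ext_power n l" and Q: "Q \<in> ext_power n l" for P Q
 proof -
  have "rename_x \<pi> (P + Q) = rename_x \<pi> P + rename_x \<pi> Q"
   "rename_X \<pi> (P + Q) = rename_X \<pi> P + rename_X \<pi> Q" for \<pi> by (rule ev_eqI; simp)+
  thus ?thesis using P Q n unfolding ext_power_iff by (auto simp: distrib_left intro: degX_add)
 qed
 thus "P + Q \<in> ext_power n l" using P Q by blast
 have "P + const (-1) * Q \<in> ext_power n l" using a c P Q by blast
 moreover have "P - Q = P + const (-1) * Q" by (rule ev_eqI) simp
 ultimately show "P - Q \<in> ext_power n l" by (simp only:)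
 have "const 0 * P = 0" by simp
 thus "0 \<in> ext_power n l" using c[OF P, of 0] by simp
qed

section \<open>The modules \<open>U\<close>\<close>

text \<open>\<open>U\<close> for natural indices, with l = 0 absorbed: antisymmetry in no variables
  is vacuous, see \<open>sym_polys_ext_power\<close>.\<close>

definition UU :: "nat => nat => mpoly set" where
 "UU n l = {P \<in> ext_power n l. 1 \<le> l --> 2 \<le> n --> specialize 1 n l P = 0 \<and> specialize (-1) n l P = 0}"

lemma sym_polys_ext_power: "sym_polys n = ext_power n 0"
proof -
 have "rX id v = v" for v by (rule var_fun_eqI) simp_all
 hence "rename_X id P = P" for P by (intro ev_eqI) simp
 hence id: "rename_X id P = of_int (sign id) * P" for P by (simp add: sign_id)
 have e: "{1..0::nat} = {}" by simp
 have perm: "(\<forall>\<sigma>. \<sigma> permutes {1..0} --> rename_X \<sigma> P = of_int (sign \<sigma>) * P) \<longleftrightarrow> True" for P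
  unfolding e permutes_empty using id by blast
 show ?thesis unfolding sym_polys_def ext_power_def perm by (simp add: e)
qed

lemma U_UU: "U n (int l) = UU n l"
 by (auto simp: U_def UU_def sym_polys_ext_power)

lemma U_neg: "l < 0 ==> U n l = {0}"
 by (simp add: U_def)

definition spt :: "complex => nat => nat => (var => complex) => var => complex" where
 "spt s n l v = v(VX l := s * inverse (v (Vx (n - 1))), Vx n := - v (Vx (n - 1)))"

lemma lev_specialize:
 assumes v: "!!w. v w ~= 0"
 shows "lev v (specialize s n l P) = ev (spt s n l v) P"
proof -
 interpret eval_hom "%c. c" "ppowi v" rewrites "geval (%c. c) (ppowi v) = lev v"
  using lev_hom[OF v] by (auto simp: lev_def)
 have lv: "lev v (lvar w k) = v w powi k" for w k by (simp add: lvar_def geval_single)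
 show ?thesis unfolding specialize_def by (subst lev_poly_subst[OF v], rule arg_cong[of _ _ "%u. ev u P"])
   (auto simp: fun_eq_iff spt_def lv geval_mult geval_const geval_uminus power_int_minus)
qed

lemma UU_iff:
 "P \<in> UU n l \<longleftrightarrow> P \<in> ext_power n l \<and> (1 \<le> l --> 2 \<le> n -->
   (\<forall>v. (\<forall>w. v w ~= 0) --> ev (spt 1 n l v) P = 0 \<and> ev (spt (-1) n l v) P = 0))"
proof -
 have "specialize s n l P = 0 \<longleftrightarrow> (\<forall>v. (\<forall>w. v w ~= 0) --> ev (spt s n l v) P = 0)" for s
 proof
  assume "specialize s n l P = 0"
  thus "\<forall>v. (\<forall>w. v w ~= 0) --> ev (spt s n l v) P = 0"
   using lev_specialize[of _ s n l P] by (auto simp: lev_def geval_def)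
 next
  assume "\<forall>v. (\<forall>w. v w ~= 0) --> ev (spt s n l v) P = 0"
  thus "specialize s n l P = 0" by (intro lev_eq_0I) (simp add: lev_specialize)
 qed
 thus ?thesis unfolding UU_def by blast
qed

lemma permutes_two_ex:
 assumes "a \<in> {1..n}" "b \<in> {1..n}" "a ~= b" "2 \<le> n"
 shows "\<exists>\<pi>. \<pi> permutes {1..n} \<and> \<pi> (n - 1) = a \<and> \<pi> n = (b::nat)"
proof -
 define t where "t = transpose n b"
 define a' where "a' = t a"
 have t: "t permutes {1..n}" unfolding t_def using assms by (intro permutes_swap_id) auto
 have a': "a' \<in> {1..n}" using permutes_in_image[OF t] assms by (simp add: a'_def)
 hence "(t \<circ> transpose (n - 1) a') permutes {1..n}"
  using assms by (intro permutes_compose[OF permutes_swap_id t]) auto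
 moreover have "t a' = a" by (simp add: a'_def t_def)
 moreover have "a' ~= n" using assms by (auto simp: a'_def t_def transpose_def split: if_splits)
 moreover have "t n = b" by (simp add: t_def)
 ultimately show ?thesis using assms by (intro exI[of _ "t \<circ> transpose (n - 1) a'"]) auto
qed

text \<open>Symmetry in the x_j carries the last two indices to any ordered pair a, b, and
  antisymmetry carries X_l to any X_i.\<close>

lemma UU_vanish:
 assumes P: "P \<in> UU n l" and n: "2 \<le> n" and i: "i \<in> {1..l}"
  and ab: "a \<in> {1..n}" "b \<in> {1..n}" "a ~= b"
  and u: "!!w. u w ~= 0" "u (Vx b) = - u (Vx a)" "u (VX i) = inverse (u (Vx a))"
 shows "ev u P = 0"
proof -
 have E: "P \<in> ext_power n l" using P by (simp add: UU_iff)
 obtain \<pi> where p: "\<pi> permutes {1..n}" "\<pi> (n - 1) = a" "\<pi> n = b" using permutes_two_ex ab n by blast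
 let ?t = "transpose i l"
 have t: "?t permutes {1..l}" using i by (intro permutes_swap_id) auto
 define v where "v = vp \<pi> (rX ?t u)"
 have vnz: "v w ~= 0" for w unfolding v_def using u(1) by (cases w) auto
 have "spt 1 n l v = v" using p u n by (auto simp: spt_def v_def fun_eq_iff)
 moreover have "ev (spt 1 n l v) P = 0" using P vnz i n unfolding UU_iff by (metis atLeastAtMost_iff order_trans)
 ultimately have "ev v P = 0" by simp
 hence "of_int (sign ?t) * ev u P = 0" by (simp add: v_def ext_sym[OF E p(1)] ext_antisym[OF E t])
 thus ?thesis by (simp add: sign_def split: if_splits)
qed

lemma UU_lin:
 assumes n: "0 < n \<or> l = 0" and P: "P \<in> UU n l" and Q: "Q \<in> UU n l"
 shows "P + Q \<in> UU n l" "const c * P \<in> UU n l" "P - Q \<in> UU n l" "0 \<in> UU n l"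
 using ext_power_lin[OF n, of P Q] P Q by (auto simp: UU_iff)

text \<open>In each summand X_{p+q} occurs in just one factor, and that factor vanishes by
  itself.\<close>

lemma wedge_UU:
 assumes n: "2 \<le> n" and P: "P \<in> UU n p" and Q: "Q \<in> UU n q"
 shows "wedge p q P Q \<in> UU n (p + q)"
proof -
 have E: "P \<in> ext_power n p" "Q \<in> ext_power n q" using P Q by (auto simp: UU_iff)
 have "ev (spt s n (p + q) v) (wedge p q P Q) = 0"
  if l: "1 \<le> p + q" and v: "!!w. v w ~= 0" and s: "s \<in> {1, -1}" for v s
 proof -
  let ?u = "spt s n (p + q) v"
  have unz: "?u w ~= 0" for w using v s by (auto simp: spt_def)
  have rnz: "rX f ?u w ~= 0" for w f using unz by (cases w) auto
  \<comment> \<open>The index \<open>a\<close> is chosen such that X_{p+q} = 1 / x_a; then x_b = -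
    x_a for the other one.\<close>
  define a where "a = (if s = 1 then n - 1 else n)"
  define b where "b = (if s = 1 then n else n - 1)"
  have ab: "a \<in> {1..n}" "b \<in> {1..n}" "a ~= b" using n by (auto simp: a_def b_def)
  have neg: "inverse (- z) = - inverse z" for z :: complex by (rule inverse_minus_eq)
  have u: "?u (Vx b) = - ?u (Vx a)" "?u (VX (p + q)) = inverse (?u (Vx a))"
   using n s by (auto simp: a_def b_def spt_def)
  have "ev (rX \<sigma> ?u) P * ev (rX (%a. \<sigma> (p + a)) ?u) Q = 0" if s: "\<sigma> permutes {1..p+q}" for \<sigma>
  proof -
   obtain c where c: "p + q = \<sigma> c" "c \<in> {1..p+q}" using l permutes_image[OF s] by (metis atLeastAtMost_iff imageE order_refl)
   show ?thesis
   proof (cases "c \<le> p")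
    case True
    have "ev (rX \<sigma> ?u) P = 0" by (rule UU_vanish[OF P n _ ab, of c]) (use True c u rnz in auto)
    thus ?thesis by simp
   next
    case False
    have "ev (rX (%a. \<sigma> (p + a)) ?u) Q = 0"
     by (rule UU_vanish[OF Q n _ ab, of "c - p"]) (use False c u rnz in auto)
    thus ?thesis by simp
   qed
  qed
  thus ?thesis by (simp add: wedge_def mult.assoc del: mult_eq_0_iff)
 qed
 thus ?thesis using wedge_ext_power[of n P p Q q] n E by (auto simp: UU_iff)
qed

section \<open>The correspondence between \<open>U\<close> and equivariant families\<close>

definition sX :: "(nat => nat) => (var => complex) => var => complex" where
 "sX s v = (%w. case w of VX a => inverse (v (Vx (s a))) | Vx j => v (Vx j))"

lemma sX_simps [simp]: "sX s v (VX a) = inverse (v (Vx (s a)))" "sX s v (Vx j) = v (Vx j)"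
 by (simp_all add: sX_def)

lemma rX_sX: "rX f (sX s v) = sX (s \<circ> f) v"
 by (rule var_fun_eqI) auto

text \<open>The divisor common to the values of all elements of U at X_a = 1 / x_{s a}. The
  Vandermonde product of squares joins the factors x_a - x_b from antisymmetry to the factors x_a +
  x_b from the vanishing condition within the arrangement; the middle product collects the latter
  towards the outside. The powers of 1 / x account for the degree bound n - 1.\<close>

definition den :: "nat => nat => (nat => nat) => (var => complex) => complex" where
 "den n l s v = (\<Prod>a\<in>{1..l}. inverse (v (Vx (s a))) ^ (n - 1)) *
   (\<Prod>a\<in>{1..l}. \<Prod>j\<in>{1..n} - s ` {1..l}. v (Vx (s a)) + v (Vx j)) *
   vdm {1..l} (%a. (v (Vx (s a)))\<^sup>2)"

text \<open>A relation, not a map: \<open>corr_unique_poly\<close> and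
  \<open>corr_unique_fam\<close> show that each side determines the other, and
  \<open>corr_fam_ex\<close> and \<open>corr_poly_ex\<close> give existence.\<close>

definition corr :: "nat => nat => mpoly => (nat set => mpoly) => bool" where
 "corr n l P G \<longleftrightarrow> (\<forall>v s. gen n v --> inj_on s {1..l} --> s ` {1..l} \<subseteq> {1..n} -->
   ev (sX s v) P = ev v (G (s ` {1..l})) * den n l s v)"

lemma corrD: "corr n l P G ==> gen n v ==> inj_on s {1..l} ==> s ` {1..l} \<subseteq> {1..n} ==>
  ev (sX s v) P = ev v (G (s ` {1..l})) * den n l s v" by (simp add: corr_def)

lemma corr_lin:
 assumes "corr n l P G" "corr n l Q H"
 shows "corr n l (P + Q) (%I. G I + H I)" "corr n l (const c * P) (%I. const c * G I)"
 using assms by (auto simp: corr_def algebra_simps)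

lemma den_nz:
 assumes v: "gen n v" and s: "inj_on s {1..l}" "s ` {1..l} \<subseteq> {1..n}"
 shows "den n l s v ~= 0"
proof -
 interpret generic_point "{1..n}" "pt v" using gen_point v .
 have sq: "v (Vx a) ^ 2 ~= v (Vx b) ^ 2" if "a \<in> {1..n}" "b \<in> {1..n}" "a ~= b" for a b
  using sum_nz[OF that] diff_nz[OF that] unfolding power2_eq_iff by (auto simp: eq_neg_iff_add_eq_0)
 have "inj_on (%a. (v (Vx (s a)))\<^sup>2) {1..l}"
 proof (rule inj_onI, rule ccontr)
  fix a b assume ab: "a \<in> {1..l}" "b \<in> {1..l}" "(v (Vx (s a)))\<^sup>2 = (v (Vx (s b)))\<^sup>2" "a ~= b"
  have "s a \<in> {1..n}" "s b \<in> {1..n}" using s(2) ab(1,2) by blast+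
  moreover have "s a ~= s b" using inj_onD[OF s(1) _ ab(1,2)] ab(4) by blast
  ultimately show False using sq[of "s a" "s b"] ab(3) by simp
 qed
 hence "vdm {1..l} (%a. (v (Vx (s a)))\<^sup>2) ~= 0" by (intro vdm_nz) auto
 moreover have "(\<Prod>a\<in>{1..l}. \<Prod>j\<in>{1..n} - s ` {1..l}. v (Vx (s a)) + v (Vx j)) ~= 0"
 proof -
  have "v (Vx (s a)) + v (Vx j) ~= 0" if "a \<in> {1..l}" "j \<in> {1..n} - s ` {1..l}" for a j
  proof (rule sum_nz)
   show "s a \<in> {1..n}" using s(2) that(1) by blast
  qed (use that in auto)
  thus ?thesis by simp
 qed
 ultimately show ?thesis using gen_nonzero[OF v] by (auto simp: den_def)
qed

lemma den_permutes:
 assumes "\<sigma> permutes {1..l}"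
 shows "den n l (s \<circ> \<sigma>) v = of_int (sign \<sigma>) * den n l s v"
proof -
 have r: "(\<Prod>a\<in>{1..l}. h (\<sigma> a)) = (\<Prod>a\<in>{1..l}. h a)" for h :: "nat => complex"
  using prod.permute[OF assms, of h] by (simp add: comp_def)
 have "(s \<circ> \<sigma>) ` {1..l} = s ` {1..l}" using permutes_image[OF assms] by (simp only: image_comp[symmetric])
 moreover have "vdm {1..l} (%a. (v (Vx ((s \<circ> \<sigma>) a)))\<^sup>2) = of_int (sign \<sigma>) * vdm {1..l} (%a. (v (Vx (s a)))\<^sup>2)"
  using vdm_permutes[OF assms, of "%a. (v (Vx (s a)))\<^sup>2"] by (simp add: comp_def)
 ultimately show ?thesis unfolding den_def using r[of "%a. inverse (v (Vx (s a))) ^ (n - 1)"]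
   r[of "%a. \<Prod>j\<in>{1..n} - s ` {1..l}. v (Vx (s a)) + v (Vx j)"] by (simp add: mult_ac)
qed

lemma den_cong: "(!!a. a \<in> {1..l} ==> s a = s' a) ==> den n l s v = den n l s' v"
proof -
 assume s: "!!a. a \<in> {1..l} ==> s a = s' a"
 hence img: "s ` {1..l} = s' ` {1..l}" by (intro image_cong) auto
 show ?thesis unfolding den_def img by (intro arg_cong2[of _ _ _ _ "(*)"] prod.cong vdm_cong) (simp_all add: s)
qed

lemma den_vp:
 assumes p: "\<pi> permutes {1..n}"
 shows "den n l s (vp \<pi> v) = den n l (\<pi> \<circ> s) v"
proof -
 have "{1..n} - \<pi> ` s ` {1..l} = \<pi> ` ({1..n} - s ` {1..l})"
  using p by (simp add: image_set_diff permutes_inj permutes_image)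
 hence "(\<Prod>j\<in>{1..n} - (\<pi> \<circ> s) ` {1..l}. v (Vx (\<pi> (s a))) + v (Vx j)) =
   (\<Prod>j\<in>{1..n} - s ` {1..l}. v (Vx (\<pi> (s a))) + v (Vx (\<pi> j)))" for a
  using permutes_inj_on[OF p] by (simp only: image_comp[symmetric]) (subst prod.reindex, auto)
 thus ?thesis by (simp add: den_def)
qed


text \<open>Frees one X-variable at a time: a polynomial in it of degree less than \<open>n\<close>
  with \<open>n\<close> zeros in \<open>S\<close> is 0.\<close>

lemma grid_vanish:
 assumes P: "P \<in> ext_power n l" and n: "0 < n" and S: "finite S" "card S = n"
  and van: "!!u. (!!a. a \<in> {1..l} ==> u (VX a) \<in> S) ==> (!!j. u (Vx j) = v (Vx j)) ==> ev u P = 0"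
 shows "ev v P = 0"
proof -
 have "ev u P = 0" if "k \<le> l" "!!a. a \<in> {k+1..l} ==> u (VX a) \<in> S" "!!j. u (Vx j) = v (Vx j)" for k u
  using that
 proof (induction k arbitrary: u)
  case (Suc k)
  have "degX n (VX (Suc k)) P" using P Suc.prems by (auto simp: ext_power_iff)
  then obtain q where q: "degree q < n" "!!t. ev (u(VX (Suc k) := t)) P = poly q t" using degX_iff[OF n] by blast
  have "poly q t = 0" if "t \<in> S" for t unfolding q(2)[symmetric] using Suc.prems that by (intro Suc.IH) auto
  hence "q = 0" using q(1) S card_mono[of "{t. poly q t = 0}" S] card_poly_roots_bound[of q] poly_roots_finite[of q]
   by (metis (mono_tags, lifting) leD le_trans mem_Collect_eq subsetI)
  thus ?case using q(2)[of "u (VX (Suc k))"] by simp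
 qed (use van in auto)
 from this[of l v] show ?thesis by auto
qed

text \<open>The nodes 1 / x_j form a grid; where a node is repeated antisymmetry gives 0, so
  injective arrangements suffice.\<close>

lemma ext_power_zeroI:
 assumes P: "P \<in> ext_power n l" and n: "0 < n"
  and van: "!!v s. gen n v ==> inj_on s {1..l} ==> s ` {1..l} \<subseteq> {1..n} ==> ev (sX s v) P = 0"
 shows "P = 0"
proof (rule ev_eqI_gen[of n])
 fix v assume v: "gen n v"
 interpret generic_point "{1..n}" "pt v" using gen_point v .
 have "ev v P = 0"
 proof (rule grid_vanish[OF P n, where S = "(%j. inverse (v (Vx j))) ` {1..n}"])
  show "card ((%j. inverse (v (Vx j))) ` {1..n}) = n"
  proof -
   have "inj_on (%j. inverse (v (Vx j))) {1..n}"
   proof (rule inj_onI)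
    fix a b assume "a \<in> {1..n}" "b \<in> {1..n}" "inverse (v (Vx a)) = inverse (v (Vx b))"
    thus "a = b" using inj_onD[OF inj_x, of a b] by simp
   qed
   thus ?thesis by (simp add: card_image)
  qed
  fix u assume u: "!!a. a \<in> {1..l} ==> u (VX a) \<in> (%j. inverse (v (Vx j))) ` {1..n}"
   "!!j. u (Vx j) = v (Vx j)"
  obtain s where s: "!!a. a \<in> {1..l} ==> s a \<in> {1..n} \<and> u (VX a) = inverse (v (Vx (s a)))"
  proof -
   have "\<forall>a\<in>{1..l}. \<exists>j. j \<in> {1..n} \<and> u (VX a) = inverse (v (Vx j))"
   proof
    fix a assume "a \<in> {1..l}"
    from u(1)[OF this] show "\<exists>j. j \<in> {1..n} \<and> u (VX a) = inverse (v (Vx j))"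
     by (elim imageE) (rule exI, rule conjI, assumption+)
   qed
   then obtain f where "\<forall>a\<in>{1..l}. f a \<in> {1..n} \<and> u (VX a) = inverse (v (Vx (f a)))"
    using bchoice[of "{1..l}" "%a j. j \<in> {1..n} \<and> u (VX a) = inverse (v (Vx j))"] by blast
   thus ?thesis by (intro that[of f]) blast
  qed
  have *: "ev u P = ev (sX s v) P" using s u(2) by (intro ext_ev_cong[OF P]) (auto simp: evars_def)
  show "ev u P = 0"
  proof (cases "inj_on s {1..l}")
   case True
   moreover have "s ` {1..l} \<subseteq> {1..n}" using s by blast
   ultimately show ?thesis using van[OF v] * by simp
  next
   case False
   then obtain a b where ab: "a \<in> {1..l}" "b \<in> {1..l}" "a ~= b" "s a = s b" by (auto simp: inj_on_def)
   show ?thesis unfolding * by (rule ext_repeated[OF P ab(1,2,3)]) (simp add: ab(4))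
  qed
 qed simp
 thus "ev v P = ev v 0" by simp
qed

lemma corr_unique_poly:
 assumes "P \<in> ext_power n l" "Q \<in> ext_power n l" "0 < n" "corr n l P G" "corr n l Q G"
 shows "P = Q"
proof -
 have "P - Q = 0" by (rule ext_power_zeroI[of _ n l]) (use assms ext_power_lin in \<open>auto simp: corr_def\<close>)
 thus ?thesis by simp
qed

lemma corr_unique_fam:
 assumes "Fam n l G" "Fam n l H" "corr n l P G" "corr n l P H"
 shows "G = H"
proof
 fix I show "G I = H I"
 proof (cases "I \<subseteq> {1..n} \<and> card I = l")
  case True
  hence "finite I" using finite_subset[of I "{1..n}"] by simp
  then obtain s where s: "bij_betw s {1..l} I" using finite_same_card_bij[of "{1..l}" I] True by auto
  hence s': "inj_on s {1..l}" "s ` {1..l} = I" by (auto simp: bij_betw_def)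
  show ?thesis
  proof (rule ev_eqI_gen)
   fix v assume v: "gen n v"
   show "ev v (G I) = ev v (H I)"
    using corrD[OF assms(3) v s'(1)] corrD[OF assms(4) v s'(1)] den_nz[OF v s'(1)] s'(2) True by auto
  qed
 qed (use FamD(1)[OF assms(1)] FamD(1)[OF assms(2)] in simp)
qed

lemma corr_fam_ex:
 assumes P: "P \<in> UU n l" and n: "2 \<le> n" and l: "l \<le> n"
 shows "\<exists>G. Fam n l G \<and> corr n l P G"
proof -
 have E: "P \<in> ext_power n l" using P by (simp add: UU_iff)
 \<comment> \<open>The value at X_a = 1 / x_a times the powers x_a^(n-1); the degree bound makes
   this a polynomial.\<close>
 define Nm where "Nm = (\<Sum>m\<in>pkeys P. const (coef P m) *
   (\<Prod>a\<in>{1..l}. Var (Vx a) ^ (n - 1 - coef m (VX a))) *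
   (\<Prod>j\<in>{1..n}. Var (Vx j) ^ coef m (Vx j)))"
 have evN: "ev v Nm = (\<Prod>a\<in>{1..l}. v (Vx a) ^ (n - 1)) * ev (sX id v) P" if v: "!!w. v w ~= 0" for v
 proof -
  have "ppow (sX id v) m * (\<Prod>a\<in>{1..l}. v (Vx a) ^ (n - 1)) =
    (\<Prod>a\<in>{1..l}. v (Vx a) ^ (n - 1 - coef m (VX a))) *
    (\<Prod>j\<in>{1..n}. v (Vx j) ^ coef m (Vx j))" if m: "m \<in> pkeys P" for m
  proof -
   have k: "pkeys m \<subseteq> VX ` {1..l} \<union> Vx ` {1..n}"
    using E m by (auto simp: ext_power_def poly_vars_def)
   have deg: "coef m (VX a) \<le> n - 1" if "a \<in> {1..l}" for a
   proof -
    have "degX n (VX a) P" using E that by (simp add: ext_power_iff)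
    thus ?thesis using m by (auto simp: degX_def)
   qed
   have "ppow (sX id v) m = (\<Prod>w\<in>VX ` {1..l} \<union> Vx ` {1..n}. sX id v w ^ coef m w)"
    by (rule ppow_superset[OF _ k]) simp
   also have "... = (\<Prod>w\<in>VX ` {1..l}. sX id v w ^ coef m w) * (\<Prod>w\<in>Vx ` {1..n}. sX id v w ^ coef m w)"
    by (rule prod.union_disjoint) auto
   also have "... = (\<Prod>a\<in>{1..l}. inverse (v (Vx a)) ^ coef m (VX a)) *
     (\<Prod>j\<in>{1..n}. v (Vx j) ^ coef m (Vx j))" by (simp add: prod.reindex inj_on_def)
   finally have 1: "ppow (sX id v) m = (\<Prod>a\<in>{1..l}. inverse (v (Vx a)) ^ coef m (VX a)) *
     (\<Prod>j\<in>{1..n}. v (Vx j) ^ coef m (Vx j))" .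
   have 2: "(\<Prod>a\<in>{1..l}. inverse (v (Vx a)) ^ coef m (VX a)) * (\<Prod>a\<in>{1..l}. v (Vx a) ^ (n - 1)) =
     (\<Prod>a\<in>{1..l}. v (Vx a) ^ (n - 1 - coef m (VX a)))" unfolding prod.distrib[symmetric]
   proof (intro prod.cong refl)
    fix a assume a: "a \<in> {1..l}"
    have "v (Vx a) ^ (n - 1) = v (Vx a) ^ (coef m (VX a) + (n - 1 - coef m (VX a)))"
     using deg[OF a] by (subst le_add_diff_inverse) auto
    also have "... = v (Vx a) ^ coef m (VX a) * v (Vx a) ^ (n - 1 - coef m (VX a))"
     by (rule power_add)
    finally have "v (Vx a) ^ (n - 1) = v (Vx a) ^ coef m (VX a) * v (Vx a) ^ (n - 1 - coef m (VX a))" .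
    thus "inverse (v (Vx a)) ^ coef m (VX a) * v (Vx a) ^ (n - 1) =
      v (Vx a) ^ (n - 1 - coef m (VX a))" using v by (simp add: power_inverse field_simps)
   qed
   have "ppow (sX id v) m * (\<Prod>a\<in>{1..l}. v (Vx a) ^ (n - 1)) =
     ((\<Prod>a\<in>{1..l}. inverse (v (Vx a)) ^ coef m (VX a)) * (\<Prod>a\<in>{1..l}. v (Vx a) ^ (n - 1))) *
     (\<Prod>j\<in>{1..n}. v (Vx j) ^ coef m (Vx j))"
    unfolding 1 by (simp only: mult.assoc mult.commute mult.left_commute)
   thus ?thesis unfolding 2 .
  qed
  thus ?thesis unfolding Nm_def ev_def[of "sX id v"] geval_def by (simp add: sum_distrib_left mult_ac)
 qed
 \<comment> \<open>The zeros of the numerator: x_a = x_b by antisymmetry (\<open>B1\<close>), and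
   x_a = - x_b by the vanishing condition, with b inside (\<open>B2\<close>) or outside
   (\<open>B3\<close>) the first l indices.\<close>
 define B where "B = {(a, b). a \<in> {1..l} \<and> b \<in> {1..l} \<and> a < b}"
 define B1 where "B1 = (%(a, b). (a, b, 1 :: complex)) ` B"
 define B2 where "B2 = (%(a, b). (a, b, -1 :: complex)) ` B"
 define B3 where "B3 = (%(a, b). (a, b, -1 :: complex)) ` ({1..l} \<times> {l+1..n})"
 define dp where "dp = (\<Prod>(a, b, c)\<in>B1 \<union> B2 \<union> B3. lin c a b)"
 have finB: "finite B" unfolding B_def by (rule finite_pairs) simp
 have "dp dvd Nm" unfolding dp_def
 proof (rule lin_prod_dvdI)
  show "finite (B1 \<union> B2 \<union> B3)" using finB by (simp add: B1_def B2_def B3_def)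
  fix a b :: nat and c :: complex assume abc: "(a, b, c) \<in> B1 \<union> B2 \<union> B3"
  show "a < b \<and> c \<in> {1, -1}" using abc by (auto simp: B1_def B2_def B3_def B_def)
  fix v :: "var => complex" assume v: "!!w. v w ~= 0" and eq: "v (Vx a) = c * v (Vx b)"
  have snz: "sX id v w ~= 0" for w using v by (cases w) auto
  have a: "a \<in> {1..l}" using abc by (auto simp: B1_def B2_def B3_def B_def)
  have "ev (sX id v) P = 0"
  proof (cases "(a, b, c) \<in> B1")
   case True
   hence "c = 1" "b \<in> {1..l}" "a ~= b" by (auto simp: B1_def B_def)
   thus ?thesis using a eq by (intro ext_repeated[OF E, of a b]) auto
  next
   case False
   hence "c = -1" "b \<in> {1..n}" "a ~= b" using abc l by (auto simp: B2_def B3_def B_def)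
   thus ?thesis using a l eq snz by (intro UU_vanish[OF P n, of a a b]) auto
  qed
  thus "ev v Nm = 0" using evN v by simp
 qed
 then obtain G0 where G0: "Nm = dp * G0" by (auto elim: dvdE)
 have dpx: "xpoly n dp" unfolding dp_def using l by (intro xpoly_simps) (auto simp: B1_def B2_def B3_def B_def)
 have disj: "B1 \<inter> B2 = {}" "(B1 \<union> B2) \<inter> B3 = {}" by (auto simp: B1_def B2_def B3_def B_def)
 have evdp: "ev v dp = vdm {1..l} (%a. (v (Vx a))\<^sup>2) * (\<Prod>a\<in>{1..l}. \<Prod>j\<in>{l+1..n}. v (Vx a) + v (Vx j))" for v
 proof -
  have i: "inj_on (%(a, b). (a, b, c)) A" for c :: complex and A :: "(nat \<times> nat) set" by (auto simp: inj_on_def)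
  have "dp = (\<Prod>(a, b, c)\<in>B1. lin c a b) * (\<Prod>(a, b, c)\<in>B2. lin c a b) * (\<Prod>(a, b, c)\<in>B3. lin c a b)"
   unfolding dp_def using finB disj
   by (subst prod.union_disjoint, simp_all add: B1_def B2_def B3_def) (subst prod.union_disjoint, simp_all)
  also have "... = (\<Prod>(a, b)\<in>B. lin 1 a b) * (\<Prod>(a, b)\<in>B. lin (-1) a b) * (\<Prod>(a, b)\<in>{1..l} \<times> {l+1..n}. lin (-1) a b)"
   unfolding B1_def B2_def B3_def prod.reindex[OF i] by (simp add: case_prod_unfold)
  finally have "ev v dp = (\<Prod>(a, b)\<in>B. (v (Vx a) - v (Vx b)) * (v (Vx a) + v (Vx b))) *
    (\<Prod>(a, b)\<in>{1..l} \<times> {l+1..n}. v (Vx a) + v (Vx b))" by (simp add: case_prod_unfold prod.distrib)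
  moreover have "(v (Vx a) - v (Vx b)) * (v (Vx a) + v (Vx b)) = (v (Vx a))\<^sup>2 - (v (Vx b))\<^sup>2" for a b
   by (simp add: power2_eq_square algebra_simps)
  ultimately show ?thesis by (simp add: vdm_def B_def prod.cartesian_product)
 qed
 have idl: "{1..n} - id ` {1..l} = {l+1..n}" using l by auto
 have evG0: "ev (sX id v) P = ev v G0 * den n l id v" if v: "gen n v" for v
 proof -
  have c: "(\<Prod>a\<in>{1..l}. v (Vx a) ^ (n - 1)) * (\<Prod>a\<in>{1..l}. inverse (v (Vx a)) ^ (n - 1)) = 1"
   using gen_nonzero[OF v] by (simp add: prod.distrib[symmetric] power_mult_distrib[symmetric])
  have e: "ev v G0 * ev v dp = (\<Prod>a\<in>{1..l}. v (Vx a) ^ (n - 1)) * ev (sX id v) P"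
   using evN[of v] gen_nonzero[OF v] by (simp add: G0 mult.commute)
  have "ev v G0 * den n l id v = (\<Prod>a\<in>{1..l}. inverse (v (Vx a)) ^ (n - 1)) * (ev v G0 * ev v dp)"
   unfolding den_def idl evdp by (simp only: id_apply mult_ac)
  also have "... = ((\<Prod>a\<in>{1..l}. v (Vx a) ^ (n - 1)) * (\<Prod>a\<in>{1..l}. inverse (v (Vx a)) ^ (n - 1))) * ev (sX id v) P"
   unfolding e by (simp only: mult_ac)
  finally show ?thesis unfolding c by simp
 qed
 \<comment> \<open>By symmetry of \<open>P\<close> in the x_j, the arrangement \<open>s\<close> may
   be replaced by the identity at a permuted point.\<close>
 have general: "ev (sX s v) P = ev (vp \<pi> v) G0 * den n l s v"
  if v: "gen n v" and p: "\<pi> permutes {1..n}" "!!a. a \<in> {1..l} ==> \<pi> a = s a" for v s \<pi>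
 proof -
  have "ev (sX s v) P = ev (vp \<pi> (sX s v)) P" by (simp add: ext_sym[OF E p(1)])
  also have "... = ev (sX id (vp \<pi> v)) P" using p(2) by (intro ext_ev_cong[OF E]) (auto simp: evars_def)
  also have "... = ev (vp \<pi> v) G0 * den n l id (vp \<pi> v)" using evG0 gen_vp[OF v p(1)] .
  also have "den n l id (vp \<pi> v) = den n l s v" unfolding den_vp[OF p(1)] by (rule den_cong) (use p(2) in simp)
  finally show ?thesis .
 qed
 have "Inv n l G0" unfolding Inv_def
 proof (intro conjI allI impI)
  have "xpoly n Nm" unfolding Nm_def using l by (intro xpoly_simps) auto
  moreover have "dp ~= 0"
  proof
   assume "dp = 0"
   hence "ev v dp = 0" for v by simp
   hence "den n l id v = 0" for v unfolding den_def idl using evdp[of v] by auto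
   hence "\<not> gen n v" for v using den_nz[of n v id l] l by auto
   thus False using disc_nz[of n] ev_eqI_gen[of n "disc n" 0] by blast
  qed
  ultimately show "xpoly n G0" using dpx xpoly_cancel unfolding G0 by blast
  fix \<pi> assume p: "\<pi> permutes {1..n}" "\<pi> ` {1..l} = {1..l}"
  \<comment> \<open>Rearranging the first l nodes multiplies the value of \<open>P\<close> and
    \<open>den\<close> by the same sign, so the quotient \<open>G0\<close> is invariant.\<close>
  define \<sigma> where "\<sigma> a = (if a \<in> {1..l} then \<pi> a else a)" for a
  have "bij_betw \<pi> {1..l} {1..l}" using p permutes_inj_on[OF p(1)] by (auto simp: bij_betw_def)
  hence "bij_betw \<sigma> {1..l} {1..l}" by (subst bij_betw_cong[of _ _ \<pi>]) (auto simp: \<sigma>_def)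
  hence s: "\<sigma> permutes {1..l}" by (rule bij_imp_permutes) (auto simp: \<sigma>_def)
  show "rename_x \<pi> G0 = G0"
  proof (rule ev_eqI_gen)
   fix v assume v: "gen n v"
   have "ev (vp \<pi> v) G0 * den n l \<sigma> v = ev (sX \<sigma> v) P"
    by (rule general[OF v p(1), symmetric]) (simp add: \<sigma>_def)
   also have "... = of_int (sign \<sigma>) * ev (sX id v) P"
    using ext_antisym[OF E s, of "sX id v"] by (simp add: rX_sX)
   also have "... = ev v G0 * den n l \<sigma> v" using evG0[OF v] den_permutes[OF s, of n id v] by simp
   finally show "ev v (rename_x \<pi> G0) = ev v G0"
    using den_nz[OF v, of \<sigma> l] permutes_inj_on[OF s] permutes_image[OF s] l by auto
  qed
 qed
 then obtain G where G: "Fam n l G" "G {1..l} = G0" using Fam_ex l by blast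
 have "corr n l P G" unfolding corr_def
 proof (intro allI impI)
  fix v s assume v: "gen n v" and s: "inj_on s {1..l}" "s ` {1..l} \<subseteq> {1..n}"
  obtain \<pi> where p: "\<pi> permutes {1..n}" "\<forall>a\<in>{1..l}. \<pi> a = s a" using permutes_extend[OF s] by blast
  hence "s ` {1..l} = \<pi> ` {1..l}" by (intro image_cong) auto
  moreover have "ev v (G (\<pi> ` {1..l})) = ev (vp \<pi> v) G0"
   using Fam_ev[OF G(1) p(1), of "{1..l}" v] l G(2) by simp
  ultimately show "ev (sX s v) P = ev v (G (s ` {1..l})) * den n l s v" using general[OF v p(1), of s] p(2) by simp
 qed
 thus ?thesis using G by blast
qed

section \<open>Exterior multiplication by \<open>\<Xi>\<^sub>1\<close> and \<open>\<Xi>\<^sub>2\<close>\<close>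

context generic_point
begin

lemma E1_alt: "I \<subseteq> N ==> E1 g I = (\<Sum>b\<in>I. w b (I - {b}) * g (I - {b}))"
proof -
 assume I: "I \<subseteq> N"
 have "E1 g I = (\<Sum>b\<in>I. eps b g I)"
  unfolding opE_def mult_1 using I by (intro sum.mono_neutral_right) (auto simp: eps_def)
 also have "... = (\<Sum>b\<in>I. w b (I - {b}) * g (I - {b}))" by (intro sum.cong refl) (simp add: eps_def I)
 finally show ?thesis .
qed

text \<open>Here \<theta> b b' cancels the factor f b b' of the outer weight, so both removed
  indices are weighted only against what remains. Wedge products with Xi2 have this shape.\<close>

lemma E2_alt:
 assumes I: "I \<subseteq> N"
 shows "E2 g I = (\<Sum>b\<in>I. \<Sum>b'\<in>I - {b}. w b (I - {b, b'}) * w b' (I - {b, b'}) * g (I - {b, b'})) / 2"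
proof -
 have fin: "finite I" using I finite_N by (rule finite_subset)
 have 1: "(\<Sum>b'\<in>N. \<theta> b b' * eps b (eps b' g) I) =
   (\<Sum>b'\<in>I - {b}. w b (I - {b, b'}) * w b' (I - {b, b'}) * g (I - {b, b'}))" if b: "b \<in> I" for b
 proof -
  have "(\<Sum>b'\<in>N. \<theta> b b' * eps b (eps b' g) I) = (\<Sum>b'\<in>I - {b}. \<theta> b b' * eps b (eps b' g) I)"
   using I by (intro sum.mono_neutral_right) (auto simp: eps_def)
  also have "... = (\<Sum>b'\<in>I - {b}. w b (I - {b, b'}) * w b' (I - {b, b'}) * g (I - {b, b'}))"
  proof (intro sum.cong refl)
   fix b' assume b': "b' \<in> I - {b}"
   have e: "I - {b} - {b'} = I - {b, b'}" by auto
   have "w b (I - {b}) = f b b' * w b (I - {b} - {b'})" using fin b' by (intro w_remove) auto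
   hence "\<theta> b b' * w b (I - {b}) = (f b b' * \<theta> b b') * w b (I - {b, b'})" by (simp add: e)
   also have "f b b' * \<theta> b b' = 1" using b b' I by (intro f_\<theta>) auto
   finally have "\<theta> b b' * w b (I - {b}) = w b (I - {b, b'})" by simp
   moreover have "eps b (eps b' g) I = w b (I - {b}) * (w b' (I - {b, b'}) * g (I - {b, b'}))"
    using b b' I by (auto simp: eps_def e)
   ultimately show "\<theta> b b' * eps b (eps b' g) I = w b (I - {b, b'}) * w b' (I - {b, b'}) * g (I - {b, b'})"
    by (simp add: mult.assoc[symmetric])
  qed
  finally show ?thesis .
 qed
 have "E2 g I = (\<Sum>b\<in>I. \<Sum>b'\<in>N. \<theta> b b' * eps b (eps b' g) I) / 2"
  unfolding E2_def using I by (intro arg_cong[of _ _ "%z. z / 2"] sum.mono_neutral_right) (auto simp: eps_def)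
 thus ?thesis by (simp only: 1 cong: sum.cong)
qed

end

text \<open>Each value at the last position is taken by p! permutations, which cancels the 1 / p! in
  \<open>wedge\<close>.\<close>

lemma sum_perm1:
 fixes \<Phi> :: "nat => complex"
 shows "(\<Sum>\<sigma> | \<sigma> permutes {1..Suc p}. \<Phi> (\<sigma> (Suc p))) = fact p * (\<Sum>c\<in>{1..Suc p}. \<Phi> c)"
proof -
 have ins: "{1..Suc p} = insert (Suc p) {1..p}" by auto
 have "(\<Sum>\<sigma> | \<sigma> permutes {1..Suc p}. \<Phi> (\<sigma> (Suc p))) =
   (\<Sum>b\<in>{1..Suc p}. \<Sum>q | q permutes {1..p}. \<Phi> ((transpose (Suc p) b \<circ> q) (Suc p)))"
  unfolding ins by (rule sum_over_permutations_insert) auto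
 also have "... = (\<Sum>b\<in>{1..Suc p}. \<Sum>q | q permutes {1..p}. \<Phi> b)"
 proof (intro sum.cong refl)
  fix b q assume "q \<in> {q. q permutes {1..p}}"
  hence "q (Suc p) = Suc p" using permutes_not_in[of q "{1..p}" "Suc p"] by simp
  thus "\<Phi> ((transpose (Suc p) b \<circ> q) (Suc p)) = \<Phi> b" by simp
 qed
 also have "... = fact p * (\<Sum>c\<in>{1..Suc p}. \<Phi> c)"
  by (simp add: card_permutations[of "{1..p}" p] sum_distrib_left del: sum.cl_ivl_Suc)
 finally show ?thesis .
qed

text \<open>Splitting off the value \<open>b\<close> of the last position leaves a permutation of
  the others, to which \<open>sum_perm1\<close> applies; the transposition then relabels its
  value.\<close>

lemma sum_perm2:
 fixes \<Phi> :: "nat => nat => complex"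
 shows "(\<Sum>\<sigma> | \<sigma> permutes {1..Suc (Suc p)}. \<Phi> (\<sigma> (Suc p)) (\<sigma> (Suc (Suc p)))) =
  fact p * (\<Sum>c\<in>{1..Suc (Suc p)}. \<Sum>d\<in>{1..Suc (Suc p)} - {c}. \<Phi> d c)"
proof -
 let ?m = "Suc (Suc p)"
 have ins: "{1..?m} = insert ?m {1..Suc p}" by auto
 have "(\<Sum>\<sigma> | \<sigma> permutes {1..?m}. \<Phi> (\<sigma> (Suc p)) (\<sigma> ?m)) =
   (\<Sum>b\<in>{1..?m}. \<Sum>q | q permutes {1..Suc p}. \<Phi> ((transpose ?m b \<circ> q) (Suc p)) ((transpose ?m b \<circ> q) ?m))"
  unfolding ins by (rule sum_over_permutations_insert) auto
 also have "... = (\<Sum>b\<in>{1..?m}. \<Sum>q | q permutes {1..Suc p}. \<Phi> (transpose ?m b (q (Suc p))) b)"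
 proof (intro sum.cong refl)
  fix b q assume "q \<in> {q. q permutes {1..Suc p}}"
  hence "q ?m = ?m" using permutes_not_in[of q "{1..Suc p}" ?m] by simp
  thus "\<Phi> ((transpose ?m b \<circ> q) (Suc p)) ((transpose ?m b \<circ> q) ?m) = \<Phi> (transpose ?m b (q (Suc p))) b" by simp
 qed
 also have "... = (\<Sum>b\<in>{1..?m}. fact p * (\<Sum>c\<in>{1..Suc p}. \<Phi> (transpose ?m b c) b))"
  by (intro sum.cong refl sum_perm1)
 also have "... = (\<Sum>b\<in>{1..?m}. fact p * (\<Sum>d\<in>{1..?m} - {b}. \<Phi> d b))"
 proof (rule sum.cong[OF refl])
  fix b assume b: "b \<in> {1..?m}"
  have t: "transpose ?m b permutes {1..?m}" using b by (intro permutes_swap_id) auto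
  have "transpose ?m b ` ({1..?m} - {?m}) = {1..?m} - {b}"
   using permutes_image[OF t] by (simp add: image_set_diff permutes_inj[OF t])
  moreover have "{1..?m} - {?m} = {1..Suc p}" by auto
  ultimately have "bij_betw (transpose ?m b) {1..Suc p} ({1..?m} - {b})"
   using permutes_inj_on[OF t] by (simp add: bij_betw_def)
  hence "(\<Sum>c\<in>{1..Suc p}. \<Phi> (transpose ?m b c) b) = (\<Sum>d\<in>{1..?m} - {b}. \<Phi> d b)"
   by (rule sum.reindex_bij_betw)
  thus "fact p * (\<Sum>c\<in>{1..Suc p}. \<Phi> (transpose ?m b c) b) = fact p * (\<Sum>d\<in>{1..?m} - {b}. \<Phi> d b)"
   by (rule arg_cong)
 qed
 finally show ?thesis by (simp only: sum_distrib_left)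
qed

lemma prod_split: "(\<Prod>a\<in>{1..p + q}. h a) = (\<Prod>a\<in>{1..p}. h a) * (\<Prod>a\<in>{1..q}. h (p + a) :: 'r::comm_monoid_mult)" for p q :: nat
 by (induction q) (simp_all add: mult.assoc)

lemma vdm_Suc: "vdm {1..Suc m} z = vdm {1..m} z * (\<Prod>a\<in>{1..m}. z a - z (Suc m) :: complex)"
proof -
 let ?P = "%m. {(a, b). a \<in> {1..m} \<and> b \<in> {1..m} \<and> a < (b::nat)}"
 have "?P (Suc m) = ?P m \<union> (%a. (a, Suc m)) ` {1..m}" by auto
 hence "vdm {1..Suc m} z = (\<Prod>(a, b)\<in>?P m \<union> (%a. (a, Suc m)) ` {1..m}. z a - z b)"
  unfolding vdm_def by (rule arg_cong)
 also have "... = vdm {1..m} z * (\<Prod>(a, b)\<in>(%a. (a, Suc m)) ` {1..m}. z a - z b)"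
  unfolding vdm_def
 proof (rule prod.union_disjoint)
  show "finite (?P m)" by (rule finite_pairs) simp
 qed auto
 also have "(\<Prod>(a, b)\<in>(%a. (a, Suc m)) ` {1..m}. z a - z b) = (\<Prod>a\<in>{1..m}. z a - z (Suc m))"
  by (subst prod.reindex) (auto simp: inj_on_def)
 finally show ?thesis .
qed

lemma vdm_split: "vdm {1..p + q} z = vdm {1..p} z * vdm {1..q} (%a. z (p + a)) *
  (\<Prod>a\<in>{1..p}. \<Prod>b\<in>{1..q}. z a - z (p + b) :: complex)"
proof (induction q)
 case 0
 show ?case by (simp add: vdm_def)
next
 case (Suc q)
 have "vdm {1..p + Suc q} z = vdm {1..p + q} z * (\<Prod>a\<in>{1..p + q}. z a - z (p + Suc q))"
  using vdm_Suc[of "p + q" z] by simp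
 also have "(\<Prod>a\<in>{1..p + q}. z a - z (p + Suc q)) =
   (\<Prod>a\<in>{1..p}. z a - z (p + Suc q)) * (\<Prod>a\<in>{1..q}. z (p + a) - z (p + Suc q))" by (rule prod_split)
 also have "vdm {1..p + q} z = vdm {1..p} z * vdm {1..q} (%a. z (p + a)) *
  (\<Prod>a\<in>{1..p}. \<Prod>b\<in>{1..q}. z a - z (p + b))" by (rule Suc.IH)
 also have "... * ((\<Prod>a\<in>{1..p}. z a - z (p + Suc q)) * (\<Prod>a\<in>{1..q}. z (p + a) - z (p + Suc q))) =
   vdm {1..p} z * (vdm {1..q} (%a. z (p + a)) * (\<Prod>a\<in>{1..q}. z (p + a) - z (p + Suc q))) *
   (\<Prod>a\<in>{1..p}. (\<Prod>b\<in>{1..q}. z a - z (p + b)) * (z a - z (p + Suc q)))"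
  by (simp only: prod.distrib mult_ac)
 also have "vdm {1..q} (%a. z (p + a)) * (\<Prod>a\<in>{1..q}. z (p + a) - z (p + Suc q)) = vdm {1..Suc q} (%a. z (p + a))"
  by (rule vdm_Suc[symmetric])
 also have "(%a. (\<Prod>b\<in>{1..q}. z a - z (p + b)) * (z a - z (p + Suc q))) = (%a. \<Prod>b\<in>{1..Suc q}. z a - z (p + b))"
  by (rule ext) (simp add: prod.nat_ivl_Suc' mult.commute)
 finally show ?case .
qed

text \<open>The mixed factors decide: the two denominators on the left contribute the product of the
  x_a + x_b twice, the one on the right contributes x_a^2 - x_b^2, and the quotient is
  \<open>f\<close>. Factors towards indices outside both blocks agree.\<close>

lemma den_split:
 assumes v: "gen n v" and s: "inj_on s {1..p + q}" "s ` {1..p + q} \<subseteq> {1..n}"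
 shows "den n p s v * den n q (%a. s (p + a)) v = den n (p + q) s v *
  (\<Prod>a\<in>{1..p}. \<Prod>b\<in>{1..q}. generic_point.f (pt v) (s a) (s (p + b)))"
proof -
 interpret generic_point "{1..n}" "pt v" using gen_point v .
 let ?A = "{1..p}" and ?B = "{1..q}"
 define s' where "s' b = s (p + b)" for b
 define y where "y a = v (Vx (s a))" for a
 define R where "R = {1..n} - s ` {1..p + q}"
 have sq: "(%a. s (p + a)) = s'" by (simp add: s'_def fun_eq_iff)
 have ivl: "{1..p + q} = ?A \<union> (+) p ` ?B" unfolding image_add_atLeastAtMost by auto
 have im: "s ` {1..p + q} = s ` ?A \<union> s' ` ?B" unfolding ivl image_Un image_image s'_def ..
 have sn: "s a \<in> {1..n}" if "a \<in> {1..p + q}" for a using s(2) that by blast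
 have eq: "s a = s b \<longleftrightarrow> a = b" if "a \<in> {1..p + q}" "b \<in> {1..p + q}" for a b
  using inj_on_eq_iff[OF s(1) that] .
 have disj: "s ` ?A \<inter> s' ` ?B = {}"
 proof -
  have "s a ~= s' b" if "a \<in> ?A" "b \<in> ?B" for a b unfolding s'_def using eq[of a "p + b"] that by auto
  thus ?thesis by blast
 qed
 have injA: "inj_on s ?A" using s(1) by (rule inj_on_subset) auto
 have injB: "inj_on s' ?B"
 proof (rule inj_onI)
  fix a b assume "a \<in> ?B" "b \<in> ?B" "s' a = s' b"
  thus "a = b" unfolding s'_def using eq[of "p + a" "p + b"] by auto
 qed
 have setA: "{1..n} - s ` ?A = R \<union> s' ` ?B" and setB: "{1..n} - s' ` ?B = R \<union> s ` ?A"
  using disj s(2) unfolding R_def im by blast+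
 have RA: "R \<inter> s ` ?A = {}" and RB: "R \<inter> s' ` ?B = {}" unfolding R_def im by blast+
 have finR: "finite R" by (simp add: R_def)
 have prA: "(\<Prod>j\<in>{1..n} - s ` ?A. h j) = (\<Prod>j\<in>R. h j) * (\<Prod>b\<in>?B. h (s' b))" for h :: "nat => complex"
  unfolding setA using RB finR injB by (simp add: prod.union_disjoint prod.reindex)
 have prB: "(\<Prod>j\<in>{1..n} - s' ` ?B. h j) = (\<Prod>j\<in>R. h j) * (\<Prod>a\<in>?A. h (s a))" for h :: "nat => complex"
  unfolding setB using RA finR injA by (simp add: prod.union_disjoint prod.reindex)
 define IA where "IA = (\<Prod>a\<in>?A. inverse (y a) ^ (n - 1))"
 define IB where "IB = (\<Prod>b\<in>?B. inverse (y (p + b)) ^ (n - 1))"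
 define LA where "LA = (\<Prod>a\<in>?A. \<Prod>j\<in>R. y a + v (Vx j))"
 define LB where "LB = (\<Prod>b\<in>?B. \<Prod>j\<in>R. y (p + b) + v (Vx j))"
 define S where "S = (\<Prod>a\<in>?A. \<Prod>b\<in>?B. y a + y (p + b))"
 define VA where "VA = vdm ?A (%a. (y a)\<^sup>2)"
 define VB where "VB = vdm ?B (%b. (y (p + b))\<^sup>2)"
 define Dm where "Dm = (\<Prod>a\<in>?A. \<Prod>b\<in>?B. (y a)\<^sup>2 - (y (p + b))\<^sup>2)"
 define F where "F = (\<Prod>a\<in>?A. \<Prod>b\<in>?B. f (s a) (s (p + b)))"
 have FD: "F * Dm = S * S" unfolding F_def Dm_def S_def prod.distrib[symmetric]
 proof (intro prod.cong refl)
  fix a b assume ab: "a \<in> ?A" "b \<in> ?B"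
  have "y a ~= y (p + b)" unfolding y_def
   using ab eq[of a "p + b"] sn[of a] sn[of "p + b"] by (intro diff_nz) auto
  hence "y a - y (p + b) ~= 0" by simp
  thus "f (s a) (s (p + b)) * ((y a)\<^sup>2 - (y (p + b))\<^sup>2) = (y a + y (p + b)) * (y a + y (p + b))"
   unfolding f_def y_def[symmetric] power2_eq_square by (simp add: field_simps)
 qed
 have "den n p s v = IA * (LA * S) * VA"
  unfolding den_def prA IA_def LA_def S_def VA_def y_def s'_def prod.distrib by simp
 moreover have "den n q s' v = IB * (LB * S) * VB"
 proof -
  have "S = (\<Prod>b\<in>?B. \<Prod>a\<in>?A. y (p + b) + y a)"
   unfolding S_def by (subst prod.swap) (simp add: add.commute)
  thus ?thesis unfolding den_def prB IB_def LB_def VB_def by (simp add: y_def s'_def prod.distrib)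
 qed
 moreover have "den n (p + q) s v = (IA * IB) * (LA * LB) * (VA * VB * Dm)"
  unfolding den_def R_def[symmetric] IA_def IB_def LA_def LB_def VA_def VB_def Dm_def y_def
  by (simp only: prod_split vdm_split)
 ultimately have "den n p s v * den n q s' v = den n (p + q) s v * F" using FD by (simp add: mult_ac)
 thus ?thesis unfolding F_def sq .
qed

text \<open>The case of a constant family, which covers Xi1 and Xi2 with the values 1 and
  -2.\<close>

definition corrc :: "nat => nat => mpoly => complex => bool" where
 "corrc n l P k \<longleftrightarrow> (\<forall>v s. gen n v --> inj_on s {1..l} --> s ` {1..l} \<subseteq> {1..n} -->
   ev (sX s v) P = k * den n l s v)"

text \<open>The sign of \<sigma> in \<open>wedge\<close> cancels against the one from
  \<open>den_permutes\<close>, and \<open>den_split\<close> turns the two denominators into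
  one.\<close>

lemma ev_wedge:
 assumes P: "corr n p P G" and Q: "corrc n q Q k" and v: "gen n v"
  and s: "inj_on s {1..p + q}" "s ` {1..p + q} \<subseteq> {1..n}"
 shows "ev (sX s v) (wedge p q P Q) = k / (fact p * fact q) * den n (p + q) s v *
  (\<Sum>\<sigma> | \<sigma> permutes {1..p + q}. ev v (G (s ` \<sigma> ` {1..p})) *
   (\<Prod>a\<in>{1..p}. \<Prod>b\<in>{1..q}. generic_point.f (pt v) (s (\<sigma> a)) (s (\<sigma> (p + b)))))"
proof -
 let ?F = "%\<sigma>. \<Prod>a\<in>{1..p}. \<Prod>b\<in>{1..q}. generic_point.f (pt v) (s (\<sigma> a)) (s (\<sigma> (p + b)))"
 have summand: "of_int (sign \<sigma>) * (ev (sX (s \<circ> \<sigma>) v) P * ev (sX (s \<circ> (%a. \<sigma> (p + a))) v) Q) =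
   k * den n (p + q) s v * (ev v (G (s ` \<sigma> ` {1..p})) * ?F \<sigma>)" if p: "\<sigma> permutes {1..p + q}" for \<sigma>
 proof -
  have \<sigma>: "inj_on (s \<circ> \<sigma>) {1..p + q}" "(s \<circ> \<sigma>) ` {1..p + q} \<subseteq> {1..n}"
   unfolding image_comp[symmetric] permutes_image[OF p]
   using s permutes_image[OF p] permutes_inj_on[OF p] by (auto intro!: comp_inj_on)
  have sub: "(s \<circ> \<sigma>) ` {1..p} \<subseteq> {1..n}" "(%a. (s \<circ> \<sigma>) (p + a)) ` {1..q} \<subseteq> {1..n}"
  proof -
   have "(s \<circ> \<sigma>) ` {1..p} \<subseteq> (s \<circ> \<sigma>) ` {1..p + q}" by (intro image_mono) auto
   thus "(s \<circ> \<sigma>) ` {1..p} \<subseteq> {1..n}" using \<sigma>(2) by blast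
   have "(%a. (s \<circ> \<sigma>) (p + a)) ` {1..q} = (s \<circ> \<sigma>) ` (+) p ` {1..q}" unfolding image_image ..
   also have "... \<subseteq> (s \<circ> \<sigma>) ` {1..p + q}" unfolding image_add_atLeastAtMost by (intro image_mono) auto
   finally show "(%a. (s \<circ> \<sigma>) (p + a)) ` {1..q} \<subseteq> {1..n}" using \<sigma>(2) by blast
  qed
  have inj: "inj_on (s \<circ> \<sigma>) {1..p}" "inj_on (%a. (s \<circ> \<sigma>) (p + a)) {1..q}"
  proof -
   show "inj_on (s \<circ> \<sigma>) {1..p}" using \<sigma>(1) by (rule inj_on_subset) auto
   show "inj_on (%a. (s \<circ> \<sigma>) (p + a)) {1..q}"
   proof (rule inj_onI)
    fix a b assume "a \<in> {1..q}" "b \<in> {1..q}" "(s \<circ> \<sigma>) (p + a) = (s \<circ> \<sigma>) (p + b)"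
    thus "a = b" using inj_onD[OF \<sigma>(1), of "p + a" "p + b"] by auto
   qed
  qed
  have c: "s \<circ> (%a. \<sigma> (p + a)) = (%a. (s \<circ> \<sigma>) (p + a))" by (simp add: comp_def)
  have "ev (sX (s \<circ> \<sigma>) v) P * ev (sX (s \<circ> (%a. \<sigma> (p + a))) v) Q =
    (ev v (G ((s \<circ> \<sigma>) ` {1..p})) * den n p (s \<circ> \<sigma>) v) * (k * den n q (%a. (s \<circ> \<sigma>) (p + a)) v)"
   unfolding c using corrD[OF P v inj(1) sub(1)] Q v inj(2) sub(2) unfolding corrc_def by simp
  also have "... = ev v (G ((s \<circ> \<sigma>) ` {1..p})) * k * (den n p (s \<circ> \<sigma>) v * den n q (%a. (s \<circ> \<sigma>) (p + a)) v)"
   by (simp only: mult_ac)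
  also have "den n p (s \<circ> \<sigma>) v * den n q (%a. (s \<circ> \<sigma>) (p + a)) v =
    of_int (sign \<sigma>) * den n (p + q) s v * ?F \<sigma>"
   unfolding den_split[OF v \<sigma>] den_permutes[OF p] by (simp only: comp_apply)
  finally have e: "ev (sX (s \<circ> \<sigma>) v) P * ev (sX (s \<circ> (%a. \<sigma> (p + a))) v) Q =
   ev v (G (s ` \<sigma> ` {1..p})) * k * (of_int (sign \<sigma>) * den n (p + q) s v * ?F \<sigma>)"
   by (simp only: image_comp)
  have sg: "of_int (sign \<sigma>) * of_int (sign \<sigma>) = (1::complex)" by (simp add: sign_def)
  have "of_int (sign \<sigma>) * (ev (sX (s \<circ> \<sigma>) v) P * ev (sX (s \<circ> (%a. \<sigma> (p + a))) v) Q) =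
   (of_int (sign \<sigma>) * of_int (sign \<sigma>)) * (k * den n (p + q) s v * (ev v (G (s ` \<sigma> ` {1..p})) * ?F \<sigma>))"
   unfolding e by (simp only: mult_ac)
  thus ?thesis unfolding sg by simp
 qed
 have "ev (sX s v) (wedge p q P Q) = 1 / (fact p * fact q) *
   (\<Sum>\<sigma> | \<sigma> permutes {1..p + q}. of_int (sign \<sigma>) * (ev (sX (s \<circ> \<sigma>) v) P * ev (sX (s \<circ> (%a. \<sigma> (p + a))) v) Q))"
  unfolding wedge_def by (simp add: rX_sX mult.assoc)
 also have "(\<Sum>\<sigma> | \<sigma> permutes {1..p + q}. of_int (sign \<sigma>) * (ev (sX (s \<circ> \<sigma>) v) P * ev (sX (s \<circ> (%a. \<sigma> (p + a))) v) Q)) =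
   (\<Sum>\<sigma> | \<sigma> permutes {1..p + q}. k * den n (p + q) s v * (ev v (G (s ` \<sigma> ` {1..p})) * ?F \<sigma>))"
  by (intro sum.cong refl) (simp only: summand mem_Collect_eq)
 also have "... = k * den n (p + q) s v * (\<Sum>\<sigma> | \<sigma> permutes {1..p + q}. ev v (G (s ` \<sigma> ` {1..p})) * ?F \<sigma>)"
  by (rule sum_distrib_left[symmetric])
 finally show ?thesis by simp
qed

text \<open>The sign (-1)^p arises from reversing the arguments of \<open>f\<close>, since
  \<open>w\<close> puts the removed index first.\<close>

lemma ev_wedge1:
 assumes P: "corr n p P G" and Q: "corrc n 1 Q k" and v: "gen n v"
  and s: "inj_on s {1..p + 1}" "s ` {1..p + 1} \<subseteq> {1..n}"
 shows "ev (sX s v) (wedge p 1 P Q) = (-1) ^ p * k * den n (p + 1) s v *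
  generic_point.opE {1..n} (pt v) (%_. 1) (%I. ev v (G I)) (s ` {1..p + 1})"
proof -
 interpret generic_point "{1..n}" "pt v" using gen_point v .
 let ?I = "s ` {1..p + 1}" and ?g = "%I. ev v (G I)"
 let ?\<Phi> = "%c. ?g (?I - {s c}) * ((-1) ^ p * w (s c) (?I - {s c}))"
 have ivl: "{1..p + 1} - {p + 1} = {1..p}" by auto
 have "?g (s ` \<sigma> ` {1..p}) * (\<Prod>a\<in>{1..p}. \<Prod>b\<in>{1..1}. f (s (\<sigma> a)) (s (\<sigma> (p + b)))) = ?\<Phi> (\<sigma> (Suc p))"
  if p: "\<sigma> permutes {1..p + 1}" for \<sigma>
 proof -
  have inj: "inj_on (s \<circ> \<sigma>) {1..p + 1}"
   using s permutes_image[OF p] permutes_inj_on[OF p] by (auto intro!: comp_inj_on)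
  have im: "(s \<circ> \<sigma>) ` {1..p + 1} = ?I" unfolding image_comp[symmetric] permutes_image[OF p] ..
  have set: "(s \<circ> \<sigma>) ` {1..p} = ?I - {s (\<sigma> (p + 1))}"
   unfolding ivl[symmetric] using inj im by (subst inj_on_image_set_diff[OF inj]) auto
  have "(\<Prod>a\<in>{1..p}. f (s (\<sigma> a)) (s (\<sigma> (p + 1)))) = (\<Prod>i\<in>(s \<circ> \<sigma>) ` {1..p}. f i (s (\<sigma> (p + 1))))"
   by (subst prod.reindex[OF inj_on_subset[OF inj]]) auto
  also have "... = (\<Prod>i\<in>(s \<circ> \<sigma>) ` {1..p}. - 1 * f (s (\<sigma> (p + 1))) i)"
   by (intro prod.cong refl) (subst f_antisym, simp)
  also have "... = (-1) ^ p * w (s (\<sigma> (p + 1))) (?I - {s (\<sigma> (p + 1))})"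
   unfolding prod.distrib prod_constant w_def set[symmetric] by (subst card_image[OF inj_on_subset[OF inj]]) auto
  finally show ?thesis using set by (simp add: image_comp Suc_eq_plus1)
 qed
 hence "(\<Sum>\<sigma> | \<sigma> permutes {1..p + 1}. ?g (s ` \<sigma> ` {1..p}) *
   (\<Prod>a\<in>{1..p}. \<Prod>b\<in>{1..1}. f (s (\<sigma> a)) (s (\<sigma> (p + b))))) =
   (\<Sum>\<sigma> | \<sigma> permutes {1..p + 1}. ?\<Phi> (\<sigma> (Suc p)))"
  by (intro sum.cong refl) (simp only: mem_Collect_eq)
 also have "... = fact p * (\<Sum>c\<in>{1..p + 1}. ?\<Phi> c)"
  using sum_perm1[of ?\<Phi> p] by (simp only: Suc_eq_plus1)
 also have "(\<Sum>c\<in>{1..p + 1}. ?\<Phi> c) = (\<Sum>b\<in>?I. ?g (?I - {b}) * ((-1) ^ p * w b (?I - {b})))"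
  by (rule sum.reindex[OF s(1), symmetric, unfolded comp_def])
 also have "... = (-1) ^ p * E1 ?g ?I" unfolding E1_alt[OF s(2)] sum_distrib_left by (simp only: mult_ac)
 finally show ?thesis unfolding ev_wedge[OF P Q v s] by simp
qed

text \<open>Two indices are removed, so the signs (-1)^p cancel; the sum over ordered pairs is twice
  \<open>E2\<close>, which absorbs the 1 / 2! in \<open>wedge\<close>.\<close>

lemma ev_wedge2:
 assumes P: "corr n p P G" and Q: "corrc n 2 Q k" and v: "gen n v"
  and s: "inj_on s {1..p + 2}" "s ` {1..p + 2} \<subseteq> {1..n}"
 shows "ev (sX s v) (wedge p 2 P Q) = k * den n (p + 2) s v *
  generic_point.E2 {1..n} (pt v) (%I. ev v (G I)) (s ` {1..p + 2})"
proof -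
 interpret generic_point "{1..n}" "pt v" using gen_point v .
 let ?I = "s ` {1..p + 2}" and ?g = "%I. ev v (G I)"
 let ?\<Psi> = "%t u. w t (?I - {t, u}) * w u (?I - {t, u}) * ?g (?I - {t, u})"
 have ivl: "{1..p + 2} - {p + 2, p + 1} = {1..p}" by auto
 have B: "{1..2::nat} = {1, 2}" by auto
 have "?g (s ` \<sigma> ` {1..p}) * (\<Prod>a\<in>{1..p}. \<Prod>b\<in>{1..2}. f (s (\<sigma> a)) (s (\<sigma> (p + b)))) =
   ?\<Psi> (s (\<sigma> (p + 2))) (s (\<sigma> (p + 1)))"
  if p: "\<sigma> permutes {1..p + 2}" for \<sigma>
 proof -
  have inj: "inj_on (s \<circ> \<sigma>) {1..p + 2}"
   using s permutes_image[OF p] permutes_inj_on[OF p] by (auto intro!: comp_inj_on)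
  have im: "(s \<circ> \<sigma>) ` {1..p + 2} = ?I" unfolding image_comp[symmetric] permutes_image[OF p] ..
  let ?t = "s (\<sigma> (p + 2))" and ?u = "s (\<sigma> (p + 1))"
  have set: "(s \<circ> \<sigma>) ` {1..p} = ?I - {?t, ?u}"
   unfolding ivl[symmetric] using inj im by (subst inj_on_image_set_diff[OF inj]) auto
  have sgn: "(\<Prod>a\<in>{1..p}. f (s (\<sigma> a)) r) = (-1) ^ p * w r (?I - {?t, ?u})" for r
  proof -
   have "(\<Prod>a\<in>{1..p}. f (s (\<sigma> a)) r) = (\<Prod>i\<in>(s \<circ> \<sigma>) ` {1..p}. f i r)"
    by (subst prod.reindex[OF inj_on_subset[OF inj]]) auto
   also have "... = (\<Prod>i\<in>(s \<circ> \<sigma>) ` {1..p}. - 1 * f r i)"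
    by (intro prod.cong refl) (subst f_antisym, simp)
   also have "... = (-1) ^ p * w r (?I - {?t, ?u})" unfolding prod.distrib prod_constant w_def set[symmetric]
    by (subst card_image[OF inj_on_subset[OF inj]]) auto
   finally show ?thesis .
  qed
  have "(\<Prod>a\<in>{1..p}. \<Prod>b\<in>{1..2}. f (s (\<sigma> a)) (s (\<sigma> (p + b)))) =
    (\<Prod>a\<in>{1..p}. f (s (\<sigma> a)) ?u) * (\<Prod>a\<in>{1..p}. f (s (\<sigma> a)) ?t)"
   unfolding B prod.distrib[symmetric] by simp
  also have "... = ((-1) ^ p * (-1) ^ p) * (w ?t (?I - {?t, ?u}) * w ?u (?I - {?t, ?u}))"
   unfolding sgn by (simp only: mult_ac)
  also have "(-1) ^ p * (-1) ^ p = (1::complex)" by (simp add: power_add[symmetric])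
  finally show ?thesis using set by (simp add: image_comp)
 qed
 hence "(\<Sum>\<sigma> | \<sigma> permutes {1..p + 2}. ?g (s ` \<sigma> ` {1..p}) *
   (\<Prod>a\<in>{1..p}. \<Prod>b\<in>{1..2}. f (s (\<sigma> a)) (s (\<sigma> (p + b))))) =
   (\<Sum>\<sigma> | \<sigma> permutes {1..p + 2}. ?\<Psi> (s (\<sigma> (p + 2))) (s (\<sigma> (p + 1))))"
  by (intro sum.cong refl) (simp only: mem_Collect_eq)
 also have "... = fact p * (\<Sum>c\<in>{1..p + 2}. \<Sum>d\<in>{1..p + 2} - {c}. ?\<Psi> (s c) (s d))"
  using sum_perm2[of "%d c. ?\<Psi> (s c) (s d)" p] by (simp add: numeral_2_eq_2 One_nat_def)
 also have "(\<Sum>c\<in>{1..p + 2}. \<Sum>d\<in>{1..p + 2} - {c}. ?\<Psi> (s c) (s d)) =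
   (\<Sum>c\<in>{1..p + 2}. \<Sum>u\<in>?I - {s c}. ?\<Psi> (s c) u)"
 proof (rule sum.cong[OF refl])
  fix c assume c: "c \<in> {1..p + 2}"
  have "?I - {s c} = s ` ({1..p + 2} - {c})" using c by (subst inj_on_image_set_diff[OF s(1)]) auto
  thus "(\<Sum>d\<in>{1..p + 2} - {c}. ?\<Psi> (s c) (s d)) = (\<Sum>u\<in>?I - {s c}. ?\<Psi> (s c) u)"
   using sum.reindex[OF inj_on_subset[OF s(1), of "{1..p + 2} - {c}"], of "?\<Psi> (s c)"] by simp
 qed
 also have "... = (\<Sum>t\<in>?I. \<Sum>u\<in>?I - {t}. ?\<Psi> t u)"
  by (rule sum.reindex[OF s(1), symmetric, unfolded comp_def])
 also have "... = 2 * E2 ?g ?I" unfolding E2_alt[OF s(2)] by simp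
 finally show ?thesis unfolding ev_wedge[OF P Q v s] by simp
qed

section \<open>The elements \<open>\<Xi>\<^sub>1\<close> and \<open>\<Xi>\<^sub>2\<close>\<close>

lemma degree_prod_1_linear: "degree (\<Prod>j\<in>S. [:1, c j:] :: complex poly) \<le> card S"
proof (cases "finite S")
 case True
 have "degree (\<Prod>j\<in>S. [:1, c j:]) \<le> (\<Sum>j\<in>S. degree [:1, c j:])"
  using degree_prod_sum_le[OF True, of "%j. [:1, c j:]"] by (simp add: comp_def)
 also have "... \<le> (\<Sum>j\<in>S. 1)" by (intro sum_mono) simp
 finally show ?thesis by simp
qed simp

lemma coeff_prod_1_linear:
 "finite S ==> poly.coeff (\<Prod>j\<in>S. [:1, c j:] :: complex poly) (card S) = (\<Prod>j\<in>S. c j)"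
proof (induction S rule: finite_induct)
 case (insert a S)
 thus ?case using degree_prod_1_linear[of c S] by (simp add: coeff_eq_0)
qed simp

lemma prod_neg: "(\<Prod>j\<in>S. - h j) = (-1) ^ card S * (\<Prod>j\<in>S. h j :: complex)"
 by (induction S rule: infinite_finite_induct) auto

lemma ev_Theta [simp]:
 "ev v (Theta_plus n Y) = (\<Prod>j\<in>{1..n}. 1 + ev v Y * v (Vx j))"
 "ev v (Theta_minus n Y) = (\<Prod>j\<in>{1..n}. 1 - ev v Y * v (Vx j))"
 by (simp_all add: Theta_plus_def Theta_minus_def)

lemma ev_neg1_power [simp]: "ev v ((-1) ^ k) = (-1) ^ k"
 by simp

lemma ev_Xi1: "ev v (Xi1 n) = ((\<Prod>j\<in>{1..n}. 1 + v (VX 1) * v (Vx j)) +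
  (-1) ^ (n + 1) * (\<Prod>j\<in>{1..n}. 1 - v (VX 1) * v (Vx j))) / 2" by (simp add: Xi1_def)

lemma Xi1_ext_power:
 assumes n: "0 < n"
 shows "Xi1 n \<in> ext_power n 1"
 unfolding ext_power_iff
proof (intro conjI allI impI ballI)
 fix w assume w: "w \<notin> evars n 1"
 hence w': "w ~= VX 1" "!!j. j \<in> {1..n} ==> w ~= Vx j" by (auto simp: evars_def)
 show "indep w (Xi1 n)" unfolding indep_def ev_Xi1
 proof (intro allI)
  fix v :: "var => complex" and t
  have 1: "(v(w := t)) (VX 1) = v (VX 1)" using w' by simp
  have 2: "(\<Prod>j\<in>{1..n}. h ((v(w := t)) (Vx j))) = (\<Prod>j\<in>{1..n}. h (v (Vx j)))" for h :: "complex => complex"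
   by (intro prod.cong refl arg_cong[of _ _ h]) (use w'(2) in auto)
  show "((\<Prod>j\<in>{1..n}. 1 + (v(w := t)) (VX 1) * (v(w := t)) (Vx j)) +
   (-1) ^ (n + 1) * (\<Prod>j\<in>{1..n}. 1 - (v(w := t)) (VX 1) * (v(w := t)) (Vx j))) / 2 =
   ((\<Prod>j\<in>{1..n}. 1 + v (VX 1) * v (Vx j)) + (-1) ^ (n + 1) * (\<Prod>j\<in>{1..n}. 1 - v (VX 1) * v (Vx j))) / 2"
   unfolding 1 2[of "%z. 1 + v (VX 1) * z"] 2[of "%z. 1 - v (VX 1) * z"] ..
 qed
next
 fix a :: nat assume "a \<in> {1..1}"
 hence a: "a = 1" by simp
 show "degX n (VX a) (Xi1 n)" unfolding a degX_iff[OF n]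
 proof
  fix v :: "var => complex"
  define q where "q = Polynomial.smult (1/2) ((\<Prod>j\<in>{1..n}. [:1, v (Vx j):]) +
    Polynomial.smult ((-1) ^ (n + 1)) (\<Prod>j\<in>{1..n}. [:1, - v (Vx j):]))"
  have neg: "(\<Prod>j\<in>{1..n}. - v (Vx j)) = (-1) ^ n * (\<Prod>j\<in>{1..n}. v (Vx j))" by (simp add: prod_neg)
  have "degree q \<le> n" unfolding q_def
   using degree_prod_1_linear[of "%j. v (Vx j)" "{1..n}"] degree_prod_1_linear[of "%j. - v (Vx j)" "{1..n}"]
   by (intro order.trans[OF degree_smult_le] degree_add_le) simp_all
  \<comment> \<open>The sign of Theta_minus in Xi1 is the one that cancels the terms of degree
    n.\<close>
  moreover have "poly.coeff q n = 0" unfolding q_def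
   using coeff_prod_1_linear[of "{1..n}" "%j. v (Vx j)"] coeff_prod_1_linear[of "{1..n}" "%j. - v (Vx j)"]
   by (simp add: neg power_add[symmetric] mult.assoc[symmetric])
  ultimately have "degree q < n" using eq_zero_or_degree_less[of q n] n by auto
  moreover have "ev (v(VX 1 := t)) (Xi1 n) = poly q t" for t by (simp add: ev_Xi1 q_def poly_prod mult.commute)
  ultimately show "\<exists>q. degree q < n \<and> (\<forall>t. ev (v(VX 1 := t)) (Xi1 n) = poly q t)" by blast
 qed
next
 fix \<pi> assume p: "\<pi> permutes {1..n}"
 have r: "(\<Prod>j\<in>{1..n}. h (\<pi> j)) = (\<Prod>j\<in>{1..n}. h j)" for h :: "nat => complex"
  using prod.permute[OF p, of h] by (simp add: comp_def)
 show "rename_x \<pi> (Xi1 n) = Xi1 n" by (rule ev_eqI)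
   (simp add: ev_Xi1 r[of "%j. 1 + _ * _ (Vx j)"] r[of "%j. 1 - _ * _ (Vx j)"])
next
 fix \<sigma> :: "nat => nat" assume "\<sigma> permutes {1..1}"
 hence id: "\<sigma> = id" by (simp add: permutes_sing)
 show "rename_X \<sigma> (Xi1 n) = of_int (sign \<sigma>) * Xi1 n"
  unfolding id by (rule ev_eqI) (simp add: ev_Xi1 sign_id)
qed

text \<open>The factor with j = i equals 2 in the first product and 0 in the second.\<close>

lemma Theta_at_inverse:
 fixes v :: "var => complex"
 assumes x: "v (Vx i) ~= 0" and i: "i \<in> {1..n}"
 shows "(\<Prod>j\<in>{1..n}. 1 + inverse (v (Vx i)) * v (Vx j)) =
   2 * inverse (v (Vx i)) ^ (n - 1) * (\<Prod>j\<in>{1..n} - {i}. v (Vx i) + v (Vx j))"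
  and "(\<Prod>j\<in>{1..n}. 1 - inverse (v (Vx i)) * v (Vx j)) = 0"
proof -
 show "(\<Prod>j\<in>{1..n}. 1 - inverse (v (Vx i)) * v (Vx j)) = 0" using i x by (intro prod_zero bexI[of _ i]) auto
 have "(\<Prod>j\<in>{1..n}. 1 + inverse (v (Vx i)) * v (Vx j)) =
   2 * (\<Prod>j\<in>{1..n} - {i}. 1 + inverse (v (Vx i)) * v (Vx j))" using i x by (subst prod.remove[of _ i]) auto
 also have "(\<Prod>j\<in>{1..n} - {i}. 1 + inverse (v (Vx i)) * v (Vx j)) =
   (\<Prod>j\<in>{1..n} - {i}. inverse (v (Vx i)) * (v (Vx i) + v (Vx j)))"
  using x by (intro prod.cong refl) (simp add: distrib_left)
 also have "... = inverse (v (Vx i)) ^ (n - 1) * (\<Prod>j\<in>{1..n} - {i}. v (Vx i) + v (Vx j))"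
  unfolding prod.distrib prod_constant using i by simp
 finally show "(\<Prod>j\<in>{1..n}. 1 + inverse (v (Vx i)) * v (Vx j)) =
   2 * inverse (v (Vx i)) ^ (n - 1) * (\<Prod>j\<in>{1..n} - {i}. v (Vx i) + v (Vx j))" by (simp add: mult.assoc)
qed

text \<open>Only Theta_plus survives at 1 / x_i; its factor 2 cancels the 1 / 2 in Xi1, and what
  remains is \<open>den n 1\<close>.\<close>

lemma Xi1_corrc: "corrc n 1 (Xi1 n) 1"
 unfolding corrc_def
proof (intro allI impI)
 fix v s assume v: "gen n v" and s: "inj_on s {1..1::nat}" "s ` {1..1} \<subseteq> {1..n}"
 have i: "s 1 \<in> {1..n}" using s by auto
 have V: "vdm {1..1} (z :: nat => complex) = 1" for z unfolding vdm_def by (rule prod.neutral) auto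
 have "ev (sX s v) (Xi1 n) = inverse (v (Vx (s 1))) ^ (n - 1) * (\<Prod>j\<in>{1..n} - {s 1}. v (Vx (s 1)) + v (Vx j))"
  using Theta_at_inverse[of v "s 1" n, OF gen_nonzero[OF v] i] by (simp add: ev_Xi1)
 also have "... = den n 1 s v" unfolding den_def V by simp
 finally show "ev (sX s v) (Xi1 n) = 1 * den n 1 s v" by simp
qed

text \<open>Kept multiplied by X_1 + X_2, since Xi2 contains an exact quotient;
  \<open>Xi2_eqI\<close> later excludes the zeros of that factor.\<close>

lemma ev_Xi2:
 "(v (VX 1) + v (VX 2)) * 2 * ev v (Xi2 n) =
  ((\<Prod>j\<in>{1..n}. 1 + v (VX 1) * v (Vx j)) * (\<Prod>j\<in>{1..n}. 1 + v (VX 2) * v (Vx j)) -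
   (\<Prod>j\<in>{1..n}. 1 - v (VX 1) * v (Vx j)) * (\<Prod>j\<in>{1..n}. 1 - v (VX 2) * v (Vx j))) * (v (VX 1) - v (VX 2)) +
  (v (VX 1) + v (VX 2)) * ((-1) ^ n *
   ((\<Prod>j\<in>{1..n}. 1 + v (VX 1) * v (Vx j)) * (\<Prod>j\<in>{1..n}. 1 - v (VX 2) * v (Vx j)) -
   (\<Prod>j\<in>{1..n}. 1 + v (VX 2) * v (Vx j)) * (\<Prod>j\<in>{1..n}. 1 - v (VX 1) * v (Vx j))))"
 using arg_cong[OF Xi2_spec[of n], of "ev v"]
 by (simp add: mult.assoc del: distrib_right_numeral distrib_left_numeral)

lemma cancel2: "(a::complex) ~= 0 ==> a * 2 * x = a * 2 * y ==> x = y"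
 by simp

lemma Xi2_eqI:
 assumes "!!v. v (VX 1) + v (VX 2) ~= 0 ==> ev v P = ev v Q"
 shows "P = Q"
 by (rule ev_eqI_dense[OF Var_sum_nonzero]) (use assms in simp)

lemma Xi2_swap:
 "ev (rX (transpose 1 2) v) (Xi2 n) = - ev v (Xi2 n)"
proof -
 have "rename_X (transpose 1 2) (Xi2 n) = - Xi2 n"
 proof (rule Xi2_eqI)
  fix v :: "var => complex" assume nz: "v (VX 1) + v (VX 2) ~= 0"
  have alg: "(P2 * P1 - M2 * M1) * (x2 - x1) + (x2 + x1) * (r * (P2 * M1 - P1 * M2)) =
   - ((P1 * P2 - M1 * M2) * (x1 - x2) + (x1 + x2) * (r * (P1 * M2 - P2 * M1)))"
   for P1 P2 M1 M2 x1 x2 r :: complex by (simp add: algebra_simps)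
  have t: "transpose 1 2 1 = (2::nat)" "transpose 1 2 2 = (1::nat)" by simp_all
  have "(v (VX 2) + v (VX 1)) * 2 * ev (rX (transpose 1 2) v) (Xi2 n) =
   - ((v (VX 1) + v (VX 2)) * 2 * ev v (Xi2 n))"
   unfolding ev_Xi2[of v n] by (rule trans[OF ev_Xi2[of "rX (transpose 1 2) v" n, unfolded rX_simps t] alg])
  hence "(v (VX 1) + v (VX 2)) * 2 * ev (rX (transpose 1 2) v) (Xi2 n) =
   - ((v (VX 1) + v (VX 2)) * 2 * ev v (Xi2 n))" by (simp only: add.commute)
  also have "... = (v (VX 1) + v (VX 2)) * 2 * (- ev v (Xi2 n))" by simp
  finally have "ev (rX (transpose 1 2) v) (Xi2 n) = - ev v (Xi2 n)" by (rule cancel2[OF nz])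
  thus "ev v (rename_X (transpose 1 2) (Xi2 n)) = ev v (- Xi2 n)" by simp
 qed
 thus ?thesis using ev_rename_X_rX[of v "transpose 1 2" "Xi2 n"] by simp
qed

text \<open>In X_1 the equation reads 2 (X_1 + X_2) Xi2 = C (X_1 - X_2) + D (X_1 + X_2) with C and D
  of degree at most n. Their coefficients at n cancel in C + D, so the right side, X_1 (C + D) + X_2
  (D - C), has degree at most n.\<close>

lemma Xi2_degX1:
 assumes n: "0 < n"
 shows "degX n (VX 1) (Xi2 n)"
 unfolding degX_iff[OF n]
proof
 fix v :: "var => complex"
 define X2 where "X2 = v (VX 2)"
 define q where "q = uni v (VX 1) (Xi2 n)"
 define A where "A = (\<Prod>j\<in>{1..n}. [:1, v (Vx j):])"
 define B where "B = (\<Prod>j\<in>{1..n}. [:1, - v (Vx j):])"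
 define a where "a = (\<Prod>j\<in>{1..n}. 1 + X2 * v (Vx j))"
 define b where "b = (\<Prod>j\<in>{1..n}. 1 - X2 * v (Vx j))"
 define e where "e = (\<Prod>j\<in>{1..n}. v (Vx j))"
 have neg: "(\<Prod>j\<in>{1..n}. - v (Vx j)) = (-1) ^ n * e" by (simp add: e_def prod_neg)
 have AB: "degree A \<le> n" "degree B \<le> n" "poly.coeff A n = e" "poly.coeff B n = (-1) ^ n * e"
  unfolding A_def B_def e_def neg[unfolded e_def, symmetric]
  using degree_prod_1_linear[of _ "{1..n}"] coeff_prod_1_linear[of "{1..n}"] by fastforce+
 define C where "C = Polynomial.smult a A - Polynomial.smult b B"
 define D where "D = Polynomial.smult ((-1) ^ n) (Polynomial.smult b A - Polynomial.smult a B)"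
 have CD: "degree (C + D) \<le> n" "poly.coeff (C + D) n = 0"
 proof -
  show "degree (C + D) \<le> n" unfolding C_def D_def
   using AB by (intro degree_add_le degree_diff_le order.trans[OF degree_smult_le]) auto
  have "(-1) ^ n * (-1) ^ n = (1::complex)" by (simp add: power_add[symmetric])
  thus "poly.coeff (C + D) n = 0" by (simp add: C_def D_def AB algebra_simps)
 qed
 have eq: "Polynomial.smult 2 ([:X2, 1:] * q) = C * [:- X2, 1:] + [:X2, 1:] * D"
 proof -
  have "poly (Polynomial.smult 2 ([:X2, 1:] * q)) t = poly (C * [:- X2, 1:] + [:X2, 1:] * D) t" for t
  proof -
   define Q where "Q = ev (v(VX 1 := t)) (Xi2 n)"
   have pA: "poly A t = (\<Prod>j\<in>{1..n}. 1 + t * v (Vx j))" and pB: "poly B t = (\<Prod>j\<in>{1..n}. 1 - t * v (Vx j))"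
    by (simp_all add: A_def B_def poly_prod)
   have "poly (Polynomial.smult 2 ([:X2, 1:] * q)) t = 2 * ((X2 + t) * Q)"
    unfolding poly_smult poly_mult q_def poly_uni Q_def by simp
   also have "... = (t + X2) * 2 * Q" by (simp only: mult_ac add.commute)
   also have "... = (poly A t * a - poly B t * b) * (t - X2) + (t + X2) * ((-1) ^ n * (poly A t * b - a * poly B t))"
    using ev_Xi2[of "v(VX 1 := t)" n] unfolding pA pB a_def b_def Q_def X2_def
    by (simp del: distrib_right_numeral distrib_left_numeral)
   also have "... = poly (C * [:- X2, 1:] + [:X2, 1:] * D) t" by (simp add: C_def D_def algebra_simps)
   finally show ?thesis .
  qed
  thus ?thesis by (simp add: poly_eq_poly_eq_iff[symmetric] fun_eq_iff)
 qed
 have "degree q < n"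
 proof (cases "q = 0")
  case False
  have "C * [:- X2, 1:] + [:X2, 1:] * D = pCons 0 (C + D) + Polynomial.smult X2 (D - C)"
   by (simp add: algebra_simps smult_diff_right smult_add_right)
  moreover have "degree (pCons 0 (C + D)) \<le> n"
   using CD eq_zero_or_degree_less[of "C + D" n] n by (auto simp: degree_pCons_eq_if)
  moreover have "degree (Polynomial.smult X2 (D - C)) \<le> n" unfolding C_def D_def using AB
   by (intro degree_diff_le order.trans[OF degree_smult_le]) auto
  ultimately have "degree (Polynomial.smult 2 ([:X2, 1:] * q)) \<le> n" unfolding eq by (simp only: degree_add_le)
  thus ?thesis using False by (simp add: degree_mult_eq del: mult_pCons_left)
 qed (simp add: n)
 thus "\<exists>q. degree q < n \<and> (\<forall>t. ev (v(VX 1 := t)) (Xi2 n) = poly q t)"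
  using poly_uni[of v "VX 1" "Xi2 n"] unfolding q_def by metis
qed

lemma Xi2_ext_power:
 assumes n: "0 < n"
 shows "Xi2 n \<in> ext_power n 2"
 unfolding ext_power_iff
proof (intro conjI allI impI ballI)
 fix w assume w: "w \<notin> evars n 2"
 hence w': "w ~= VX 1" "w ~= VX 2" "!!j. j \<in> {1..n} ==> w ~= Vx j" by (auto simp: evars_def)
 have T: "indep w (Theta_plus n Y)" "indep w (Theta_minus n Y)" if "indep w Y" for Y
 proof -
  have V: "indep w (Var (Vx j))" if "j \<in> {1..n}" for j using w'(3)[OF that] by simp
  show "indep w (Theta_plus n Y)" "indep w (Theta_minus n Y)"
   unfolding Theta_plus_def Theta_minus_def by (intro indep_simps that V, assumption)+
 qed
 have X: "indep w (Var (VX 1))" "indep w (Var (VX 2))" using w'(1,2) by simp_all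
 have "indep w ((Var (VX 1) + Var (VX 2)) * (2 * Xi2 n))" unfolding Xi2_spec by (intro indep_simps X T)
 hence "indep w (2 * Xi2 n)" by (rule indep_cancel[OF indep_simps(1)[OF X] Var_sum_nonzero])
 thus "indep w (Xi2 n)" by (simp add: indep_def)
next
 fix a :: nat assume "a \<in> {1..2}"
 then consider "a = 1" | "a = 2" by force
 thus "degX n (VX a) (Xi2 n)"
 proof cases
  case 1
  thus ?thesis using Xi2_degX1[OF n] by simp
 next
  case 2
  show ?thesis unfolding 2 degX_iff[OF n]
  proof
   fix v
   obtain q where q: "degree q < n" "!!t. ev ((rX (transpose 1 2) v)(VX 1 := t)) (Xi2 n) = poly q t"
    using Xi2_degX1[OF n] unfolding degX_iff[OF n] by blast
   have "ev (v(VX 2 := t)) (Xi2 n) = poly (- q) t" for t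
   proof -
    have "rX (transpose 1 2) (v(VX 2 := t)) = (rX (transpose 1 2) v)(VX 1 := t)"
     by (rule var_fun_eqI) (auto simp: transpose_def)
    thus ?thesis using Xi2_swap[of "v(VX 2 := t)" n] q(2)[of t] by simp
   qed
   thus "\<exists>q. degree q < n \<and> (\<forall>t. ev (v(VX 2 := t)) (Xi2 n) = poly q t)"
    using q(1) by (intro exI[of _ "- q"]) simp
  qed
 qed
next
 fix \<pi> assume p: "\<pi> permutes {1..n}"
 have r: "(\<Prod>j\<in>{1..n}. h (\<pi> j)) = (\<Prod>j\<in>{1..n}. h j)" for h :: "nat => complex"
  using prod.permute[OF p, of h] by (simp add: comp_def)
 show "rename_x \<pi> (Xi2 n) = Xi2 n"
 proof (rule Xi2_eqI)
  fix v :: "var => complex" assume nz: "v (VX 1) + v (VX 2) ~= 0"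
  have "(v (VX 1) + v (VX 2)) * 2 * ev (vp \<pi> v) (Xi2 n) = (v (VX 1) + v (VX 2)) * 2 * ev v (Xi2 n)"
   using ev_Xi2[of "vp \<pi> v" n] unfolding ev_Xi2[of v n]
   by (simp add: r[of "%j. 1 + _ * v (Vx j)"] r[of "%j. 1 - _ * v (Vx j)"])
  hence "ev (vp \<pi> v) (Xi2 n) = ev v (Xi2 n)" by (rule cancel2[OF nz])
  thus "ev v (rename_x \<pi> (Xi2 n)) = ev v (Xi2 n)" by simp
 qed
next
 fix \<sigma> :: "nat => nat" assume s: "\<sigma> permutes {1..2}"
 have "{1..2::nat} = {1, 2}" by auto
 hence "\<sigma> = id \<or> \<sigma> = transpose 1 2" using s by (simp add: permutes_doubleton_iff)
 thus "rename_X \<sigma> (Xi2 n) = of_int (sign \<sigma>) * Xi2 n"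
 proof
  assume id: "\<sigma> = id"
  have "rX id v = v" for v by (rule var_fun_eqI) simp_all
  thus ?thesis unfolding id by (intro ev_eqI) (simp add: sign_id)
 next
  assume t: "\<sigma> = transpose 1 2"
  show ?thesis unfolding t by (rule ev_eqI) (simp add: Xi2_swap sign_swap_id)
 qed
qed

text \<open>Both Theta_minus vanish at the nodes 1 / x and 1 / y. Division by their sum leaves 2 (x
  + y) (y - x) times the other factors of \<open>den\<close>, while \<open>den\<close> contains x^2
  - y^2; hence -2.\<close>

lemma Xi2_corrc: "corrc n 2 (Xi2 n) (-2)"
 unfolding corrc_def
proof (intro allI impI)
 fix v s assume v: "gen n v" and s: "inj_on s {1..2::nat}" "s ` {1..2} \<subseteq> {1..n}"
 interpret generic_point "{1..n}" "pt v" using gen_point v .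
 have iv: "{1..2::nat} = {1, 2}" by auto
 have i: "s 1 \<in> {1..n}" "s 2 \<in> {1..n}" "s 1 ~= s 2" using s by (auto simp: iv)
 define x where "x = v (Vx (s 1))"
 define y where "y = v (Vx (s 2))"
 have nz: "x ~= 0" "y ~= 0" "x + y ~= 0"
  using gen_nonzero[OF v] sum_nz[OF i] by (auto simp: x_def y_def)
 have V: "vdm {1..2} z = z 1 - z 2" for z :: "nat => complex"
 proof -
  have "{(a, b). a \<in> {1..2} \<and> b \<in> {1..2} \<and> a < (b::nat)} = {(1, 2)}" by auto
  thus ?thesis unfolding vdm_def by simp
 qed
 define Px where "Px = (\<Prod>j\<in>{1..n} - {s 1, s 2}. x + v (Vx j))"
 define Py where "Py = (\<Prod>j\<in>{1..n} - {s 1, s 2}. y + v (Vx j))"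
 have e1: "{1..n} - {s 1} = insert (s 2) ({1..n} - {s 1, s 2})" "{1..n} - {s 2} = insert (s 1) ({1..n} - {s 1, s 2})"
  using i by auto
 have Tx: "(\<Prod>j\<in>{1..n}. 1 + inverse x * v (Vx j)) = 2 * inverse x ^ (n - 1) * ((x + y) * Px)"
  using Theta_at_inverse(1)[of v "s 1" n] nz i unfolding x_def[symmetric] e1 by (simp add: Px_def y_def[symmetric])
 have Ty: "(\<Prod>j\<in>{1..n}. 1 + inverse y * v (Vx j)) = 2 * inverse y ^ (n - 1) * ((x + y) * Py)"
  using Theta_at_inverse(1)[of v "s 2" n] nz i unfolding y_def[symmetric] e1 by (simp add: Py_def x_def[symmetric] add.commute)
 have Zx: "(\<Prod>j\<in>{1..n}. 1 - inverse x * v (Vx j)) = 0" "(\<Prod>j\<in>{1..n}. 1 - inverse y * v (Vx j)) = 0"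
  using Theta_at_inverse(2)[of v "s 1" n] Theta_at_inverse(2)[of v "s 2" n] nz i by (auto simp: x_def y_def)
 have D: "den n 2 s v = inverse x ^ (n - 1) * inverse y ^ (n - 1) * (Px * Py) * (x\<^sup>2 - y\<^sup>2)"
  unfolding den_def V unfolding iv using i by (simp add: x_def y_def Px_def Py_def insert_commute)
 define c where "c = inverse x ^ (n - 1) * inverse y ^ (n - 1) * (Px * Py)"
 have "(inverse x + inverse y) * 2 * ev (sX s v) (Xi2 n) =
   (2 * inverse x ^ (n - 1) * ((x + y) * Px)) * (2 * inverse y ^ (n - 1) * ((x + y) * Py)) * (inverse x - inverse y)"
  using ev_Xi2[of "sX s v" n] unfolding sX_simps x_def[symmetric] y_def[symmetric] Zx Tx Ty by simp
 also have "... = 4 * c * (x + y) * ((x + y) * (inverse x - inverse y))" by (simp add: c_def mult_ac)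
 also have "(x + y) * (inverse x - inverse y) = (inverse x + inverse y) * (y - x)" using nz by (simp add: field_simps)
 also have "4 * c * (x + y) * ((inverse x + inverse y) * (y - x)) =
   (inverse x + inverse y) * 2 * (2 * c * (x + y) * (y - x))"
 proof -
  have "4 * c * r * (i * d) = i * 2 * (2 * c * r * d)" for r i d :: complex by simp
  thus ?thesis .
 qed
 finally have "(inverse x + inverse y) * 2 * ev (sX s v) (Xi2 n) = (inverse x + inverse y) * 2 * (2 * c * (x + y) * (y - x))" .
 moreover have "inverse x + inverse y ~= 0"
 proof -
  have "inverse x + inverse y = (x + y) * (inverse x * inverse y)" using nz by (simp add: field_simps)
  thus ?thesis using nz by simp
 qed
 ultimately have "ev (sX s v) (Xi2 n) = 2 * c * (x + y) * (y - x)" by (rule cancel2[rotated])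
 also have "... = -2 * den n 2 s v" unfolding D c_def[symmetric] by (simp add: power2_eq_square algebra_simps)
 finally show "ev (sX s v) (Xi2 n) = -2 * den n 2 s v" .
qed

section \<open>The grading\<close>

interpretation mp: vector_space "%c (P::mpoly). const c * P"
 by unfold_locales (simp_all only: distrib_left distrib_right const_add const_mult mult.assoc const_1 mult_1_left)

definition homd :: "int => mpoly => bool" where
 "homd d P \<longleftrightarrow> (\<forall>m\<in>pkeys P. deg1_monom m = d)"

definition hcomp :: "int => mpoly => mpoly" where
 "hcomp d P = (\<Sum>m | m \<in> pkeys P \<and> deg1_monom m = d. Poly_Mapping.single m (coef P m))"

lemma lookup_comp: "coef (hcomp d P) m = (if deg1_monom m = d then coef P m else 0)"
proof -
 have "coef (hcomp d P) m =
   (\<Sum>m' | m' \<in> pkeys P \<and> deg1_monom m' = d. if m' = m then coef P m' else 0)"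
  by (simp add: hcomp_def lookup_sum lookup_single when_def)
 also have "... = (if deg1_monom m = d then coef P m else 0)"
  using sum.delta[of "{m' \<in> pkeys P. deg1_monom m' = d}" m "coef P"]
  by (simp add: in_keys_iff)
 finally show ?thesis .
qed

lemma comp_add: "hcomp d (P + Q) = hcomp d P + hcomp d Q"
 by (rule poly_mapping_eqI) (simp add: lookup_comp lookup_add)

lemma comp_0 [simp]: "hcomp d 0 = 0"
 by (rule poly_mapping_eqI) (simp add: lookup_comp)

lemma comp_sum: "hcomp d (\<Sum>i\<in>I. F i) = (\<Sum>i\<in>I. hcomp d (F i))"
 by (induction I rule: infinite_finite_induct) (auto simp: comp_add)

lemma keys_comp: "pkeys (hcomp d P) \<subseteq> pkeys P"
 by (auto simp: in_keys_iff lookup_comp split: if_splits)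

lemma homd_comp: "homd d (hcomp d P)"
 by (auto simp: homd_def in_keys_iff lookup_comp split: if_splits)

lemma comp_homd: "homd e P ==> hcomp d P = (if d = e then P else 0)"
 by (rule poly_mapping_eqI) (auto simp: homd_def lookup_comp in_keys_iff)

lemma sum_comp: "P = (\<Sum>e\<in>deg1_monom ` pkeys P. hcomp e P)"
proof (rule poly_mapping_eqI)
 fix m
 have "(\<Sum>e\<in>deg1_monom ` pkeys P. coef (hcomp e P) m) =
   (\<Sum>e\<in>deg1_monom ` pkeys P. if deg1_monom m = e then coef P m else 0)"
  by (simp add: lookup_comp)
 also have "... = coef P m"
  using sum.delta'[of "deg1_monom ` pkeys P" "deg1_monom m" "%_. coef P m"]
  by (auto simp: in_keys_iff)
 finally show "coef P m = coef (\<Sum>e\<in>deg1_monom ` pkeys P. hcomp e P) m"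
  by (simp add: lookup_sum)
qed

lemma homd_0 [simp]: "homd d 0" by (simp add: homd_def)

lemma homd_add: "homd d P ==> homd d Q ==> homd d (P + Q)"
 unfolding homd_def using Poly_Mapping.keys_add by fastforce

lemma homd_sum: "(!!i. i \<in> I ==> homd d (F i)) ==> homd d (\<Sum>i\<in>I. F i)"
 by (induction I rule: infinite_finite_induct) (auto intro: homd_add)

text \<open>The torus action whose weights are given by \<open>deg1_monom\<close>: a homogeneous
  polynomial of degree d scales by c^d.\<close>

definition scl :: "complex => (var => complex) => var => complex" where
 "scl c v = (%w. case w of VX a => inverse c * v (VX a) | Vx j => c * v (Vx j))"

lemma scl_simps [simp]: "scl c v (VX a) = inverse c * v (VX a)" "scl c v (Vx j) = c * v (Vx j)"
 by (simp_all add: scl_def)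

lemma ppow_scl: "c ~= 0 ==> ppow (scl c v) m = c powi deg1_monom m * ppow v m"
proof -
 assume c: "c ~= 0"
 let ?e = "%w. (case w of VX _ => -1 | Vx _ => 1) * int (coef m w)"
 have "scl c v w ^ coef m w = c powi ?e w * v w ^ coef m w" for w
  by (cases w) (simp_all add: power_mult_distrib power_int_minus power_inverse)
 hence "ppow (scl c v) m = (\<Prod>w\<in>pkeys m. c powi ?e w) * ppow v m"
  by (simp add: ppow_def prod.distrib)
 also have "(\<Prod>w\<in>A. c powi ?e w) = c powi (\<Sum>w\<in>A. ?e w)" for A
  by (induction A rule: infinite_finite_induct) (auto simp: power_int_add c)
 finally show ?thesis by (simp add: deg1_monom_def)
qed

lemma homd_ev: "homd d P ==> c ~= 0 ==> ev (scl c v) P = c powi d * ev v P"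
 unfolding ev_def geval_def homd_def by (simp add: ppow_scl sum_distrib_left mult_ac)

lemma ev_scl: "c ~= 0 ==> ev (scl c v) P = (\<Sum>e\<in>deg1_monom ` pkeys P. c powi e * ev v (hcomp e P))"
proof -
 assume c: "c ~= 0"
 have "ev (scl c v) P = ev (scl c v) (\<Sum>e\<in>deg1_monom ` pkeys P. hcomp e P)"
  by (subst sum_comp[of P]) simp
 also have "... = (\<Sum>e\<in>deg1_monom ` pkeys P. c powi e * ev v (hcomp e P))"
  using homd_ev[OF homd_comp c] by simp
 finally show ?thesis .
qed

text \<open>Dedekind's argument in one variable: distinct integral powers are distinct
  characters.\<close>

lemma laurent_zero:
 assumes "finite E" and "!!c. c ~= 0 ==> (\<Sum>e\<in>E. c powi e * \<alpha> e) = (0 :: complex)"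
 shows "\<forall>e\<in>E. \<alpha> e = 0"
proof (rule characters_independent[OF assms(1), where \<chi> = "%e v. v () powi e"])
 fix m m' :: int assume "m ~= m'"
 thus "\<exists>v. (\<forall>w. v w ~= 0) \<and> (v () powi m :: complex) ~= v () powi m'"
  by (intro exI[of _ "%_. 2"]) (simp add: two_powi_inject)
qed (use assms(2) in \<open>auto simp: power_int_mult_distrib mult.commute\<close>)

lemma gen_scl: "gen n v ==> c ~= 0 ==> gen n (scl c v)"
 unfolding gen_def
proof (intro conjI allI ballI impI)
 fix w assume "(\<forall>w. v w ~= 0) \<and> (\<forall>a\<in>{1..n}. \<forall>b\<in>{1..n}. a ~= b --> v (Vx a) + v (Vx b) ~= 0 \<and> v (Vx a) ~= v (Vx b))" "c ~= 0"
 thus "scl c v w ~= 0" by (cases w) auto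
qed (auto simp: distrib_left[symmetric])

text \<open>Comparing coefficients of powers of c shows that every component of a degree other than
  \<open>d\<close> vanishes at all generic points.\<close>

lemma homdI:
 assumes "!!c v. c ~= 0 ==> gen n v ==> ev (scl c v) P = c powi d * ev v P"
 shows "homd d P"
proof -
 let ?E = "deg1_monom ` pkeys P"
 have z: "hcomp e P = 0" if e: "e ~= d" for e
 proof (cases "e \<in> ?E")
  case False
  thus ?thesis by (intro poly_mapping_eqI) (auto simp: lookup_comp in_keys_iff)
 next
  case True
  show ?thesis
  proof (rule ev_eqI_gen[of n])
   fix v assume v: "gen n v"
   let ?\<alpha> = "%e. ev v (hcomp e P) - (if e = d then ev v P else 0)"
   have nin: "ev v (hcomp d P) = 0" if "d \<notin> ?E"
   proof -
    have "hcomp d P = 0" using that by (intro poly_mapping_eqI) (auto simp: lookup_comp in_keys_iff)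
    thus ?thesis by simp
   qed
   have "\<forall>e\<in>insert d ?E. ?\<alpha> e = 0"
   proof (rule laurent_zero)
    fix c :: complex assume c: "c ~= 0"
    have "(\<Sum>e\<in>insert d ?E. c powi e * ev v (hcomp e P)) = (\<Sum>e\<in>?E. c powi e * ev v (hcomp e P))"
     using nin by (cases "d \<in> ?E") (simp_all add: insert_absorb)
    also have "... = c powi d * ev v P" using ev_scl[OF c, of v P] assms[OF c v] by simp
    also have "... = (\<Sum>e\<in>insert d ?E. c powi e * (if e = d then ev v P else 0))"
     by (subst sum.mono_neutral_right[of _ "{d}"]) auto
    finally show "(\<Sum>e\<in>insert d ?E. c powi e * ?\<alpha> e) = 0"
     by (simp only: right_diff_distrib sum_subtractf) simp
   qed simp
   thus "ev v (hcomp e P) = ev v 0" using True e by auto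
  qed
 qed
 have "P = (\<Sum>e\<in>?E. hcomp e P)" by (rule sum_comp)
 also have "homd d ..." by (rule homd_sum) (metis z homd_0 homd_comp)
 finally show ?thesis by simp
qed

lemma homd_mult: "homd d P ==> homd e Q ==> homd (d + e) (P * Q)"
 by (rule homdI[of 0]) (simp add: homd_ev power_int_add)

lemma homd_const [simp]: "homd 0 (const c)" and homd_1 [simp]: "homd 0 1" and homd_of_int [simp]: "homd 0 (of_int k)"
 and homd_Var_x [simp]: "homd 1 (Var (Vx j))"
 by (rule homdI[of 0], simp)+

lemma homd_cmult: "homd d P ==> homd d (const c * P)"
 using homd_mult[of 0 "const c" d P] by simp

lemma homd_power: "homd d P ==> homd (int k * d) (P ^ k)"
proof (induction k)
 case (Suc k)
 hence "homd (d + int k * d) (P * P ^ k)" by (intro homd_mult) auto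
 moreover have "d + int k * d = int (Suc k) * d" by (simp add: algebra_simps)
 ultimately show ?case by simp
qed simp

lemma homd_prod: "(!!i. i \<in> I ==> homd (d i) (F i)) ==> homd (\<Sum>i\<in>I. d i) (\<Prod>i\<in>I. F i)"
 by (induction I rule: infinite_finite_induct) (auto intro: homd_mult)

text \<open>Lets homogeneous components pass through renamings, scalar multiples and wedge products
  by one argument.\<close>

lemma comp_commute:
 fixes T :: "mpoly => mpoly"
 assumes add: "!!P Q. T (P + Q) = T P + T Q" and hom: "!!e P. homd e P ==> homd (e + k) (T P)"
 shows "hcomp (d + k) (T P) = T (hcomp d P)"
proof -
 let ?E = "deg1_monom ` pkeys P"
 have T0: "T 0 = 0" using add[of 0 0] by simp
 have Tsum: "T (\<Sum>e\<in>A. F e) = (\<Sum>e\<in>A. T (F e))" for F and A :: "int set"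
  by (induction A rule: infinite_finite_induct) (auto simp: T0 add)
 have nin: "hcomp d P = 0" if "d \<notin> ?E"
  using that by (intro poly_mapping_eqI) (auto simp: lookup_comp in_keys_iff)
 have "hcomp (d + k) (T P) = (\<Sum>e\<in>?E. hcomp (d + k) (T (hcomp e P)))"
  by (subst sum_comp[of P]) (simp add: Tsum comp_sum)
 also have "... = (\<Sum>e\<in>?E. if e = d then T (hcomp d P) else 0)"
  using comp_homd[OF hom[OF homd_comp]] by (intro sum.cong) auto
 also have "... = T (hcomp d P)" using nin T0 by (subst sum.delta) auto
 finally show ?thesis .
qed

lemma homd_rename_x: "homd d P ==> homd d (rename_x \<pi> P)"
proof (rule homdI[of 0])
 fix c v assume "homd d P" and c: "(c::complex) ~= 0"
 have "vp \<pi> (scl c v) = scl c (vp \<pi> v)" by (rule var_fun_eqI) simp_all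
 thus "ev (scl c v) (rename_x \<pi> P) = c powi d * ev v (rename_x \<pi> P)"
  using homd_ev[OF \<open>homd d P\<close> c] by simp
qed

lemma homd_rename_X: "homd d P ==> homd d (rename_X \<pi> P)"
proof (rule homdI[of 0])
 fix c v assume "homd d P" and c: "(c::complex) ~= 0"
 have "rX \<pi> (scl c v) = scl c (rX \<pi> v)" by (rule var_fun_eqI) simp_all
 thus "ev (scl c v) (rename_X \<pi> P) = c powi d * ev v (rename_X \<pi> P)"
  using homd_ev[OF \<open>homd d P\<close> c] by simp
qed

lemma rename_x_add: "rename_x \<pi> (P + Q) = rename_x \<pi> P + rename_x \<pi> Q"
 by (rule ev_eqI) simp

lemma rename_X_add: "rename_X \<pi> (P + Q) = rename_X \<pi> P + rename_X \<pi> Q"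
 by (rule ev_eqI) simp

lemma comp_rename_x: "hcomp d (rename_x \<pi> P) = rename_x \<pi> (hcomp d P)"
 using comp_commute[of "rename_x \<pi>" 0 d P] by (simp add: rename_x_add homd_rename_x)

lemma comp_rename_X: "hcomp d (rename_X \<pi> P) = rename_X \<pi> (hcomp d P)"
 using comp_commute[of "rename_X \<pi>" 0 d P] by (simp add: rename_X_add homd_rename_X)

lemma comp_of_int: "hcomp d (of_int k * P) = of_int k * hcomp d P"
 using comp_commute[of "%P. of_int k * P" 0 d P] homd_mult[of 0 "of_int k"] by (simp add: distrib_left)

text \<open>The vanishing condition is stable under scaling, because X_l and x scale inversely; the
  coefficients of the powers of c then vanish separately.\<close>

lemma comp_UU:
 assumes P: "P \<in> UU n l"
 shows "hcomp d P \<in> UU n l"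
proof -
 have E: "P \<in> ext_power n l" using P by (simp add: UU_iff)
 have pv: "poly_vars (hcomp d P) \<subseteq> poly_vars P" using keys_comp[of d P] by (auto simp: poly_vars_def)
 have "hcomp d P \<in> ext_power n l" unfolding ext_power_iff
 proof (intro conjI allI impI ballI)
  fix w assume "w \<notin> evars n l"
  hence "w \<notin> poly_vars P" using E by (simp add: ext_power_iff notin_poly_vars_iff)
  thus "indep w (hcomp d P)" using pv notin_poly_vars_iff by blast
 next
  fix a assume "a \<in> {1..l}"
  hence "degX n (VX a) P" using E by (simp add: ext_power_iff)
  thus "degX n (VX a) (hcomp d P)" using keys_comp[of d P] by (auto simp: degX_def)
 next
  fix \<pi> assume "\<pi> permutes {1..n}"
  hence "rename_x \<pi> P = P" using E by (simp add: ext_power_iff)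
  thus "rename_x \<pi> (hcomp d P) = hcomp d P" by (metis comp_rename_x)
 next
  fix \<sigma> assume "\<sigma> permutes {1..l}"
  hence "rename_X \<sigma> P = of_int (sign \<sigma>) * P" using E by (simp add: ext_power_iff)
  thus "rename_X \<sigma> (hcomp d P) = of_int (sign \<sigma>) * hcomp d P" by (metis comp_rename_X comp_of_int)
 qed
 moreover have "ev (spt s n l v) (hcomp d P) = 0"
  if l: "1 \<le> l" "2 \<le> n" and s: "s \<in> {1, -1}" and v: "!!w. v w ~= 0" for s v
 proof (cases "d \<in> deg1_monom ` pkeys P")
  case True
  have "\<forall>e\<in>deg1_monom ` pkeys P. ev (spt s n l v) (hcomp e P) = 0"
  proof (rule laurent_zero)
   fix c :: complex assume c: "c ~= 0"
   have "scl c (spt s n l v) = spt s n l (scl c v)" using l by (intro var_fun_eqI) (auto simp: spt_def)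
   moreover have "scl c v w ~= 0" for w using v c by (cases w) auto
   hence "ev (spt s n l (scl c v)) P = 0" using P l s by (auto simp: UU_iff)
   ultimately show "(\<Sum>e\<in>deg1_monom ` pkeys P. c powi e * ev (spt s n l v) (hcomp e P)) = 0"
    using ev_scl[OF c, of "spt s n l v" P] by simp
  qed simp
  thus ?thesis using True by blast
 next
  case False
  hence "hcomp d P = 0" by (intro poly_mapping_eqI) (auto simp: lookup_comp in_keys_iff)
  thus ?thesis by simp
 qed
 ultimately show ?thesis unfolding UU_iff by blast
qed

lemma vdm_scale: "vdm {1..l} (%a. c\<^sup>2 * z a) = c ^ (l * (l - 1)) * (vdm {1..l} z :: complex)"
proof (induction l)
 case 0
 show ?case by (simp add: vdm_def)
next
 case (Suc l)
 have "(\<Prod>a\<in>{1..l}. c\<^sup>2 * z a - c\<^sup>2 * z (Suc l)) = (\<Prod>a\<in>{1..l}. c\<^sup>2 * (z a - z (Suc l)))"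
  by (simp only: right_diff_distrib)
 also have "... = c ^ (2 * l) * (\<Prod>a\<in>{1..l}. z a - z (Suc l))"
  unfolding prod.distrib prod_constant by (simp add: power_mult)
 finally have "vdm {1..Suc l} (%a. c\<^sup>2 * z a) = c ^ (l * (l - 1) + 2 * l) * vdm {1..Suc l} z"
  unfolding vdm_Suc Suc.IH by (simp add: power_add mult_ac)
 also have "l * (l - 1) + 2 * l = Suc l * (Suc l - 1)" by (cases l) auto
 finally show ?case .
qed

text \<open>The exponents of c are - l (n - 1), l (n - l) and l (l - 1), with sum 0: passing to
  families does not shift the degree.\<close>

lemma den_scl:
 assumes c: "c ~= 0" and s: "inj_on s {1..l}" "s ` {1..l} \<subseteq> {1..n}"
 shows "den n l s (scl c v) = den n l s v"
proof -
 have "card (s ` {1..l}) \<le> card {1..n}" using s(2) by (intro card_mono) auto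
 hence l: "l \<le> n" using card_image[OF s(1)] by simp
 have cR: "card ({1..n} - s ` {1..l}) = n - l" using s card_image[OF s(1)] by (simp add: card_Diff_subset)
 have 1: "(\<Prod>a\<in>{1..l}. inverse (c * v (Vx (s a))) ^ (n - 1)) =
   inverse c ^ (l * (n - 1)) * (\<Prod>a\<in>{1..l}. inverse (v (Vx (s a))) ^ (n - 1))"
  by (simp add: power_mult_distrib prod.distrib mult.commute[of l] power_mult)
 have 2: "(\<Prod>a\<in>{1..l}. \<Prod>j\<in>{1..n} - s ` {1..l}. c * v (Vx (s a)) + c * v (Vx j)) =
   c ^ (l * (n - l)) * (\<Prod>a\<in>{1..l}. \<Prod>j\<in>{1..n} - s ` {1..l}. v (Vx (s a)) + v (Vx j))"
  unfolding distrib_left[symmetric] prod.distrib prod_constant cR by (simp add: mult.commute[of l] power_mult)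
 have 3: "vdm {1..l} (%a. (c * v (Vx (s a)))\<^sup>2) = c ^ (l * (l - 1)) * vdm {1..l} (%a. (v (Vx (s a)))\<^sup>2)"
  using vdm_scale[of l c "%a. (v (Vx (s a)))\<^sup>2"] by (simp add: power_mult_distrib)
 have "l * (n - l) + l * (l - 1) = l * (n - 1)"
  using l by (simp only: add_mult_distrib2[symmetric]) (cases l; simp add: One_nat_def)
 hence "inverse c ^ (l * (n - 1)) * (c ^ (l * (n - l)) * c ^ (l * (l - 1))) = 1"
  using c by (simp add: power_add[symmetric] power_inverse)
 hence e: "inverse c ^ (l * (n - 1)) * c ^ (l * (n - l)) * c ^ (l * (l - 1)) = 1" by (simp only: mult.assoc)
 have alg: "(i * A) * (j * B) * (k * C) = (i * j * k) * (A * B * C)" for i j k A B C :: complex by (simp only: mult_ac)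
 show ?thesis unfolding den_def scl_simps 1 2 3 by (subst alg) (simp add: e)
qed

lemma corr_homd:
 assumes c: "corr n l P G" and G: "Fam n l G" and P: "homd d P"
 shows "homd d (G I)"
proof (cases "I \<subseteq> {1..n} \<and> card I = l")
 case True
 hence "finite I" using finite_subset[of I "{1..n}"] by simp
 then obtain s where s: "bij_betw s {1..l} I" using finite_same_card_bij[of "{1..l}" I] True by auto
 hence s': "inj_on s {1..l}" "s ` {1..l} = I" by (auto simp: bij_betw_def)
 have s2: "s ` {1..l} \<subseteq> {1..n}" using s' True by simp
 show ?thesis
 proof (rule homdI)
  fix k :: complex and v assume k: "k ~= 0" and v: "gen n v"
  have sc: "sX s (scl k v) = scl k (sX s v)" by (rule var_fun_eqI) (simp_all add: mult.commute)
  let ?D = "den n l s v"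
  have "ev (scl k v) (G I) * ?D = ev (sX s (scl k v)) P"
   using corrD[OF c gen_scl[OF v k] s'(1) s2] unfolding den_scl[OF k s'(1) s2] s'(2) by (rule sym)
  also have "... = k powi d * ev (sX s v) P" unfolding sc using P k by (rule homd_ev)
  also have "ev (sX s v) P = ev v (G I) * ?D" using corrD[OF c v s'(1) s2] unfolding s'(2) .
  finally have "ev (scl k v) (G I) * ?D = (k powi d * ev v (G I)) * ?D" by (rule trans) (rule mult.assoc[symmetric])
  thus "ev (scl k v) (G I) = k powi d * ev v (G I)" by (rule mult_right_cancel[OF den_nz[OF v s'(1) s2], THEN iffD1])
 qed
qed (simp add: FamD(1)[OF G])

section \<open>Elementary symmetric polynomials\<close>

definition es :: "nat set => nat => (nat => complex) => complex" where
 "es S k x = poly.coeff (\<Prod>j\<in>S. [:1, x j:]) k"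

definition esym :: "nat set => nat => mpoly" where
 "esym S k = poly.coeff (\<Prod>j\<in>S. [:1, Var (Vx j):]) k"

lemma coeff_one: "poly.coeff 1 k = (if k = 0 then 1 else 0)"
 by (simp add: one_pCons coeff_pCons split: nat.split)

lemma es_insert: "finite S ==> s \<notin> S ==> es (insert s S) (Suc k) x = es S (Suc k) x + x s * es S k x"
 by (simp add: es_def)

lemma esym_insert: "finite S ==> s \<notin> S ==> esym (insert s S) (Suc k) = esym S (Suc k) + Var (Vx s) * esym S k"
 by (simp add: esym_def)

lemma es_0 [simp]: "es S 0 x = 1"
 by (induction S rule: infinite_finite_induct) (auto simp: es_def)

lemma esym_0 [simp]: "esym S 0 = 1"
 by (induction S rule: infinite_finite_induct) (auto simp: esym_def)

lemma ev_esym: "finite S ==> ev v (esym S k) = es S k (pt v)"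
proof (induction S arbitrary: k rule: finite_induct)
 case empty
 show ?case by (simp add: es_def esym_def coeff_one)
next
 case (insert s S)
 thus ?case by (cases k) (simp_all add: es_insert esym_insert)
qed

lemma es_permutes: "\<pi> permutes S ==> es S k (x \<circ> \<pi>) = es S k x"
 unfolding es_def using prod.permute[of \<pi> S "%j. [:1, x j:]"] by (simp add: comp_def)

lemma es_cong: "(!!j. j \<in> S ==> x j = y j) ==> es S k x = es S k y"
 unfolding es_def by (intro arg_cong[of _ _ "%p. poly.coeff p k"] prod.cong) auto

lemma es_image: "inj_on \<pi> S ==> es (\<pi> ` S) k x = es S k (x \<circ> \<pi>)"
 unfolding es_def by (subst prod.reindex) (auto simp: comp_def)

lemma es_uminus: "finite S ==> es S k (%j. - x j) = (-1) ^ k * es S k x"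
proof (induction S arbitrary: k rule: finite_induct)
 case empty
 show ?case by (cases k) (simp_all add: es_def coeff_one)
next
 case (insert s S)
 thus ?case by (cases k) (simp_all add: es_insert algebra_simps)
qed

lemma es_eq_0: "card S < k ==> es S k x = 0"
 unfolding es_def using degree_prod_1_linear[of x S] by (intro coeff_eq_0) simp

lemma xpoly_esym [simp]: "S \<subseteq> {1..n} ==> xpoly n (esym S k)"
proof -
 assume S: "S \<subseteq> {1..n}"
 hence "finite S" using finite_subset by blast
 thus ?thesis using S
 proof (induction S arbitrary: k rule: finite_induct)
  case empty
  show ?case by (simp add: esym_def coeff_one)
 next
  case (insert s S)
  thus ?case by (cases k) (simp_all add: esym_insert)
 qed
qed

lemma homd_esym: "finite S ==> homd (int k) (esym S k)"
proof (induction S arbitrary: k rule: finite_induct)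
 case empty
 show ?case by (cases k) (simp_all add: esym_def coeff_one)
next
 case (insert s S)
 show ?case
 proof (cases k)
  case (Suc j)
  have "homd (1 + int j) (Var (Vx s) * esym S j)" by (intro homd_mult homd_Var_x insert.IH)
  thus ?thesis using insert Suc insert.IH[of k] by (auto simp: esym_insert intro!: homd_add)
 qed simp
qed

lemma rename_x_esym: "finite S ==> inj \<pi> ==> rename_x \<pi> (esym S k) = esym (\<pi> ` S) k"
 by (rule ev_eqI) (simp add: ev_esym es_image[unfolded o_def] inj_on_subset[of \<pi> UNIV])

text \<open>The generating function of \<open>S\<close> is divided by 1 + x_s T, expanded as a
  geometric series.\<close>

lemma esym_remove:
 assumes "finite S" "s \<in> S"
 shows "esym (S - {s}) k = (\<Sum>i\<le>k. (- Var (Vx s)) ^ i * esym S (k - i))"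
proof (induction k)
 case (Suc k)
 have "esym S (Suc k) = esym (S - {s}) (Suc k) + Var (Vx s) * esym (S - {s}) k"
  using esym_insert[of "S - {s}" s k] assms by (simp add: insert_absorb)
 hence "esym (S - {s}) (Suc k) = esym S (Suc k) + (- Var (Vx s)) * (\<Sum>i\<le>k. (- Var (Vx s)) ^ i * esym S (k - i))"
  using Suc by simp
 also have "... = (\<Sum>i\<le>Suc k. (- Var (Vx s)) ^ i * esym S (Suc k - i))"
  by (subst sum.atMost_Suc_shift) (simp add: sum_distrib_left mult.assoc)
 finally show ?case .
qed simp


text \<open>\<open>S - {s}\<close> is too small for a non-zero elementary symmetric polynomial of
  index \<open>card S\<close>; expanding that by \<open>esym_remove\<close> gives a monic equation
  for - x_s.\<close>

lemma esym_monic: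
 assumes "finite S" "s \<in> S"
 shows "(- Var (Vx s)) ^ card S = - (\<Sum>i<card S. (- Var (Vx s)) ^ i * esym S (card S - i))"
proof -
 have "esym (S - {s}) (card S) = 0" using assms by (intro ev_eqI) (auto simp: ev_esym intro!: es_eq_0 card_Diff1_less)
 hence "(\<Sum>i\<le>card S. (- Var (Vx s)) ^ i * esym S (card S - i)) = 0" using esym_remove[OF assms] by simp
 hence "(- Var (Vx s)) ^ card S + (\<Sum>i<card S. (- Var (Vx s)) ^ i * esym S (card S - i)) = 0"
  by (simp add: lessThan_Suc_atMost[symmetric] add.commute)
 thus ?thesis by (simp add: eq_neg_iff_add_eq_0)
qed

section \<open>Subalgebras generated by elementary symmetric polynomials and variables\<close>

inductive_set Alg :: "mpoly set => mpoly set" for T :: "mpoly set" where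
 Alg_const: "const c \<in> Alg T"
| Alg_gen: "P \<in> T ==> P \<in> Alg T"
| Alg_add: "P \<in> Alg T ==> Q \<in> Alg T ==> P + Q \<in> Alg T"
| Alg_mult: "P \<in> Alg T ==> Q \<in> Alg T ==> P * Q \<in> Alg T"

lemma Alg_0: "0 \<in> Alg T" and Alg_1: "1 \<in> Alg T"
 using Alg_const[of 0 T] Alg_const[of 1 T] by simp_all

lemma Alg_uminus: "P \<in> Alg T ==> - P \<in> Alg T"
proof -
 have "const (- 1) * P = - P" by (rule ev_eqI) simp
 thus "P \<in> Alg T ==> - P \<in> Alg T" using Alg_mult[OF Alg_const[of "- 1"], of P T] by simp
qed

lemma Alg_sum: "(!!i. i \<in> I ==> F i \<in> Alg T) ==> (\<Sum>i\<in>I. F i) \<in> Alg T"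
 by (induction I rule: infinite_finite_induct) (auto intro: Alg_add Alg_0)

lemma Alg_power: "P \<in> Alg T ==> P ^ k \<in> Alg T"
 by (induction k) (auto intro: Alg_mult Alg_1)

lemma Alg_prod: "(!!i. i \<in> I ==> F i \<in> Alg T) ==> (\<Prod>i\<in>I. F i) \<in> Alg T"
 by (induction I rule: infinite_finite_induct) (auto intro: Alg_mult Alg_1)

lemma Alg_subset:
 assumes "T \<subseteq> Alg T'" shows "Alg T \<subseteq> Alg T'"
proof
 fix P assume "P \<in> Alg T"
 thus "P \<in> Alg T'" by induction (use assms in \<open>auto intro: Alg.intros\<close>)
qed

lemma xpoly_Alg: "xpoly n P ==> P \<in> Alg ((%j. Var (Vx j)) ` {1..n})"
proof -
 assume P: "xpoly n P"
 have "poly_subst Var P \<in> Alg ((%j. Var (Vx j)) ` {1..n})" unfolding poly_subst_def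
 proof (intro Alg_sum Alg_mult Alg_const Alg_prod Alg_power)
  fix m w assume "m \<in> pkeys P" "w \<in> pkeys m"
  hence "w \<in> Vx ` {1..n}" using P by (auto simp: xpoly_def poly_vars_def)
  thus "Var w \<in> Alg ((%j. Var (Vx j)) ` {1..n})" by (auto intro: Alg_gen)
 qed
 thus ?thesis by (simp add: poly_subst_Var)
qed

text \<open>The monic equation of x_s rewrites its powers from \<open>card S\<close> on, so the
  reduced expressions are closed under the algebra operations.\<close>

lemma Alg_reduce:
 assumes S: "finite S" "s \<in> S" and e: "!!k. esym S k \<in> Alg T"
  and P: "P \<in> Alg (insert (Var (Vx s)) T)"
 shows "\<exists>r. (\<forall>k. r k \<in> Alg T) \<and> P = (\<Sum>k<card S. r k * Var (Vx s) ^ k)"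
proof -
 let ?x = "Var (Vx s)" and ?m = "card S"
 define B where "B = {P. \<exists>r. (\<forall>k. r k \<in> Alg T) \<and> P = (\<Sum>k<?m. r k * ?x ^ k)}"
 have m: "0 < ?m" using S by (auto simp: card_gt_0_iff)
 have B_add: "P + Q \<in> B" if "P \<in> B" "Q \<in> B" for P Q
 proof -
  obtain r r' where "\<forall>k. r k \<in> Alg T" "P = (\<Sum>k<?m. r k * ?x ^ k)" "\<forall>k. r' k \<in> Alg T" "Q = (\<Sum>k<?m. r' k * ?x ^ k)"
   using \<open>P \<in> B\<close> \<open>Q \<in> B\<close> unfolding B_def by blast
  thus ?thesis unfolding B_def
   by (intro CollectI exI[of _ "%k. r k + r' k"]) (simp add: Alg_add distrib_right sum.distrib)
 qed
 have B_0: "0 \<in> B" unfolding B_def by (intro CollectI exI[of _ "%_. 0"]) (simp add: Alg_0)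
 have B_sum: "(\<Sum>i\<in>I. F i) \<in> B" if "!!i. i \<in> I ==> F i \<in> B" for F and I :: "nat set"
  using that by (induction I rule: infinite_finite_induct) (auto intro: B_add B_0)
 have B_smult: "a * P \<in> B" if "a \<in> Alg T" "P \<in> B" for a P
 proof -
  obtain r where r: "\<forall>k. r k \<in> Alg T" "P = (\<Sum>k<?m. r k * ?x ^ k)" using \<open>P \<in> B\<close> unfolding B_def by blast
  thus ?thesis unfolding B_def
   by (intro CollectI exI[of _ "%k. a * r k"]) (simp add: Alg_mult that sum_distrib_left mult.assoc)
 qed
 have B_pow: "?x ^ k \<in> B" if "k < ?m" for k unfolding B_def
 proof (intro CollectI exI[of _ "%i. if i = k then 1 else 0"] conjI allI)
  show "?x ^ k = (\<Sum>i<?m. (if i = k then 1 else 0) * ?x ^ i)"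
   using that by (simp add: if_distrib[of "%z. z * _"] cong: if_cong)
 qed (auto intro: Alg_0 Alg_1)
 have B_Alg: "a \<in> B" if "a \<in> Alg T" for a using B_smult[OF that B_pow[of 0]] m by simp
 have B_top: "?x ^ ?m \<in> B"
 proof -
  have c: "const ((-1) ^ k) = (-1 :: mpoly) ^ k" for k
   by (induction k) (simp_all add: const_mult, simp add: const_def single_uminus)
  have pm: "(- ?x) ^ k = const ((-1) ^ k) * ?x ^ k" for k unfolding c by (rule power_minus)
  have "(- ?x) ^ ?m = (\<Sum>i<?m. - (const ((-1) ^ i) * esym S (?m - i)) * ?x ^ i)"
  proof -
   have "(- ?x) ^ ?m = (\<Sum>i<?m. - ((- ?x) ^ i * esym S (?m - i)))" by (simp only: esym_monic[OF S] sum_negf)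
   also have "... = (\<Sum>i<?m. - (const ((-1) ^ i) * esym S (?m - i)) * ?x ^ i)"
    by (intro sum.cong refl) (simp only: pm, simp add: mult_ac)
   finally show ?thesis .
  qed
  also have "... \<in> B" by (intro B_sum B_smult Alg_uminus Alg_mult Alg_const e B_pow) simp
  finally have "const ((-1) ^ ?m) * ((- ?x) ^ ?m) \<in> B" by (intro B_smult Alg_const)
  also have "const ((-1) ^ ?m) * ((- ?x) ^ ?m) = const ((-1) ^ ?m * (-1) ^ ?m) * ?x ^ ?m"
   unfolding pm const_mult by (simp only: mult.assoc)
  also have "(-1 :: complex) ^ ?m * (-1) ^ ?m = 1" by (simp add: power_add[symmetric])
  finally show ?thesis by simp
 qed
 have B_x: "?x * P \<in> B" if "P \<in> B" for P
 proof -
  obtain r where r: "\<forall>k. r k \<in> Alg T" "P = (\<Sum>k<?m. r k * ?x ^ k)" using \<open>P \<in> B\<close> unfolding B_def by blast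
  have "?x * P = (\<Sum>k<?m. r k * ?x ^ Suc k)" unfolding r(2) sum_distrib_left by (simp add: mult_ac)
  also have "... \<in> B"
  proof (intro B_sum B_smult)
   fix k assume "k \<in> {..<?m}"
   then consider "Suc k < ?m" | "Suc k = ?m" by fastforce
   thus "?x ^ Suc k \<in> B" using B_pow[of "Suc k"] B_top by cases (simp_all del: power_Suc)
  qed (use r in auto)
  finally show ?thesis .
 qed
 have B_xpow: "?x ^ k * P \<in> B" if "P \<in> B" for k P
  by (induction k) (use that B_x in \<open>auto simp: mult.assoc\<close>)
 from P have "P \<in> B"
 proof induction
  case (Alg_const c)
  show ?case by (intro B_Alg Alg.Alg_const)
 next
  case (Alg_gen P)
  thus ?case using B_Alg[OF Alg.Alg_gen] B_x[OF B_Alg[OF Alg_1]] by auto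
 next
  case (Alg_add P Q)
  thus ?case by (intro B_add)
 next
  case (Alg_mult P Q)
  obtain r where r: "\<forall>k. r k \<in> Alg T" "P = (\<Sum>k<?m. r k * ?x ^ k)" using Alg_mult.IH(1) unfolding B_def by blast
  have "P * Q = (\<Sum>k<?m. r k * (?x ^ k * Q))" unfolding r(2) sum_distrib_right by (simp add: mult.assoc)
  also have "... \<in> B" using r Alg_mult.IH(2) by (intro B_sum B_smult B_xpow) auto
  finally show ?case .
 qed
 thus ?thesis unfolding B_def by blast
qed

definition egen :: "nat set => mpoly set" where "egen S = range (esym S)"

lemma Alg_invariant:
 assumes "!!P. P \<in> T ==> rename_x \<pi> P = P" "P \<in> Alg T"
 shows "rename_x \<pi> P = P"
 using assms(2)
proof induction
 case (Alg_const c)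
 show ?case by (rule ev_eqI) simp
next
 case (Alg_mult P Q)
 have "rename_x \<pi> (P * Q) = rename_x \<pi> P * rename_x \<pi> Q" by (rule ev_eqI) simp
 thus ?case using Alg_mult by simp
qed (use assms(1) in \<open>auto simp: rename_x_add\<close>)

text \<open>The fundamental theorem on symmetric polynomials, with further variables as parameters:
 a symmetric polynomial reduced to \<open>\<Sum>k<card S. r k * x\<^sup>k\<close> is constant in each \<open>x\<close> from \<open>S\<close>.\<close>

lemma symmetric_in_Alg_over:
 assumes S: "S \<subseteq> D" and D: "D \<subseteq> {1..n}" and P: "P \<in> Alg (T \<union> (%j. Var (Vx j)) ` D)"
  and T: "!!\<pi> Q. \<pi> permutes S ==> Q \<in> T ==> rename_x \<pi> Q = Q"
  and sym: "!!\<pi>. \<pi> permutes S ==> rename_x \<pi> P = P"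
 shows "P \<in> Alg (T \<union> egen S \<union> (%j. Var (Vx j)) ` (D - S))"
proof -
 have "finite S" using S D finite_subset by (meson finite_atLeastAtMost)
 thus ?thesis using S T sym
 proof (induction S rule: finite_induct)
  case empty
  have "T \<union> (%j. Var (Vx j)) ` D \<subseteq> Alg (T \<union> egen {} \<union> (%j. Var (Vx j)) ` (D - {}))"
   by (auto intro: Alg_gen)
  from subsetD[OF Alg_subset[OF this] P] show ?case .
 next
  case (insert s S)
  let ?S = "insert s S" and ?V = "%A. (%j. Var (Vx j)) ` (D - A)"
  let ?T = "T \<union> egen ?S \<union> ?V ?S"
  have fin: "finite ?S" "s \<in> ?S" using insert.hyps by auto
  have ps: "\<pi> permutes ?S" if "\<pi> permutes S" for \<pi> using that by (rule permutes_subset) auto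
  have "P \<in> Alg (T \<union> egen S \<union> ?V S)"
   using insert.prems(1) insert.prems(2)[OF ps] insert.prems(3)[OF ps] by (intro insert.IH) auto
  moreover have "T \<union> egen S \<union> ?V S \<subseteq> Alg (insert (Var (Vx s)) ?T)"
  proof
   fix Q assume "Q \<in> T \<union> egen S \<union> ?V S"
   then consider "Q \<in> T" | k where "Q = esym S k" | j where "Q = Var (Vx j)" "j \<in> D - S" by (auto simp: egen_def)
   thus "Q \<in> Alg (insert (Var (Vx s)) ?T)"
   proof cases
    case 1
    thus ?thesis by (auto intro: Alg_gen)
   next
    case 2
    have "S = ?S - {s}" using insert.hyps by auto
    hence "Q = (\<Sum>i\<le>k. (- Var (Vx s)) ^ i * esym ?S (k - i))" using esym_remove[OF fin, of k] 2 by simp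
    also have "... \<in> Alg (insert (Var (Vx s)) ?T)"
     by (intro Alg_sum Alg_mult Alg_power Alg_uminus Alg_gen) (auto simp: egen_def)
    finally show ?thesis .
   next
    case 3
    thus ?thesis by (cases "j = s") (auto intro!: Alg_gen)
   qed
  qed
  ultimately have "P \<in> Alg (insert (Var (Vx s)) ?T)" using Alg_subset by blast
  moreover have "esym ?S k \<in> Alg ?T" for k by (rule Alg_gen) (auto simp: egen_def)
  ultimately obtain r where r: "!!k. r k \<in> Alg ?T" "P = (\<Sum>k<card ?S. r k * Var (Vx s) ^ k)"
   using Alg_reduce[OF fin, of ?T P] by blast
  have inv: "rename_x \<pi> (r k) = r k" if p: "\<pi> permutes ?S" for \<pi> k
  proof (rule Alg_invariant[OF _ r(1)])
   fix Q assume "Q \<in> ?T"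
   then consider "Q \<in> T" | k where "Q = esym ?S k" | j where "Q = Var (Vx j)" "j \<notin> ?S" by (auto simp: egen_def)
   thus "rename_x \<pi> Q = Q"
   proof cases
    case 1
    thus ?thesis by (rule insert.prems(2)[OF p])
   next
    case 2
    show ?thesis unfolding 2 rename_x_esym[OF fin(1) permutes_inj[OF p]] permutes_image[OF p] ..
   next
    case 3
    hence "\<pi> j = j" using permutes_not_in[OF p] by blast
    thus ?thesis unfolding 3(1) by (intro ev_eqI) simp
   qed
  qed
  \<comment> \<open>At each generic point, the reduced expression minus \<open>P\<close> becomes a
    polynomial \<open>q\<close> of degree less than \<open>card S\<close>. By invariance under
    transpositions it has the root x_t for every t in \<open>S\<close>, hence is zero.\<close>
  have "P = r 0"
  proof (rule ev_eqI_gen[of n])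
   fix v assume v: "gen n v"
   interpret generic_point "{1..n}" "pt v" using gen_point v .
   define q where "q = (\<Sum>k<card ?S. monom (ev v (r k)) k) - [:ev v P:]"
   have m: "0 < card ?S" using fin by (auto simp: card_gt_0_iff)
   have "poly q (v (Vx t)) = 0" if t: "t \<in> ?S" for t
   proof -
    have p: "transpose s t permutes ?S" using t by (intro permutes_swap_id) auto
    have "ev v P = ev (vp (transpose s t) v) P" using arg_cong[OF insert.prems(3)[OF p], of "ev v"] by simp
    also have "... = (\<Sum>k<card ?S. ev (vp (transpose s t) v) (r k) * v (Vx t) ^ k)" unfolding r(2) by simp
    also have "... = (\<Sum>k<card ?S. ev v (r k) * v (Vx t) ^ k)"
    proof (rule sum.cong[OF refl])
     fix k
     show "ev (vp (transpose s t) v) (r k) * v (Vx t) ^ k = ev v (r k) * v (Vx t) ^ k"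
      using arg_cong[OF inv[OF p, of k], of "ev v"] by simp
    qed
    finally show ?thesis by (simp add: q_def poly_sum poly_monom)
   qed
   moreover have "inj_on (pt v) ?S" using inj_on_subset[OF inj_x order_trans[OF insert.prems(1) D]] .
   hence "card (pt v ` ?S) = card ?S" by (rule card_image)
   moreover have "degree q < card ?S"
   proof -
    have "degree q \<le> card ?S - 1" unfolding q_def
     by (intro degree_diff_le degree_sum_le order.trans[OF degree_monom_le]) auto
    thus ?thesis using m by simp
   qed
   moreover have "card (pt v ` ?S) \<le> degree q" if "q ~= 0"
   proof -
    have "pt v ` ?S \<subseteq> {x. poly q x = 0}" using calculation(1) by blast
    hence "card (pt v ` ?S) \<le> card {x. poly q x = 0}" by (rule card_mono[OF poly_roots_finite[OF that]])
    also have "... \<le> degree q" by (rule card_poly_roots_bound[OF that])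
    finally show ?thesis .
   qed
   ultimately have "q = 0" by linarith
   hence "poly.coeff q 0 = 0" by simp
   moreover have "poly.coeff (\<Sum>k<card ?S. monom (ev v (r k)) k) 0 = ev v (r 0)" using m by (simp add: coeff_sum)
   ultimately show "ev v P = ev v (r 0)" by (simp add: q_def)
  qed
  thus ?case using r(1)[of 0] by simp
 qed
qed

lemma symmetric_in_Alg:
 assumes S: "S \<subseteq> {1..n}" and P: "xpoly n P" and sym: "!!\<pi>. \<pi> permutes S ==> rename_x \<pi> P = P"
 shows "P \<in> Alg (egen S \<union> (%j. Var (Vx j)) ` ({1..n} - S))"
 using symmetric_in_Alg_over[OF S order_refl, of P "{}"] xpoly_Alg[OF P] sym by simp

section \<open>From families to exterior powers\<close>

definition emon :: "nat => (nat => nat) => mpoly" where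
 "emon n \<alpha> = (\<Prod>k\<in>{1..n}. esym {1..n} k ^ \<alpha> k)"

definition xmon :: "nat => (nat => nat) => mpoly" where
 "xmon l \<kappa> = (\<Prod>a\<in>{1..l}. Var (Vx a) ^ \<kappa> a)"

text \<open>The bound is Artin's: over the symmetric polynomials and the earlier variables, x_a
  satisfies a monic equation of degree n - a + 1. It also keeps every exponent below n, as lifting
  to powers of X_a requires.\<close>

definition BB :: "nat => nat => mpoly set" where
 "BB n l = {emon n \<alpha> * xmon l \<kappa> | \<alpha> \<kappa>. \<forall>a\<in>{1..l}. \<kappa> a + a \<le> n}"

definition xs :: "nat => mpoly set" where "xs l = (%j. Var (Vx j)) ` {1..l}"

lemma span_mult:
 assumes "P \<in> mp.span B" "!!b. b \<in> B ==> b * c \<in> mp.span B'"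
 shows "P * c \<in> mp.span B'"
 using assms(1)
proof (induction rule: mp.span_induct_alt)
 case base
 show ?case by (simp add: mp.span_zero)
next
 case (step k x y)
 have "(const k * x + y) * c = const k * (x * c) + y * c" by (simp only: distrib_right mult.assoc)
 thus ?case using mp.span_add[OF mp.span_scale[OF assms(2)[OF step(1)], of k] step(2)] by simp
qed

lemma esym_in_Alg: "l \<le> n ==> esym {l + 1..n} k \<in> Alg (egen {1..n} \<union> xs l)"
proof (induction l arbitrary: k)
 case 0
 show ?case by (intro Alg_gen) (auto simp: egen_def)
next
 case (Suc l)
 have e: "{Suc l + 1..n} = {l + 1..n} - {Suc l}" by auto
 have "Suc l \<in> {l + 1..n}" using Suc.prems by simp
 hence "esym {Suc l + 1..n} k = (\<Sum>i\<le>k. (- Var (Vx (Suc l))) ^ i * esym {l + 1..n} (k - i))"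
  unfolding e by (intro esym_remove) auto
 also have "... \<in> Alg (egen {1..n} \<union> xs (Suc l))"
 proof (intro Alg_sum Alg_mult Alg_power Alg_uminus)
  fix i
  show "Var (Vx (Suc l)) \<in> Alg (egen {1..n} \<union> xs (Suc l))" by (rule Alg_gen) (simp add: xs_def)
  have "egen {1..n} \<union> xs l \<subseteq> Alg (egen {1..n} \<union> xs (Suc l))" by (auto intro!: Alg_gen simp: xs_def)
  thus "esym {l + 1..n} (k - i) \<in> Alg (egen {1..n} \<union> xs (Suc l))"
   using Suc.IH[of "k - i"] Suc.prems Alg_subset[of "egen {1..n} \<union> xs l"] by (meson Suc_leD in_mono)
 qed
 finally show ?case .
qed

lemma esym_eq_0: "finite S ==> card S < k ==> esym S k = 0"
 by (rule ev_eqI) (simp add: ev_esym es_eq_0)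

lemma emon_mult: "emon n \<alpha> * emon n \<beta> = emon n (%k. \<alpha> k + \<beta> k)"
 by (simp add: emon_def power_add prod.distrib)

lemma Alg_span_0:
 assumes "P \<in> Alg (egen {1..n})"
 shows "P \<in> mp.span (range (emon n))"
 using assms
proof induction
 case (Alg_const c)
 have "emon n (%_. 0) = 1" by (simp add: emon_def)
 hence "1 \<in> mp.span (range (emon n))" by (metis mp.span_base rangeI)
 from mp.span_scale[OF this, of c] show ?case by simp
next
 case (Alg_gen P)
 then obtain k where k: "P = esym {1..n} k" by (auto simp: egen_def)
 consider "k = 0" | "n < k" | "k \<in> {1..n}" by fastforce
 thus ?case
 proof cases
  case 1
  have "emon n (%_. 0) = P" by (simp add: emon_def k 1)
  thus ?thesis by (metis mp.span_base rangeI)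
 next
  case 2
  thus ?thesis by (simp add: k esym_eq_0 mp.span_zero)
 next
  case 3
  have "emon n (%i. if i = k then 1 else 0) = (\<Prod>i\<in>{1..n}. if i = k then P else 1)"
   unfolding emon_def by (intro prod.cong) (auto simp: k)
  also have "... = P" using 3 by simp
  finally show ?thesis by (metis mp.span_base rangeI)
 qed
next
 case (Alg_add P Q)
 thus ?case by (intro mp.span_add)
next
 case (Alg_mult P Q)
 show ?case
 proof (rule span_mult[OF Alg_mult.IH(1)])
  fix b assume b: "b \<in> range (emon n)"
  have "Q * b \<in> mp.span (range (emon n))"
  proof (rule span_mult[OF Alg_mult.IH(2)])
   fix b' assume "b' \<in> range (emon n)"
   hence "b' * b \<in> range (emon n)" using b by (auto simp: emon_mult)
   thus "b' * b \<in> mp.span (range (emon n))" by (rule mp.span_base)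
  qed
  thus "b * Q \<in> mp.span (range (emon n))" by (simp add: mult.commute)
 qed
qed

text \<open>The variables are adjoined one at a time; x_{l+1} is reduced by the monic equation for
  the variables in \<open>{l + 1..n}\<close>, of degree n - l.\<close>

lemma Alg_span: "l \<le> n ==> P \<in> Alg (egen {1..n} \<union> xs l) ==> P \<in> mp.span (BB n l)"
proof (induction l arbitrary: P)
 case 0
 have "BB n 0 = range (emon n)" by (auto simp: BB_def xmon_def)
 thus ?case using 0 Alg_span_0 by (simp add: xs_def)
next
 case (Suc l)
 let ?T = "egen {1..n} \<union> xs l" and ?S = "{l + 1..n}" and ?x = "Var (Vx (Suc l))"
 have "xs (Suc l) = insert ?x (xs l)" by (simp add: xs_def atLeastAtMostSuc_conv)
 hence "P \<in> Alg (insert ?x ?T)" using Suc.prems by simp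
 moreover have "Suc l \<in> ?S" "finite ?S" using Suc.prems by auto
 ultimately obtain r where r: "\<forall>k. r k \<in> Alg ?T" "P = (\<Sum>k<card ?S. r k * ?x ^ k)"
  using Alg_reduce[of ?S "Suc l" ?T P] esym_in_Alg[of l n] Suc.prems by auto
 show ?case unfolding r(2)
 proof (intro mp.span_sum)
  fix k assume k: "k \<in> {..<card ?S}"
  show "r k * ?x ^ k \<in> mp.span (BB n (Suc l))"
  proof (rule span_mult)
   show "r k \<in> mp.span (BB n l)" using r(1) Suc by simp
   fix b assume "b \<in> BB n l"
   then obtain \<alpha> \<kappa> where b: "b = emon n \<alpha> * xmon l \<kappa>" "\<forall>a\<in>{1..l}. \<kappa> a + a \<le> n" by (auto simp: BB_def)
   have "xmon (Suc l) (\<kappa>(Suc l := k)) = xmon l \<kappa> * ?x ^ k"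
   proof -
    have "(\<Prod>a\<in>{1..l}. Var (Vx a) ^ (\<kappa>(Suc l := k)) a) = xmon l \<kappa>"
     unfolding xmon_def by (intro prod.cong) auto
    thus ?thesis by (simp add: xmon_def atLeastAtMostSuc_conv mult.commute)
   qed
   hence "b * ?x ^ k = emon n \<alpha> * xmon (Suc l) (\<kappa>(Suc l := k))" by (simp only: b mult.assoc)
   moreover have "\<forall>a\<in>{1..Suc l}. (\<kappa>(Suc l := k)) a + a \<le> n" using b(2) k by auto
   ultimately have "b * ?x ^ k \<in> BB n (Suc l)" unfolding BB_def by blast
   thus "b * ?x ^ k \<in> mp.span (BB n (Suc l))" by (rule mp.span_base)
  qed
 qed
qed

lemma ev_emon_cong: "(!!j. u (Vx j) = v (Vx j)) ==> ev u (emon n \<alpha>) = ev v (emon n \<alpha>)"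
 by (simp add: emon_def ev_esym)

lemma ev_emon_vp: "\<pi> permutes {1..n} ==> ev (vp \<pi> v) (emon n \<alpha>) = ev v (emon n \<alpha>)"
 using es_permutes[of \<pi> "{1..n}" _ "pt v", unfolded comp_def] by (simp add: emon_def ev_esym)

lemma xpoly_emon [simp]: "xpoly n (emon n \<alpha>)"
 unfolding emon_def by (intro xpoly_simps(7) xpoly_simps(5) xpoly_esym) simp

text \<open>\<open>f\<close> arises from a polynomial in the \<open>X\<close>, of degree less than \<open>n\<close> in each of them and with
 symmetric coefficients, by substituting \<open>1 / x\<close> for \<open>X\<close> and clearing denominators.\<close>

definition liftable :: "nat => nat => mpoly => bool" where
 "liftable n l f \<longleftrightarrow> (\<exists>P. poly_vars P \<subseteq> evars n l \<and> (\<forall>a\<in>{1..l}. degX n (VX a) P) \<and>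
   (\<forall>\<pi>. \<pi> permutes {1..n} --> rename_x \<pi> P = P) \<and>
   (\<forall>v \<pi>. \<pi> permutes {1..n} --> (\<forall>j. v (Vx j) ~= 0) -->
    ev (sX \<pi> v) P = (\<Prod>a\<in>{1..l}. inverse (v (Vx (\<pi> a))) ^ (n - 1)) * ev (vp \<pi> v) f))"

lemma liftable_basis:
 assumes n: "0 < n" and l: "l \<le> n" and f: "f \<in> BB n l"
 shows "liftable n l f"
proof -
 obtain \<alpha> \<kappa> where f: "f = emon n \<alpha> * xmon l \<kappa>" and \<kappa>: "!!a. a \<in> {1..l} ==> \<kappa> a + a \<le> n"
  using f by (auto simp: BB_def)
 \<comment> \<open>After the substitution X_a = 1 / x_a and multiplication by x_a^(n-1), this power
   becomes the required power \<kappa> a of x_a.\<close>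
 let ?X = "%a. Var (VX a) ^ (n - 1 - \<kappa> a)"
 let ?P = "emon n \<alpha> * (\<Prod>a\<in>{1..l}. ?X a)"
 have ind: "indep w (emon n \<alpha>)" if "w \<notin> Vx ` {1..n}" for w
  using xpoly_emon that by (auto simp: xpoly_iff)
 have "poly_vars ?P \<subseteq> evars n l" unfolding poly_vars_subset_iff
 proof (intro allI impI)
  fix w assume "w \<notin> evars n l"
  hence "w \<notin> Vx ` {1..n}" and "!!a. a \<in> {1..l} ==> w ~= VX a" by (auto simp: evars_def)
  thus "indep w ?P" by (intro indep_simps(3) ind indep_simps(7) indep_simps(5)) auto
 qed
 moreover have "degX n (VX a) ?P" if a: "a \<in> {1..l}" for a
 proof -
  have e: "?P = ?X a * (emon n \<alpha> * (\<Prod>b\<in>{1..l} - {a}. ?X b))"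
   using a by (simp add: prod.remove[of _ a] mult_ac)
  have d: "degX n (VX a) (?X a)" unfolding degX_iff[OF n] using n
   by (intro allI exI[of _ "monom 1 (n - 1 - \<kappa> a)"]) (auto simp: degree_monom_eq poly_monom)
  have i: "indep (VX a) (emon n \<alpha> * (\<Prod>b\<in>{1..l} - {a}. ?X b))"
   by (intro indep_simps(3) ind indep_simps(7) indep_simps(5)) auto
  show ?thesis unfolding e by (rule degX_mult_indep[OF n d i])
 qed
 moreover have "rename_x \<pi> ?P = ?P" if "\<pi> permutes {1..n}" for \<pi>
  using ev_emon_vp[OF that] by (intro ev_eqI) simp
 moreover have "ev (sX \<pi> v) ?P = (\<Prod>a\<in>{1..l}. inverse (v (Vx (\<pi> a))) ^ (n - 1)) * ev (vp \<pi> v) f"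
  if p: "\<pi> permutes {1..n}" and v: "\<forall>j. v (Vx j) ~= 0" for v \<pi>
 proof -
  have e: "inverse (v (Vx (\<pi> a))) ^ (n - 1 - \<kappa> a) = inverse (v (Vx (\<pi> a))) ^ (n - 1) * v (Vx (\<pi> a)) ^ \<kappa> a"
   if a: "a \<in> {1..l}" for a
  proof -
   have "n - 1 = (n - 1 - \<kappa> a) + \<kappa> a" using \<kappa>[OF a] a by auto
   hence "inverse (v (Vx (\<pi> a))) ^ (n - 1) = inverse (v (Vx (\<pi> a))) ^ (n - 1 - \<kappa> a) * inverse (v (Vx (\<pi> a))) ^ \<kappa> a"
    by (metis power_add)
   moreover have "inverse (v (Vx (\<pi> a))) ^ \<kappa> a * v (Vx (\<pi> a)) ^ \<kappa> a = 1"
    using v by (simp add: power_mult_distrib[symmetric])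
   ultimately show ?thesis by (simp only: mult.assoc) simp
  qed
  have em: "ev (sX \<pi> v) (emon n \<alpha>) = ev v (emon n \<alpha>)" by (intro ev_emon_cong) simp
  have pe: "(\<Prod>a\<in>{1..l}. inverse (v (Vx (\<pi> a))) ^ (n - 1 - \<kappa> a)) =
    (\<Prod>a\<in>{1..l}. inverse (v (Vx (\<pi> a))) ^ (n - 1)) * (\<Prod>a\<in>{1..l}. v (Vx (\<pi> a)) ^ \<kappa> a)"
   unfolding prod.distrib[symmetric] by (rule prod.cong[OF refl]) (rule e)
  have "ev (sX \<pi> v) ?P = ev (sX \<pi> v) (emon n \<alpha>) * (\<Prod>a\<in>{1..l}. inverse (v (Vx (\<pi> a))) ^ (n - 1 - \<kappa> a))"
   by simp
  also have "... = (\<Prod>a\<in>{1..l}. inverse (v (Vx (\<pi> a))) ^ (n - 1)) * (ev v (emon n \<alpha>) * (\<Prod>a\<in>{1..l}. v (Vx (\<pi> a)) ^ \<kappa> a))"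
   by (simp only: pe em mult_ac)
  also have "ev v (emon n \<alpha>) * (\<Prod>a\<in>{1..l}. v (Vx (\<pi> a)) ^ \<kappa> a) = ev (vp \<pi> v) f"
   by (simp add: f xmon_def ev_emon_vp[OF p])
  finally show ?thesis .
 qed
 ultimately show ?thesis unfolding liftable_def by blast
qed

lemma liftable_lin:
 assumes n: "0 < n" and f: "liftable n l f" and g: "liftable n l g"
 shows "liftable n l (const c * f + g)"
proof -
 obtain P where P: "poly_vars P \<subseteq> evars n l" "\<forall>a\<in>{1..l}. degX n (VX a) P"
  "!!\<pi>. \<pi> permutes {1..n} ==> rename_x \<pi> P = P"
  "!!v \<pi>. \<pi> permutes {1..n} ==> (\<forall>j. v (Vx j) ~= 0) ==>
    ev (sX \<pi> v) P = (\<Prod>a\<in>{1..l}. inverse (v (Vx (\<pi> a))) ^ (n - 1)) * ev (vp \<pi> v) f"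
  using f unfolding liftable_def by blast
 obtain Q where Q: "poly_vars Q \<subseteq> evars n l" "\<forall>a\<in>{1..l}. degX n (VX a) Q"
  "!!\<pi>. \<pi> permutes {1..n} ==> rename_x \<pi> Q = Q"
  "!!v \<pi>. \<pi> permutes {1..n} ==> (\<forall>j. v (Vx j) ~= 0) ==>
    ev (sX \<pi> v) Q = (\<Prod>a\<in>{1..l}. inverse (v (Vx (\<pi> a))) ^ (n - 1)) * ev (vp \<pi> v) g"
  using g unfolding liftable_def by blast
 show ?thesis unfolding liftable_def
 proof (intro exI[of _ "const c * P + Q"] conjI allI impI ballI)
  show "poly_vars (const c * P + Q) \<subseteq> evars n l"
   using P(1) Q(1) unfolding poly_vars_subset_iff by (auto intro: indep_simps)
  show "degX n (VX a) (const c * P + Q)" if "a \<in> {1..l}" for a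
   using degX_mult_indep[OF n, of "VX a" P "const c"] P(2) Q(2) that
   by (intro degX_add[OF n]) (auto simp: mult.commute[of "const c"])
  show "rename_x \<pi> (const c * P + Q) = const c * P + Q" if p: "\<pi> permutes {1..n}" for \<pi>
  proof (rule ev_eqI)
   fix v
   show "ev v (rename_x \<pi> (const c * P + Q)) = ev v (const c * P + Q)"
    using arg_cong[OF P(3)[OF p], of "ev v"] arg_cong[OF Q(3)[OF p], of "ev v"] by simp
  qed
  show "ev (sX \<pi> v) (const c * P + Q) = (\<Prod>a\<in>{1..l}. inverse (v (Vx (\<pi> a))) ^ (n - 1)) * ev (vp \<pi> v) (const c * f + g)"
   if "\<pi> permutes {1..n}" "\<forall>j. v (Vx j) ~= 0" for v \<pi>
   by (simp add: P(4)[OF that] Q(4)[OF that] algebra_simps)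
 qed
qed

lemma liftable_0: "liftable n l 0"
proof -
 have "rename_x \<pi> 0 = 0" for \<pi> by (rule ev_eqI) simp
 thus ?thesis unfolding liftable_def by (intro exI[of _ 0]) (auto simp: poly_vars_def)
qed

lemma liftable_span:
 assumes n: "0 < n" and l: "l \<le> n" and f: "f \<in> mp.span (BB n l)"
 shows "liftable n l f"
 using f
proof (induction rule: mp.span_induct_alt)
 case (step c x y)
 thus ?case by (intro liftable_lin[OF n liftable_basis[OF n l]])
qed (rule liftable_0)

text \<open>\<open>den\<close> for the identity arrangement without the powers of 1 / x_a, hence a
  polynomial.\<close>

definition dpol :: "nat => nat => mpoly" where
 "dpol n l = (\<Prod>a\<in>{1..l}. \<Prod>j\<in>{l + 1..n}. Var (Vx a) + Var (Vx j)) * vdm {1..l} (%a. (Var (Vx a))\<^sup>2)"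

lemma ev_dpol: "ev v (dpol n l) = (\<Prod>a\<in>{1..l}. \<Prod>j\<in>{l + 1..n}. v (Vx a) + v (Vx j)) * vdm {1..l} (%a. (v (Vx a))\<^sup>2)"
 by (simp add: dpol_def ev_vdm)

lemma dpol_den:
 assumes p: "\<pi> permutes {1..n}" and l: "l \<le> n"
 shows "(\<Prod>a\<in>{1..l}. inverse (v (Vx (\<pi> a))) ^ (n - 1)) * ev (vp \<pi> v) (dpol n l) = den n l \<pi> v"
proof -
 have "{1..n} - \<pi> ` {1..l} = \<pi> ` ({1..n} - {1..l})"
  using permutes_image[OF p] image_set_diff[OF permutes_inj[OF p], of "{1..n}" "{1..l}"] by simp
 also have "{1..n} - {1..l} = {l + 1..n}" by auto
 finally have R: "{1..n} - \<pi> ` {1..l} = \<pi> ` {l + 1..n}" .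
 have "(\<Prod>j\<in>\<pi> ` {l + 1..n}. c + v (Vx j)) = (\<Prod>j\<in>{l + 1..n}. c + v (Vx (\<pi> j)))" for c
  using inj_on_subset[OF permutes_inj[OF p] subset_UNIV] by (simp add: prod.reindex)
 thus ?thesis by (simp add: den_def R ev_dpol mult.assoc)
qed

lemma xpoly_dpol: "l \<le> n ==> xpoly n (dpol n l)"
 unfolding dpol_def vdm_def
 by (intro xpoly_simps(3) xpoly_simps(7) xpoly_simps(1)) (auto intro!: xpoly_simps(2) xpoly_simps(5) xpoly_simps(13))

lemma dpol_invariant:
 assumes r: "\<rho> permutes {l + 1..n}"
 shows "ev (vp \<rho> v) (dpol n l) = ev v (dpol n l)"
proof -
 have fx: "\<rho> a = a" if "a \<in> {1..l}" for a using permutes_not_in[OF r] that by simp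
 have "(\<Prod>j\<in>{l + 1..n}. c + v (Vx (\<rho> j))) = (\<Prod>j\<in>{l + 1..n}. c + v (Vx j))" for c
  using prod.permute[OF r, of "%j. c + v (Vx j)"] by (simp add: comp_def)
 note pe = this
 have "(\<Prod>a\<in>{1..l}. \<Prod>j\<in>{l + 1..n}. v (Vx (\<rho> a)) + v (Vx (\<rho> j))) = (\<Prod>a\<in>{1..l}. \<Prod>j\<in>{l + 1..n}. v (Vx a) + v (Vx j))"
  by (rule prod.cong[OF refl]) (simp only: fx pe)
 moreover have "vdm {1..l} (%a. (v (Vx (\<rho> a)))\<^sup>2) = vdm {1..l} (%a. (v (Vx a))\<^sup>2)"
  using fx by (intro vdm_cong) simp
 ultimately show ?thesis by (simp add: ev_dpol)
qed

lemma sum_permutes_left: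
 assumes t: "\<tau> permutes S"
 shows "(\<Sum>\<sigma> | \<sigma> permutes S. h (\<tau> \<circ> \<sigma>)) = (\<Sum>\<sigma> | \<sigma> permutes S. h \<sigma>)"
proof (rule sum.reindex_bij_witness[of _ "%\<sigma>. inv_into UNIV \<tau> \<circ> \<sigma>" "%\<sigma>. \<tau> \<circ> \<sigma>"])
 fix \<sigma> assume "\<sigma> \<in> {\<sigma>. \<sigma> permutes S}"
 thus "inv_into UNIV \<tau> \<circ> (\<tau> \<circ> \<sigma>) = \<sigma>" "\<tau> \<circ> \<sigma> \<in> {\<sigma>. \<sigma> permutes S}"
  "\<tau> \<circ> (inv_into UNIV \<tau> \<circ> \<sigma>) = \<sigma>" "inv_into UNIV \<tau> \<circ> \<sigma> \<in> {\<sigma>. \<sigma> permutes S}"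
  using t permutes_inv_o[OF t] by (auto simp: o_assoc permutes_compose permutes_inv)
qed simp

text \<open>Antisymmetrising the lift in the X_a lands in the exterior power; its values at
  arrangements of nodes are recorded because they determine it.\<close>

lemma liftable_antisymmetrize:
 assumes n: "0 < n" and l: "l \<le> n" and f: "liftable n l f"
 shows "\<exists>P\<in>ext_power n l. \<forall>v \<pi>. \<pi> permutes {1..n} --> (\<forall>j. v (Vx j) ~= 0) -->
   ev (sX \<pi> v) P = (\<Sum>\<sigma> | \<sigma> permutes {1..l}. of_int (sign \<sigma>) *
    ((\<Prod>a\<in>{1..l}. inverse (v (Vx ((\<pi> \<circ> \<sigma>) a))) ^ (n - 1)) * ev (vp (\<pi> \<circ> \<sigma>) v) f))"
proof -
 obtain Q where Q: "poly_vars Q \<subseteq> evars n l" "!!a. a \<in> {1..l} ==> degX n (VX a) Q"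
  "!!\<pi>. \<pi> permutes {1..n} ==> rename_x \<pi> Q = Q"
  "!!v \<pi>. \<pi> permutes {1..n} ==> (\<forall>j. v (Vx j) ~= 0) ==>
    ev (sX \<pi> v) Q = (\<Prod>a\<in>{1..l}. inverse (v (Vx (\<pi> a))) ^ (n - 1)) * ev (vp \<pi> v) f"
  using f unfolding liftable_def by blast
 let ?S = "{\<sigma>. \<sigma> permutes {1..l}}"
 define P where "P = (\<Sum>\<sigma>\<in>?S. of_int (sign \<sigma>) * rename_X \<sigma> Q)"
 have "P \<in> ext_power n l" unfolding ext_power_iff
 proof (intro conjI allI impI ballI)
  fix w assume w: "w \<notin> evars n l"
  have "indep w (rename_X \<sigma> Q)" if "\<sigma> \<in> ?S" for \<sigma> unfolding indep_def ev_rename_X_rX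
  proof (intro allI indep_agree[OF Q(1)])
   fix v t u assume "u \<in> evars n l"
   thus "rX \<sigma> (v(w := t)) u = rX \<sigma> v u"
    using w permutes_in_image[of \<sigma> "{1..l}"] that unfolding evars_def by auto
  qed
  thus "indep w P" unfolding P_def by (intro indep_simps(6) indep_simps(3) indep_simps(11)) blast
 next
  fix a assume a: "a \<in> {1..l}"
  have "degX n (VX a) (rename_X \<sigma> Q)" if s: "\<sigma> \<in> ?S" for \<sigma>
  proof -
   have s: "\<sigma> permutes {1..l}" using s by simp
   obtain b where b: "\<sigma> b = a" "b \<in> {1..l}"
   proof -
    have "a \<in> \<sigma> ` {1..l}" using a permutes_image[OF s] by simp
    thus ?thesis using that by blast
   qed
   have sb: "\<sigma> c = a \<longleftrightarrow> c = b" for c using b(1) injD[OF permutes_inj[OF s], of c b] by auto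
   have u: "rX \<sigma> (v(VX a := t)) = (rX \<sigma> v)(VX b := t)" for v t by (intro var_fun_eqI) (simp_all add: sb)
   show ?thesis unfolding degX_iff[OF n] ev_rename_X_rX u
   proof
    fix v
    show "\<exists>q. degree q < n \<and> (\<forall>t. ev ((rX \<sigma> v)(VX b := t)) Q = poly q t)"
     using Q(2)[OF b(2)] unfolding degX_iff[OF n] by (rule spec)
   qed
  qed
  hence "degX n (VX a) (of_int (sign \<sigma>) * rename_X \<sigma> Q)" if "\<sigma> \<in> ?S" for \<sigma>
   using degX_mult_indep[OF n _ indep_simps(11)[of "VX a" "sign \<sigma>"], of "rename_X \<sigma> Q"] that
   by (simp add: mult.commute)
  thus "degX n (VX a) P" unfolding P_def by (intro degX_sum[OF n]) blast
 next
  fix \<pi> assume p: "\<pi> permutes {1..n}"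
  show "rename_x \<pi> P = P"
  proof (rule ev_eqI)
   fix v
   have "rX f (vp \<pi> v) = vp \<pi> (rX f v)" for f by (rule var_fun_eqI) auto
   moreover have "ev (vp \<pi> u) Q = ev u Q" for u using arg_cong[OF Q(3)[OF p], of "ev u"] by simp
   ultimately show "ev v (rename_x \<pi> P) = ev v P" by (simp add: P_def)
  qed
 next
  fix \<tau> assume t: "\<tau> permutes {1..l}"
  have pt: "permutation \<tau>" using t permutation_permutes by blast
  have "rename_X \<tau> P = (\<Sum>\<sigma>\<in>?S. of_int (sign \<sigma>) * rename_X (\<tau> \<circ> \<sigma>) Q)"
   by (simp only: P_def rename_X_sum rename_X_mult rename_X_of_int rename_X_comp)
  also have "... = (\<Sum>\<sigma>\<in>?S. of_int (sign \<tau>) * (of_int (sign (\<tau> \<circ> \<sigma>)) * rename_X (\<tau> \<circ> \<sigma>) Q))"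
  proof (rule sum.cong[OF refl])
   fix \<sigma> assume "\<sigma> \<in> ?S"
   hence "permutation \<sigma>" using permutation_permutes by blast
   hence "sign (\<tau> \<circ> \<sigma>) = sign \<tau> * sign \<sigma>" by (rule sign_compose[OF pt])
   moreover have "sign \<tau> * sign \<tau> = 1" by (simp add: sign_def)
   ultimately have "sign \<sigma> = sign \<tau> * sign (\<tau> \<circ> \<sigma>)" by (simp add: mult.assoc[symmetric])
   thus "of_int (sign \<sigma>) * rename_X (\<tau> \<circ> \<sigma>) Q = of_int (sign \<tau>) * (of_int (sign (\<tau> \<circ> \<sigma>)) * rename_X (\<tau> \<circ> \<sigma>) Q)"
    by (simp only: of_int_mult mult.assoc)
  qed
  also have "... = of_int (sign \<tau>) * P" unfolding sum_distrib_left[symmetric] P_def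
   using sum_permutes_left[OF t, of "%\<sigma>. of_int (sign \<sigma>) * rename_X \<sigma> Q"] by simp
  finally show "rename_X \<tau> P = of_int (sign \<tau>) * P" .
 qed
 moreover have "ev (sX \<pi> v) P = (\<Sum>\<sigma>\<in>?S. of_int (sign \<sigma>) *
    ((\<Prod>a\<in>{1..l}. inverse (v (Vx ((\<pi> \<circ> \<sigma>) a))) ^ (n - 1)) * ev (vp (\<pi> \<circ> \<sigma>) v) f))"
  if p: "\<pi> permutes {1..n}" and v: "\<forall>j. v (Vx j) ~= 0" for v \<pi>
 proof -
  have "ev (rX \<sigma> (sX \<pi> v)) Q = (\<Prod>a\<in>{1..l}. inverse (v (Vx ((\<pi> \<circ> \<sigma>) a))) ^ (n - 1)) * ev (vp (\<pi> \<circ> \<sigma>) v) f"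
   if "\<sigma> \<in> ?S" for \<sigma>
  proof -
   have "\<sigma> permutes {1..n}" using that l by (auto intro: permutes_subset)
   hence "\<pi> \<circ> \<sigma> permutes {1..n}" using p by (rule permutes_compose)
   from Q(4)[OF this v] show ?thesis by (simp only: rX_sX)
  qed
  thus ?thesis unfolding P_def by (simp del: comp_apply)
 qed
 ultimately show ?thesis by blast
qed

lemma vdm_repeated:
 assumes "finite S" "i \<in> S" "k \<in> S" "i ~= k" "z i = z k"
 shows "vdm S z = (0 :: complex)"
proof -
 have "z \<circ> transpose i k = z" using assms(5) by (auto simp: transpose_def fun_eq_iff)
 hence "vdm S z = - vdm S z" using vdm_swap[OF assms(1-4), of z] by simp
 thus ?thesis by (rule eq_uminus_complex)
qed

text \<open>The vanishing condition on the level of denominators: the responsible factor lies in the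
  Vandermonde product of squares or in the middle product, according to whether \<open>q\<close>
  belongs to the arrangement.\<close>

lemma den_eq_0:
 assumes p: "\<pi> permutes {1..n}" and i: "i \<in> {1..l}" and q: "q \<in> {1..n}" "q ~= \<pi> i" "v (Vx q) = - v (Vx (\<pi> i))"
 shows "den n l \<pi> v = 0"
proof (cases "q \<in> \<pi> ` {1..l}")
 case True
 then obtain k where k: "k \<in> {1..l}" "q = \<pi> k" by blast
 have "vdm {1..l} (%a. (v (Vx (\<pi> a)))\<^sup>2) = 0" using i k q by (intro vdm_repeated[of _ i k]) auto
 thus ?thesis by (simp add: den_def)
next
 case False
 hence z: "(\<Prod>j\<in>{1..n} - \<pi> ` {1..l}. v (Vx (\<pi> i)) + v (Vx j)) = 0"
  using q by (intro prod_zero bexI[of _ q]) auto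
 have "(\<Prod>a\<in>{1..l}. \<Prod>j\<in>{1..n} - \<pi> ` {1..l}. v (Vx (\<pi> a)) + v (Vx j)) = 0"
  by (rule prod_zero, simp, rule bexI, rule z, rule i)
 thus ?thesis by (simp add: den_def)
qed

text \<open>Like \<open>grid_vanish\<close>, with the X-variables beyond \<open>k\<close> held
  fixed; in the vanishing condition X_l is prescribed already.\<close>

lemma grid_vanish_upto:
 assumes P: "P \<in> ext_power n l" and n: "0 < n" and S: "finite S" "card S = n" and k: "k \<le> l"
  and van: "!!u. (!!a. a \<in> {1..k} ==> u (VX a) \<in> S) ==> (!!a. a \<notin> {1..k} ==> u (VX a) = v (VX a)) ==>
   (!!j. u (Vx j) = v (Vx j)) ==> ev u P = 0"
 shows "ev v P = 0"
proof -
 have "ev u P = 0" if "i \<le> k" "!!a. a \<in> {i+1..k} ==> u (VX a) \<in> S" "!!a. a \<notin> {1..k} ==> u (VX a) = v (VX a)"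
   "!!j. u (Vx j) = v (Vx j)" for i u using that
 proof (induction i arbitrary: u)
  case (Suc i)
  have "degX n (VX (Suc i)) P" using P k Suc.prems(1) by (auto simp: ext_power_iff)
  then obtain q where q: "degree q < n" "!!t. ev (u(VX (Suc i) := t)) P = poly q t" using degX_iff[OF n] by blast
  have z: "poly q t = 0" if "t \<in> S" for t unfolding q(2)[symmetric] using Suc.prems that by (intro Suc.IH) auto
  have "q = 0"
  proof (rule ccontr)
   assume q0: "q ~= 0"
   have "card S \<le> card {t. poly q t = 0}" using z by (intro card_mono[OF poly_roots_finite[OF q0]]) auto
   also have "... \<le> degree q" by (rule card_poly_roots_bound[OF q0])
   finally show False using q(1) S(2) by simp
  qed
  thus ?case using q(2)[of "u (VX (Suc i))"] by simp
 qed (use van in auto)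
 from this[of k v] show ?thesis by auto
qed

definition xdisc :: "nat => mpoly" where
 "xdisc n = (\<Prod>a\<in>{1..n}. \<Prod>b\<in>{1..n} - {a}. Var (Vx a) - Var (Vx b))"

lemma ev_xdisc: "ev v (xdisc n) = 0 \<longleftrightarrow> \<not> inj_on (pt v) {1..n}"
 by (auto simp: xdisc_def inj_on_def)

text \<open>The points of the vanishing condition are not generic; it suffices to treat those at which
 \<open>x\<^sub>1, \<dots>, x\<^sub>n\<close> are distinct.\<close>

lemma specialize_zeroI:
 assumes n: "2 \<le> n" and van: "!!v. (!!w. v w ~= 0) ==> inj_on (pt (spt s n l v)) {1..n} ==> ev (spt s n l v) P = 0"
 shows "specialize s n l P = 0"
proof -
 let ?f = "(%w. lvar w 1)(Vx n := - lvar (Vx (n - 1)) 1)"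
 let ?E = "poly_subst ?f (xdisc n)" and ?L = "specialize s n l P"
 have E: "lev v ?E = 0 \<longleftrightarrow> \<not> inj_on (pt (spt s n l v)) {1..n}" and m: "lev v (?E * ?L) = lev v ?E * lev v ?L"
  and L: "lev v ?L = ev (spt s n l v) P" if v: "!!w. v w ~= 0" for v
 proof -
  interpret eval_hom "%c. c" "ppowi v" rewrites "geval (%c. c) (ppowi v) = lev v"
   using lev_hom[OF v] by (auto simp: lev_def)
  have lv: "lev v (lvar w k) = v w powi k" for w k by (simp add: lvar_def geval_single)
  have "lev v ?E = ev (%w. lev v (?f w)) (xdisc n)" by (rule lev_poly_subst[OF v])
  moreover have "lev v (?f (Vx j)) = spt s n l v (Vx j)" for j by (simp add: spt_def lv geval_uminus)
  ultimately show "lev v ?E = 0 \<longleftrightarrow> \<not> inj_on (pt (spt s n l v)) {1..n}" by (simp only: ev_xdisc)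
  show "lev v (?E * ?L) = lev v ?E * lev v ?L" by (rule geval_mult)
  show "lev v ?L = ev (spt s n l v) P" by (rule lev_specialize[OF v])
 qed
 have "?E * ?L = 0"
 proof (rule lev_eq_0I)
  fix v :: "var => complex" assume v: "!!w. v w ~= 0"
  show "lev v (?E * ?L) = 0" unfolding m[OF v] L[OF v] using E[OF v] van[OF v] by auto
 qed
 moreover have "?E ~= 0"
 proof
  assume z: "?E = 0"
  define v :: "var => complex" where "v = (%w. case w of VX _ => 1 | Vx j => of_nat (Suc j))"
  have v: "v w ~= 0" for w unfolding v_def by (cases w) (auto simp del: of_nat_Suc)
  have x: "spt s n l v (Vx j) = (if j = n then - of_nat (Suc (n - 1)) else of_nat (Suc j))" for j
   by (simp add: spt_def v_def)
  have ne: "of_nat (Suc b) ~= (- of_nat (Suc a) :: complex)" for a b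
  proof
   assume h: "of_nat (Suc b) = (- of_nat (Suc a) :: complex)"
   have "of_nat (Suc b + Suc a) = (0 :: complex)" unfolding of_nat_add h by (rule left_minus)
   thus False unfolding of_nat_eq_0_iff by simp
  qed
  have "inj_on (pt (spt s n l v)) {1..n}"
  proof (rule inj_onI)
   fix a b assume "spt s n l v (Vx a) = spt s n l v (Vx b)"
   thus "a = b" unfolding x using ne[of a "n - 1"] ne[of b "n - 1"] ne[of "n - 1" a] ne[of "n - 1" b]
    by (auto simp del: of_nat_Suc split: if_splits)
  qed
  hence "lev v ?E ~= 0" using E[OF v] by simp
  thus False unfolding z by (simp add: lev_def geval_def)
 qed
 ultimately show ?thesis by simp
qed

text \<open>Multiplied by \<open>dpol\<close>, the value G {1..l} is symmetric in the variables
  beyond l, hence in the span of \<open>BB n l\<close> and liftable. Antisymmetrising the lift gives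
  l! equal summands.\<close>

lemma corr_poly_ex:
 assumes n: "2 \<le> n" and l: "l \<le> n" and G: "Fam n l G"
 shows "\<exists>P\<in>UU n l. corr n l P G"
proof -
 have n0: "0 < n" using n by simp
 define f where "f = G {1..l} * dpol n l"
 have "rename_x \<rho> f = f" if r: "\<rho> permutes {l + 1..n}" for \<rho>
 proof (rule ev_eqI)
  fix v
  have "\<rho> ` {1..l} = {1..l}" using permutes_not_in[OF r] by (auto simp: image_iff)
  moreover have "\<rho> permutes {1..n}" using r by (rule permutes_subset) auto
  ultimately have "ev (vp \<rho> v) (G {1..l}) = ev v (G {1..l})" using Fam_ev[OF G, of \<rho> "{1..l}" v] l by simp
  thus "ev v (rename_x \<rho> f) = ev v f" by (simp add: f_def dpol_invariant[OF r])
 qed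
 moreover have "xpoly n f" unfolding f_def by (intro xpoly_simps(3) FamD(2)[OF G] xpoly_dpol l)
 ultimately have "f \<in> Alg (egen {l + 1..n} \<union> (%j. Var (Vx j)) ` ({1..n} - {l + 1..n}))"
  by (intro symmetric_in_Alg) auto
 moreover have "egen {l + 1..n} \<union> (%j. Var (Vx j)) ` ({1..n} - {l + 1..n}) \<subseteq> Alg (egen {1..n} \<union> xs l)"
 proof (rule Un_least)
  show "egen {l + 1..n} \<subseteq> Alg (egen {1..n} \<union> xs l)"
   using esym_in_Alg[OF l] unfolding egen_def[of "{l + 1..n}"] by blast
  show "(%j. Var (Vx j)) ` ({1..n} - {l + 1..n}) \<subseteq> Alg (egen {1..n} \<union> xs l)"
   by (auto simp: xs_def intro!: Alg_gen)
 qed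
 ultimately have "f \<in> Alg (egen {1..n} \<union> xs l)" using Alg_subset by blast
 hence "liftable n l f" using Alg_span[OF l] liftable_span[OF n0 l] by blast
 then obtain P0 where P0: "P0 \<in> ext_power n l" "!!v \<pi>. \<pi> permutes {1..n} ==> (\<forall>j. v (Vx j) ~= 0) ==>
   ev (sX \<pi> v) P0 = (\<Sum>\<sigma> | \<sigma> permutes {1..l}. of_int (sign \<sigma>) *
    ((\<Prod>a\<in>{1..l}. inverse (v (Vx ((\<pi> \<circ> \<sigma>) a))) ^ (n - 1)) * ev (vp (\<pi> \<circ> \<sigma>) v) f))"
  using liftable_antisymmetrize[OF n0 l] by blast
 define P where "P = const (1 / fact l) * P0"
 have PE: "P \<in> ext_power n l" unfolding P_def using ext_power_lin(2)[OF _ P0(1) P0(1)] n0 by blast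
 \<comment> \<open>Proved for all points with non-zero x_j and not just for generic ones, since the
   vanishing condition lives where x_q = - x_p.\<close>
 have val: "ev (sX \<pi> v) P = ev v (G (\<pi> ` {1..l})) * den n l \<pi> v"
  if p: "\<pi> permutes {1..n}" and v: "\<forall>j. v (Vx j) ~= 0" for \<pi> v
 proof -
  have "of_int (sign \<sigma>) * ((\<Prod>a\<in>{1..l}. inverse (v (Vx ((\<pi> \<circ> \<sigma>) a))) ^ (n - 1)) * ev (vp (\<pi> \<circ> \<sigma>) v) f)
    = ev v (G (\<pi> ` {1..l})) * den n l \<pi> v" if s: "\<sigma> \<in> {\<sigma>. \<sigma> permutes {1..l}}" for \<sigma>
  proof -
   have s: "\<sigma> permutes {1..l}" using s by simp
   have "\<sigma> permutes {1..n}" using s by (rule permutes_subset) (use l in auto)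
   hence ps: "\<pi> \<circ> \<sigma> permutes {1..n}" using p by (rule permutes_compose)
   have im: "(\<pi> \<circ> \<sigma>) ` {1..l} = \<pi> ` {1..l}" unfolding image_comp[symmetric] permutes_image[OF s] ..
   have 1: "ev (vp (\<pi> \<circ> \<sigma>) v) (G {1..l}) = ev v (G (\<pi> ` {1..l}))"
    using Fam_ev[OF G ps, of "{1..l}" v] l im by simp
   have 2: "(\<Prod>a\<in>{1..l}. inverse (v (Vx ((\<pi> \<circ> \<sigma>) a))) ^ (n - 1)) * ev (vp (\<pi> \<circ> \<sigma>) v) (dpol n l) =
     of_int (sign \<sigma>) * den n l \<pi> v" unfolding dpol_den[OF ps l] by (rule den_permutes[OF s])
   have 3: "of_int (sign \<sigma>) * of_int (sign \<sigma>) = (1 :: complex)" by (simp add: sign_def)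
   have f: "ev (vp (\<pi> \<circ> \<sigma>) v) f = ev v (G (\<pi> ` {1..l})) * ev (vp (\<pi> \<circ> \<sigma>) v) (dpol n l)"
    unfolding f_def ev_simps 1 ..
   have alg: "s * (i * (g * e)) = (s * (i * e)) * g" "s * (s * d) = (s * s) * d" for s i g e d :: complex by (simp_all only: mult_ac)
   show ?thesis unfolding f alg(1) 2 unfolding alg(2) 3 by (simp only: mult_1_left mult.commute)
  qed
  hence "ev (sX \<pi> v) P0 = (\<Sum>\<sigma> | \<sigma> permutes {1..l}. ev v (G (\<pi> ` {1..l})) * den n l \<pi> v)"
   unfolding P0(2)[OF p v] by (rule sum.cong[OF refl])
  also have "... = fact l * (ev v (G (\<pi> ` {1..l})) * den n l \<pi> v)"
   using card_permutations[of "{1..l}" l] by simp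
  finally show ?thesis by (simp add: P_def)
 qed
 have corr: "corr n l P G" unfolding corr_def
 proof (intro allI impI)
  fix v s assume v: "gen n v" and s: "inj_on s {1..l}" "s ` {1..l} \<subseteq> {1..n}"
  obtain \<pi> where p: "\<pi> permutes {1..n}" "!!a. a \<in> {1..l} ==> \<pi> a = s a" using permutes_extend[OF s] by blast
  have "ev (sX s v) P = ev (sX \<pi> v) P" by (rule ext_ev_cong[OF PE]) (auto simp: evars_def p(2))
  moreover have "den n l s v = den n l \<pi> v" using p(2) by (intro den_cong) simp
  moreover have "s ` {1..l} = \<pi> ` {1..l}" by (intro image_cong refl) (simp add: p(2))
  ultimately show "ev (sX s v) P = ev v (G (s ` {1..l})) * den n l s v"
   using val[OF p(1), of v] gen_nonzero[OF v] by simp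
 qed
 have spec: "specialize s n l P = 0" if l1: "1 \<le> l" and s: "s \<in> {1, -1}" for s
 proof (rule specialize_zeroI[OF n])
  fix v :: "var => complex" assume v: "!!w. v w ~= 0" and inj: "inj_on (pt (spt s n l v)) {1..n}"
  define y where "y = spt s n l v"
  \<comment> \<open>\<open>p0\<close> is the index with X_l = 1 / x_p0, and \<open>q0\<close> the
    one with x_q0 = - x_p0.\<close>
  define p0 q0 where "p0 = (if s = 1 then n - 1 else n)" and "q0 = (if s = 1 then n else n - 1)"
  have pq: "p0 \<in> {1..n}" "q0 \<in> {1..n}" "q0 ~= p0" using n by (auto simp: p0_def q0_def)
  have ypq: "y (Vx q0) = - y (Vx p0)" "y (VX l) = inverse (y (Vx p0))"
   using n s v by (auto simp: y_def spt_def p0_def q0_def)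
  have ynz: "y (Vx j) ~= 0" for j using v by (auto simp: y_def spt_def)
  let ?S = "(%j. inverse (y (Vx j))) ` {1..n}"
  have "inj_on (%j. inverse (y (Vx j))) {1..n}"
  proof (rule inj_onI)
   fix a b assume "a \<in> {1..n}" "b \<in> {1..n}" "inverse (y (Vx a)) = inverse (y (Vx b))"
   thus "a = b" using inj_onD[OF inj, of a b] by (simp add: y_def)
  qed
  hence cS: "card ?S = n" by (simp add: card_image)
  have "ev y P = 0"
  proof (rule grid_vanish_upto[OF PE n0 _ cS])
   show "l - 1 \<le> l" by simp
   fix u assume u: "!!a. a \<in> {1..l - 1} ==> u (VX a) \<in> ?S" "!!a. a \<notin> {1..l - 1} ==> u (VX a) = y (VX a)"
    "!!j. u (Vx j) = y (Vx j)"
   have "\<forall>a\<in>{1..l - 1}. \<exists>j. j \<in> {1..n} \<and> u (VX a) = inverse (y (Vx j))" using u(1) by blast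
   then obtain t0 where t0: "!!a. a \<in> {1..l - 1} ==> t0 a \<in> {1..n} \<and> u (VX a) = inverse (y (Vx (t0 a)))"
    using bchoice[of "{1..l - 1}"] by metis
   \<comment> \<open>With \<open>p0\<close> at position l, the whole grid point is an arrangement of
     nodes, and \<open>den\<close> vanishes there because of \<open>q0\<close>.\<close>
   define t where "t a = (if a = l then p0 else t0 a)" for a
   have t: "t a \<in> {1..n} \<and> u (VX a) = inverse (y (Vx (t a)))" if a: "a \<in> {1..l}" for a
   proof (cases "a = l")
    case True
    thus ?thesis using u(2)[of l] l1 pq ypq by (simp add: t_def)
   next
    case False
    hence "a \<in> {1..l - 1}" using a by auto
    thus ?thesis using t0 False by (simp add: t_def)
   qed
   show "ev u P = 0"
   proof (cases "inj_on t {1..l}")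
    case True
    have "t ` {1..l} \<subseteq> {1..n}" using t by blast
    then obtain \<pi> where p: "\<pi> permutes {1..n}" "!!a. a \<in> {1..l} ==> \<pi> a = t a"
     using permutes_extend[OF True] by blast
    have "ev u P = ev (sX \<pi> u) P"
     by (rule ext_ev_cong[OF PE]) (use p(2) t u(3) in \<open>auto simp: evars_def\<close>)
    also have "... = ev u (G (\<pi> ` {1..l})) * den n l \<pi> u" using u(3) ynz by (intro val[OF p(1)]) simp
    also have "den n l \<pi> u = 0"
     using l1 p(2)[of l] pq ypq u(3) by (intro den_eq_0[OF p(1), of l l q0]) (auto simp: t_def)
    finally show ?thesis by simp
   next
    case False
    then obtain a b where "a \<in> {1..l}" "b \<in> {1..l}" "a ~= b" "t a = t b" by (auto simp: inj_on_def)
    thus ?thesis using t[of a] t[of b] by (intro ext_repeated[OF PE, of a b]) auto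
   qed
  qed simp
  thus "ev (spt s n l v) P = 0" by (simp add: y_def)
 qed
 have "P \<in> UU n l" unfolding UU_def using PE spec by simp
 thus ?thesis using corr by blast
qed

lemma UU_ext: "P \<in> UU n l ==> P \<in> ext_power n l"
 by (simp add: UU_def)

lemma UU_sum:
 assumes "0 < n \<or> l = 0" "!!i. i \<in> A ==> F i \<in> UU n l"
 shows "(\<Sum>i\<in>A. F i) \<in> UU n l"
proof -
 have z: "0 \<in> UU n l"
 proof -
  have "rename_x \<pi> 0 = 0" "rename_X \<pi> 0 = 0" for \<pi> by (rule ev_eqI, simp)+
  hence "0 \<in> ext_power n l" by (simp add: ext_power_iff)
  thus ?thesis by (simp add: UU_def specialize_def poly_subst_def)
 qed
 show ?thesis using assms(2)
  by (induction A rule: infinite_finite_induct) (auto simp: z intro: UU_lin(1)[OF assms(1)])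
qed

lemma homd_corr:
 assumes n: "0 < n" and P: "P \<in> UU n l" and c: "corr n l P G" and G: "!!I. homd d (G I)"
 shows "homd d P"
proof (rule homdI[of n])
 fix c :: complex and v assume c0: "c ~= 0" and "gen n v"
 \<comment> \<open>\<open>P\<close> rescaled by c, written as a combination of components so that it
   visibly lies in \<open>UU\<close>. Its family is c^d G, which is also that of c^d P.\<close>
 define Q where "Q = (\<Sum>e\<in>deg1_monom ` pkeys P. const (c powi e) * hcomp e P)"
 have evQ: "ev u Q = ev (scl c u) P" for u by (simp add: Q_def ev_scl[OF c0])
 have QU: "Q \<in> UU n l" unfolding Q_def using UU_lin(2)[OF _ comp_UU[OF P] comp_UU[OF P]] n by (intro UU_sum) blast+
 have "corr n l Q (%I. const (c powi d) * G I)" unfolding corr_def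
 proof (intro allI impI)
  fix v s assume v: "gen n v" and s: "inj_on s {1..l}" "s ` {1..l} \<subseteq> {1..n}"
  have sc: "sX s (scl c v) = scl c (sX s v)" by (rule var_fun_eqI) (simp_all add: mult.commute)
  have "ev (sX s v) Q = ev (scl c v) (G (s ` {1..l})) * den n l s (scl c v)"
   unfolding evQ sc[symmetric] by (rule corrD[OF assms(3) gen_scl[OF v c0] s])
  thus "ev (sX s v) Q = ev v (const (c powi d) * G (s ` {1..l})) * den n l s v"
   unfolding den_scl[OF c0 s] homd_ev[OF G c0] by simp
 qed
 moreover have "corr n l (const (c powi d) * P) (%I. const (c powi d) * G I)" by (rule corr_lin(2)[OF c c])
 moreover have "const (c powi d) * P \<in> UU n l" using UU_lin(2)[OF _ P P] n by blast
 ultimately have "Q = const (c powi d) * P" using corr_unique_poly[OF UU_ext[OF QU] UU_ext n] by blast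
 thus "ev (scl c v) P = c powi d * ev v P" using evQ[of v] by simp
qed

lemma Fam_const: "Fam n l (%I. if I \<subseteq> {1..n} \<and> card I = l then const k else 0)"
 unfolding Fam_def
proof (intro conjI allI impI)
 fix \<pi> I assume p: "\<pi> permutes {1..n}" and I: "I \<subseteq> {1..n}"
 have "\<pi> ` I \<subseteq> {1..n}" using permutes_image[OF p] I by blast
 moreover have "card (\<pi> ` I) = card I" by (intro card_image inj_on_subset[OF permutes_inj[OF p]]) simp
 moreover have "rename_x \<pi> (const k) = const k" "rename_x \<pi> 0 = 0" by (rule ev_eqI, simp)+
 ultimately show "rename_x \<pi> (if I \<subseteq> {1..n} \<and> card I = l then const k else 0) =
   (if \<pi> ` I \<subseteq> {1..n} \<and> card (\<pi> ` I) = l then const k else 0)" using I by simp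
qed auto

text \<open>The constant family comes from some element of \<open>UU\<close> of degree 0, and
  uniqueness identifies it with \<open>Q\<close>. This replaces a direct check of the vanishing
  condition for Xi1 and Xi2.\<close>

lemma corrc_UU:
 assumes n: "2 \<le> n" and l: "l \<le> n" and Q: "Q \<in> ext_power n l" "corrc n l Q k"
 shows "Q \<in> UU n l" "homd 0 Q"
proof -
 let ?G = "%I. if I \<subseteq> {1..n} \<and> card I = l then const k else 0"
 obtain P where P: "P \<in> UU n l" "corr n l P ?G" using corr_poly_ex[OF n l Fam_const] by blast
 have "corr n l Q ?G" unfolding corr_def
 proof (intro allI impI)
  fix v s assume v: "gen n v" and s: "inj_on s {1..l}" "s ` {1..l} \<subseteq> {1..n}"
  hence "ev (sX s v) Q = k * den n l s v" using Q(2) by (simp add: corrc_def)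
  thus "ev (sX s v) Q = ev v (?G (s ` {1..l})) * den n l s v" using s card_image[OF s(1)] by simp
 qed
 hence "P = Q" using n by (intro corr_unique_poly[OF UU_ext[OF P(1)] Q(1) _ P(2)]) auto
 thus "Q \<in> UU n l" "homd 0 Q" using P homd_corr[OF _ P, of 0] n by auto
qed

lemma Xi1_UU: "2 \<le> n ==> Xi1 n \<in> UU n 1" and Xi1_homd: "2 \<le> n ==> homd 0 (Xi1 n)"
 using corrc_UU[of n 1 "Xi1 n" 1] Xi1_ext_power Xi1_corrc by auto

lemma Xi2_UU: "2 \<le> n ==> Xi2 n \<in> UU n 2" and Xi2_homd: "2 \<le> n ==> homd 0 (Xi2 n)"
 using corrc_UU[of n 2 "Xi2 n" "-2"] Xi2_ext_power Xi2_corrc by auto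

lemma homd_wedge:
 assumes "homd d P" "homd 0 Q"
 shows "homd d (wedge p q P Q)"
proof -
 have "homd d (of_int (sign \<sigma>) * rename_X \<sigma> P * rename_X (%a. \<sigma> (p + a)) Q)" for \<sigma>
  using homd_mult[OF homd_mult[OF homd_of_int homd_rename_X[OF assms(1)]] homd_rename_X[OF assms(2)]] by simp
 thus ?thesis unfolding wedge_def by (intro homd_cmult homd_sum)
qed

lemma wedge_lin:
 "wedge p q (P + P') Q = wedge p q P Q + wedge p q P' Q"
 "wedge p q (const c * P) Q = const c * wedge p q P Q"
 "wedge p q 0 Q = 0"
proof -
 show "wedge p q (P + P') Q = wedge p q P Q + wedge p q P' Q"
  by (simp only: wedge_def rename_X_add distrib_left distrib_right sum.distrib)
 show s: "wedge p q (const c * P) Q = const c * wedge p q P Q" for c P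
  by (simp only: wedge_def rename_X_mult rename_X_const sum_distrib_left mult_ac)
 show "wedge p q 0 Q = 0" using s[of 0 0] by simp
qed

lemma Fam_cmult: "Fam n l G ==> Fam n l (%I. const c * G I)"
 unfolding Fam_def
proof (elim conjE, intro conjI allI impI)
 fix \<pi> I assume "\<forall>\<pi> I. \<pi> permutes {1..n} --> I \<subseteq> {1..n} --> rename_x \<pi> (G I) = G (\<pi> ` I)" "\<pi> permutes {1..n}" "I \<subseteq> {1..n}"
 hence "rename_x \<pi> (G I) = G (\<pi> ` I)" by blast
 moreover have "rename_x \<pi> (const c * G I) = const c * rename_x \<pi> (G I)" by (rule ev_eqI) simp
 ultimately show "rename_x \<pi> (const c * G I) = const c * G (\<pi> ` I)" by simp
qed auto

lemma wedge1_fam: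
 assumes G: "Fam n p G" and c: "corr n p P G"
 shows "\<exists>H. Fam n (Suc p) H \<and> corr n (Suc p) (wedge p 1 P (Xi1 n)) H \<and>
  (\<forall>v I. gen n v --> ev v (H I) = (-1) ^ p * generic_point.opE {1..n} (pt v) (%_. 1) (%I. ev v (G I)) I)"
proof -
 have "rename_x \<pi> 1 = 1" for \<pi> by (rule ev_eqI) simp
 then obtain H where H: "Fam n (Suc p) H" "!!v I. gen n v ==>
  ev v (H I) = generic_point.opE {1..n} (pt v) (%a. ev v 1) (%I. ev v (G I)) I"
  using opE_Fam[OF G, of "%_. 1"] by auto
 let ?H = "%I. const ((-1) ^ p) * H I"
 have e: "ev v (?H I) = (-1) ^ p * generic_point.opE {1..n} (pt v) (%_. 1) (%I. ev v (G I)) I" if "gen n v" for v I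
  using H(2)[OF that, of I] by simp
 moreover have "corr n (Suc p) (wedge p 1 P (Xi1 n)) ?H" unfolding corr_def
 proof (intro allI impI)
  fix v s assume v: "gen n v" and s: "inj_on s {1..Suc p}" "s ` {1..Suc p} \<subseteq> {1..n}"
  show "ev (sX s v) (wedge p 1 P (Xi1 n)) = ev v (?H (s ` {1..Suc p})) * den n (Suc p) s v"
   using ev_wedge1[OF c Xi1_corrc v s[unfolded Suc_eq_plus1]] unfolding e[OF v] Suc_eq_plus1 by (simp only: mult_ac mult_1_left)
 qed
 ultimately show ?thesis using Fam_cmult[OF H(1)] by blast
qed

lemma E2_support:
 assumes "gen n v" and g: "!!I. \<not> (I \<subseteq> {1..n} \<and> card I = p) ==> g I = 0" and I: "\<not> (I \<subseteq> {1..n} \<and> card I = p + 2)"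
 shows "generic_point.E2 {1..n} (pt v) g I = 0"
proof -
 interpret generic_point "{1..n}" "pt v" using gen_point assms(1) .
 show ?thesis
 proof (cases "I \<subseteq> {1..n}")
  case True
  hence "finite I" using finite_subset by blast
  have "g (I - {b, b'}) = 0" if "b \<in> I" "b' \<in> I - {b}" for b b'
  proof (rule g)
   have "card (I - {b, b'}) = card I - 2" using that \<open>finite I\<close> by (subst card_Diff_subset) auto
   moreover have "card {b, b'} \<le> card I" using that \<open>finite I\<close> by (intro card_mono) auto
   ultimately show "\<not> (I - {b, b'} \<subseteq> {1..n} \<and> card (I - {b, b'}) = p)" using I True that by auto
  qed
  thus ?thesis unfolding E2_alt[OF True] by simp
 next
  case False
  thus ?thesis by (simp add: E2_def eps_def)
 qed
qed

lemma set_enum_ex: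
 fixes n l :: nat
 assumes "I \<subseteq> {1..n}" "card I = l"
 shows "\<exists>s. inj_on s {1..l} \<and> s ` {1..l} = I"
proof -
 have "finite I" using assms(1) finite_subset by blast
 then obtain s where "bij_betw s {1..l} I" using finite_same_card_bij[of "{1..l}" I] assms(2) by auto
 thus ?thesis by (auto simp: bij_betw_def)
qed

text \<open>The family of the wedge product exists because the product lies in \<open>UU\<close>;
  comparing values then shows that \<open>E2\<close> preserves polynomial families.\<close>

lemma wedge2_fam:
 assumes n: "2 \<le> n" and p: "p + 2 \<le> n" and P: "P \<in> UU n p" and G: "Fam n p G" and c: "corr n p P G"
 shows "\<exists>H. Fam n (p + 2) H \<and> corr n (p + 2) (wedge p 2 P (Xi2 n)) H \<and>
  (\<forall>v I. gen n v --> ev v (H I) = - 2 * generic_point.E2 {1..n} (pt v) (%I. ev v (G I)) I)"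
proof -
 obtain H where H: "Fam n (p + 2) H" "corr n (p + 2) (wedge p 2 P (Xi2 n)) H"
  using corr_fam_ex[OF wedge_UU[OF n P Xi2_UU[OF n]] n p] by blast
 have "ev v (H I) = - 2 * generic_point.E2 {1..n} (pt v) (%I. ev v (G I)) I" if v: "gen n v" for v I
 proof (cases "I \<subseteq> {1..n} \<and> card I = p + 2")
  case True
  then obtain s where s: "inj_on s {1..p + 2}" "s ` {1..p + 2} = I" using set_enum_ex by blast
  hence s2: "s ` {1..p + 2} \<subseteq> {1..n}" using True by simp
  have "ev v (H I) * den n (p + 2) s v = (- 2 * generic_point.E2 {1..n} (pt v) (%I. ev v (G I)) I) * den n (p + 2) s v"
   using ev_wedge2[OF c Xi2_corrc v s(1) s2] corrD[OF H(2) v s(1) s2] unfolding s(2) by (simp only: mult_ac)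
  thus ?thesis by (rule mult_right_cancel[OF den_nz[OF v s(1) s2], THEN iffD1])
 next
  case False
  have "ev v (G I) = 0" if "\<not> (I \<subseteq> {1..n} \<and> card I = p)" for I using FamD(1)[OF G that] by simp
  thus ?thesis using E2_support[OF v _ False, of "%I. ev v (G I)"] FamD(1)[OF H(1) False] by simp
 qed
 thus ?thesis using H by blast
qed

section \<open>The elementary symmetric polynomials form a regular sequence\<close>

definition supp :: "nat => (nat => nat) set" where
 "supp n = {m. \<forall>i. i \<notin> {1..n} --> m i = 0}"

definition Mset :: "nat => nat => (nat => nat) set" where
 "Mset n d = {m \<in> supp n. (\<Sum>i\<in>{1..n}. m i) = d}"

text \<open>The products of elementary symmetric polynomials and Artin's monomials, indexed by the
 exponents of the monomials: both are bases of the polynomial ring, with matching degrees.\<close>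

definition bb :: "nat => (nat => nat) => mpoly" where
 "bb n m = (\<Prod>i\<in>{1..n}. esym {1..n} i ^ (m i div i) * Var (Vx (n + 1 - i)) ^ (m i mod i))"

text \<open>Linear independence of an indexed family; unlike \<open>mp.independent\<close> for its
  image it excludes repetitions.\<close>

definition LI :: "'i set => ('i => mpoly) => bool" where
 "LI M b \<longleftrightarrow> (\<forall>c. (\<Sum>m\<in>M. const (c m) * b m) = 0 --> (\<forall>m\<in>M. c m = 0))"

lemma LID:
 assumes "LI M b" "(\<Sum>m\<in>M. const (c m) * b m) = 0" "m \<in> M"
 shows "c m = 0"
 using assms by (simp add: LI_def)

lemma LI_iff:
 assumes M: "finite M"
 shows "LI M b \<longleftrightarrow> inj_on b M \<and> mp.independent (b ` M)"
proof
 assume L: "LI M b"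
 have inj: "inj_on b M"
 proof (rule inj_onI, rule ccontr)
  fix m m' assume m: "m \<in> M" "m' \<in> M" "b m = b m'" "m ~= m'"
  let ?c = "%k. if k = m then 1 else if k = m' then -1 else (0 :: complex)"
  have "(\<Sum>k\<in>M. const (?c k) * b k) = (\<Sum>k\<in>M. (if k = m then b m else 0) + (if k = m' then - b m else 0))"
  proof (rule sum.cong[OF refl])
   fix k
   have "const (- 1) * b m = - b m" by (rule ev_eqI) simp
   thus "const (?c k) * b k = (if k = m then b m else 0) + (if k = m' then - b m else 0)" using m(3,4) by auto
  qed
  also have "... = 0" using m M by (simp add: sum.distrib)
  finally have "?c m = 0" by (rule LID[OF L _ m(1)])
  thus False by simp
 qed
 moreover have "mp.independent (b ` M)" unfolding mp.dependent_finite[OF finite_imageI[OF M]]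
 proof
  assume "\<exists>u. (\<exists>v\<in>b ` M. u v ~= 0) \<and> (\<Sum>v\<in>b ` M. const (u v) * v) = 0"
  then obtain u where u: "\<exists>v\<in>b ` M. u v ~= 0" "(\<Sum>v\<in>b ` M. const (u v) * v) = 0" by blast
  hence "(\<Sum>m\<in>M. const (u (b m)) * b m) = 0" by (simp add: sum.reindex[OF inj])
  moreover obtain m where "m \<in> M" "u (b m) ~= 0" using u(1) by blast
  ultimately show False using LID[OF L, of "%m. u (b m)" m] by simp
 qed
 ultimately show "inj_on b M \<and> mp.independent (b ` M)" by blast
next
 assume A: "inj_on b M \<and> mp.independent (b ` M)"
 hence inj: "inj_on b M" by blast
 show "LI M b" unfolding LI_def
 proof (intro allI impI ballI, rule ccontr)
  fix c m assume s: "(\<Sum>m\<in>M. const (c m) * b m) = 0" and m: "m \<in> M" and cm: "c m ~= 0"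
  let ?u = "%v. c (the_inv_into M b v)"
  have "(\<Sum>v\<in>b ` M. const (?u v) * v) = (\<Sum>m\<in>M. const (?u (b m)) * b m)"
   by (rule sum.reindex[OF inj, unfolded o_def])
  also have "... = (\<Sum>m\<in>M. const (c m) * b m)"
   by (rule sum.cong[OF refl]) (simp only: the_inv_into_f_f[OF inj])
  finally have "(\<Sum>v\<in>b ` M. const (?u v) * v) = 0" unfolding s .
  moreover have "?u (b m) ~= 0" unfolding the_inv_into_f_f[OF inj m] by (rule cm)
  ultimately have "mp.dependent (b ` M)"
   unfolding mp.dependent_finite[OF finite_imageI[OF M]] using imageI[OF m, of b]
   by (intro exI[of _ ?u] conjI bexI[of _ "b m"])
  thus False using A by blast
 qed
qed

text \<open>A dimension count: a maximal independent subset of \<open>b\<close>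
  M\<open>has at least\<close>card M\<open>elements, hence is all of\<close>b \<open>M\<close>
  without repetition.\<close>

lemma LI_counting:
 assumes M: "finite M" and x: "LI M x" and sp: "x ` M \<subseteq> mp.span (b ` M)"
 shows "LI M b"
proof -
 have x': "inj_on x M" "mp.independent (x ` M)" using x LI_iff[OF M] by auto
 obtain B where B: "B \<subseteq> b ` M" "mp.independent B" "b ` M \<subseteq> mp.span B"
  by (rule mp.maximal_independent_subset)
 have fB: "finite B" using B(1) M finite_subset by blast
 have "mp.span (b ` M) \<subseteq> mp.span B" by (rule mp.span_minimal[OF B(3) mp.subspace_span])
 hence "card (x ` M) \<le> card B" using mp.independent_span_bound[OF fB x'(2)] sp by blast
 hence "card M \<le> card B" by (simp add: card_image[OF x'(1)])
 moreover have "card B \<le> card (b ` M)" using B(1) M by (intro card_mono) auto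
 moreover have "card (b ` M) \<le> card M" by (rule card_image_le[OF M])
 ultimately have c: "card (b ` M) = card M" "card B = card (b ` M)" by simp_all
 hence "B = b ` M" using B(1) M by (intro card_subset_eq) auto
 thus ?thesis using LI_iff[OF M] B(2) eq_card_imp_inj_on[OF M c(1)] by simp
qed

lemma finite_Mset: "finite (Mset n d)"
proof (rule finite_subset)
 show "Mset n d \<subseteq> {f. \<forall>i. (i \<in> {1..n} --> f i \<in> {..d}) \<and> (i \<notin> {1..n} --> f i = 0)}"
  using member_le_sum[of _ "{1..n}"] by (fastforce simp: Mset_def supp_def)
 show "finite {f. \<forall>i. (i \<in> {1..n} --> f i \<in> {..d}) \<and> (i \<notin> {1..n} --> f i = (0::nat))}"
  by (rule finite_set_of_finite_funs) auto
qed

text \<open>Induction on the variables: the terms that share the exponent of \<open>m0\<close> in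
  \<open>a\<close> form one coefficient of a Laurent polynomial in that variable.\<close>

lemma characters_LI:
 fixes e :: "'i => nat => nat"
 assumes "finite A" "finite M"
  and "!!m m'. m \<in> M ==> m' \<in> M ==> (!!i. i \<in> A ==> e m i = e m' i) ==> m = m'"
  and "!!z. (!!i. z i ~= 0) ==> (\<Sum>m\<in>M. c m * (\<Prod>i\<in>A. z i ^ e m i)) = (0 :: complex)"
  and "m0 \<in> M"
 shows "c m0 = 0"
 using assms
proof (induction A arbitrary: M rule: finite_induct)
 case empty
 have "M = {m0}" using empty(2,4) by auto
 thus ?case using empty(3)[of "%_. 1"] by simp
next
 case (insert a A)
 let ?M = "{m \<in> M. e m a = e m0 a}"
 show ?case
 proof (rule insert.IH[of ?M])
  show "finite ?M" "m0 \<in> ?M" using insert.prems by auto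
  fix m m' assume "m \<in> ?M" "m' \<in> ?M" "!!i. i \<in> A ==> e m i = e m' i"
  thus "m = m'" by (intro insert.prems(2)) auto
 next
  fix z :: "nat => complex" assume z: "!!i. z i ~= 0"
  let ?h = "%m. c m * (\<Prod>i\<in>A. z i ^ e m i)"
  let ?E = "(%m. int (e m a)) ` M"
  have "\<forall>k\<in>?E. (\<Sum>m | m \<in> M \<and> int (e m a) = k. ?h m) = 0"
  proof (rule laurent_zero)
   fix t :: complex assume t: "t ~= 0"
   have "(\<Prod>i\<in>A. (z(a := t)) i ^ e m i) = (\<Prod>i\<in>A. z i ^ e m i)" for m
    using insert.hyps by (intro prod.cong) auto
   hence "c m * (\<Prod>i\<in>insert a A. (z(a := t)) i ^ e m i) = t powi int (e m a) * ?h m" for m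
    unfolding prod.insert[OF insert.hyps] by simp
   note eqn = this
   have "(\<Sum>m\<in>M. c m * (\<Prod>i\<in>insert a A. (z(a := t)) i ^ e m i)) = 0"
    by (rule insert.prems(3)) (use z t in auto)
   hence "(\<Sum>m\<in>M. t powi int (e m a) * ?h m) = 0" by (simp only: eqn)
   hence "(\<Sum>k\<in>?E. \<Sum>m | m \<in> M \<and> int (e m a) = k. t powi int (e m a) * ?h m) = 0"
    using sum.image_gen[OF insert.prems(1), of "%m. t powi int (e m a) * ?h m" "%m. int (e m a)"] by simp
   moreover have "(\<Sum>m | m \<in> M \<and> int (e m a) = k. t powi int (e m a) * ?h m) =
     t powi k * (\<Sum>m | m \<in> M \<and> int (e m a) = k. ?h m)" for k
    unfolding sum_distrib_left by (rule sum.cong) auto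
   ultimately show "(\<Sum>k\<in>?E. t powi k * (\<Sum>m | m \<in> M \<and> int (e m a) = k. ?h m)) = 0" by simp
  qed (use insert.prems in simp)
  thus "(\<Sum>m\<in>?M. ?h m) = 0" using insert.prems(4) by auto
 qed
qed

lemma LI_xmon: "LI (Mset n d) (xmon n)"
 unfolding LI_def
proof (intro allI impI ballI)
 fix c m0 assume z: "(\<Sum>m\<in>Mset n d. const (c m) * xmon n m) = 0" and m0: "m0 \<in> Mset n d"
 show "c m0 = 0"
 proof (rule characters_LI[of "{1..n}" "Mset n d" "%m. m", OF _ finite_Mset _ _ m0])
  fix m m' assume m: "m \<in> Mset n d" "m' \<in> Mset n d" "!!i. i \<in> {1..n} ==> m i = m' i"
  show "m = m'"
  proof
   fix i show "m i = m' i" using m by (cases "i \<in> {1..n}") (auto simp: Mset_def supp_def)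
  qed
 next
  fix z :: "nat => complex"
  define v where "v = (%w. case w of VX _ => 1 | Vx j => z j)"
  have "ev v (\<Sum>m\<in>Mset n d. const (c m) * xmon n m) = 0" unfolding \<open>(\<Sum>m\<in>Mset n d. const (c m) * xmon n m) = 0\<close> by simp
  thus "(\<Sum>m\<in>Mset n d. c m * (\<Prod>i\<in>{1..n}. z i ^ m i)) = 0" by (simp add: xmon_def v_def)
 qed simp
qed

lemma homd_xmon: "m \<in> Mset n d ==> homd (int d) (xmon n m)"
proof -
 assume m: "m \<in> Mset n d"
 have "homd (\<Sum>i\<in>{1..n}. int (m i) * 1) (xmon n m)"
  unfolding xmon_def by (intro homd_prod homd_power homd_Var_x)
 moreover have "(\<Sum>i\<in>{1..n}. int (m i) * 1) = int d" using m by (simp add: Mset_def flip: of_nat_sum)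
 ultimately show ?thesis by simp
qed

lemma homd_bb: "homd (int (\<Sum>i\<in>{1..n}. m i)) (bb n m)"
proof -
 have "homd (\<Sum>i\<in>{1..n}. int (m i div i) * int i + int (m i mod i) * 1) (bb n m)"
  unfolding bb_def by (intro homd_prod homd_mult homd_power homd_Var_x homd_esym) simp
 moreover have "int (m i div i) * int i + int (m i mod i) * 1 = int (m i)" for i
  by (metis div_mult_mod_eq mult.right_neutral of_nat_add of_nat_mult)
 ultimately show ?thesis by (simp only: of_nat_sum)
qed

lemma BB_bb: "BB n n \<subseteq> bb n ` supp n"
proof
 fix P assume "P \<in> BB n n"
 then obtain \<alpha> \<kappa> where P: "P = emon n \<alpha> * xmon n \<kappa>" and \<kappa>: "!!a. a \<in> {1..n} ==> \<kappa> a + a \<le> n"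
  by (auto simp: BB_def)
 \<comment> \<open>Division with remainder by \<open>i\<close>: the quotient is the exponent of the
   i-th elementary symmetric polynomial, and the remainder that of x_{n+1-i}, which is less than
   \<open>i\<close> by Artin's bound.\<close>
 define m where "m i = (if i \<in> {1..n} then i * \<alpha> i + \<kappa> (n + 1 - i) else 0)" for i
 have d: "m i div i = \<alpha> i" "m i mod i = \<kappa> (n + 1 - i)" if i: "i \<in> {1..n}" for i
 proof -
  have "n + 1 - i \<in> {1..n}" using i by auto
  hence "\<kappa> (n + 1 - i) < i" using \<kappa>[of "n + 1 - i"] i by auto
  thus "m i div i = \<alpha> i" "m i mod i = \<kappa> (n + 1 - i)" using i by (simp_all add: m_def)
 qed
 have "xmon n \<kappa> = (\<Prod>i\<in>{1..n}. Var (Vx (n + 1 - i)) ^ \<kappa> (n + 1 - i))"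
  unfolding xmon_def by (subst prod.atLeastAtMost_rev) (simp add: add.commute)
 hence "bb n m = P" unfolding P emon_def bb_def prod.distrib[symmetric] by (simp add: d prod.distrib)
 moreover have "m \<in> supp n" by (auto simp: supp_def m_def)
 ultimately show "P \<in> bb n ` supp n" by blast
qed

lemma span_bb: "xpoly n P ==> P \<in> mp.span (bb n ` supp n)"
proof -
 assume P: "xpoly n P"
 have "xs n \<subseteq> Alg (egen {1..n} \<union> xs n)" by (auto intro: Alg_gen)
 hence "P \<in> Alg (egen {1..n} \<union> xs n)" using Alg_subset xpoly_Alg[OF P] unfolding xs_def by blast
 hence "P \<in> mp.span (BB n n)" by (rule Alg_span[OF order_refl])
 thus ?thesis using mp.span_mono[OF BB_bb] by blast
qed

lemma hcomp_cmult: "hcomp d (const c * P) = const c * hcomp d P"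
 using comp_commute[of "%P. const c * P" 0 d P] homd_cmult by (simp add: distrib_left)

lemma hcomp_bb: "hcomp (int d) (bb n m) = (if (\<Sum>i\<in>{1..n}. m i) = d then bb n m else 0)"
 using comp_homd[OF homd_bb[where n = n and m = m], where d = "int d"] unfolding of_nat_eq_iff by auto

lemma hcomp_span_bb:
 assumes "P \<in> mp.span (bb n ` supp n)"
 shows "hcomp (int d) P \<in> mp.span (bb n ` Mset n d)"
 using assms
proof (induction rule: mp.span_induct_alt)
 case base
 show ?case by (simp add: mp.span_zero)
next
 case (step c x y)
 then obtain m where m: "x = bb n m" "m \<in> supp n" by blast
 have "hcomp (int d) x \<in> mp.span (bb n ` Mset n d)"
  unfolding m(1) hcomp_bb using m(2) by (auto intro!: mp.span_base mp.span_zero simp: Mset_def)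
 thus ?case unfolding comp_add hcomp_cmult by (intro mp.span_add mp.span_scale step)
qed

lemma xpoly_xmon: "l \<le> n ==> xpoly n (xmon l m)"
 unfolding xmon_def by (intro xpoly_simps(7) xpoly_simps(5) xpoly_simps(13)) auto

text \<open>In each degree the products \<open>bb\<close> span the monomials and carry the same
  index set, so they are independent by counting.\<close>

lemma LI_bb_degree: "LI (Mset n d) (bb n)"
proof (rule LI_counting[OF finite_Mset LI_xmon])
 show "xmon n ` Mset n d \<subseteq> mp.span (bb n ` Mset n d)"
 proof
  fix P assume "P \<in> xmon n ` Mset n d"
  then obtain m where m: "P = xmon n m" "m \<in> Mset n d" by blast
  hence "hcomp (int d) P = P" using comp_homd[OF homd_xmon[OF m(2)], of "int d"] by simp
  thus "P \<in> mp.span (bb n ` Mset n d)"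
   using hcomp_span_bb[OF span_bb[OF xpoly_xmon[OF order_refl]], of d n m] m(1) by simp
 qed
qed

text \<open>The homogeneous component of a relation in the degree of \<open>m0\<close> is a relation
  covered by \<open>LI_bb_degree\<close>.\<close>

lemma LI_bb:
 assumes F: "finite F" "F \<subseteq> supp n"
 shows "LI F (bb n)"
 unfolding LI_def
proof (intro allI impI ballI)
 fix c m0 assume z: "(\<Sum>m\<in>F. const (c m) * bb n m) = 0" and m0: "m0 \<in> F"
 define d where "d = (\<Sum>i\<in>{1..n}. m0 i)"
 let ?c = "%m. if m \<in> F then c m else 0"
 have "(\<Sum>m\<in>Mset n d. const (?c m) * bb n m) = (\<Sum>m\<in>F. const (c m) * hcomp (int d) (bb n m))"
 proof (rule sum.mono_neutral_cong)
  fix m assume "m \<in> F - Mset n d"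
  thus "const (c m) * hcomp (int d) (bb n m) = 0" using F by (auto simp: hcomp_bb Mset_def)
 next
  fix m assume "m \<in> Mset n d \<inter> F"
  thus "const (?c m) * bb n m = const (c m) * hcomp (int d) (bb n m)" by (simp add: hcomp_bb Mset_def)
 qed (use F finite_Mset in auto)
 also have "... = hcomp (int d) (\<Sum>m\<in>F. const (c m) * bb n m)" by (simp add: comp_sum hcomp_cmult)
 also have "... = 0" unfolding z by simp
 finally have z0: "(\<Sum>m\<in>Mset n d. const (?c m) * bb n m) = 0" .
 have "m0 \<in> Mset n d" using F m0 by (auto simp: Mset_def d_def)
 from LID[OF LI_bb_degree z0 this] show "c m0 = 0" using m0 by simp
qed

lemma span_family:
 assumes "P \<in> mp.span (b ` A)"
 shows "\<exists>F c. finite F \<and> F \<subseteq> A \<and> P = (\<Sum>m\<in>F. const (c m) * b m)"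
 using assms
proof (induction rule: mp.span_induct_alt)
 case base
 show ?case by (intro exI[of _ "{}"]) simp
next
 case (step k x y)
 then obtain m0 F c where m0: "x = b m0" "m0 \<in> A" and F: "finite F" "F \<subseteq> A" "y = (\<Sum>m\<in>F. const (c m) * b m)"
  by blast
 let ?c = "%m. (if m \<in> F then c m else 0) + (if m = m0 then k else 0)"
 have "(\<Sum>m\<in>insert m0 F. const (?c m) * b m) =
   (\<Sum>m\<in>insert m0 F. if m \<in> F then const (c m) * b m else 0) + (\<Sum>m\<in>insert m0 F. if m = m0 then const k * b m else 0)"
  unfolding sum.distrib[symmetric] by (rule sum.cong[OF refl]) (auto simp: const_add distrib_right)
 also have "(\<Sum>m\<in>insert m0 F. if m \<in> F then const (c m) * b m else 0) = y"
  unfolding F(3) using F(1) by (intro sum.mono_neutral_cong_right) auto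
 also have "(\<Sum>m\<in>insert m0 F. if m = m0 then const k * b m else 0) = const k * x" using F(1) by (simp add: m0)
 finally have "const k * x + y = (\<Sum>m\<in>insert m0 F. const (?c m) * b m)" by (simp only: add.commute)
 thus ?case using F m0 by (intro exI[of _ "insert m0 F"] exI[of _ ?c]) auto
qed

text \<open>On the basis \<open>bb\<close>, multiplication by an elementary symmetric polynomial is
  a shift of one index; regularity thus becomes a matter of index sets.\<close>

lemma esym_bb:
 assumes i: "i \<in> {1..n}"
 shows "esym {1..n} i * bb n m = bb n (m(i := m i + i))"
proof -
 let ?t = "%m j. esym {1..n} j ^ (m j div j) * Var (Vx (n + 1 - j)) ^ (m j mod j)"
 have s: "bb n m = ?t m i * (\<Prod>j\<in>{1..n} - {i}. ?t m j)" for m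
  unfolding bb_def by (rule prod.remove[OF _ i]) simp
 have "(\<Prod>j\<in>{1..n} - {i}. ?t (m(i := m i + i)) j) = (\<Prod>j\<in>{1..n} - {i}. ?t m j)"
  by (rule prod.cong) auto
 moreover have "?t (m(i := m i + i)) i = esym {1..n} i * ?t m i" using i by (simp add: power_add mult_ac)
 ultimately show ?thesis unfolding s by (simp only: mult.assoc)
qed

text \<open>The ideal generated by \<open>K\<close> is spanned by the \<open>bb n m\<close> with m i
  \<ge> i for some i in \<open>K\<close>. Multiplication by e_k shifts another coordinate
  injectively, so it maps the remaining basis elements to remaining ones, and their coefficients in
  \<open>g\<close> must vanish.\<close>

lemma esym_regular:
 assumes K: "K \<subseteq> {1..n}" and k: "k \<in> {1..n}" "k \<notin> K" and g: "xpoly n g"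
  and S: "!!i. i \<in> K ==> xpoly n (S i)"
  and eq: "esym {1..n} k * g = (\<Sum>i\<in>K. esym {1..n} i * S i)"
 shows "\<exists>H. (\<forall>i\<in>K. xpoly n (H i)) \<and> g = (\<Sum>i\<in>K. esym {1..n} i * H i)"
proof -
 have fK: "finite K" using K finite_subset by blast
 define J where "J = {P. \<exists>H. (\<forall>i\<in>K. xpoly n (H i)) \<and> P = (\<Sum>i\<in>K. esym {1..n} i * H i)}"
 define good where "good = {m \<in> supp n. \<exists>i\<in>K. i \<le> m i}"
 have J_add: "P + Q \<in> J" if PQ: "P \<in> J" "Q \<in> J" for P Q
 proof -
  obtain H H' where "\<forall>i\<in>K. xpoly n (H i)" "P = (\<Sum>i\<in>K. esym {1..n} i * H i)"
   "\<forall>i\<in>K. xpoly n (H' i)" "Q = (\<Sum>i\<in>K. esym {1..n} i * H' i)" using PQ unfolding J_def by blast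
  thus ?thesis unfolding J_def
   by (intro CollectI exI[of _ "%i. H i + H' i"]) (simp add: distrib_left sum.distrib)
 qed
 have J_mult: "Q * P \<in> J" if PQ: "P \<in> J" "xpoly n Q" for P Q
 proof -
  obtain H where "\<forall>i\<in>K. xpoly n (H i)" "P = (\<Sum>i\<in>K. esym {1..n} i * H i)" using PQ unfolding J_def by blast
  thus ?thesis unfolding J_def using PQ(2)
   by (intro CollectI exI[of _ "%i. Q * H i"]) (simp add: sum_distrib_left mult_ac)
 qed
 have J_0: "0 \<in> J" unfolding J_def by (intro CollectI exI[of _ "%_. 0"]) simp
 have J_sum: "(\<Sum>m\<in>A. F m) \<in> J" if "!!m. m \<in> A ==> F m \<in> J" for F and A :: "(nat => nat) set"
  using that by (induction A rule: infinite_finite_induct) (auto intro: J_add J_0)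
 have xbb: "xpoly n (bb n m)" for m
  unfolding bb_def by (intro xpoly_simps(7) xpoly_simps(3) xpoly_simps(5) xpoly_esym xpoly_simps(13)) auto
 have good_J: "bb n m \<in> J" if m: "m \<in> good" for m
 proof -
  obtain i where i: "i \<in> K" "i \<le> m i" using m by (auto simp: good_def)
  have "bb n m = esym {1..n} i * bb n (m(i := m i - i))" using i K by (subst esym_bb) auto
  also have "... = (\<Sum>j\<in>K. if j = i then esym {1..n} i * bb n (m(i := m i - i)) else 0)" using i fK by simp
  also have "... = (\<Sum>j\<in>K. esym {1..n} j * (if j = i then bb n (m(i := m i - i)) else 0))"
   by (rule sum.cong) auto
  finally show ?thesis unfolding J_def using xbb
   by (intro CollectI exI[of _ "%j. if j = i then bb n (m(i := m i - i)) else 0"]) simp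
 qed
 have J_span: "P \<in> mp.span (bb n ` good)" if P: "P \<in> J" for P
 proof -
  obtain H where H: "\<forall>i\<in>K. xpoly n (H i)" "P = (\<Sum>i\<in>K. esym {1..n} i * H i)" using P unfolding J_def by blast
  have "H i * esym {1..n} i \<in> mp.span (bb n ` good)" if i: "i \<in> K" for i
  proof (rule span_mult)
   show "H i \<in> mp.span (bb n ` supp n)" using H(1) i span_bb by blast
   fix b assume "b \<in> bb n ` supp n"
   then obtain m where m: "b = bb n m" "m \<in> supp n" by blast
   have "b * esym {1..n} i = bb n (m(i := m i + i))" using esym_bb[of i n m] i K m(1) by (auto simp: mult.commute)
   moreover have "m(i := m i + i) \<in> good" using m(2) i K by (auto simp: good_def supp_def)
   ultimately show "b * esym {1..n} i \<in> mp.span (bb n ` good)" by (auto intro: mp.span_base)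
  qed
  thus ?thesis unfolding H(2) by (intro mp.span_sum) (simp add: mult.commute)
 qed
 obtain F c where F: "finite F" "F \<subseteq> supp n" "g = (\<Sum>m\<in>F. const (c m) * bb n m)"
  using span_family[OF span_bb[OF g]] by blast
 let ?g1 = "\<Sum>m\<in>F \<inter> good. const (c m) * bb n m" and ?G2 = "F - good"
 let ?g2 = "\<Sum>m\<in>?G2. const (c m) * bb n m"
 have g12: "g = ?g1 + ?g2" unfolding F(3) by (rule sum.Int_Diff[OF F(1)])
 have g1: "?g1 \<in> J" by (intro J_sum J_mult good_J) auto
 let ?sh = "%m :: nat => nat. m(k := m k + k)"
 have "esym {1..n} k * g \<in> J" unfolding eq J_def using S by blast
 moreover have "const (- 1) * (esym {1..n} k * ?g1) \<in> J" by (intro J_mult g1) auto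
 ultimately have "esym {1..n} k * g + const (- 1) * (esym {1..n} k * ?g1) \<in> J" by (rule J_add)
 moreover have "esym {1..n} k * g + const (- 1) * (esym {1..n} k * ?g1) = esym {1..n} k * ?g2"
  by (rule ev_eqI) (simp add: g12 distrib_left)
 ultimately have "esym {1..n} k * ?g2 \<in> J" by (simp only:)
 note sp = span_family[OF J_span[OF this]]
 then obtain F' c' where F': "finite F'" "F' \<subseteq> good" "esym {1..n} k * ?g2 = (\<Sum>m\<in>F'. const (c' m) * bb n m)"
  using sp by blast
 have e2: "esym {1..n} k * ?g2 = (\<Sum>m\<in>?G2. const (c m) * bb n (?sh m))" unfolding sum_distrib_left
 proof (rule sum.cong[OF refl])
  fix m
  show "esym {1..n} k * (const (c m) * bb n m) = const (c m) * bb n (?sh m)"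
   unfolding esym_bb[OF k(1), of m, symmetric] by (simp only: mult_ac)
 qed
 have inj: "inj_on ?sh ?G2"
 proof (rule inj_onI)
  fix m m' assume h: "?sh m = ?sh m'"
  show "m = m'"
  proof
   fix i show "m i = m' i" using fun_cong[OF h, of i] by (cases "i = k") auto
  qed
 qed
 have disj: "?sh m \<notin> good" "?sh m \<in> supp n" if m: "m \<in> ?G2" for m
  using m F(2) k by (auto simp: good_def supp_def)
 \<comment> \<open>The difference of the two expansions of e_k times \<open>?g2\<close>, written as
   a single relation; the index sets are disjoint.\<close>
 let ?d = "%m. if m \<in> F' then c' m else - c (m(k := m k - k))"
 let ?F = "F' \<union> ?sh ` ?G2"
 have "(\<Sum>m\<in>?F. const (?d m) * bb n m) = (\<Sum>m\<in>F'. const (?d m) * bb n m) + (\<Sum>m\<in>?sh ` ?G2. const (?d m) * bb n m)"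
  using F F' disj by (intro sum.union_disjoint) auto
 also have "(\<Sum>m\<in>F'. const (?d m) * bb n m) = (\<Sum>m\<in>?G2. const (c m) * bb n (?sh m))"
  unfolding e2[symmetric] F'(3) by (rule sum.cong[OF refl]) simp
 also have "(\<Sum>m\<in>?sh ` ?G2. const (?d m) * bb n m) = (\<Sum>m\<in>?G2. const (?d (?sh m)) * bb n (?sh m))"
  by (rule sum.reindex[OF inj, unfolded o_def])
 also have "... = (\<Sum>m\<in>?G2. const (- c m) * bb n (?sh m))" using F'(2) disj by (intro sum.cong) auto
 also have "(\<Sum>m\<in>?G2. const (c m) * bb n (?sh m)) + (\<Sum>m\<in>?G2. const (- c m) * bb n (?sh m)) = 0"
  unfolding sum.distrib[symmetric] by (rule sum.neutral) (simp add: distrib_right[symmetric] const_add[symmetric])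
 finally have z: "(\<Sum>m\<in>?F. const (?d m) * bb n m) = 0" .
 have "?F \<subseteq> supp n"
 proof (rule Un_least)
  show "F' \<subseteq> supp n" using F'(2) unfolding good_def by blast
  show "?sh ` ?G2 \<subseteq> supp n" using disj(2) by (rule image_subsetI)
 qed
 moreover have "finite ?F" by (rule finite_UnI[OF F'(1) finite_imageI[OF finite_Diff[OF F(1)]]])
 ultimately have "finite ?F" "?F \<subseteq> supp n" by simp_all
 note dz = LID[OF LI_bb[OF this] z]
 have "c m = 0" if m: "m \<in> ?G2" for m
 proof -
  have "?sh m \<in> ?F" by (rule UnI2[OF imageI[OF m]])
  from dz[OF this] have 1: "?d (?sh m) = 0" .
  have "?sh m \<notin> F'" using disj(1)[OF m] F'(2) by blast
  with 1 show ?thesis by simp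
 qed
 hence "?g2 = 0" by (intro sum.neutral) simp
 hence "g \<in> J" using g12 g1 by simp
 thus ?thesis unfolding J_def by blast
qed

lemma rename_x_mult: "rename_x \<pi> (P * Q) = rename_x \<pi> P * rename_x \<pi> Q"
 by (rule ev_eqI) simp

lemma rename_x_sum: "rename_x \<pi> (\<Sum>i\<in>A. F i) = (\<Sum>i\<in>A. rename_x \<pi> (F i))"
 by (rule ev_eqI) simp

lemma rename_x_const: "rename_x \<pi> (const c) = const c"
 by (rule ev_eqI) simp

lemma rename_x_esym_full: "\<pi> permutes {1..n} ==> rename_x \<pi> (esym {1..n} k) = esym {1..n} k"
 using rename_x_esym[OF _ permutes_inj, of "{1..n}" \<pi>] permutes_image[of \<pi> "{1..n}"] by simp

lemma Fam_add: "Fam n l G ==> Fam n l H ==> Fam n l (%I. G I + H I)"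
 unfolding Fam_def by (simp add: rename_x_add)

lemma Fam_0: "Fam n l (%I. 0)"
 unfolding Fam_def using rename_x_const[of _ 0] by simp

lemma Fam_sum: "(!!i. i \<in> A ==> Fam n l (H i)) ==> Fam n l (%I. \<Sum>i\<in>A. H i I)"
 by (induction A rule: infinite_finite_induct) (auto simp: Fam_0 intro: Fam_add)

lemma Fam_esym: "Fam n l H ==> Fam n l (%I. esym {1..n} k * H I)"
 unfolding Fam_def by (simp add: rename_x_mult rename_x_esym_full)

text \<open>Averaging over the stabiliser of \<open>{1..l}\<close> makes the coefficients from
  \<open>esym_regular\<close> invariant, hence values of families; it commutes with multiplication
  by e_i and fixes \<open>G {1..l}\<close>.\<close>

lemma Fam_regular:
 assumes l: "l \<le> n" and K: "K \<subseteq> {1..n}" and k: "k \<in> {1..n}" "k \<notin> K" and G: "Fam n l G"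
  and S: "!!i I. i \<in> K ==> xpoly n (S i I)"
  and eq: "!!I. esym {1..n} k * G I = (\<Sum>i\<in>K. esym {1..n} i * S i I)"
 shows "\<exists>H. (\<forall>i\<in>K. Fam n l (H i)) \<and> (\<forall>I. G I = (\<Sum>i\<in>K. esym {1..n} i * H i I))"
proof -
 have fK: "finite K" using K finite_subset by blast
 let ?I = "{1..l}"
 obtain H where H: "\<forall>i\<in>K. xpoly n (H i)" "G ?I = (\<Sum>i\<in>K. esym {1..n} i * H i)"
  using esym_regular[OF K k FamD(2)[OF G] S eq[of ?I]] by blast
 define \<Gamma> where "\<Gamma> = {\<pi>. \<pi> permutes {1..n} \<and> \<pi> ` ?I = ?I}"
 have f\<Gamma>: "finite \<Gamma>" unfolding \<Gamma>_def by (rule finite_subset[OF _ finite_permutations[of "{1..n}"]]) auto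
 have "id \<in> \<Gamma>" by (simp add: \<Gamma>_def permutes_id)
 hence c\<Gamma>: "card \<Gamma> ~= 0" using f\<Gamma> by auto
 define av where "av h = const (1 / of_nat (card \<Gamma>)) * (\<Sum>\<pi>\<in>\<Gamma>. rename_x \<pi> h)" for h
 have "Inv n l (av h)" if h: "xpoly n h" for h unfolding Inv_def
 proof (intro conjI allI impI)
  show "xpoly n (av h)" unfolding av_def
   using h xpoly_rename by (intro xpoly_simps(3) xpoly_simps(6) xpoly_simps(8)) (auto simp: \<Gamma>_def)
  fix \<rho> assume r: "\<rho> permutes {1..n}" "\<rho> ` ?I = ?I"
  have ri: "inv_into UNIV \<rho> ` ?I = ?I"
  proof -
   have "inv_into UNIV \<rho> ` \<rho> ` ?I = ?I" using permutes_inj[OF r(1)] by (simp add: image_comp permutes_inv_o[OF r(1)])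
   thus ?thesis unfolding r(2) .
  qed
  have "rename_x \<rho> (av h) = const (1 / of_nat (card \<Gamma>)) * (\<Sum>\<pi>\<in>\<Gamma>. rename_x (\<rho> \<circ> \<pi>) h)"
   by (simp only: av_def rename_x_mult rename_x_const rename_x_sum rename_x_comp)
  also have "(\<Sum>\<pi>\<in>\<Gamma>. rename_x (\<rho> \<circ> \<pi>) h) = (\<Sum>\<pi>\<in>\<Gamma>. rename_x \<pi> h)"
  proof (rule sum.reindex_bij_witness[of _ "%\<pi>. inv_into UNIV \<rho> \<circ> \<pi>" "%\<pi>. \<rho> \<circ> \<pi>"])
   fix \<pi> assume "\<pi> \<in> \<Gamma>"
   hence p: "\<pi> permutes {1..n}" "\<pi> ` ?I = ?I" by (auto simp: \<Gamma>_def)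
   show "inv_into UNIV \<rho> \<circ> (\<rho> \<circ> \<pi>) = \<pi>" "\<rho> \<circ> (inv_into UNIV \<rho> \<circ> \<pi>) = \<pi>"
    by (simp_all add: o_assoc permutes_inv_o[OF r(1)])
   show "\<rho> \<circ> \<pi> \<in> \<Gamma>" "inv_into UNIV \<rho> \<circ> \<pi> \<in> \<Gamma>"
    unfolding \<Gamma>_def mem_Collect_eq image_comp[symmetric] p(2) r(2) ri
    using permutes_compose[OF p(1) r(1)] permutes_compose[OF p(1) permutes_inv[OF r(1)]] by simp_all
  qed simp
  finally show "rename_x \<rho> (av h) = av h" by (simp only: av_def)
 qed
 hence "\<forall>i\<in>K. \<exists>H'. Fam n l H' \<and> H' ?I = av (H i)" using H(1) Fam_ex[OF _ l] by blast
 then obtain H' where H': "\<forall>i\<in>K. Fam n l (H' i) \<and> H' i ?I = av (H i)" using bchoice by metis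
 have ae: "av (esym {1..n} i * h) = esym {1..n} i * av h" for i h
 proof -
  have "(\<Sum>\<pi>\<in>\<Gamma>. rename_x \<pi> (esym {1..n} i * h)) = (\<Sum>\<pi>\<in>\<Gamma>. esym {1..n} i * rename_x \<pi> h)"
   by (rule sum.cong[OF refl]) (simp add: \<Gamma>_def rename_x_mult rename_x_esym_full)
  thus ?thesis by (simp only: av_def sum_distrib_left mult_ac)
 qed
 have as: "av (\<Sum>i\<in>K. F i) = (\<Sum>i\<in>K. av (F i))" for F :: "nat => mpoly"
  unfolding av_def rename_x_sum sum_distrib_left by (rule sum.swap)
 have "av (G ?I) = G ?I"
 proof (rule ev_eqI)
  fix v
  have "ev (vp \<pi> v) (G ?I) = ev v (G ?I)" if "\<pi> \<in> \<Gamma>" for \<pi>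
   using Fam_ev[OF G, of \<pi> ?I v] that l by (simp add: \<Gamma>_def)
  thus "ev v (av (G ?I)) = ev v (G ?I)" using c\<Gamma> by (simp add: av_def)
 qed
 hence "G ?I = (\<Sum>i\<in>K. esym {1..n} i * av (H i))" using arg_cong[OF H(2), of av] by (simp add: as ae)
 also have "... = (\<Sum>i\<in>K. esym {1..n} i * H' i ?I)" using H' by (intro sum.cong) auto
 finally have "G = (%I. \<Sum>i\<in>K. esym {1..n} i * H' i I)"
  using H' by (intro Fam_eqI[OF G] Fam_sum Fam_esym) auto
 thus ?thesis using H' by (intro exI[of _ H']) (auto dest: fun_cong)
qed

section \<open>Exactness of multiplication by the first operator\<close>

lemma poly_eqI_nonzero:
 fixes p q :: "complex poly"
 assumes "!!s. s ~= 0 ==> poly p s = poly q s"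
 shows "p = q"
proof -
 have "poly ([:0, 1:] * (p - q)) s = poly 0 s" for s using assms[of s] by (cases "s = 0") simp_all
 hence "[:0, 1:] * (p - q) = 0" by (simp only: poly_eq_poly_eq_iff[symmetric] fun_eq_iff) simp
 thus ?thesis by simp
qed

context generic_point begin

lemma prod_scale:
 assumes "finite S" "s ~= (0 :: complex)"
 shows "s ^ card S * (\<Prod>b\<in>S. y b + 1 / s) = (\<Prod>b\<in>S. 1 + s * y b)"
proof -
 have "s ^ card S * (\<Prod>b\<in>S. y b + 1 / s) = (\<Prod>b\<in>S. s * (y b + 1 / s))" by (simp add: prod.distrib)
 also have "... = (\<Prod>b\<in>S. 1 + s * y b)" using assms by (intro prod.cong refl) (simp add: field_simps)
 finally show ?thesis .
qed

text \<open>The coefficient of s^k in \<open>partial_fractions\<close> with X = 1 / s and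
  denominators cleared. For odd k, e_k(-x) = - e_k(x), so both sides acquire a factor 2.\<close>

lemma sum_\<gamma>_es:
 assumes k: "odd k"
 shows "(\<Sum>a\<in>N. x a * es (N - {a}) (k - 1) x * \<gamma> a) = es N k x"
proof -
 let ?C = "%a. \<Prod>b\<in>N - {a}. [:1, - x b:]"
 have "(\<Prod>b\<in>N. [:1, x b:]) = (\<Prod>b\<in>N. [:1, - x b:]) + (\<Sum>a\<in>N. Polynomial.smult (2 * x a * \<gamma> a) (pCons 0 (?C a)))"
 proof (rule poly_eqI_nonzero)
  fix s :: complex assume s: "s ~= 0"
  have c: "s ^ card N * (\<Prod>b\<in>N - {a}. - x b + 1 / s) = s * (\<Prod>b\<in>N - {a}. 1 + s * - x b)" if "a \<in> N" for a
  proof -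
   have "s ^ card N = s * s ^ card (N - {a})" unfolding card.remove[OF finite_N that] by (rule power_Suc)
   thus ?thesis by (simp only: mult.assoc prod_scale[OF finite_Diff[OF finite_N] s])
  qed
  have "poly (\<Prod>b\<in>N. [:x b, 1:]) (1 / s) = poly ((\<Prod>b\<in>N. [:- x b, 1:]) +
   (\<Sum>a\<in>N. Polynomial.smult (2 * x a * w a (N - {a})) (\<Prod>b\<in>N - {a}. [:- x b, 1:]))) (1 / s)"
   by (simp only: partial_fractions[OF order_refl])
  hence "(\<Prod>b\<in>N. x b + 1 / s) = (\<Prod>b\<in>N. - x b + 1 / s) +
   (\<Sum>a\<in>N. 2 * x a * \<gamma> a * (\<Prod>b\<in>N - {a}. - x b + 1 / s))"
   by (simp add: poly_prod poly_sum \<gamma>_def)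
  hence "s ^ card N * (\<Prod>b\<in>N. x b + 1 / s) = s ^ card N * (\<Prod>b\<in>N. - x b + 1 / s) +
   (\<Sum>a\<in>N. 2 * x a * \<gamma> a * (s ^ card N * (\<Prod>b\<in>N - {a}. - x b + 1 / s)))"
   by (simp add: distrib_left sum_distrib_left mult_ac)
  also have "(\<Sum>a\<in>N. 2 * x a * \<gamma> a * (s ^ card N * (\<Prod>b\<in>N - {a}. - x b + 1 / s))) =
    (\<Sum>a\<in>N. 2 * x a * \<gamma> a * (s * (\<Prod>b\<in>N - {a}. 1 + s * - x b)))"
   by (rule sum.cong[OF refl]) (simp only: c)
  finally have e: "(\<Prod>b\<in>N. 1 + s * x b) = (\<Prod>b\<in>N. 1 + s * - x b) +
    (\<Sum>a\<in>N. 2 * x a * \<gamma> a * (s * (\<Prod>b\<in>N - {a}. 1 + s * - x b)))"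
   unfolding prod_scale[OF finite_N s] .
  have p: "poly [:1, c:] s = 1 + s * c" for c by simp
  have q: "poly (pCons 0 r) s = s * poly r s" for r by simp
  show "poly (\<Prod>b\<in>N. [:1, x b:]) s = poly ((\<Prod>b\<in>N. [:1, - x b:]) +
    (\<Sum>a\<in>N. Polynomial.smult (2 * x a * \<gamma> a) (pCons 0 (?C a)))) s"
   unfolding poly_prod poly_add poly_sum poly_smult q p by (rule e)
 qed
 hence "poly.coeff (\<Prod>b\<in>N. [:1, x b:]) k = poly.coeff ((\<Prod>b\<in>N. [:1, - x b:]) +
   (\<Sum>a\<in>N. Polynomial.smult (2 * x a * \<gamma> a) (pCons 0 (?C a)))) k" by (rule arg_cong)
 moreover obtain j where j: "k = Suc j" using k by (cases k) auto
 ultimately have "es N k x = es N k (%b. - x b) + (\<Sum>a\<in>N. 2 * x a * \<gamma> a * es (N - {a}) j (%b. - x b))"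
  by (simp add: es_def coeff_sum)
 hence "es N k x = - es N k x + (\<Sum>a\<in>N. 2 * x a * \<gamma> a * es (N - {a}) j x)"
  using k j by (simp add: es_uminus)
 hence "2 * es N k x = 2 * (\<Sum>a\<in>N. x a * es (N - {a}) (k - 1) x * \<gamma> a)"
  by (simp add: j sum_distrib_left mult_ac)
 thus ?thesis by simp
qed

lemma op_lin:
 "opE K (%I. g I + h I) J = opE K g J + opE K h J"
 "opE K (%I. c * g I) J = c * opE K g J"
 "opE K (%I. \<Sum>i\<in>A. d i * F i I) J = (\<Sum>i\<in>A. d i * opE K (F i) J)"
 "opF K (%I. g I + h I) J = opF K g J + opF K h J"
 "opF K (%I. \<Sum>i\<in>A. d i * F i I) J = (\<Sum>i\<in>A. d i * opF K (F i) J)"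
proof -
 show "opE K (%I. \<Sum>i\<in>A. d i * F i I) J = (\<Sum>i\<in>A. d i * opE K (F i) J)"
  unfolding opE_def eps_lin(5) eps_lin(4) sum_distrib_left by (subst sum.swap) (simp add: mult_ac)
 show "opF K (%I. \<Sum>i\<in>A. d i * F i I) J = (\<Sum>i\<in>A. d i * opF K (F i) J)"
  unfolding opF_def phi_lin(5) phi_lin(4) sum_distrib_left by (subst sum.swap) (simp add: mult_ac)
qed (simp_all add: opE_def opF_def eps_lin phi_lin distrib_left sum.distrib sum_distrib_left mult_ac)

lemma E2_cmult: "E2 (%I. c * g I) J = c * E2 g J"
 by (simp add: E2_def eps_lin sum_distrib_left mult_ac)

end

text \<open>Chosen so that the anticommutator of \<open>E1\<close> with \<open>opF\<close> for these
  coefficients is e_k, by \<open>sum_\<gamma>_es\<close>.\<close>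

definition hK :: "nat => nat => nat => mpoly" where
 "hK n k a = Var (Vx a) * esym ({1..n} - {a}) (k - 1)"

text \<open>The choice is determined, since polynomials are fixed by their generic values; for
  families \<open>EE_Fam\<close> supplies a witness.\<close>

definition EE :: "nat => (nat set => mpoly) => nat set => mpoly" where
 "EE n G I = (SOME P. \<forall>v. gen n v --> ev v P = generic_point.opE {1..n} (pt v) (%_. 1) (%I. ev v (G I)) I)"

definition FF :: "nat => nat => (nat set => mpoly) => nat set => mpoly" where
 "FF n k G I = (SOME P. \<forall>v. gen n v -->
   ev v P = generic_point.opF {1..n} (pt v) (%a. ev v (hK n k a)) (%I. ev v (G I)) I)"

lemma some_family:
 assumes "Fam n l H" "!!v I. gen n v ==> ev v (H I) = \<Phi> v I"
 shows "(%I. SOME P. \<forall>v. gen n v --> ev v P = \<Phi> v I) = H"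
proof
 fix I
 have "\<forall>v. gen n v --> ev v (SOME P. \<forall>v. gen n v --> ev v P = \<Phi> v I) = \<Phi> v I"
  by (rule someI[of "%P. \<forall>v. gen n v --> ev v P = \<Phi> v I" "H I"]) (simp add: assms(2))
 thus "(SOME P. \<forall>v. gen n v --> ev v P = \<Phi> v I) = H I" using assms(2) by (intro ev_eqI_gen[of n]) simp
qed

lemma EE_Fam:
 assumes G: "Fam n l G"
 shows "Fam n (Suc l) (EE n G)"
  and "gen n v ==> ev v (EE n G I) = generic_point.opE {1..n} (pt v) (%_. 1) (%I. ev v (G I)) I"
proof -
 have "rename_x \<pi> 1 = 1" for \<pi> by (rule ev_eqI) simp
 then obtain H where H: "Fam n (Suc l) H" "!!v I. gen n v ==>
  ev v (H I) = generic_point.opE {1..n} (pt v) (%_. 1) (%I. ev v (G I)) I"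
  using opE_Fam[OF G, of "%_. 1"] by auto
 have "EE n G = H" using some_family[OF H] by (simp add: EE_def[abs_def])
 thus "Fam n (Suc l) (EE n G)"
  "gen n v ==> ev v (EE n G I) = generic_point.opE {1..n} (pt v) (%_. 1) (%I. ev v (G I)) I"
  using H by auto
qed

lemma FF_Fam:
 assumes G: "Fam n (Suc l) G"
 shows "Fam n l (FF n k G)"
  and "gen n v ==> ev v (FF n k G I) = generic_point.opF {1..n} (pt v) (%a. ev v (hK n k a)) (%I. ev v (G I)) I"
proof -
 have "xpoly n (hK n k a)" if "a \<in> {1..n}" for a
  unfolding hK_def using that by (intro xpoly_simps(3) xpoly_esym xpoly_simps(13)) auto
 moreover have "rename_x \<pi> (hK n k a) = hK n k (\<pi> a)" if p: "\<pi> permutes {1..n}" and a: "a \<in> {1..n}" for \<pi> a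
 proof -
  have "\<pi> ` ({1..n} - {a}) = {1..n} - {\<pi> a}"
   using permutes_image[OF p] image_set_diff[OF permutes_inj[OF p], of "{1..n}" "{a}"] by simp
  moreover have "rename_x \<pi> (Var (Vx a)) = Var (Vx (\<pi> a))" by (rule ev_eqI) simp
  ultimately show ?thesis
   unfolding hK_def rename_x_mult using rename_x_esym[OF _ permutes_inj[OF p], of "{1..n} - {a}"] by simp
 qed
 ultimately obtain H where H: "Fam n l H" "!!v I. gen n v ==>
  ev v (H I) = generic_point.opF {1..n} (pt v) (%a. ev v (hK n k a)) (%I. ev v (G I)) I"
  using opF_Fam[OF G, of "hK n k"] by blast
 have "FF n k G = H" using some_family[OF H] by (simp add: FF_def[abs_def])
 thus "Fam n l (FF n k G)"
  "gen n v ==> ev v (FF n k G I) = generic_point.opF {1..n} (pt v) (%a. ev v (hK n k a)) (%I. ev v (G I)) I"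
  using H by auto
qed

lemma Fam_supported: "Fam n l G ==> gen n v ==> generic_point.supported {1..n} (%I. ev v (G I))"
 using FamD(1)[of n l G] by (simp add: generic_point.supported_def[OF gen_point])

text \<open>\<open>{E\<^sub>1, h\<^sub>k} = e\<^sub>k\<close>: every \<open>e\<^sub>k\<close> with odd \<open>k\<close> is null-homotopic.\<close>

lemma homotopy:
 assumes G: "Fam n l G" and v: "gen n v" and k: "odd k"
 shows "generic_point.opE {1..n} (pt v) (%_. 1) (generic_point.opF {1..n} (pt v) (%a. ev v (hK n k a)) (%I. ev v (G I))) I =
  ev v (esym {1..n} k) * ev v (G I) -
  generic_point.opF {1..n} (pt v) (%a. ev v (hK n k a)) (generic_point.opE {1..n} (pt v) (%_. 1) (%I. ev v (G I))) I"
proof -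
 interpret generic_point "{1..n}" "pt v" using gen_point v .
 have "(\<Sum>a\<in>{1..n}. ev v (hK n k a) * \<gamma> a) = ev v (esym {1..n} k)"
  using sum_\<gamma>_es[OF k] by (simp add: hK_def ev_esym)
 thus ?thesis using E1_opF[OF Fam_supported[OF G v], of "%a. ev v (hK n k a)" I] by simp
qed

text \<open>In degree 0 only the zero family counts, so exactness there means injectivity of
  \<open>E1\<close>.\<close>

definition boundary :: "nat => nat => (nat set => mpoly) => bool" where
 "boundary n j T \<longleftrightarrow> T = (%I. 0) \<or> (\<exists>i R. j = Suc i \<and> Fam n i R \<and> T = EE n R)"

lemma boundary_cycle:
 assumes "boundary n j T" "gen n v"
 shows "generic_point.opE {1..n} (pt v) (%_. 1) (%I. ev v (T I)) J = 0"
proof -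
 interpret generic_point "{1..n}" "pt v" using gen_point assms(2) .
 from assms(1) consider "T = (%I. 0)" | i R where "Fam n i R" "T = EE n R" unfolding boundary_def by blast
 thus ?thesis
 proof cases
  case 1
  thus ?thesis by (simp add: opE_def eps_lin)
 next
  case 2
  have "(%I. ev v (T I)) = E1 (%I. ev v (R I))" unfolding 2(2) by (rule ext) (rule EE_Fam(2)[OF 2(1) assms(2)])
  thus ?thesis by (simp add: E1_E1)
 qed
qed

definition odds :: "nat => nat set" where "odds n = {k \<in> {1..n}. odd k}"

text \<open>Exactness is proved modulo a set \<open>K\<close> of odd e_i, so that the induction can
  lower the degree while \<open>K\<close> grows. For a fresh odd k, the homotopy h_k sends a cycle
  \<open>G\<close> modulo \<open>K\<close> to a cycle \<open>T0\<close> modulo K and e_k, one degree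
  lower. The cardinality condition guarantees fresh indices down to degree 0.\<close>

lemma Koszul:
 assumes "j \<le> n" "K \<subseteq> odds n" "card K + j < card (odds n)" "Fam n j G" "!!i. i \<in> K ==> Fam n (Suc j) (S i)"
  and "!!v I. gen n v ==> generic_point.opE {1..n} (pt v) (%_. 1) (%I. ev v (G I)) I = (\<Sum>i\<in>K. ev v (esym {1..n} i) * ev v (S i I))"
 shows "\<exists>T H. boundary n j T \<and> (\<forall>i\<in>K. Fam n j (H i)) \<and> (\<forall>I. G I = T I + (\<Sum>i\<in>K. esym {1..n} i * H i I))"
 using assms
proof (induction j arbitrary: K G S)
 case 0
 have K: "K \<subseteq> {1..n}" using 0(2) by (auto simp: odds_def)
 have fO: "finite (odds n)" by (simp add: odds_def)
 have "K ~= odds n" using 0(3) by auto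
 then obtain k where k: "k \<in> odds n" "k \<notin> K" using 0(2) by blast
 hence k': "k \<in> {1..n}" "odd k" by (auto simp: odds_def)
 have "esym {1..n} k * G I = (\<Sum>i\<in>K. esym {1..n} i * FF n k (S i) I)" for I
 proof (rule ev_eqI_gen[of n])
  fix v assume v: "gen n v"
  interpret generic_point "{1..n}" "pt v" using gen_point v .
  let ?g = "%I. ev v (G I)" and ?h = "%a. ev v (hK n k a)"
  \<comment> \<open>The homotopy lowers degree 0 to nothing, so only the term with \<open>E1\<close>
    applied first remains, and it lies in the ideal of \<open>K\<close>.\<close>
  have "opF ?h ?g J = 0" for J
  proof -
   have "phi a ?g J = 0" for a
   proof (cases "a \<in> {1..n} \<and> J \<subseteq> {1..n}")
    case True
    hence "finite (insert a J)" using finite_subset[of J "{1..n}"] by auto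
    hence "card (insert a J) ~= 0" by simp
    hence "\<not> (insert a J \<subseteq> {1..n} \<and> card (insert a J) = 0)" by blast
    from FamD(1)[OF 0(4) this] show ?thesis by (simp add: phi_def)
   qed (auto simp: phi_def)
   thus ?thesis by (simp add: opF_def)
  qed
  hence "E1 (opF ?h ?g) I = 0" by (simp add: opE_def eps_def)
  hence "ev v (esym {1..n} k) * ?g I = opF ?h (E1 ?g) I" using homotopy[OF 0(4) v k'(2), of I] by simp
  also have "E1 ?g = (%I. \<Sum>i\<in>K. ev v (esym {1..n} i) * ev v (S i I))" by (rule ext) (rule 0(6)[OF v])
  also have "opF ?h ... I = (\<Sum>i\<in>K. ev v (esym {1..n} i) * opF ?h (%I. ev v (S i I)) I)" by (rule op_lin(5))
  also have "... = (\<Sum>i\<in>K. ev v (esym {1..n} i) * ev v (FF n k (S i) I))"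
   by (rule sum.cong[OF refl]) (simp only: FF_Fam(2)[OF 0(5) v])
  finally show "ev v (esym {1..n} k * G I) = ev v (\<Sum>i\<in>K. esym {1..n} i * FF n k (S i) I)" by simp
 qed
 moreover have "xpoly n (FF n k (S i) I)" if "i \<in> K" for i I using FamD(2)[OF FF_Fam(1)[OF 0(5)[OF that]]] .
 ultimately obtain H where "\<forall>i\<in>K. Fam n 0 (H i)" "\<forall>I. G I = (\<Sum>i\<in>K. esym {1..n} i * H i I)"
  using Fam_regular[OF _ K k'(1) k(2) 0(4), of "%i. FF n k (S i)"] by blast
 thus ?case by (intro exI[of _ "%I. 0"] exI[of _ H]) (simp add: boundary_def)
next
 case (Suc j)
 have K: "K \<subseteq> {1..n}" using Suc.prems(2) by (auto simp: odds_def)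
 have fO: "finite (odds n)" by (simp add: odds_def)
 hence fK: "finite K" using Suc.prems(2) finite_subset by blast
 have "K ~= odds n" using Suc.prems(3) by auto
 then obtain k where k: "k \<in> odds n" "k \<notin> K" using Suc.prems(2) by blast
 hence k': "k \<in> {1..n}" "odd k" by (auto simp: odds_def)
 note G = Suc.prems(4) and S = Suc.prems(5)
 let ?e = "%i. esym {1..n} i"
 define T0 where "T0 = FF n k G"
 \<comment> \<open>The boundary of \<open>T0\<close> is e_k G minus the homotopy applied to the
   boundary of \<open>G\<close>; these are its coefficients at e_k and at the e_i.\<close>
 define S' where "S' i = (if i = k then G else (%I. const (-1) * FF n k (S i) I))" for i
 have T0: "Fam n j T0" unfolding T0_def by (rule FF_Fam(1)[OF G])
 have S': "Fam n (Suc j) (S' i)" if "i \<in> insert k K" for i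
 proof (cases "i = k")
  case True
  thus ?thesis using G by (simp add: S'_def)
 next
  case False
  hence "Fam n (Suc j) (%I. const (-1) * FF n k (S i) I)" using that by (intro Fam_cmult FF_Fam(1) S) simp
  thus ?thesis unfolding S'_def if_not_P[OF False] .
 qed
 have eq: "generic_point.opE {1..n} (pt v) (%_. 1) (%I. ev v (T0 I)) I = (\<Sum>i\<in>insert k K. ev v (?e i) * ev v (S' i I))"
  and key: "ev v (?e k) * ev v (G I) = generic_point.opE {1..n} (pt v) (%_. 1) (%I. ev v (T0 I)) I +
    (\<Sum>i\<in>K. ev v (?e i) * ev v (FF n k (S i) I))"
  if v: "gen n v" for v I
 proof -
  interpret generic_point "{1..n}" "pt v" using gen_point v .
  let ?g = "%I. ev v (G I)" and ?h = "%a. ev v (hK n k a)"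
  have t: "(%I. ev v (T0 I)) = opF ?h ?g" unfolding T0_def by (rule ext) (rule FF_Fam(2)[OF G v])
  have "E1 ?g = (%I. \<Sum>i\<in>K. ev v (?e i) * ev v (S i I))" by (rule ext) (rule Suc.prems(6)[OF v])
  hence "opF ?h (E1 ?g) I = (\<Sum>i\<in>K. ev v (?e i) * opF ?h (%I. ev v (S i I)) I)" by (simp only: op_lin(5))
  also have "... = (\<Sum>i\<in>K. ev v (?e i) * ev v (FF n k (S i) I))"
   by (rule sum.cong[OF refl]) (simp only: FF_Fam(2)[OF S v])
  finally have h: "E1 (opF ?h ?g) I = ev v (?e k) * ?g I - (\<Sum>i\<in>K. ev v (?e i) * ev v (FF n k (S i) I))"
   using homotopy[OF G v k'(2), of I] by simp
  thus "ev v (?e k) * ev v (G I) = E1 (%I. ev v (T0 I)) I +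
    (\<Sum>i\<in>K. ev v (?e i) * ev v (FF n k (S i) I))" unfolding t by simp
  have "(\<Sum>i\<in>K. ev v (?e i) * ev v (S' i I)) = - (\<Sum>i\<in>K. ev v (?e i) * ev v (FF n k (S i) I))"
   unfolding sum_negf[symmetric] using k by (intro sum.cong) (auto simp: S'_def)
  moreover have "S' k = G" by (simp add: S'_def)
  ultimately show "E1 (%I. ev v (T0 I)) I = (\<Sum>i\<in>insert k K. ev v (?e i) * ev v (S' i I))"
   unfolding t h sum.insert[OF fK k(2)] by simp
 qed
 have "card (insert k K) + j < card (odds n)" using Suc.prems(3) fK k by simp
 then obtain T H where T: "boundary n j T" and H: "\<forall>i\<in>insert k K. Fam n j (H i)"
  and TH: "!!I. T0 I = T I + (\<Sum>i\<in>insert k K. ?e i * H i I)"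
  using Suc.IH[of "insert k K" T0 S', OF _ _ _ T0 S' eq] Suc.prems(1,2) k by auto
 have Hk: "Fam n j (H k)" using H by simp
 \<comment> \<open>Applying \<open>E1\<close> to the decomposition of \<open>T0\<close> and
   comparing with \<open>key\<close> puts e_k (G - E1 H_k) into the ideal of \<open>K\<close>, where
   regularity cancels e_k.\<close>
 define G' where "G' I = G I + const (-1) * EE n (H k) I" for I
 define S2 where "S2 i I = EE n (H i) I + FF n k (S i) I" for i I
 have G': "Fam n (Suc j) G'" unfolding G'_def by (intro Fam_add G Fam_cmult EE_Fam(1)[OF Hk])
 have "?e k * G' I = (\<Sum>i\<in>K. ?e i * S2 i I)" for I
 proof (rule ev_eqI_gen[of n])
  fix v assume v: "gen n v"
  interpret generic_point "{1..n}" "pt v" using gen_point v .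
  have t: "(%I. ev v (T0 I)) = (%I. ev v (T I) + (\<Sum>i\<in>insert k K. ev v (?e i) * ev v (H i I)))" by (simp add: TH)
  have EH: "E1 (%I. ev v (H i I)) I = ev v (EE n (H i) I)" if "i \<in> insert k K" for i
   by (rule sym, rule EE_Fam(2)[OF _ v, of j]) (use H that in blast)
  have "E1 (%I. ev v (T0 I)) I = (\<Sum>i\<in>insert k K. ev v (?e i) * E1 (%I. ev v (H i I)) I)"
   unfolding t op_lin(1) op_lin(3) using boundary_cycle[OF T v, of I] by simp
  also have "... = (\<Sum>i\<in>insert k K. ev v (?e i) * ev v (EE n (H i) I))"
   by (rule sum.cong[OF refl]) (simp only: EH)
  also have "... = ev v (?e k) * ev v (EE n (H k) I) + (\<Sum>i\<in>K. ev v (?e i) * ev v (EE n (H i) I))"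
   by (rule sum.insert[OF fK k(2)])
  finally have "ev v (?e k) * ev v (G I) = ev v (?e k) * ev v (EE n (H k) I) + (\<Sum>i\<in>K. ev v (?e i) * ev v (EE n (H i) I)) +
    (\<Sum>i\<in>K. ev v (?e i) * ev v (FF n k (S i) I))" using key[OF v, of I] by simp
  thus "ev v (?e k * G' I) = ev v (\<Sum>i\<in>K. ?e i * S2 i I)"
   by (simp add: G'_def S2_def distrib_left right_diff_distrib sum.distrib)
 qed
 moreover have "xpoly n (S2 i I)" if "i \<in> K" for i I
  unfolding S2_def using FamD(2)[OF EE_Fam(1)[of n j "H i"]] FamD(2)[OF FF_Fam(1)[OF S[OF that]]] H that by (intro xpoly_simps(1)) auto
 ultimately obtain H' where H': "\<forall>i\<in>K. Fam n (Suc j) (H' i)" "\<forall>I. G' I = (\<Sum>i\<in>K. ?e i * H' i I)"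
  using Fam_regular[OF Suc.prems(1) K k'(1) k(2) G', of S2] by blast
 have "G I = EE n (H k) I + (\<Sum>i\<in>K. ?e i * H' i I)" for I
 proof -
  have "G' I = (\<Sum>i\<in>K. ?e i * H' i I)" using H'(2) by blast
  hence "EE n (H k) I + (\<Sum>i\<in>K. ?e i * H' i I) = EE n (H k) I + G' I" by (simp only:)
  also have "... = G I" by (rule ev_eqI) (simp add: G'_def)
  finally show ?thesis by (rule sym)
 qed
 moreover have "boundary n (Suc j) (EE n (H k))" unfolding boundary_def using Hk by blast
 ultimately show ?case using H'(1) by blast
qed

text \<open>The j + 1 indices 1, 3, ..., 2 j + 1 are available; this is how the range 2 (j + 1)
  \<le> n enters exactness.\<close>

lemma card_odds: "2 * (j + 1) \<le> n ==> j < card (odds n)"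
proof -
 assume j: "2 * (j + 1) \<le> n"
 have "(%i. 2 * i + 1) ` {..j} \<subseteq> odds n" using j by (auto simp: odds_def)
 hence "card ((%i. 2 * i + 1) ` {..j}) \<le> card (odds n)" by (intro card_mono) (auto simp: odds_def)
 moreover have "card ((%i. 2 * i + (1::nat)) ` {..j}) = card {..j}" by (intro card_image) (simp add: inj_on_def)
 ultimately show ?thesis by simp
qed

lemma Fam_exact:
 assumes j: "2 * (j + 1) \<le> n" and G: "Fam n j G"
  and c: "!!v I. gen n v ==> generic_point.opE {1..n} (pt v) (%_. 1) (%I. ev v (G I)) I = 0"
 shows "boundary n j G"
proof -
 obtain T H where "boundary n j T" "\<forall>I. G I = T I + (\<Sum>i\<in>{}. esym {1..n} i * H i I)"
  using Koszul[of j n "{}" G "%_ _. 0"] j card_odds[OF j] G c by auto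
 hence "G = T" by (simp add: fun_eq_iff)
 thus ?thesis using \<open>boundary n j T\<close> by simp
qed

section \<open>Wedge multiplication by the two elements on the modules\<close>

definition W1 :: "nat => nat => mpoly => mpoly" where "W1 n p P = wedge p 1 P (Xi1 n)"
definition W2 :: "nat => nat => mpoly => mpoly" where "W2 n p P = wedge p 2 P (Xi2 n)"

lemma W1_UU: "2 \<le> n ==> P \<in> UU n p ==> W1 n p P \<in> UU n (Suc p)"
 using wedge_UU[OF _ _ Xi1_UU, of n P p] by (simp add: W1_def Suc_eq_plus1)

lemma W2_UU: "2 \<le> n ==> P \<in> UU n p ==> W2 n p P \<in> UU n (p + 2)"
 using wedge_UU[OF _ _ Xi2_UU, of n P p] by (simp add: W2_def)

lemma W_lin:
 "W1 n p (P + Q) = W1 n p P + W1 n p Q" "W1 n p (const c * P) = const c * W1 n p P" "W1 n p 0 = 0"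
 "W2 n p (P + Q) = W2 n p P + W2 n p Q" "W2 n p (const c * P) = const c * W2 n p P" "W2 n p 0 = 0"
 by (simp_all add: W1_def W2_def wedge_lin)

lemma W_homd: "2 \<le> n ==> homd d P ==> homd d (W1 n p P)" "2 \<le> n ==> homd d P ==> homd d (W2 n p P)"
 unfolding W1_def W2_def by (intro homd_wedge Xi1_homd Xi2_homd; assumption)+

lemma corr_0: "corr n l 0 (%I. 0)"
 by (simp add: corr_def)

lemma corr_sX_zero: "corr n l P G ==> (!!v I. gen n v ==> ev v (G I) = 0) ==> P \<in> UU n l ==> 0 < n ==> P = 0"
 by (rule ext_power_zeroI[OF UU_ext]) (auto simp: corr_def)

lemma W1_exact:
 assumes n: "2 \<le> n" and P: "P \<in> UU n j" and j: "2 * (j + 1) \<le> n" and z: "W1 n j P = 0"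
 shows "P = 0 \<or> (\<exists>i R. j = Suc i \<and> R \<in> UU n i \<and> P = W1 n i R)"
proof -
 have n0: "0 < n" and jn: "j \<le> n" using n j by auto
 obtain G where G: "Fam n j G" "corr n j P G" using corr_fam_ex[OF P n jn] by blast
 obtain H where H: "Fam n (Suc j) H" "corr n (Suc j) (W1 n j P) H"
  "!!v I. gen n v ==> ev v (H I) = (-1) ^ j * generic_point.opE {1..n} (pt v) (%_. 1) (%I. ev v (G I)) I"
  using wedge1_fam[OF G] unfolding W1_def by blast
 have "H = (%I. 0)" using corr_unique_fam[OF H(1) Fam_0 H(2)] corr_0 unfolding z by blast
 hence "generic_point.opE {1..n} (pt v) (%_. 1) (%I. ev v (G I)) I = 0" if "gen n v" for v I
  using H(3)[OF that, of I] by simp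
 hence "boundary n j G" by (rule Fam_exact[OF j G(1)])
 then consider "G = (%I. 0)" | i R where "j = Suc i" "Fam n i R" "G = EE n R" unfolding boundary_def by blast
 thus ?thesis
 proof cases
  case 1
  have "P = 0" by (rule corr_sX_zero[OF G(2) _ P n0]) (simp add: 1)
  thus ?thesis by simp
 next
  case 2
  have "i \<le> n" using jn 2(1) by simp
  then obtain Q where Q: "Q \<in> UU n i" "corr n i Q R" using corr_poly_ex[OF n _ 2(2)] by blast
  obtain H2 where H2: "Fam n (Suc i) H2" "corr n (Suc i) (W1 n i Q) H2"
   "!!v I. gen n v ==> ev v (H2 I) = (-1) ^ i * generic_point.opE {1..n} (pt v) (%_. 1) (%I. ev v (R I)) I"
   using wedge1_fam[OF 2(2) Q(2)] unfolding W1_def by blast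
  \<comment> \<open>Compensates the sign by which the family of \<open>W1 n i Q\<close> differs from
    \<open>E1\<close> of the family of \<open>Q\<close>.\<close>
  let ?c = "const ((-1) ^ i)"
  have "?c * H2 I = G I" for I
  proof (rule ev_eqI_gen[of n])
   fix v assume v: "gen n v"
   have "(-1) ^ i * ((-1) ^ i * t) = t" for t :: complex by (simp add: mult.assoc[symmetric] power_add[symmetric])
   thus "ev v (?c * H2 I) = ev v (G I)" using H2(3)[OF v, of I] EE_Fam(2)[OF 2(2) v, of I] by (simp add: 2(3))
  qed
  hence "corr n j (W1 n i (?c * Q)) G" using corr_lin(2)[OF H2(2) H2(2), of "(-1) ^ i"] 2(1) by (simp add: W_lin)
  moreover have cQ: "?c * Q \<in> UU n i" using UU_lin(2)[OF _ Q(1) Q(1)] n0 by blast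
  hence "W1 n i (?c * Q) \<in> UU n j" using W1_UU[OF n] 2(1) by simp
  ultimately have "P = W1 n i (?c * Q)" using corr_unique_poly[OF UU_ext[OF P] UU_ext n0 G(2)] by blast
  thus ?thesis using 2(1) cQ by blast
 qed
qed

lemma W1_W1:
 assumes n: "2 \<le> n" and P: "P \<in> UU n p" and p: "p \<le> n"
 shows "W1 n (Suc p) (W1 n p P) = 0"
proof -
 obtain G where G: "Fam n p G" "corr n p P G" using corr_fam_ex[OF P n p] by blast
 obtain H where H: "Fam n (Suc p) H" "corr n (Suc p) (W1 n p P) H"
  "!!v I. gen n v ==> ev v (H I) = (-1) ^ p * generic_point.opE {1..n} (pt v) (%_. 1) (%I. ev v (G I)) I"
  using wedge1_fam[OF G] unfolding W1_def by blast
 obtain H2 where H2: "corr n (Suc (Suc p)) (W1 n (Suc p) (W1 n p P)) H2"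
  "!!v I. gen n v ==> ev v (H2 I) = (-1) ^ Suc p * generic_point.opE {1..n} (pt v) (%_. 1) (%I. ev v (H I)) I"
  using wedge1_fam[OF H(1,2)] unfolding W1_def by blast
 show ?thesis
 proof (rule corr_sX_zero[OF H2(1)])
  fix v I assume v: "gen n v"
  interpret generic_point "{1..n}" "pt v" using gen_point v .
  show "ev v (H2 I) = 0" unfolding H2(2)[OF v] H(3)[OF v] op_lin(2) E1_E1 by simp
 qed (use W1_UU[OF n W1_UU[OF n P]] n in auto)
qed

text \<open>Compared through values at the nodes, where it becomes \<open>E1_E2\<close>; the signs
  (-1)^(p+2) and (-1)^p agree.\<close>

lemma W1_W2:
 assumes n: "2 \<le> n" and P: "P \<in> UU n p" and p: "p + 2 \<le> n"
 shows "W1 n (p + 2) (W2 n p P) = W2 n (Suc p) (W1 n p P)"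
proof -
 have pn: "p \<le> n" and s: "Suc (p + 2) = Suc p + 2" using p by auto
 obtain G where G: "Fam n p G" "corr n p P G" using corr_fam_ex[OF P n pn] by blast
 obtain H where H: "Fam n (Suc p) H" "corr n (Suc p) (W1 n p P) H"
  "!!v I. gen n v ==> ev v (H I) = (-1) ^ p * generic_point.opE {1..n} (pt v) (%_. 1) (%I. ev v (G I)) I"
  using wedge1_fam[OF G] unfolding W1_def by blast
 obtain H2 where H2: "Fam n (p + 2) H2" "corr n (p + 2) (W2 n p P) H2"
  "!!v I. gen n v ==> ev v (H2 I) = - 2 * generic_point.E2 {1..n} (pt v) (%I. ev v (G I)) I"
  using wedge2_fam[OF n p P G] unfolding W2_def by blast
 obtain H3 where H3: "corr n (Suc (p + 2)) (W1 n (p + 2) (W2 n p P)) H3"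
  "!!v I. gen n v ==> ev v (H3 I) = (-1) ^ (p + 2) * generic_point.opE {1..n} (pt v) (%_. 1) (%I. ev v (H2 I)) I"
  using wedge1_fam[OF H2(1,2)] unfolding W1_def by blast
 have U: "W2 n (Suc p) (W1 n p P) \<in> UU n (Suc p + 2)" "W1 n (p + 2) (W2 n p P) \<in> UU n (Suc p + 2)"
  using W2_UU[OF n W1_UU[OF n P]] W1_UU[OF n W2_UU[OF n P]] by (simp_all only: s)
 have "W1 n (p + 2) (W2 n p P) - W2 n (Suc p) (W1 n p P) = 0"
 proof (rule ext_power_zeroI)
  show "W1 n (p + 2) (W2 n p P) - W2 n (Suc p) (W1 n p P) \<in> ext_power n (Suc p + 2)"
   using n by (intro ext_power_lin(3) UU_ext U) simp
  fix v t assume v: "gen n v" and t: "inj_on t {1..Suc p + 2}" "t ` {1..Suc p + 2} \<subseteq> {1..n}"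
  interpret generic_point "{1..n}" "pt v" using gen_point v .
  let ?g = "%I. ev v (G I)" and ?J = "t ` {1..Suc p + 2}"
  have "ev (sX t v) (W1 n (p + 2) (W2 n p P)) = ev v (H3 ?J) * den n (Suc p + 2) t v"
   using corrD[OF H3(1) v] t unfolding s by blast
  also have "ev v (H3 ?J) = (-1) ^ p * (- 2 * E2 (E1 ?g) ?J)"
   unfolding H3(2)[OF v] H2(3)[OF v] op_lin(2) E1_E2 by simp
  finally have 1: "ev (sX t v) (W1 n (p + 2) (W2 n p P)) = (-1) ^ p * (- 2 * E2 (E1 ?g) ?J) * den n (Suc p + 2) t v" .
  have "ev (sX t v) (W2 n (Suc p) (W1 n p P)) = - 2 * den n (Suc p + 2) t v * E2 (%I. ev v (H I)) ?J"
   unfolding W2_def by (rule ev_wedge2[OF H(2) Xi2_corrc v t])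
  also have "(%I. ev v (H I)) = (%I. (-1) ^ p * E1 ?g I)" by (rule ext) (rule H(3)[OF v])
  also have "E2 (%I. (-1) ^ p * E1 ?g I) ?J = (-1) ^ p * E2 (E1 ?g) ?J" by (rule E2_cmult)
  finally have 2: "ev (sX t v) (W2 n (Suc p) (W1 n p P)) = - 2 * den n (Suc p + 2) t v * ((-1) ^ p * E2 (E1 ?g) ?J)" .
  show "ev (sX t v) (W1 n (p + 2) (W2 n p P) - W2 n (Suc p) (W1 n p P)) = 0"
   unfolding ev_simps 1 2 by (simp add: mult_ac)
 qed (use n in simp)
 thus ?thesis by simp
qed

text \<open>Injectivity on the image of \<open>W1\<close>: by \<open>E1_E1\<close> the family there
  satisfies the cycle condition that \<open>E2_injective\<close> asks for when n is odd.\<close>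

lemma W2_inj:
 assumes n: "2 \<le> n" and P: "P \<in> UU n p" and p: "2 * (p + 1) + 2 \<le> n" and z: "W2 n (Suc p) (W1 n p P) = 0"
 shows "W1 n p P = 0"
proof -
 have pn: "p \<le> n" using p by auto
 obtain G where G: "Fam n p G" "corr n p P G" using corr_fam_ex[OF P n pn] by blast
 obtain H where H: "Fam n (Suc p) H" "corr n (Suc p) (W1 n p P) H"
  "!!v I. gen n v ==> ev v (H I) = (-1) ^ p * generic_point.opE {1..n} (pt v) (%_. 1) (%I. ev v (G I)) I"
  using wedge1_fam[OF G] unfolding W1_def by blast
 have s: "Suc p + 2 \<le> n" using p by simp
 obtain H2 where H2: "Fam n (Suc p + 2) H2" "corr n (Suc p + 2) (W2 n (Suc p) (W1 n p P)) H2"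
  "!!v I. gen n v ==> ev v (H2 I) = - 2 * generic_point.E2 {1..n} (pt v) (%I. ev v (H I)) I"
  using wedge2_fam[OF n s W1_UU[OF n P] H(1,2)] unfolding W2_def by blast
 have H20: "H2 = (%I. 0)" using corr_unique_fam[OF H2(1) Fam_0 H2(2)] corr_0 unfolding z by blast
 show ?thesis
 proof (rule corr_sX_zero[OF H(2)])
  fix v I assume v: "gen n v"
  interpret generic_point "{1..n}" "pt v" using gen_point v .
  have E1z: "E1 (%I. ev v (H I)) J = 0" for J unfolding H(3)[OF v] op_lin(2) E1_E1 by simp
  show "ev v (H I) = 0"
  proof (rule E2_injective[where m = "Suc p" and g = "%I. ev v (H I)"])
   show "I \<subseteq> {1..n} \<and> card I = Suc p" if "ev v (H I) ~= 0" for I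
   proof (rule ccontr)
    assume "\<not> (I \<subseteq> {1..n} \<and> card I = Suc p)"
    from FamD(1)[OF H(1) this] that show False by simp
   qed
   show "2 * Suc p + 2 \<le> card {1..n}" using p by simp
   show "E2 (%I. ev v (H I)) J = 0" for J using H2(3)[OF v, of J] by (simp add: H20)
   show "\<forall>J. E1 (%I. ev v (H I)) J = 0" using E1z by blast
  qed
 qed (use W1_UU[OF n P] n in auto)
qed

section \<open>Dimensions of the graded pieces\<close>

lemma additive_sum:
 fixes T :: "mpoly => mpoly"
 assumes add: "!!P Q. T (P + Q) = T P + T Q"
 shows "T (\<Sum>i\<in>A. F i) = (\<Sum>i\<in>A. T (F i))"
proof -
 have "T 0 = 0" using add[of 0 0] by simp
 thus ?thesis by (induction A rule: infinite_finite_induct) (simp_all add: add)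
qed

lemma span_finite_family:
 assumes S: "finite S" and x: "x \<in> mp.span S"
 shows "\<exists>u. x = (\<Sum>v\<in>S. const (u v) * v)"
 using x unfolding mp.span_finite[OF S] by blast

text \<open>\<open>J\<close> completes a basis of \<open>X \<inter> V\<close> to one of
  \<open>V\<close>, so it represents a basis of \<open>V\<close> modulo \<open>X\<close>. It is
  given explicitly because it later provides coordinates.\<close>

lemma complement_ex:
 assumes V: "mp.subspace V" and X: "mp.subspace X" and fin: "finite B" "V \<subseteq> mp.span B"
 shows "\<exists>J. finite J \<and> J \<subseteq> V \<and> card J + mp.dim (X \<inter> V) = mp.dim V \<and>
  (\<forall>c. (\<Sum>x\<in>J. const (c x) * x) \<in> X --> (\<forall>x\<in>J. c x = 0)) \<and>
  (\<forall>P\<in>V. \<exists>c. P - (\<Sum>x\<in>J. const (c x) * x) \<in> X)"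
proof -
 obtain K where K: "K \<subseteq> X \<inter> V" "mp.independent K" "X \<inter> V \<subseteq> mp.span K"
  by (rule mp.maximal_independent_subset)
 obtain C where C: "K \<subseteq> C" "C \<subseteq> V" "mp.independent C" "V \<subseteq> mp.span C"
  using mp.maximal_independent_subset_extend[of K V] K by blast
 have fC: "finite C" using mp.independent_span_bound[OF fin(1) C(3)] C(2) fin(2) by blast
 have fK: "finite K" using C(1) fC finite_subset by blast
 have LC: "LI C (%x. x)" using LI_iff[OF fC, of "%x. x"] C(3) by simp
 let ?D = "C - K"
 have "u d = 0" if z: "(\<Sum>x\<in>?D. const (u x) * x) \<in> X" and d: "d \<in> ?D" for u d
 proof -
  let ?y = "\<Sum>x\<in>?D. const (u x) * x"
  have "?y \<in> V" using C(2) by (intro mp.subspace_sum[OF V] mp.subspace_scale[OF V]) auto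
  hence "?y \<in> mp.span K" using K(3) z by blast
  then obtain a where a: "?y = (\<Sum>x\<in>K. const (a x) * x)" using span_finite_family[OF fK] by blast
  let ?c = "%x. if x \<in> K then - a x else u x"
  have "(\<Sum>x\<in>C. const (?c x) * x) = (\<Sum>x\<in>?D. const (?c x) * x) + (\<Sum>x\<in>K. const (?c x) * x)"
   by (rule sum.subset_diff[OF C(1) fC])
  also have "(\<Sum>x\<in>?D. const (?c x) * x) = ?y" by (rule sum.cong) auto
  also have "(\<Sum>x\<in>K. const (?c x) * x) = (\<Sum>x\<in>K. - (const (a x) * x))"
  proof (rule sum.cong[OF refl])
   fix x assume x: "x \<in> K"
   have "const (- a x) * x = - (const (a x) * x)" by (rule ev_eqI) simp
   thus "const (?c x) * x = - (const (a x) * x)" using x by simp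
  qed
  also have "?y + ... = 0" unfolding a sum_negf by simp
  finally have s: "(\<Sum>x\<in>C. const (?c x) * x) = 0" .
  have "d \<in> C" using d by simp
  from LID[OF LC s this] show "u d = 0" using d by simp
 qed
 moreover have "\<exists>c. P - (\<Sum>x\<in>?D. const (c x) * x) \<in> X" if P: "P \<in> V" for P
 proof -
  have "P \<in> mp.span C" using P C(4) by blast
  then obtain u where u: "P = (\<Sum>x\<in>C. const (u x) * x)" using span_finite_family[OF fC] by blast
  have "P - (\<Sum>x\<in>?D. const (u x) * x) = (\<Sum>x\<in>K. const (u x) * x)"
   unfolding u sum.subset_diff[OF C(1) fC, of "%x. const (u x) * x"] by simp
  also have "... \<in> X" using K(1) by (intro mp.subspace_sum[OF X] mp.subspace_scale[OF X]) auto
  finally show ?thesis by (rule exI[of _ u])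
 qed
 moreover have "mp.dim (X \<inter> V) = card K" by (rule mp.basis_card_eq_dim[symmetric, OF K(1) K(3) K(2)])
 moreover have "mp.dim V = card C" by (rule mp.basis_card_eq_dim[symmetric, OF C(2) C(4) C(3)])
 moreover have "card C = card K + card ?D" using C(1) fC fK card_mono[OF fC C(1)] by (simp add: card_Diff_subset)
 ultimately show ?thesis using fC C(2) by (intro exI[of _ ?D]) auto
qed

text \<open>A complement of the kernel is mapped to a basis of the image.\<close>

lemma rank_nullity:
 fixes T :: "mpoly => mpoly"
 assumes V: "mp.subspace V" and fin: "finite B" "V \<subseteq> mp.span B"
  and add: "!!P Q. T (P + Q) = T P + T Q" and sc: "!!c P. T (const c * P) = const c * T P"
 shows "mp.dim V = mp.dim {P \<in> V. T P = 0} + mp.dim (T ` V)"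
proof -
 let ?X = "{P. T P = 0}"
 have T0: "T 0 = 0" using add[of 0 0] by simp
 have ts: "T (\<Sum>x\<in>J. const (c x) * x) = (\<Sum>x\<in>J. const (c x) * T x)" for c J
  by (simp add: additive_sum[of T, OF add] sc)
 have X: "mp.subspace ?X" unfolding mp.subspace_def by (simp add: T0 add sc)
 obtain J where J: "finite J" "J \<subseteq> V" "card J + mp.dim (?X \<inter> V) = mp.dim V"
  and J1: "\<forall>c. (\<Sum>x\<in>J. const (c x) * x) \<in> ?X --> (\<forall>x\<in>J. c x = 0)"
  and J2: "\<forall>P\<in>V. \<exists>c. P - (\<Sum>x\<in>J. const (c x) * x) \<in> ?X"
  using complement_ex[OF V X fin] by (elim exE conjE)
 have "LI J T" unfolding LI_def using J1 ts by simp
 hence inj: "inj_on T J" and ind: "mp.independent (T ` J)" using LI_iff[OF J(1)] by auto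
 have "T ` V \<subseteq> mp.span (T ` J)"
 proof
  fix y assume "y \<in> T ` V"
  then obtain P where P: "y = T P" "P \<in> V" by blast
  obtain c where c: "P - (\<Sum>x\<in>J. const (c x) * x) \<in> ?X" using bspec[OF J2 P(2)] by (rule exE)
  let ?S = "\<Sum>x\<in>J. const (c x) * x"
  have "T P = T (P - ?S) + T ?S" unfolding add[symmetric] by simp
  hence "y = (\<Sum>x\<in>J. const (c x) * T x)" using c unfolding P(1) ts by simp
  thus "y \<in> mp.span (T ` J)" by (simp add: mp.span_sum mp.span_scale mp.span_base)
 qed
 hence "mp.dim (T ` V) = card (T ` J)" using J(2) by (intro mp.basis_card_eq_dim[symmetric] ind image_mono) auto
 moreover have "?X \<inter> V = {P \<in> V. T P = 0}" by blast
 ultimately show ?thesis using J(3) by (simp add: card_image[OF inj])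
qed

section \<open>Monomials in the elementary symmetric polynomials of two blocks\<close>

definition eb :: "nat => nat => (nat => nat) => mpoly" where
 "eb n l m = (\<Prod>k\<in>{1..l}. esym {1..l} k ^ m k) * (\<Prod>k\<in>{1..n - l}. esym {l + 1..n} k ^ m (l + k))"

text \<open>The degree of the i-th generator in \<open>eb\<close>: the first l belong to the first
  block, and the count restarts at 1 for the second.\<close>

definition wt :: "nat => nat => nat" where "wt l i = (if i \<le> l then i else i - l)"

definition Pset :: "nat => nat => int => (nat => nat) set" where
 "Pset n l d = {m \<in> supp n. int (\<Sum>i\<in>{1..n}. wt l i * m i) = d}"

lemma finite_weighted:
 fixes w :: "'i => nat"
 assumes A: "finite A" and w: "!!i. i \<in> A ==> 0 < w i"
 shows "finite {m :: 'i => nat. (\<forall>i. i \<notin> A --> m i = 0) \<and> (\<Sum>i\<in>A. w i * m i) = k}"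
proof (rule finite_subset)
 show "finite {f. \<forall>i. (i \<in> A --> f i \<in> {..k}) \<and> (i \<notin> A --> f i = (0::nat))}"
  by (rule finite_set_of_finite_funs) (use A in auto)
 show "{m. (\<forall>i. i \<notin> A --> m i = 0) \<and> (\<Sum>i\<in>A. w i * m i) = k} \<subseteq>
   {f. \<forall>i. (i \<in> A --> f i \<in> {..k}) \<and> (i \<notin> A --> f i = 0)}"
 proof clarify
  fix m i assume m: "\<forall>i. i \<notin> A --> m i = 0" "k = (\<Sum>i\<in>A. w i * m i)"
  have "m i \<le> (\<Sum>i\<in>A. w i * m i)" if i: "i \<in> A"
  proof -
   have "m i \<le> w i * m i" using w[OF i] by simp
   also have "... \<le> (\<Sum>i\<in>A. w i * m i)" using A i by (intro member_le_sum) auto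
   finally show ?thesis .
  qed
  thus "(i \<in> A --> m i \<in> {..(\<Sum>i\<in>A. w i * m i)}) \<and> (i \<notin> A --> m i = 0)" using m(1) by simp
 qed
qed

lemma wt_pos: "i \<in> {1..n} ==> 0 < wt l i"
 by (auto simp: wt_def)

lemma finite_Pset: "finite (Pset n l d)"
proof (rule finite_subset)
 show "Pset n l d \<subseteq> {m. (\<forall>i. i \<notin> {1..n} --> m i = 0) \<and> (\<Sum>i\<in>{1..n}. wt l i * m i) = nat d}"
  by (auto simp: Pset_def supp_def simp del: of_nat_sum of_nat_mult)
 show "finite {m. (\<forall>i. i \<notin> {1..n} --> m i = 0) \<and> (\<Sum>i\<in>{1..n}. wt l i * m i) = nat d}"
  by (rule finite_weighted[OF _ wt_pos]) auto
qed

text \<open>Roots that are missing because the degree is below \<open>card S\<close> are supplied by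
  factors with y = 0.\<close>

lemma FTA_factor:
 fixes p :: "complex poly"
 assumes "finite S" "degree p \<le> card S" "poly.coeff p 0 = 1"
 shows "\<exists>y. p = (\<Prod>j\<in>S. [:1, y j:])"
 using assms
proof (induction S arbitrary: p rule: finite_induct)
 case empty
 hence "degree p = 0" by simp
 then obtain a where "p = [:a:]" by (rule degree_eq_zeroE)
 thus ?case using empty by (simp add: one_pCons)
next
 case (insert s S)
 show ?case
 proof (cases "degree p = 0")
  case True
  then obtain a where "p = [:a:]" by (rule degree_eq_zeroE)
  hence "p = 1" using insert.prems by (simp add: one_pCons)
  moreover have "(\<Prod>j\<in>insert s S. [:1, 0:]) = (1 :: complex poly)" by (simp add: one_pCons[symmetric])
  ultimately show ?thesis by (intro exI[of _ "%_. 0"]) simp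
 next
  case False
  hence "\<not> constant (poly p)" by (simp add: constant_degree)
  then obtain r where r: "poly p r = 0" using fundamental_theorem_of_algebra by blast
  have r0: "r ~= 0" using r insert.prems(2) by (auto simp: poly_0_coeff_0)
  obtain q where q: "p = [:- r, 1:] * q" using r unfolding poly_eq_0_iff_dvd by (auto elim: dvdE)
  have q0: "q ~= 0" using False q by auto
  have dq: "degree p = Suc (degree q)" unfolding q using q0 by (subst degree_mult_eq) auto
  have p: "p = [:1, - 1 / r:] * Polynomial.smult (- r) q"
  proof -
   have "[:- r, 1:] = Polynomial.smult (- r) [:1, - 1 / r:]" using r0 by simp
   thus ?thesis unfolding q by (simp only: mult_smult_left mult_smult_right)
  qed
  have "degree (Polynomial.smult (- r) q) \<le> card S" using dq insert.prems(1) insert.hyps r0 by simp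
  moreover have "poly.coeff (Polynomial.smult (- r) q) 0 = 1" using insert.prems(2) unfolding q by simp
  ultimately obtain y where y: "Polynomial.smult (- r) q = (\<Prod>j\<in>S. [:1, y j:])" using insert.IH by blast
  have "(\<Prod>j\<in>S. [:1, (y(s := - 1 / r)) j:]) = (\<Prod>j\<in>S. [:1, y j:])"
   using insert.hyps by (intro prod.cong) auto
  hence "p = [:1, (y(s := - 1 / r)) s:] * (\<Prod>j\<in>S. [:1, (y(s := - 1 / r)) j:])"
   unfolding y[symmetric] fun_upd_same by (simp only: p[symmetric])
  hence "p = (\<Prod>j\<in>insert s S. [:1, (y(s := - 1 / r)) j:])" by (simp only: prod.insert[OF insert.hyps])
  thus ?thesis by blast
 qed
qed

text \<open>The elementary symmetric functions take arbitrary complex values; in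
  \<open>LI_eb\<close> their algebraic independence thereby reduces to that of coordinates.\<close>

lemma es_surj:
 assumes S: "finite S"
 shows "\<exists>y. \<forall>k\<in>{1..card S}. es S k y = z k"
proof -
 define p where "p = (\<Sum>k\<le>card S. monom (if k = 0 then 1 else z k) k)"
 have c: "poly.coeff p k = (if k = 0 then 1 else z k)" if "k \<le> card S" for k
  using that by (simp add: p_def coeff_sum)
 have "degree p \<le> card S" unfolding p_def by (intro degree_sum_le order.trans[OF degree_monom_le]) auto
 then obtain y where y: "p = (\<Prod>j\<in>S. [:1, y j:])" using FTA_factor[OF S] c[of 0] by auto
 have "es S k y = z k" if "k \<in> {1..card S}" for k using c[of k] that unfolding es_def y[symmetric] by auto
 thus ?thesis by blast
qed

lemma LI_eb:
 assumes l: "l \<le> n"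
 shows "LI (Pset n l d) (eb n l)"
 unfolding LI_def
proof (intro allI impI ballI)
 fix c m0 assume z: "(\<Sum>m\<in>Pset n l d. const (c m) * eb n l m) = 0" and m0: "m0 \<in> Pset n l d"
 show "c m0 = 0"
 proof (rule characters_LI[of "{1..n}" "Pset n l d" "%m. m", OF _ finite_Pset _ _ m0])
  fix m m' assume m: "m \<in> Pset n l d" "m' \<in> Pset n l d" "!!i. i \<in> {1..n} ==> m i = m' i"
  show "m = m'"
  proof
   fix i show "m i = m' i" using m by (cases "i \<in> {1..n}") (auto simp: Pset_def supp_def)
  qed
 next
  fix t :: "nat => complex"
  have c: "card {1..l} = l" "card {l + 1..n} = n - l" by simp_all
  obtain y1 where y1: "\<forall>k\<in>{1..l}. es {1..l} k y1 = t k" using es_surj[of "{1..l}" t, unfolded c] by blast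
  obtain y2 where y2: "\<forall>k\<in>{1..n - l}. es {l + 1..n} k y2 = t (l + k)"
   using es_surj[of "{l + 1..n}" "%k. t (l + k)", unfolded c] by blast
  define v where "v = (%w. case w of VX _ => 1 | Vx j => if j \<le> l then y1 j else y2 j)"
  have e1: "es {1..l} k (pt v) = t k" if "k \<in> {1..l}" for k
   using bspec[OF y1 that] es_cong[of "{1..l}" "pt v" y1 k] by (simp add: v_def)
  have e2: "es {l + 1..n} k (pt v) = t (l + k)" if "k \<in> {1..n - l}" for k
   using bspec[OF y2 that] es_cong[of "{l + 1..n}" "pt v" y2 k] by (simp add: v_def)
  have "ev v (eb n l m) = (\<Prod>k\<in>{1..l}. t k ^ m k) * (\<Prod>k\<in>{1..n - l}. t (l + k) ^ m (l + k))" for m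
  proof -
   have "(\<Prod>k\<in>{1..l}. es {1..l} k (pt v) ^ m k) = (\<Prod>k\<in>{1..l}. t k ^ m k)"
    by (rule prod.cong[OF refl]) (simp only: e1)
   moreover have "(\<Prod>k\<in>{1..n - l}. es {l + 1..n} k (pt v) ^ m (l + k)) = (\<Prod>k\<in>{1..n - l}. t (l + k) ^ m (l + k))"
    by (rule prod.cong[OF refl]) (simp only: e2)
   ultimately show ?thesis by (simp add: eb_def ev_esym)
  qed
  hence "ev v (eb n l m) = (\<Prod>i\<in>{1..n}. t i ^ m i)" for m
   using prod_split[where p = l and q = "n - l" and h = "%i. t i ^ m i"] l by simp
  hence "(\<Sum>m\<in>Pset n l d. c m * (\<Prod>i\<in>{1..n}. t i ^ m i)) = ev v (\<Sum>m\<in>Pset n l d. const (c m) * eb n l m)" by simp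
  thus "(\<Sum>m\<in>Pset n l d. c m * (\<Prod>i\<in>{1..n}. t i ^ m i)) = 0" unfolding z by simp
 qed simp
qed

lemma sum_split: "(\<Sum>a\<in>{1..p + q}. h a) = (\<Sum>a\<in>{1..p}. h a) + (\<Sum>a\<in>{1..q}. h (p + a) :: nat)" for p q :: nat
 by (induction q) simp_all

lemma homd_eb:
 assumes l: "l \<le> n"
 shows "homd (int (\<Sum>i\<in>{1..n}. wt l i * m i)) (eb n l m)"
proof -
 have "homd ((\<Sum>k\<in>{1..l}. int (m k) * int k) + (\<Sum>k\<in>{1..n - l}. int (m (l + k)) * int k)) (eb n l m)"
  unfolding eb_def by (intro homd_mult homd_prod homd_power homd_esym) auto
 moreover have "(\<Sum>i\<in>{1..n}. wt l i * m i) = (\<Sum>k\<in>{1..l}. m k * k) + (\<Sum>k\<in>{1..n - l}. m (l + k) * k)"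
 proof -
  have "(\<Sum>i\<in>{1..n}. wt l i * m i) = (\<Sum>k\<in>{1..l}. wt l k * m k) + (\<Sum>k\<in>{1..n - l}. wt l (l + k) * m (l + k))"
   using sum_split[where p = l and q = "n - l" and h = "%i. wt l i * m i"] l by simp
  also have "(\<Sum>k\<in>{1..l}. wt l k * m k) = (\<Sum>k\<in>{1..l}. m k * k)" by (rule sum.cong) (auto simp: wt_def)
  also have "(\<Sum>k\<in>{1..n - l}. wt l (l + k) * m (l + k)) = (\<Sum>k\<in>{1..n - l}. m (l + k) * k)"
   by (rule sum.cong) (auto simp: wt_def)
  finally show ?thesis .
 qed
 ultimately show ?thesis by (simp only: of_nat_add of_nat_sum of_nat_mult)
qed

lemma Alg_span_gen:
 assumes P: "P \<in> Alg T" and one: "1 \<in> b ` A" and mult: "!!x y. x \<in> b ` A ==> y \<in> b ` A ==> x * y \<in> b ` A"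
  and T: "!!Q. Q \<in> T ==> Q \<in> mp.span (b ` A)"
 shows "P \<in> mp.span (b ` A)"
 using P
proof induction
 case (Alg_const c)
 from mp.span_scale[OF mp.span_base[OF one], of c] show ?case by simp
next
 case (Alg_add P Q)
 thus ?case by (intro mp.span_add)
next
 case (Alg_mult P Q)
 show ?case
 proof (rule span_mult[OF Alg_mult.IH(1)])
  fix x assume x: "x \<in> b ` A"
  have "Q * x \<in> mp.span (b ` A)" by (rule span_mult[OF Alg_mult.IH(2)]) (intro mp.span_base mult x)
  thus "x * Q \<in> mp.span (b ` A)" by (simp add: mult.commute)
 qed
qed (rule T)

lemma eb_mult: "eb n l m * eb n l m' = eb n l (%i. m i + m' i)"
 by (simp add: eb_def power_add prod.distrib mult_ac)

lemma esym_eb: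
 assumes l: "l \<le> n"
 shows "esym {1..l} k \<in> mp.span (eb n l ` supp n)" "esym {l + 1..n} k \<in> mp.span (eb n l ` supp n)"
proof -
 have one: "1 \<in> eb n l ` supp n" by (rule image_eqI[of _ _ "%_. 0"]) (simp_all add: eb_def supp_def)
 have d: "(\<Prod>j\<in>A. F j ^ (if j = k then 1 else 0)) = F k" if "finite A" "k \<in> A" for F :: "nat => mpoly" and A
 proof -
  have "(\<Prod>j\<in>A. F j ^ (if j = k then 1 else 0)) = (\<Prod>j\<in>A. if j = k then F j else 1)" by (rule prod.cong) auto
  thus ?thesis using that by simp
 qed
 show "esym {1..l} k \<in> mp.span (eb n l ` supp n)"
 proof (cases "k \<in> {1..l}")
  case True
  let ?m = "%i. if i = k then 1 else (0::nat)"
  have "(\<Prod>j\<in>{1..n - l}. esym {l + 1..n} j ^ ?m (l + j)) = 1" using True by (intro prod.neutral) auto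
  hence "eb n l ?m = esym {1..l} k" unfolding eb_def using d[of "{1..l}" "esym {1..l}"] True by simp
  moreover have "?m \<in> supp n" using True l by (auto simp: supp_def)
  ultimately show ?thesis by (metis imageI mp.span_base)
 next
  case False
  thus ?thesis using one by (cases "k = 0") (auto intro: mp.span_base simp: esym_eq_0 mp.span_zero)
 qed
 show "esym {l + 1..n} k \<in> mp.span (eb n l ` supp n)"
 proof (cases "k \<in> {1..n - l}")
  case True
  let ?m = "%i. if i = l + k then 1 else (0::nat)"
  have "(\<Prod>j\<in>{1..l}. esym {1..l} j ^ ?m j) = 1" using True by (intro prod.neutral) auto
  moreover have "(\<Prod>j\<in>{1..n - l}. esym {l + 1..n} j ^ ?m (l + j)) = (\<Prod>j\<in>{1..n - l}. esym {l + 1..n} j ^ (if j = k then 1 else 0))"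
   by (rule prod.cong) auto
  ultimately have "eb n l ?m = esym {l + 1..n} k" unfolding eb_def using d[of "{1..n - l}" "esym {l + 1..n}"] True by simp
  moreover have "?m \<in> supp n" using True l by (auto simp: supp_def)
  ultimately show ?thesis by (metis imageI mp.span_base)
 next
  case False
  thus ?thesis using one by (cases "k = 0") (auto intro: mp.span_base simp: esym_eq_0 mp.span_zero)
 qed
qed

text \<open>The fundamental theorem is applied to the first block and then, with its elementary
  symmetric polynomials as parameters, to the second.\<close>

lemma Inv_span:
 assumes l: "l \<le> n" and P: "Inv n l P"
 shows "P \<in> mp.span (eb n l ` supp n)"
proof -
 have sym: "rename_x \<pi> P = P" if p: "\<pi> permutes S" and S: "S = {1..l} \<or> S = {l + 1..n}" for \<pi> S
 proof -
  have 1: "\<pi> permutes {1..n}" using p S l by (auto intro: permutes_subset)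
  have 2: "\<pi> ` {1..l} = {1..l}" using S
  proof
   assume "S = {1..l}"
   thus ?thesis using permutes_image[of \<pi> "{1..l}"] p by simp
  next
   assume "S = {l + 1..n}"
   hence "\<pi> a = a" if "a \<in> {1..l}" for a using permutes_not_in[OF p] that by simp
   thus ?thesis by (auto simp: image_iff)
  qed
  show ?thesis using P 1 2 unfolding Inv_def by blast
 qed
 have xp: "P \<in> Alg ({} \<union> (%j. Var (Vx j)) ` {1..n})" using xpoly_Alg P unfolding Inv_def by simp
 have s1: "{1..l} \<subseteq> {1..n}" using l by auto
 have "P \<in> Alg ({} \<union> egen {1..l} \<union> (%j. Var (Vx j)) ` ({1..n} - {1..l}))"
  by (rule symmetric_in_Alg_over[OF s1 order_refl xp _ sym]) auto
 moreover have D: "{1..n} - {1..l} = {l + 1..n}" by auto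
 ultimately have P1: "P \<in> Alg (egen {1..l} \<union> (%j. Var (Vx j)) ` {l + 1..n})" by simp
 have s2: "{l + 1..n} \<subseteq> {1..n}" by auto
 have "rename_x \<pi> Q = Q" if p: "\<pi> permutes {l + 1..n}" and Q: "Q \<in> egen {1..l}" for \<pi> Q
 proof -
  have "\<pi> a = a" if "a \<in> {1..l}" for a using permutes_not_in[OF p] that by simp
  hence "\<pi> ` {1..l} = {1..l}" by (auto simp: image_iff)
  thus ?thesis using Q rename_x_esym[OF _ permutes_inj[OF p], of "{1..l}"] by (auto simp: egen_def)
 qed
 hence "P \<in> Alg (egen {1..l} \<union> egen {l + 1..n} \<union> (%j. Var (Vx j)) ` ({l + 1..n} - {l + 1..n}))"
  by (intro symmetric_in_Alg_over[OF order_refl s2 P1 _ sym]) auto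
 hence "P \<in> Alg (egen {1..l} \<union> egen {l + 1..n})" by simp
 thus ?thesis
 proof (rule Alg_span_gen)
  show "1 \<in> eb n l ` supp n" by (rule image_eqI[of _ _ "%_. 0"]) (simp_all add: eb_def supp_def)
  show "x * y \<in> eb n l ` supp n" if xy: "x \<in> eb n l ` supp n" "y \<in> eb n l ` supp n" for x y
  proof -
   obtain m m' where m: "x = eb n l m" "y = eb n l m'" "m \<in> supp n" "m' \<in> supp n" using xy by blast
   hence "(%i. m i + m' i) \<in> supp n" by (simp add: supp_def)
   thus ?thesis unfolding m eb_mult by (rule imageI)
  qed
  show "Q \<in> mp.span (eb n l ` supp n)" if "Q \<in> egen {1..l} \<union> egen {l + 1..n}" for Q
   using that esym_eb[OF l] by (auto simp: egen_def)
 qed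
qed

lemma Inv_homd_span:
 assumes l: "l \<le> n" and P: "Inv n l P" and d: "homd d P"
 shows "P \<in> mp.span (eb n l ` Pset n l d)"
proof -
 have "hcomp d Q \<in> mp.span (eb n l ` Pset n l d)" if "Q \<in> mp.span (eb n l ` supp n)" for Q using that
 proof (induction rule: mp.span_induct_alt)
  case (step c x y)
  then obtain m where m: "x = eb n l m" "m \<in> supp n" by blast
  have "hcomp d x \<in> mp.span (eb n l ` Pset n l d)"
  proof (cases "d = int (\<Sum>i\<in>{1..n}. wt l i * m i)")
   case True
   hence "m \<in> Pset n l d" using m(2) by (simp add: Pset_def)
   thus ?thesis using comp_homd[OF homd_eb[OF l], of d m] True m(1) by (simp add: mp.span_base)
  next
   case False
   thus ?thesis using comp_homd[OF homd_eb[OF l, of m], of d] unfolding m(1) by (simp only: if_False mp.span_zero)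
  qed
  thus ?case unfolding comp_add hcomp_cmult by (intro mp.span_add mp.span_scale step)
 qed (simp add: mp.span_zero)
 hence "hcomp d P \<in> mp.span (eb n l ` Pset n l d)" using Inv_span[OF l P] by blast
 thus ?thesis using comp_homd[OF d, of d] by simp
qed

lemma Inv_eb:
 assumes l: "l \<le> n"
 shows "Inv n l (eb n l m)"
 unfolding Inv_def
proof (intro conjI allI impI)
 show "xpoly n (eb n l m)" unfolding eb_def
  using l by (intro xpoly_simps(3) xpoly_simps(7) xpoly_simps(5) xpoly_esym) auto
 fix \<pi> assume p: "\<pi> permutes {1..n}" "\<pi> ` {1..l} = {1..l}"
 have "\<pi> ` ({1..n} - {1..l}) = {1..n} - {1..l}"
  using p(2) permutes_image[OF p(1)] image_set_diff[OF permutes_inj[OF p(1)], of "{1..n}" "{1..l}"] by simp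
 moreover have "{1..n} - {1..l} = {l + 1..n}" by auto
 ultimately have i2: "\<pi> ` {l + 1..n} = {l + 1..n}" by simp
 have "es S k (%j. v (Vx (\<pi> j))) = es S k (pt v)" if "\<pi> ` S = S" for S k v
  using es_image[of \<pi> S k "pt v", unfolded o_def] that inj_on_subset[OF permutes_inj[OF p(1)] subset_UNIV] by simp
 thus "rename_x \<pi> (eb n l m) = eb n l m" using p(2) i2 by (intro ev_eqI) (simp add: eb_def ev_esym)
qed

lemma Fam_homd:
 assumes G: "Fam n l G" and d: "homd d (G {1..l})" and l: "l \<le> n"
 shows "homd d (G I)"
proof (cases "I \<subseteq> {1..n} \<and> card I = l")
 case True
 then obtain \<pi> where p: "\<pi> permutes {1..n}" "\<pi> ` {1..l} = I" using permutes_image_ex by blast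
 hence "G I = rename_x \<pi> (G {1..l})" using FamD(3)[OF G p(1), of "{1..l}"] l by simp
 thus ?thesis using homd_rename_x[OF d] by simp
qed (simp add: FamD(1)[OF G])

definition VV :: "nat => nat => int => mpoly set" where
 "VV n l d = {P \<in> UU n l. homd d P}"

lemma VV_subspace: "0 < n \<or> l = 0 ==> mp.subspace (VV n l d)"
proof -
 assume n: "0 < n \<or> l = 0"
 have "0 \<in> UU n l" using UU_sum[OF n, of "{}"] by simp
 thus ?thesis unfolding mp.subspace_def VV_def
  using UU_lin(1)[OF n] UU_lin(2)[OF n] by (auto intro: homd_add homd_cmult)
qed

lemma corr_sum:
 assumes "!!m. m \<in> A ==> corr n l (u m) (G m)"
 shows "corr n l (\<Sum>m\<in>A. const (c m) * u m) (%I. \<Sum>m\<in>A. const (c m) * G m I)"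
 unfolding corr_def
proof (intro allI impI)
 fix v s assume v: "gen n v" and s: "inj_on s {1..l}" "s ` {1..l} \<subseteq> {1..n}"
 have "ev (sX s v) (\<Sum>m\<in>A. const (c m) * u m) = (\<Sum>m\<in>A. c m * (ev v (G m (s ` {1..l})) * den n l s v))"
  using corrD[OF assms v s] by simp
 thus "ev (sX s v) (\<Sum>m\<in>A. const (c m) * u m) = ev v (\<Sum>m\<in>A. const (c m) * G m (s ` {1..l})) * den n l s v"
  by (simp add: sum_distrib_right mult.assoc)
qed

text \<open>Lifts the basis \<open>eb\<close> of invariants along \<open>corr\<close>. That
  correspondence has been established for n \<ge> 2, so l = 0, where the module consists of the
  invariants themselves, is treated directly.\<close>

lemma VV_basis:
 assumes nl: "(2 \<le> n \<and> l \<le> n) \<or> l = 0"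
 shows "\<exists>u. LI (Pset n l d) u \<and> VV n l d = mp.span (u ` Pset n l d)"
proof (cases "2 \<le> n \<and> l \<le> n")
 case False
 hence l: "l = 0" using nl by blast
 have "P \<in> UU n 0 \<longleftrightarrow> Inv n 0 P" for P
  unfolding UU_def Inv_def using sym_polys_ext_power[of n] by (auto simp: sym_polys_def xpoly_def)
 hence V: "VV n 0 d = {P. Inv n 0 P \<and> homd d P}" by (auto simp: VV_def)
 have "eb n 0 ` Pset n 0 d \<subseteq> VV n 0 d" unfolding V using Inv_eb[of 0 n] homd_eb[of 0 n] by (auto simp: Pset_def)
 hence "mp.span (eb n 0 ` Pset n 0 d) \<subseteq> VV n 0 d" by (intro mp.span_minimal VV_subspace) auto
 moreover have "VV n 0 d \<subseteq> mp.span (eb n 0 ` Pset n 0 d)" unfolding V using Inv_homd_span[of 0 n] by auto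
 ultimately show ?thesis unfolding l using LI_eb[of 0 n d] by (intro exI[of _ "eb n 0"]) auto
next
 case True
 hence n: "2 \<le> n" and l: "l \<le> n" and n0: "0 < n" by auto
 have "\<exists>G P. Fam n l G \<and> G {1..l} = eb n l m \<and> P \<in> UU n l \<and> corr n l P G" for m
  using Fam_ex[OF Inv_eb[OF l] l, of m] corr_poly_ex[OF n l] by blast
 then obtain G u where Gu: "!!m. Fam n l (G m)" "!!m. G m {1..l} = eb n l m" "!!m. u m \<in> UU n l" "!!m. corr n l (u m) (G m)"
  by metis
 have uV: "u m \<in> VV n l d" if "m \<in> Pset n l d" for m
 proof -
  have "homd d (eb n l m)" using homd_eb[OF l, of m] that by (simp add: Pset_def)
  hence "homd d (G m I)" for I using Fam_homd[OF Gu(1) _ l] Gu(2) by simp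
  thus ?thesis using homd_corr[OF n0 Gu(3) Gu(4)] Gu(3) by (simp add: VV_def)
 qed
 have cs: "corr n l (\<Sum>m\<in>A. const (c m) * u m) (%I. \<Sum>m\<in>A. const (c m) * G m I)" for A c
  by (rule corr_sum) (rule Gu(4))
 have Fs: "Fam n l (%I. \<Sum>m\<in>A. const (c m) * G m I)" for A c by (intro Fam_sum Fam_cmult Gu(1))
 have "LI (Pset n l d) u" unfolding LI_def
 proof (intro allI impI)
  fix c assume z: "(\<Sum>m\<in>Pset n l d. const (c m) * u m) = 0"
  have "(%I. \<Sum>m\<in>Pset n l d. const (c m) * G m I) = (%I. 0)"
   by (rule corr_unique_fam[OF Fs Fam_0 cs]) (simp add: z corr_0)
  hence "(\<Sum>m\<in>Pset n l d. const (c m) * eb n l m) = 0" using fun_cong[of _ _ "{1..l}"] by (simp add: Gu(2)[symmetric] fun_eq_iff)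
  thus "\<forall>m\<in>Pset n l d. c m = 0" using LID[OF LI_eb[OF l]] by blast
 qed
 moreover have "mp.span (u ` Pset n l d) \<subseteq> VV n l d" using uV n0 by (intro mp.span_minimal VV_subspace) auto
 moreover have "P \<in> mp.span (u ` Pset n l d)" if P: "P \<in> VV n l d" for P
 proof -
  have PU: "P \<in> UU n l" and Pd: "homd d P" using P by (auto simp: VV_def)
  obtain H where H: "Fam n l H" "corr n l P H" using corr_fam_ex[OF PU n l] by blast
  have sp: "H {1..l} \<in> mp.span (eb n l ` Pset n l d)"
   by (rule Inv_homd_span[OF l Fam_Inv[OF H(1) l] corr_homd[OF H(2,1) Pd]])
  note sp = span_family[OF sp]
  obtain F c where F: "finite F" "F \<subseteq> Pset n l d" "H {1..l} = (\<Sum>m\<in>F. const (c m) * eb n l m)"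
   using sp by blast
  have "H = (%I. \<Sum>m\<in>F. const (c m) * G m I)" by (rule Fam_eqI[OF H(1) Fs]) (simp add: F(3) Gu(2))
  hence "corr n l P (%I. \<Sum>m\<in>F. const (c m) * G m I)" using H(2) by simp
  moreover have "(\<Sum>m\<in>F. const (c m) * u m) \<in> UU n l" using n0 UU_lin(2)[OF _ Gu(3) Gu(3)] by (intro UU_sum) auto
  ultimately have "P = (\<Sum>m\<in>F. const (c m) * u m)" using corr_unique_poly[OF UU_ext[OF PU] UU_ext n0 _ cs] by blast
  moreover have "(\<Sum>m\<in>F. const (c m) * u m) \<in> mp.span (u ` Pset n l d)"
   by (intro mp.span_sum mp.span_scale mp.span_base) (use F(2) in blast)
  ultimately show ?thesis by simp
 qed
 ultimately show ?thesis by (intro exI[of _ u]) auto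
qed

lemma VV_dim:
 assumes nl: "(2 \<le> n \<and> l \<le> n) \<or> l = 0"
 shows "mp.dim (VV n l d) = card (Pset n l d)" "\<exists>B. finite B \<and> VV n l d \<subseteq> mp.span B"
proof -
 obtain u where u: "LI (Pset n l d) u" "VV n l d = mp.span (u ` Pset n l d)" using VV_basis[OF nl] by blast
 hence "inj_on u (Pset n l d)" "mp.independent (u ` Pset n l d)" using LI_iff[OF finite_Pset] by auto
 thus "mp.dim (VV n l d) = card (Pset n l d)" unfolding u(2) by (simp add: mp.dim_eq_card_independent card_image)
 show "\<exists>B. finite B \<and> VV n l d \<subseteq> mp.span B" unfolding u(2) using finite_Pset by blast
qed


text \<open>The factor 1 - X^(w a) removes the exponent functions with m a > 0: lowering m a by 1
  matches them with those of weight smaller by w a.\<close>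

lemma weighted_gf:
 fixes w :: "'i => nat"
 assumes "finite A" "!!i. i \<in> A ==> 0 < w i"
 shows "(\<Prod>i\<in>A. 1 - fps_X ^ w i) *
  Abs_fps (%k. of_nat (card {m :: 'i => nat. (\<forall>i. i \<notin> A --> m i = 0) \<and> (\<Sum>i\<in>A. w i * m i) = k})) = (1 :: rat fps)"
 using assms
proof (induction A rule: finite_induct)
 case empty
 have "{m :: 'i => nat. (\<forall>i. i \<notin> {} --> m i = 0) \<and> (\<Sum>i\<in>{}. w i * m i) = k} = (if k = 0 then {%_. 0} else {})" for k
  by auto
 thus ?case by (auto simp: fps_eq_iff)
next
 case (insert a A)
 let ?C = "%A k. {m :: 'i => nat. (\<forall>i. i \<notin> A --> m i = 0) \<and> (\<Sum>i\<in>A. w i * m i) = k}"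
 let ?I = "insert a A"
 have wa: "0 < w a" using insert.prems by simp
 have s: "(\<Sum>i\<in>?I. w i * m i) = w a * m a + (\<Sum>i\<in>A. w i * m i)" for m :: "'i => nat"
  using insert.hyps by simp
 have card: "card (?C ?I k) = card (?C A k) + (if w a \<le> k then card (?C ?I (k - w a)) else 0)" for k
 proof -
  have eq: "m \<in> ?C A k \<longleftrightarrow> m \<in> ?C ?I k \<and> m a = 0" for m
  proof -
   have "(\<forall>i. i \<notin> A --> m i = 0) \<longleftrightarrow> (\<forall>i. i \<notin> ?I --> m i = 0) \<and> m a = 0"
    using insert.hyps(2) by (metis insert_iff)
   thus ?thesis unfolding mem_Collect_eq s by (cases "m a = 0") simp_all
  qed
  have "?C ?I k = ?C A k \<union> {m \<in> ?C ?I k. 0 < m a}"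
  proof (rule Set.set_eqI)
   fix m
   show "m \<in> ?C ?I k \<longleftrightarrow> m \<in> ?C A k \<union> {m \<in> ?C ?I k. 0 < m a}" unfolding Un_iff eq by auto
  qed
  moreover have "?C A k \<inter> {m \<in> ?C ?I k. 0 < m a} = {}" using insert.hyps by auto
  moreover have "finite (?C A k)" "finite (?C ?I k)" using insert by (intro finite_weighted; auto)+
  ultimately have "card (?C ?I k) = card (?C A k) + card {m \<in> ?C ?I k. 0 < m a}"
   by (metis (no_types, lifting) card_Un_disjoint finite_Un)
  moreover have "card {m \<in> ?C ?I k. 0 < m a} = (if w a \<le> k then card (?C ?I (k - w a)) else 0)"
  proof (cases "w a \<le> k")
   case True
   have us: "(\<Sum>i\<in>A. w i * (m(a := t)) i) = (\<Sum>i\<in>A. w i * m i)" for m :: "'i => nat" and t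
    using insert.hyps by (intro sum.cong) auto
   have "bij_betw (%m. m(a := m a - 1)) {m \<in> ?C ?I k. 0 < m a} (?C ?I (k - w a))"
   proof (rule bij_betwI[where g = "%m. m(a := m a + 1)"])
    show "(%m. m(a := m a - 1)) \<in> {m \<in> ?C ?I k. 0 < m a} \<rightarrow> ?C ?I (k - w a)"
     using True by (auto simp: s us[unfolded fun_upd_apply] diff_mult_distrib2)
    show "(%m. m(a := m a + 1)) \<in> ?C ?I (k - w a) \<rightarrow> {m \<in> ?C ?I k. 0 < m a}"
     using True by (auto simp: s us[unfolded fun_upd_apply] add_mult_distrib2)
   qed auto
   thus ?thesis using True bij_betw_same_card by auto
  next
   case False
   have lt: "k < (\<Sum>i\<in>?I. w i * m i)" if "0 < m a" for m :: "'i => nat"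
   proof -
    have "w a \<le> w a * m a" using that by simp
    thus ?thesis using False unfolding s by linarith
   qed
   have "{m \<in> ?C ?I k. 0 < m a} = {}"
   proof (rule equals0I)
    fix m assume "m \<in> {m \<in> ?C ?I k. 0 < m a}"
    hence "0 < m a" "(\<Sum>i\<in>?I. w i * m i) = k" by blast+
    thus False using lt[of m] by simp
   qed
   thus ?thesis using False by (simp only: card.empty if_False)
  qed
  ultimately show ?thesis by simp
 qed
 let ?F = "%A. Abs_fps (%k. of_nat (card (?C A k))) :: rat fps"
 have "(1 - fps_X ^ w a) * ?F ?I = ?F A"
 proof (rule fps_ext)
  fix k
  have "((1 - fps_X ^ w a) * ?F ?I) $ k = of_nat (card (?C ?I k)) - (if k < w a then 0 else of_nat (card (?C ?I (k - w a))))"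
   by (simp add: left_diff_distrib fps_X_power_mult_nth)
  also have "... = of_nat (card (?C A k))" using card[of k] by simp
  finally show "((1 - fps_X ^ w a) * ?F ?I) $ k = ?F A $ k" by simp
 qed
 moreover have "(\<Prod>i\<in>?I. 1 - fps_X ^ w i) = (\<Prod>i\<in>A. 1 - fps_X ^ w i) * (1 - fps_X ^ w a :: rat fps)"
  using insert.hyps by (simp add: mult.commute)
 ultimately show ?case using insert.IH insert.prems by (simp add: mult.assoc)
qed

section \<open>The divided-out submodule in a fixed degree\<close>

lemma W1_hcomp: "2 \<le> n ==> hcomp d (W1 n p P) = W1 n p (hcomp d P)"
 using comp_commute[of "W1 n p" 0 d P] W_lin(1) W_homd(1) by simp

lemma W2_hcomp: "2 \<le> n ==> hcomp d (W2 n p P) = W2 n p (hcomp d P)"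
 using comp_commute[of "W2 n p" 0 d P] W_lin(4) W_homd(2) by simp

lemma VV_hcomp: "P \<in> UU n l ==> hcomp d P \<in> VV n l d"
 by (simp add: VV_def comp_UU homd_comp)

lemma VV_image:
 assumes n: "2 \<le> n" and x: "x = W1 n p P" "P \<in> UU n p" "homd d x"
 shows "x \<in> W1 n p ` VV n p d"
proof -
 have "x = hcomp d x" using comp_homd[OF x(3), of d] by simp
 also have "... = W1 n p (hcomp d P)" unfolding x(1) by (rule W1_hcomp[OF n])
 finally show ?thesis using VV_hcomp[OF x(2)] by blast
qed

lemma W1_VV: "2 \<le> n ==> P \<in> VV n p d ==> W1 n p P \<in> VV n (Suc p) d"
 using W1_UU W_homd(1) by (simp add: VV_def)

lemma W2_VV: "2 \<le> n ==> P \<in> VV n p d ==> W2 n p P \<in> VV n (p + 2) d"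
 using W2_UU W_homd(2) unfolding VV_def by blast

lemma dim_0: "mp.dim {0 :: mpoly} = 0"
 by (rule mp.dim_unique[of "{}"]) (simp_all add: mp.span_zero mp.independent_empty)

lemma subspace_image:
 fixes T :: "mpoly => mpoly"
 assumes "mp.subspace V" "!!P Q. T (P + Q) = T P + T Q" "!!c P. T (const c * P) = const c * T P"
 shows "mp.subspace (T ` V)"
 unfolding mp.subspace_def
proof (intro conjI ballI allI)
 have "T 0 = 0" using assms(2)[of 0 0] by simp
 thus "0 \<in> T ` V" using mp.subspace_0[OF assms(1)] by (metis imageI)
 fix x assume "x \<in> T ` V"
 then obtain P where P: "x = T P" "P \<in> V" by blast
 show "const c * x \<in> T ` V" for c
  unfolding P(1) assms(3)[symmetric] by (intro imageI mp.subspace_scale[OF assms(1)] P(2))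
 fix y assume "y \<in> T ` V"
 then obtain Q where Q: "y = T Q" "Q \<in> V" by blast
 show "x + y \<in> T ` V"
  unfolding P(1) Q(1) assms(2)[symmetric] by (intro imageI mp.subspace_add[OF assms(1)] P(2) Q(2))
qed

text \<open>By \<open>W1_exact\<close> the kernel is the image from one degree lower.\<close>

lemma W1_rank:
 assumes n: "2 \<le> n" and j: "2 * (j + 1) \<le> n"
 shows "mp.dim (VV n j d) = (if j = 0 then 0 else mp.dim (W1 n (j - 1) ` VV n (j - 1) d)) + mp.dim (W1 n j ` VV n j d)"
proof -
 have nl: "(2 \<le> n \<and> j \<le> n) \<or> j = 0" using n j by auto
 obtain B where B: "finite B" "VV n j d \<subseteq> mp.span B" using VV_dim(2)[OF nl] by blast
 have S: "mp.subspace (VV n j d)" using n by (intro VV_subspace) simp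
 have "{P \<in> VV n j d. W1 n j P = 0} = (if j = 0 then {0} else W1 n (j - 1) ` VV n (j - 1) d)"
 proof (cases j)
  case 0
  have "P = 0" if "P \<in> VV n 0 d" "W1 n 0 P = 0" for P using W1_exact[OF n, of P 0] that 0 j by (auto simp: VV_def)
  thus ?thesis using mp.subspace_0[OF S] W_lin(3) unfolding 0 by auto
 next
  case (Suc i)
  have "P \<in> W1 n i ` VV n i d" if P: "P \<in> VV n j d" "W1 n j P = 0" for P
  proof -
   have PU: "P \<in> UU n j" "homd d P" using P by (auto simp: VV_def)
   consider "P = 0" | R where "R \<in> UU n i" "P = W1 n i R" using W1_exact[OF n PU(1) j P(2)] Suc by auto
   thus ?thesis
   proof cases
    case 1
    have "0 \<in> VV n i d" using n by (intro mp.subspace_0 VV_subspace) simp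
    thus ?thesis using W_lin(3)[of n i] 1 by (metis imageI)
   next
    case 2
    thus ?thesis using VV_image[OF n 2(2,1) PU(2)] by simp
   qed
  qed
  moreover have "W1 n j (W1 n i Q) = 0" if "Q \<in> VV n i d" for Q
   using W1_W1[OF n, of Q i] that j Suc by (simp add: VV_def)
  ultimately show ?thesis using W1_VV[OF n] Suc by auto
 qed
 thus ?thesis using rank_nullity[OF S B, of "W1 n j"] W_lin(1,2) dim_0 by simp
qed

lemma Xi_span_Suc:
 assumes n: "2 \<le> n"
 shows "Xi_span n (int (Suc 0)) = W1 n 0 ` UU n 0"
  and "Xi_span n (int (Suc (Suc r))) = {W1 n (Suc r) P + W2 n r Q | P Q. P \<in> UU n (Suc r) \<and> Q \<in> UU n r}"
proof -
 have e: "int (Suc 0) - 1 = int 0" "int (Suc 0) - 2 = - 1" by simp_all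
 have U: "U n (int (Suc 0) - 1) = UU n 0" "U n (int (Suc 0) - 2) = {0}" unfolding e U_UU by (auto simp: U_neg)
 show "Xi_span n (int (Suc 0)) = W1 n 0 ` UU n 0" unfolding Xi_span_def U by (auto simp: W1_def wedge_lin(3))
 have f: "int (Suc (Suc r)) - 1 = int (Suc r)" "int (Suc (Suc r)) - 2 = int r" by simp_all
 show "Xi_span n (int (Suc (Suc r))) = {W1 n (Suc r) P + W2 n r Q | P Q. P \<in> UU n (Suc r) \<and> Q \<in> UU n r}"
  unfolding Xi_span_def f U_UU nat_int W1_def W2_def ..
qed

lemma Xi_span_0: "Xi_span n 0 = {0}"
 by (auto simp: Xi_span_def U_neg wedge_lin(3))

text \<open>Multiplication by Xi1 and Xi2 preserves the degree, so a homogeneous element of the sum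
  is the sum of the components of its two parts.\<close>

lemma Xi_VV:
 assumes n: "2 \<le> n"
 shows "Xi_span n (int (Suc 0)) \<inter> VV n (Suc 0) d = W1 n 0 ` VV n 0 d"
  and "Xi_span n (int (Suc (Suc r))) \<inter> VV n (Suc (Suc r)) d = {W1 n (Suc r) P + W2 n r Q | P Q. P \<in> VV n (Suc r) d \<and> Q \<in> VV n r d}"
proof -
 have sub: "VV n l d \<subseteq> UU n l" for l by (auto simp: VV_def)
 show "Xi_span n (int (Suc 0)) \<inter> VV n (Suc 0) d = W1 n 0 ` VV n 0 d"
 proof
  show "Xi_span n (int (Suc 0)) \<inter> VV n (Suc 0) d \<subseteq> W1 n 0 ` VV n 0 d"
   unfolding Xi_span_Suc(1)[OF n] using VV_image[OF n] by (auto simp: VV_def)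
  show "W1 n 0 ` VV n 0 d \<subseteq> Xi_span n (int (Suc 0)) \<inter> VV n (Suc 0) d"
   unfolding Xi_span_Suc(1)[OF n] using W1_VV[OF n] sub by blast
 qed
 show "Xi_span n (int (Suc (Suc r))) \<inter> VV n (Suc (Suc r)) d = {W1 n (Suc r) P + W2 n r Q | P Q. P \<in> VV n (Suc r) d \<and> Q \<in> VV n r d}" (is "?L = ?R")
 proof
  show "?L \<subseteq> ?R"
  proof
   fix x assume x: "x \<in> ?L"
   then obtain P Q where PQ: "x = W1 n (Suc r) P + W2 n r Q" "P \<in> UU n (Suc r)" "Q \<in> UU n r"
    unfolding Xi_span_Suc(2)[OF n] by blast
   have "homd d x" using x by (simp add: VV_def)
   hence "x = hcomp d x" using comp_homd[of d x d] by simp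
   also have "... = W1 n (Suc r) (hcomp d P) + W2 n r (hcomp d Q)"
    unfolding PQ(1) comp_add W1_hcomp[OF n] W2_hcomp[OF n] ..
   finally show "x \<in> ?R" using VV_hcomp[OF PQ(2)] VV_hcomp[OF PQ(3)] by blast
  qed
  show "?R \<subseteq> ?L"
  proof
   fix x assume "x \<in> ?R"
   then obtain P Q where PQ: "x = W1 n (Suc r) P + W2 n r Q" "P \<in> VV n (Suc r) d" "Q \<in> VV n r d" by blast
   have "W1 n (Suc r) P \<in> VV n (Suc (Suc r)) d" "W2 n r Q \<in> VV n (Suc (Suc r)) d"
    using W1_VV[OF n PQ(2)] W2_VV[OF n PQ(3)] unfolding add_2_eq_Suc' by blast+
   moreover have "mp.subspace (VV n (Suc (Suc r)) d)" using n by (intro VV_subspace) simp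
   ultimately have "x \<in> VV n (Suc (Suc r)) d" unfolding PQ(1) by (intro mp.subspace_add)
   moreover have "x \<in> Xi_span n (int (Suc (Suc r)))" unfolding Xi_span_Suc(2)[OF n]
    by (intro CollectI exI[of _ P] exI[of _ Q] conjI PQ(1) subsetD[OF sub PQ(2)] subsetD[OF sub PQ(3)])
   ultimately show "x \<in> ?L" by (rule IntI[rotated])
  qed
 qed
qed

text \<open>Rank and nullity of \<open>W1\<close> on the sum give two dimensions that
  \<open>W1_rank\<close> adds up to that of the previous graded piece. For l = 1 the map
  \<open>W1\<close> is injective on the invariants.\<close>

lemma Xi_VV_dim:
 assumes nl: "l = 0 \<or> (2 \<le> n \<and> 2 * l \<le> n)"
 shows "mp.dim (Xi_span n (int l) \<inter> VV n l d) = (if l = 0 then 0 else card (Pset n (l - 1) d))"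
proof (cases l)
 case 0
 have "0 \<in> VV n 0 d" by (intro mp.subspace_0 VV_subspace) simp
 hence "Xi_span n 0 \<inter> VV n 0 d = {0}" unfolding Xi_span_0 by blast
 thus ?thesis using 0 dim_0 by simp
next
 case (Suc p)
 hence n: "2 \<le> n" and p: "2 * (p + 1) \<le> n" using nl by auto
 have n0: "0 < n" and pn: "(2 \<le> n \<and> p \<le> n) \<or> p = 0" using n p by auto
 show ?thesis
 proof (cases p)
  case 0
  have "mp.dim (W1 n 0 ` VV n 0 d) = card (Pset n 0 d)" using W1_rank[OF n, of 0 d] VV_dim(1)[of n 0 d] n by simp
  thus ?thesis unfolding Suc 0 Xi_VV(1)[OF n] by simp
 next
  case (Suc r)
  note l = \<open>l = Suc p\<close>
  let ?X = "{W1 n (Suc r) P + W2 n r Q | P Q. P \<in> VV n (Suc r) d \<and> Q \<in> VV n r d}"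
  let ?l = "Suc (Suc r)"
  have r2: "r + 2 \<le> n" and rn: "2 * (r + 1) \<le> n" "2 * (r + 1) + 2 \<le> n" and rl: "r \<le> n" "Suc r \<le> n" using p Suc by auto
  have sub: "VV n j d \<subseteq> UU n j" for j by (auto simp: VV_def)
  have SV: "mp.subspace (VV n j d)" for j using n0 by (intro VV_subspace) simp
  have ln: "(2 \<le> n \<and> ?l \<le> n) \<or> ?l = 0" using n r2 by simp
  obtain B where B: "finite B" "VV n ?l d \<subseteq> mp.span B" using VV_dim(2)[OF ln] by blast
  have X: "?X = Xi_span n (int ?l) \<inter> VV n ?l d" by (rule Xi_VV(2)[OF n, symmetric])
  hence XB: "?X \<subseteq> mp.span B" using B(2) by blast
  have "?X = {x + y | x y. x \<in> W1 n (Suc r) ` VV n (Suc r) d \<and> y \<in> W2 n r ` VV n r d}" by blast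
  hence XS: "mp.subspace ?X"
   using mp.subspace_sums[OF subspace_image[OF SV, of "W1 n (Suc r)"] subspace_image[OF SV, of "W2 n r"]] W_lin by simp
  have W12: "W1 n ?l (W2 n r Q) = W2 n (Suc r) (W1 n r Q)" if "Q \<in> VV n r d" for Q
   using W1_W2[OF n subsetD[OF sub that] r2] unfolding add_2_eq_Suc' .
  have W1x: "W1 n ?l (W1 n (Suc r) P + W2 n r Q) = W2 n (Suc r) (W1 n r Q)"
   if "P \<in> VV n (Suc r) d" "Q \<in> VV n r d" for P Q
   unfolding W_lin(1) W12[OF that(2)] W1_W1[OF n subsetD[OF sub that(1)] rl(2)] by simp
  \<comment> \<open>If \<open>W1\<close> kills W1 P + W2 Q, then W2 W1 Q = 0, so W1 Q = 0 by
    \<open>W2_inj\<close>; either Q = 0 or Q = W1 R by exactness, and then W2 Q = W1 (W2 R) is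
    absorbed into the first part.\<close>
  have ker: "{x \<in> ?X. W1 n ?l x = 0} = W1 n (Suc r) ` VV n (Suc r) d"
  proof
   show "W1 n (Suc r) ` VV n (Suc r) d \<subseteq> {x \<in> ?X. W1 n ?l x = 0}"
   proof
    fix x assume "x \<in> W1 n (Suc r) ` VV n (Suc r) d"
    then obtain P where P: "x = W1 n (Suc r) P" "P \<in> VV n (Suc r) d" by blast
    have "x = W1 n (Suc r) P + W2 n r 0" using P(1) W_lin(6) by simp
    hence "x \<in> ?X" by (intro CollectI exI[of _ P] exI[of _ 0] conjI P(2) mp.subspace_0[OF SV])
    moreover have "W1 n ?l x = 0" unfolding P(1) by (rule W1_W1[OF n subsetD[OF sub P(2)] rl(2)])
    ultimately show "x \<in> {x \<in> ?X. W1 n ?l x = 0}" by (simp only: mem_Collect_eq simp_thms)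
   qed
   show "{x \<in> ?X. W1 n ?l x = 0} \<subseteq> W1 n (Suc r) ` VV n (Suc r) d"
   proof
    fix x assume "x \<in> {x \<in> ?X. W1 n ?l x = 0}"
    then obtain P Q where PQ: "x = W1 n (Suc r) P + W2 n r Q" "P \<in> VV n (Suc r) d" "Q \<in> VV n r d"
     and z: "W1 n ?l x = 0" and xX: "x \<in> ?X" by blast
    have hx: "homd d x" using xX unfolding X by (simp add: VV_def)
    have "W2 n (Suc r) (W1 n r Q) = 0" using z W1x[OF PQ(2,3)] PQ(1) by simp
    hence "W1 n r Q = 0" by (rule W2_inj[OF n subsetD[OF sub PQ(3)] rn(2)])
    then consider "Q = 0" | i R where "r = Suc i" "R \<in> UU n i" "Q = W1 n i R"
     using W1_exact[OF n subsetD[OF sub PQ(3)] rn(1)] by blast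
    hence "\<exists>P'\<in>UU n (Suc r). W2 n r Q = W1 n (Suc r) P'"
    proof cases
     case 1
     have "0 \<in> UU n (Suc r)" using mp.subspace_0[OF SV] sub by blast
     thus ?thesis using W_lin(3)[of n "Suc r"] W_lin(6)[of n r] 1 by (intro bexI[of _ 0]) simp_all
    next
     case 2
     have "W1 n (i + 2) (W2 n i R) = W2 n (Suc i) (W1 n i R)" using 2(1) r2 by (intro W1_W2[OF n 2(2)]) simp
     moreover have "i + 2 = Suc r" using 2(1) by simp
     ultimately have "W2 n r Q = W1 n (Suc r) (W2 n i R)" using 2(1,3) by simp
     moreover have "W2 n i R \<in> UU n (Suc r)" using W2_UU[OF n 2(2)] \<open>i + 2 = Suc r\<close> by simp
     ultimately show ?thesis by blast
    qed
    then obtain P' where P': "P' \<in> UU n (Suc r)" "W2 n r Q = W1 n (Suc r) P'" by blast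
    have "x = W1 n (Suc r) (P + P')" unfolding PQ(1) P'(2) W_lin(1) ..
    moreover have "P + P' \<in> UU n (Suc r)" using UU_lin(1)[OF _ subsetD[OF sub PQ(2)] P'(1)] n0 by blast
    ultimately show "x \<in> W1 n (Suc r) ` VV n (Suc r) d" using VV_image[OF n _ _ hx] by blast
   qed
  qed
  have im: "W1 n ?l ` ?X = W2 n (Suc r) ` W1 n r ` VV n r d"
  proof
   show "W1 n ?l ` ?X \<subseteq> W2 n (Suc r) ` W1 n r ` VV n r d"
   proof
    fix y assume "y \<in> W1 n ?l ` ?X"
    then obtain P Q where PQ: "y = W1 n ?l (W1 n (Suc r) P + W2 n r Q)" "P \<in> VV n (Suc r) d" "Q \<in> VV n r d" by blast
    show "y \<in> W2 n (Suc r) ` W1 n r ` VV n r d" unfolding PQ(1) W1x[OF PQ(2,3)] by (intro imageI PQ(3))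
   qed
   show "W2 n (Suc r) ` W1 n r ` VV n r d \<subseteq> W1 n ?l ` ?X"
   proof clarify
    fix Q assume Q: "Q \<in> VV n r d"
    have 0: "0 \<in> VV n (Suc r) d" by (rule mp.subspace_0[OF SV])
    have "W1 n (Suc r) 0 + W2 n r Q \<in> ?X" by (intro CollectI exI[of _ 0] exI[of _ Q] conjI refl 0 Q)
    thus "W2 n (Suc r) (W1 n r Q) \<in> W1 n ?l ` ?X" unfolding W1x[OF 0 Q, symmetric] by (rule imageI)
   qed
  qed
  have imdim: "mp.dim (W2 n (Suc r) ` W1 n r ` VV n r d) = mp.dim (W1 n r ` VV n r d)"
  proof -
   have nr: "(2 \<le> n \<and> Suc r \<le> n) \<or> Suc r = 0" using n rl by simp
   obtain B' where B': "finite B'" "VV n (Suc r) d \<subseteq> mp.span B'" using VV_dim(2)[OF nr] by blast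
   have S: "mp.subspace (W1 n r ` VV n r d)" using subspace_image[OF SV, of "W1 n r"] W_lin by simp
   have "W1 n r ` VV n r d \<subseteq> mp.span B'" using W1_VV[OF n] B'(2) by blast
   moreover have "{x \<in> W1 n r ` VV n r d. W2 n (Suc r) x = 0} = {0}"
   proof
    show "{x \<in> W1 n r ` VV n r d. W2 n (Suc r) x = 0} \<subseteq> {0}" using W2_inj[OF n _ rn(2)] sub by blast
    show "{0} \<subseteq> {x \<in> W1 n r ` VV n r d. W2 n (Suc r) x = 0}" using mp.subspace_0[OF S] W_lin(6) by simp
   qed
   ultimately show ?thesis using rank_nullity[OF S B'(1), of "W2 n (Suc r)"] W_lin(4,5) dim_0 by simp
  qed
  have "mp.dim ?X = mp.dim (W1 n (Suc r) ` VV n (Suc r) d) + mp.dim (W1 n r ` VV n r d)"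
   using rank_nullity[OF XS B(1) XB, of "W1 n ?l"] W_lin(1,2) unfolding ker im imdim by blast
  also have "... = mp.dim (VV n (Suc r) d)" using W1_rank[OF n, of "Suc r" d] p Suc by simp
  also have "... = card (Pset n (Suc r) d)" using VV_dim(1)[of n "Suc r" d] n rl by simp
  finally show ?thesis unfolding l Suc using X by simp
 qed
qed


text \<open>\<open>T\<close> parametrises the space by functions on the whole index type, of which
  only the values on \<open>J\<close> count. The dimension can so be read off without handling
  linear combinations in the quotient itself.\<close>

lemma coordinates:
 fixes W :: "(complex, 'w) module" and T :: "('j => complex) => 'w"
 assumes J: "finite J" and carrier: "carrier W = range T"
  and add: "!!c c'. T c \<oplus>\<^bsub>W\<^esub> T c' = T (%j. c j + c' j)"
  and smult: "!!k c. k \<odot>\<^bsub>W\<^esub> T c = T (%j. k * c j)"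
  and zero: "\<zero>\<^bsub>W\<^esub> = T (%_. 0)"
  and inj: "!!c j. T c = T (%_. 0) ==> j \<in> J ==> c j = 0"
  and ext: "!!c c'. (!!j. j \<in> J ==> c j = c' j) ==> T c = T c'"
 shows "vectorspace class_ring W" "vectorspace.fin_dim class_ring W" "vectorspace.dim class_ring W = card J"
proof -
 have cr: "cring (class_ring :: complex ring)" by (rule domain.axioms(1)[OF field.axioms(1)[OF class_field]])
 have "module (class_ring :: complex ring) W"
 proof (rule module_criteria[OF cr]; (intro allI impI ballI)?)
  show "\<zero>\<^bsub>W\<^esub> \<in> carrier W" by (simp add: zero carrier)
 next
  fix v w assume "v \<in> carrier W \<and> w \<in> carrier W"
  thus "v \<oplus>\<^bsub>W\<^esub> w \<in> carrier W" "v \<oplus>\<^bsub>W\<^esub> w = w \<oplus>\<^bsub>W\<^esub> v" by (auto simp: carrier add add.commute)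
 next
  fix v assume "v \<in> carrier W"
  then obtain c where c: "v = T c" by (auto simp: carrier)
  show "\<exists>w\<in>carrier W. v \<oplus>\<^bsub>W\<^esub> w = \<zero>\<^bsub>W\<^esub>"
   by (intro bexI[of _ "T (%j. - c j)"]) (simp_all add: c add zero carrier)
 qed (auto simp: carrier add smult zero algebra_simps)
 thus vs: "vectorspace class_ring W" using class_field by (simp add: vectorspace_def)
 interpret vectorspace "class_ring :: complex ring" W by (rule vs)
 define b where "b j = T (%i. if i = j then 1 else 0)" for j
 have bC: "b j \<in> carrier W" for j by (simp add: b_def carrier)
 have Tinj: "c j = c' j" if e: "T c = T c'" and j: "j \<in> J" for c c' j
 proof -
  have "T (%j. c j + - 1 * c' j) = T c \<oplus>\<^bsub>W\<^esub> ((- 1) \<odot>\<^bsub>W\<^esub> T c')" by (simp only: add smult)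
  also have "... = T (%j. c' j + - 1 * c' j)" unfolding e by (simp only: add smult)
  also have "... = T (%_. 0)" by simp
  finally have "c j + - 1 * c' j = 0" by (rule inj[OF _ j])
  thus ?thesis by simp
 qed
 have binj: "inj_on b J"
 proof (rule inj_onI, rule ccontr)
  fix j j' assume "j \<in> J" "j' \<in> J" "b j = b j'" "j ~= j'"
  thus False using Tinj[of "%i. if i = j then 1 else 0" "%i. if i = j' then 1 else 0" j] by (simp add: b_def)
 qed
 have lc: "lincomb a (b ` K) = T (%i. if i \<in> K then a (b i) else 0)" if "finite K" "K \<subseteq> J" for a K
  using that
 proof (induction K rule: finite_induct)
  case empty
  show ?case by (simp add: lincomb_def zero)
 next
  case (insert j K)
  have nin: "b j \<notin> b ` K" using insert binj by (auto simp: inj_on_def)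
  have aC: "(%v. a v \<odot>\<^bsub>W\<^esub> v) \<in> b ` K \<rightarrow> carrier W" and aj: "a (b j) \<odot>\<^bsub>W\<^esub> b j \<in> carrier W"
   by (auto simp: b_def smult carrier)
  have "lincomb a (b ` insert j K) = a (b j) \<odot>\<^bsub>W\<^esub> b j \<oplus>\<^bsub>W\<^esub> lincomb a (b ` K)"
   unfolding lincomb_def image_insert using insert.hyps by (intro finsum_insert nin aC aj) simp
  also have "... = T (%i. a (b j) * (if i = j then 1 else 0) + (if i \<in> K then a (b i) else 0))"
   using insert.IH insert.prems unfolding b_def[of j] by (simp only: insert_subset smult add)
  also have "(%i. a (b j) * (if i = j then 1 else 0) + (if i \<in> K then a (b i) else 0)) =
    (%i. if i \<in> insert j K then a (b i) else 0)" using insert.hyps by auto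
  finally show ?case .
 qed
 have lin: "lin_indpt (b ` J)"
 proof (rule finite_lin_indpt2)
  fix a assume "lincomb a (b ` J) = \<zero>\<^bsub>W\<^esub>"
  hence "T (%i. if i \<in> J then a (b i) else 0) = T (%_. 0)" using lc[OF J order_refl, of a] zero by simp
  from inj[OF this] show "\<forall>v\<in>b ` J. a v = \<zero>\<^bsub>class_ring\<^esub>" by auto
 qed (use J bC in auto)
 have gen: "span (b ` J) = carrier W"
 proof
  show "span (b ` J) \<subseteq> carrier W" using bC by (intro span_is_subset2) auto
  show "carrier W \<subseteq> span (b ` J)"
  proof
   fix v assume "v \<in> carrier W"
   then obtain c where c: "v = T c" by (auto simp: carrier)
   let ?a = "%w. c (the_inv_into J b w)"
   have "lincomb ?a (b ` J) = v" unfolding lc[OF J order_refl] c by (rule ext) (simp add: the_inv_into_f_f[OF binj])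
   thus "v \<in> span (b ` J)" unfolding span_def using J by auto
  qed
 qed
 show "fin_dim" unfolding fin_dim_def using J bC gen by (intro exI[of _ "b ` J"]) auto
 have "basis (b ` J)" unfolding basis_def using lin gen bC by auto
 thus "dim = card J" using dim_basis[of "b ` J"] J card_image[OF binj] by simp
qed

section \<open>The graded quotients\<close>

lemma UU_subspace: "0 < n \<or> l = 0 ==> mp.subspace (UU n l)"
 unfolding mp.subspace_def using UU_sum[of n l "{}"] UU_lin(1,2)[of n l] by auto

lemma Xi_subspace:
 assumes nl: "l = 0 \<or> (2 \<le> n \<and> 2 * l \<le> n)"
 shows "mp.subspace (Xi_span n (int l))" "Xi_span n (int l) \<subseteq> UU n l"
proof -
 have "mp.subspace (Xi_span n (int l)) \<and> Xi_span n (int l) \<subseteq> UU n l"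
 proof (cases l)
  case 0
  have "0 \<in> UU n 0" using mp.subspace_0[OF UU_subspace[of n 0]] by simp
  thus ?thesis unfolding 0 by (simp add: Xi_span_0 mp.subspace_single_0)
 next
  case (Suc p)
  hence n: "2 \<le> n" using nl by simp
  have S: "mp.subspace (UU n j)" for j using n by (intro UU_subspace) simp
  show ?thesis
  proof (cases p)
   case 0
   have "W1 n 0 ` UU n 0 \<subseteq> UU n (Suc 0)" using W1_UU[OF n] by blast
   moreover have "mp.subspace (W1 n 0 ` UU n 0)" using subspace_image[OF S, of "W1 n 0"] W_lin by simp
   ultimately show ?thesis unfolding Suc 0 Xi_span_Suc(1)[OF n] by blast
  next
   case (Suc r)
   have e: "Xi_span n (int (Suc (Suc r))) = {x + y | x y. x \<in> W1 n (Suc r) ` UU n (Suc r) \<and> y \<in> W2 n r ` UU n r}"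
    unfolding Xi_span_Suc(2)[OF n] by blast
   have "mp.subspace {x + y | x y. x \<in> W1 n (Suc r) ` UU n (Suc r) \<and> y \<in> W2 n r ` UU n r}"
    using mp.subspace_sums[OF subspace_image[OF S, of "W1 n (Suc r)"] subspace_image[OF S, of "W2 n r"]] W_lin by simp
   moreover have "{x + y | x y. x \<in> W1 n (Suc r) ` UU n (Suc r) \<and> y \<in> W2 n r ` UU n r} \<subseteq> UU n (Suc (Suc r))"
   proof
    fix z assume "z \<in> {x + y | x y. x \<in> W1 n (Suc r) ` UU n (Suc r) \<and> y \<in> W2 n r ` UU n r}"
    then obtain P Q where "z = W1 n (Suc r) P + W2 n r Q" "P \<in> UU n (Suc r)" "Q \<in> UU n r" by blast
    moreover have "W2 n r Q \<in> UU n (Suc (Suc r))" using W2_UU[OF n \<open>Q \<in> UU n r\<close>] unfolding add_2_eq_Suc' .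
    ultimately show "z \<in> UU n (Suc (Suc r))" using W1_UU[OF n] by (simp add: mp.subspace_add[OF S])
   qed
   ultimately show ?thesis unfolding \<open>l = Suc p\<close> Suc e by blast
  qed
 qed
 thus "mp.subspace (Xi_span n (int l))" "Xi_span n (int l) \<subseteq> UU n l" by auto
qed

definition Vd :: "nat => nat => rat => mpoly set" where
 "Vd n l d = {P \<in> UU n l. deg2_homogeneous n d P}"

text \<open>The candidate for deg1 when deg2 is \<open>d\<close>. A rational \<open>d\<close> may
  not be attained, so \<open>pcount\<close> compares back.\<close>

definition pdeg :: "nat => rat => int" where
 "pdeg n d = \<lfloor>d - of_nat (n\<^sup>2) / 4\<rfloor>"

definition pcount :: "nat => nat => rat => nat" where
 "pcount n l d = (if of_nat (n\<^sup>2) / 4 + of_int (pdeg n d) = d then card (Pset n l (pdeg n d)) else 0)"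

lemma Vd_cases:
 "of_nat (n\<^sup>2) / 4 + of_int (pdeg n d) = d ==> Vd n l d = VV n l (pdeg n d)"
 "of_nat (n\<^sup>2) / 4 + of_int (pdeg n d) ~= d ==> 0 < n \<or> l = 0 ==> Vd n l d = {0}"
proof -
 assume e: "of_nat (n\<^sup>2) / 4 + of_int (pdeg n d) = d"
 have "of_nat (n\<^sup>2) / 4 + of_int k = d \<longleftrightarrow> k = pdeg n d" for k
 proof -
  have "of_nat (n\<^sup>2) / 4 + of_int k = d \<longleftrightarrow> of_nat (n\<^sup>2) / 4 + of_int k = of_nat (n\<^sup>2) / 4 + (of_int (pdeg n d) :: rat)"
   by (simp only: e)
  thus ?thesis by (simp only: add_left_cancel of_int_eq_iff)
 qed
 thus "Vd n l d = VV n l (pdeg n d)" by (simp add: Vd_def VV_def deg2_homogeneous_def homd_def)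
next
 assume e: "of_nat (n\<^sup>2) / 4 + of_int (pdeg n d) ~= d" and nl: "0 < n \<or> l = 0"
 have "of_nat (n\<^sup>2) / 4 + of_int k ~= d" for k
 proof
  assume k: "of_nat (n\<^sup>2) / 4 + of_int k = d"
  have "pdeg n d = k" unfolding pdeg_def k[symmetric] by simp
  thus False using e k by simp
 qed
 hence "deg2_homogeneous n d P \<longleftrightarrow> P = 0" for P unfolding deg2_homogeneous_def by auto
 thus "Vd n l d = {0}" using mp.subspace_0[OF UU_subspace[OF nl]] by (auto simp: Vd_def)
qed

definition valid :: "nat => nat => bool" where
 "valid n l \<longleftrightarrow> l = 0 \<or> (2 \<le> n \<and> 2 * l \<le> n)"

text \<open>The index n is the same as for l, so both terms carry the shift n^2 / 4 and are compared
  in the same degree.\<close>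

definition pprev :: "nat => nat => rat => nat" where
 "pprev n l d = (if l = 0 then 0 else pcount n (l - 1) d)"

lemma Vd_complement:
 assumes v: "valid n l"
 shows "\<exists>J. finite J \<and> J \<subseteq> Vd n l d \<and> card J + pprev n l d = pcount n l d \<and>
  (\<forall>c. (\<Sum>x\<in>J. const (c x) * x) \<in> Xi_span n (int l) --> (\<forall>x\<in>J. c x = 0)) \<and>
  (\<forall>P\<in>Vd n l d. \<exists>c. P - (\<Sum>x\<in>J. const (c x) * x) \<in> Xi_span n (int l))"
proof (cases "of_nat (n\<^sup>2) / 4 + of_int (pdeg n d) = d")
 case True
 have nl: "l = 0 \<or> (2 \<le> n \<and> 2 * l \<le> n)" and nl2: "(2 \<le> n \<and> l \<le> n) \<or> l = 0" and nl3: "0 < n \<or> l = 0"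
  using v by (auto simp: valid_def)
 obtain B where B: "finite B" "VV n l (pdeg n d) \<subseteq> mp.span B" using VV_dim(2)[OF nl2] by blast
 have "mp.dim (Xi_span n (int l) \<inter> VV n l (pdeg n d)) = pprev n l d"
  unfolding Xi_VV_dim[OF nl] pprev_def pcount_def using True by simp
 moreover have "mp.dim (VV n l (pdeg n d)) = pcount n l d" unfolding VV_dim(1)[OF nl2] pcount_def using True by simp
 ultimately show ?thesis
  unfolding Vd_cases(1)[OF True] using complement_ex[OF VV_subspace[OF nl3] Xi_subspace(1)[OF nl] B] by simp
next
 case False
 have nl: "l = 0 \<or> (2 \<le> n \<and> 2 * l \<le> n)" and nl3: "0 < n \<or> l = 0" using v by (auto simp: valid_def)
 have "pcount n l d = 0" "pprev n l d = 0" using False by (auto simp: pprev_def pcount_def)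
 thus ?thesis unfolding Vd_cases(2)[OF False nl3]
  using mp.subspace_0[OF Xi_subspace(1)[OF nl]] by (intro exI[of _ "{}"]) simp
qed

definition coset :: "mpoly set => mpoly => mpoly set" where
 "coset X P = (%h. h + P) ` X"

lemma r_coset_poly_space: "X +>\<^bsub>poly_space A\<^esub> P = coset X P"
 unfolding a_r_coset_def' by (auto simp: poly_space_def coset_def)

lemma coset_eq_iff:
 assumes X: "mp.subspace X"
 shows "coset X P = coset X Q \<longleftrightarrow> P - Q \<in> X"
proof
 assume "coset X P = coset X Q"
 moreover have "0 + P \<in> coset X P" unfolding coset_def using mp.subspace_0[OF X] by (rule imageI)
 ultimately obtain h where "h \<in> X" "0 + P = h + Q" unfolding coset_def by blast
 hence "P - Q = h" by (simp add: algebra_simps)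
 thus "P - Q \<in> X" using \<open>h \<in> X\<close> by simp
next
 assume d: "P - Q \<in> X"
 have d': "Q - P \<in> X" using mp.subspace_neg[OF X d] by simp
 have sub: "coset X P \<subseteq> coset X Q" if "P - Q \<in> X" for P Q
 proof
  fix y assume "y \<in> coset X P"
  then obtain h where h: "h \<in> X" "y = h + P" by (auto simp: coset_def)
  have "y = (h + (P - Q)) + Q" using h(2) by simp
  moreover have "h + (P - Q) \<in> X" by (rule mp.subspace_add[OF X h(1) that])
  ultimately show "y \<in> coset X Q" unfolding coset_def by (rule image_eqI)
 qed
 show "coset X P = coset X Q" using sub[OF d] sub[OF d'] by blast
qed

text \<open>The set-theoretic operations of the quotient act on representatives because the
  divided-out set is a subspace.\<close>

lemma M_quot_simps:
 assumes X: "mp.subspace (Xi_span n (int l))"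
 shows "carrier (M_quot n l) = coset (Xi_span n (int l)) ` UU n l"
  and "\<zero>\<^bsub>M_quot n l\<^esub> = coset (Xi_span n (int l)) 0"
  and "coset (Xi_span n (int l)) P \<oplus>\<^bsub>M_quot n l\<^esub> coset (Xi_span n (int l)) Q = coset (Xi_span n (int l)) (P + Q)"
  and "c \<odot>\<^bsub>M_quot n l\<^esub> coset (Xi_span n (int l)) P = coset (Xi_span n (int l)) (const c * P)"
proof -
 let ?X = "Xi_span n (int l)"
 have c: "carrier (poly_space A) = A" for A by (simp add: poly_space_def)
 show "carrier (M_quot n l) = coset ?X ` UU n l"
  by (auto simp: M_quot_def quotient_space_def A_RCOSETS_def' c U_UU r_coset_poly_space)
 show "\<zero>\<^bsub>M_quot n l\<^esub> = coset ?X 0" by (simp add: M_quot_def quotient_space_def coset_def)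
 have "coset ?X P \<oplus>\<^bsub>M_quot n l\<^esub> coset ?X Q = (\<Union>h\<in>coset ?X P. \<Union>k\<in>coset ?X Q. {h + k})"
  by (simp add: M_quot_def quotient_space_def set_add_def' poly_space_def)
 also have "... = coset ?X (P + Q)"
 proof
  show "(\<Union>h\<in>coset ?X P. \<Union>k\<in>coset ?X Q. {h + k}) \<subseteq> coset ?X (P + Q)"
  proof
   fix y assume "y \<in> (\<Union>h\<in>coset ?X P. \<Union>k\<in>coset ?X Q. {h + k})"
   then obtain h k where hk: "h \<in> ?X" "k \<in> ?X" "y = (h + P) + (k + Q)" by (auto simp: coset_def)
   have "y = (h + k) + (P + Q)" unfolding hk(3) by (simp only: add_ac)
   thus "y \<in> coset ?X (P + Q)" unfolding coset_def using mp.subspace_add[OF X hk(1,2)] by (rule image_eqI)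
  qed
  show "coset ?X (P + Q) \<subseteq> (\<Union>h\<in>coset ?X P. \<Union>k\<in>coset ?X Q. {h + k})"
  proof
   fix y assume "y \<in> coset ?X (P + Q)"
   then obtain h where h: "h \<in> ?X" "y = (h + P) + (0 + Q)" by (auto simp: coset_def add_ac)
   have "h + P \<in> coset ?X P" "0 + Q \<in> coset ?X Q"
    unfolding coset_def using h(1) mp.subspace_0[OF X] by (auto intro: imageI)
   thus "y \<in> (\<Union>h\<in>coset ?X P. \<Union>k\<in>coset ?X Q. {h + k})" using h(2) by blast
  qed
 qed
 finally show "coset ?X P \<oplus>\<^bsub>M_quot n l\<^esub> coset ?X Q = coset ?X (P + Q)" .
 have "c \<odot>\<^bsub>M_quot n l\<^esub> coset ?X P = (\<Union>Q\<in>coset ?X P. coset ?X (const c * Q))"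
  by (simp add: M_quot_def quotient_space_def r_coset_poly_space) (simp add: poly_space_def)
 also have "... = (\<Union>Q\<in>coset ?X P. coset ?X (const c * P))"
 proof (rule SUP_cong[OF refl])
  fix Q assume "Q \<in> coset ?X P"
  then obtain h where h: "h \<in> ?X" "Q = h + P" by (auto simp: coset_def)
  have "const c * Q - const c * P = const c * h" unfolding h(2) by (simp add: distrib_left)
  thus "coset ?X (const c * Q) = coset ?X (const c * P)"
   unfolding coset_eq_iff[OF X] using mp.subspace_scale[OF X h(1), of c] by simp
 qed
 also have "... = coset ?X (const c * P)" using mp.subspace_0[OF X] by (auto simp: coset_def)
 finally show "c \<odot>\<^bsub>M_quot n l\<^esub> coset ?X P = coset ?X (const c * P)" .
qed

lemma weight_valid: "(n, l) \<in> weight_indices i lam ==> valid n l"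
 by (auto simp: weight_indices_def valid_def)

lemma weight_le: "(n, l) \<in> weight_indices i lam ==> l \<le> n"
 by (auto simp: weight_indices_def)

text \<open>The indices that can contribute in degree \<open>d\<close>: the basis monomials have
  non-negative deg1, so deg2 starts at n^2 / 4. Their finiteness makes each graded component finite
  dimensional.\<close>

definition Iset :: "nat => nat => rat => (nat \<times> nat) set" where
 "Iset i lam d = {p \<in> weight_indices i lam. of_nat ((fst p)\<^sup>2) / 4 \<le> d}"

lemma finite_Iset: "finite (Iset i lam d)"
proof (rule finite_subset)
 let ?N = "nat \<lfloor>4 * d\<rfloor>"
 show "Iset i lam d \<subseteq> {..?N} \<times> {..?N}"
 proof
  fix p assume p: "p \<in> Iset i lam d"
  obtain n l where nl: "p = (n, l)" by (cases p)
  have "of_nat (n\<^sup>2) \<le> 4 * d" using p nl by (simp add: Iset_def)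
  hence "of_int (int (n\<^sup>2)) \<le> 4 * d" by (simp only: of_int_of_nat_eq)
  hence "int (n\<^sup>2) \<le> \<lfloor>4 * d\<rfloor>" unfolding le_floor_iff .
  hence "n\<^sup>2 \<le> ?N" by (simp only: le_nat_iff[OF order.trans[OF of_nat_0_le_iff]])
  moreover have "n \<le> n\<^sup>2" by (cases n) (simp_all add: power2_eq_square)
  moreover have "l \<le> n" using p nl weight_le[of n l i lam] by (simp add: Iset_def)
  ultimately show "p \<in> {..?N} \<times> {..?N}" using nl by simp
 qed
qed simp

lemma pcount_outside: "p \<in> weight_indices i lam ==> p \<notin> Iset i lam d ==> pcount (fst p) l d = 0"
proof -
 assume p: "p \<in> weight_indices i lam" "p \<notin> Iset i lam d"
 hence "d - of_nat ((fst p)\<^sup>2) / 4 < 0" by (simp add: Iset_def)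
 hence "pdeg (fst p) d < 0" unfolding pdeg_def by (simp only: floor_less_zero)
 hence "Pset (fst p) l (pdeg (fst p) d) = {}" by (auto simp: Pset_def simp del: of_nat_sum of_nat_mult)
 thus "pcount (fst p) l d = 0" by (simp add: pcount_def)
qed

text \<open>The dimensions \<open>jc\<close> of the summands are tied to the counts by an addition,
  which keeps truncated subtraction out.\<close>

lemma M_graded_dim:
 "\<exists>jc. vectorspace class_ring (M_graded i lam d) \<and> vectorspace.fin_dim class_ring (M_graded i lam d) \<and>
   vectorspace.dim class_ring (M_graded i lam d) = (\<Sum>p\<in>Iset i lam d. jc p) \<and>
   (\<forall>p\<in>weight_indices i lam. jc p + pprev (fst p) (snd p) d = pcount (fst p) (snd p) d)"
proof -
 let ?I = "weight_indices i lam"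
 define X where "X p = Xi_span (fst p) (int (snd p))" for p :: "nat \<times> nat"
 have val: "valid (fst p) (snd p)" if "p \<in> ?I" for p using weight_valid[of "fst p" "snd p"] that by simp
 have XS: "mp.subspace (X p)" if "p \<in> ?I" for p
  using Xi_subspace(1)[of "snd p" "fst p"] val[OF that] by (simp add: valid_def X_def)
 have nl: "0 < fst p \<or> snd p = 0" if "p \<in> ?I" for p using val[OF that] by (auto simp: valid_def)
 have "\<forall>p\<in>?I. \<exists>J. finite J \<and> J \<subseteq> Vd (fst p) (snd p) d \<and> card J + pprev (fst p) (snd p) d = pcount (fst p) (snd p) d \<and>
  (\<forall>c. (\<Sum>x\<in>J. const (c x) * x) \<in> X p --> (\<forall>x\<in>J. c x = 0)) \<and>
  (\<forall>P\<in>Vd (fst p) (snd p) d. \<exists>c. P - (\<Sum>x\<in>J. const (c x) * x) \<in> X p)"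
  unfolding X_def using Vd_complement[OF val] by blast
 from bchoice[OF this] obtain Jf where Jf: "\<forall>p\<in>?I. finite (Jf p) \<and> Jf p \<subseteq> Vd (fst p) (snd p) d \<and>
  card (Jf p) + pprev (fst p) (snd p) d = pcount (fst p) (snd p) d \<and>
  (\<forall>c. (\<Sum>x\<in>Jf p. const (c x) * x) \<in> X p --> (\<forall>x\<in>Jf p. c x = 0)) \<and>
  (\<forall>P\<in>Vd (fst p) (snd p) d. \<exists>c. P - (\<Sum>x\<in>Jf p. const (c x) * x) \<in> X p)" by blast
 have J1: "finite (Jf p)" and J2: "Jf p \<subseteq> Vd (fst p) (snd p) d"
  and J3: "card (Jf p) + pprev (fst p) (snd p) d = pcount (fst p) (snd p) d"
  and J4: "!!c x. (\<Sum>x\<in>Jf p. const (c x) * x) \<in> X p ==> x \<in> Jf p ==> c x = 0"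
  and J5: "!!P. P \<in> Vd (fst p) (snd p) d ==> \<exists>c. P - (\<Sum>x\<in>Jf p. const (c x) * x) \<in> X p"
  if "p \<in> ?I" for p using bspec[OF Jf that] by blast+
 \<comment> \<open>Summands with count 0 have no representatives, so the total set of coordinates is
   finite although the indices are not.\<close>
 have J0: "Jf p = {}" if p: "p \<in> ?I" "p \<notin> Iset i lam d" for p
  using J3[OF p(1)] pcount_outside[OF p, of "snd p"] J1[OF p(1)] by simp
 define J where "J = (SIGMA p:Iset i lam d. Jf p)"
 have IJ: "Iset i lam d \<subseteq> ?I" by (auto simp: Iset_def)
 have finJ: "finite J" unfolding J_def using finite_Iset J1 IJ by (intro finite_SigmaI) auto
 have cardJ: "card J = (\<Sum>p\<in>Iset i lam d. card (Jf p))"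
  unfolding J_def using finite_Iset J1 IJ by (intro card_SigmaI) auto
 define lc where "lc c p = (\<Sum>x\<in>Jf p. const (c (p, x)) * x)" for c :: "(nat \<times> nat) \<times> mpoly => complex" and p
 \<comment> \<open>On every summand, the coset of the combination of its chosen
   representatives.\<close>
 define T where "T c = (\<lambda>p\<in>?I. coset (X p) (lc c p))" for c
 have Tp: "T c p = coset (X p) (lc c p)" if "p \<in> ?I" for c p using that by (simp add: T_def)
 have VdS: "mp.subspace (Vd (fst p) (snd p) d)" if "p \<in> ?I" for p
 proof (cases "of_nat ((fst p)\<^sup>2) / 4 + of_int (pdeg (fst p) d) = d")
  case True
  show ?thesis unfolding Vd_cases(1)[OF True] by (rule VV_subspace[OF nl[OF that]])
 next
  case False
  show ?thesis unfolding Vd_cases(2)[OF False nl[OF that]] by (rule mp.subspace_single_0)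
 qed
 have lcV: "lc c p \<in> Vd (fst p) (snd p) d" if "p \<in> ?I" for c p
  unfolding lc_def using J2[OF that] by (intro mp.subspace_sum[OF VdS[OF that]] mp.subspace_scale[OF VdS[OF that]]) blast
 have lc_add: "lc (%j. c j + c' j) p = lc c p + lc c' p" for c c' p
  unfolding lc_def sum.distrib[symmetric] by (rule sum.cong[OF refl]) (simp only: const_add distrib_right)
 have lc_mult: "lc (%j. k * c j) p = const k * lc c p" for k c p
  unfolding lc_def sum_distrib_left by (rule sum.cong[OF refl]) (simp only: const_mult mult.assoc)
 have lc_0: "lc (%_. 0) p = 0" for p by (simp add: lc_def)
 let ?W = "M_graded i lam d"
 have qs: "carrier (M_quot (fst p) (snd p)) = coset (X p) ` UU (fst p) (snd p)"
  "\<zero>\<^bsub>M_quot (fst p) (snd p)\<^esub> = coset (X p) 0"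
  "!!P Q. coset (X p) P \<oplus>\<^bsub>M_quot (fst p) (snd p)\<^esub> coset (X p) Q = coset (X p) (P + Q)"
  "!!k P. k \<odot>\<^bsub>M_quot (fst p) (snd p)\<^esub> coset (X p) P = coset (X p) (const k * P)" if "p \<in> ?I" for p
  unfolding X_def
  by (rule M_quot_simps(1) M_quot_simps(2) M_quot_simps(3) M_quot_simps(4), rule XS[OF that, unfolded X_def])+
 have cW: "f \<in> carrier ?W \<longleftrightarrow> (f \<in> (\<Pi>\<^sub>E p\<in>?I. coset (X p) ` UU (fst p) (snd p)) \<and> finite {p \<in> ?I. f p ~= coset (X p) 0}) \<and>
   (\<forall>p\<in>?I. \<exists>P\<in>Vd (fst p) (snd p) d. f p = coset (X p) P)" for f
 proof -
  have a: "(\<Pi>\<^sub>E p\<in>?I. carrier (case p of (n, l) => M_quot n l)) = (\<Pi>\<^sub>E p\<in>?I. coset (X p) ` UU (fst p) (snd p))"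
   by (rule PiE_cong) (simp add: case_prod_beta qs)
  have b: "{p \<in> ?I. f p ~= \<zero>\<^bsub>case p of (n, l) => M_quot n l\<^esub>} = {p \<in> ?I. f p ~= coset (X p) 0}"
   by (rule Collect_cong, rule conj_cong[OF refl]) (simp only: case_prod_beta qs(2))
  have c: "(\<forall>(n, l)\<in>?I. \<exists>P\<in>U n (int l). deg2_homogeneous n d P \<and> f (n, l) = Xi_span n (int l) +>\<^bsub>poly_space (U n (int l))\<^esub> P) \<longleftrightarrow>
    (\<forall>p\<in>?I. \<exists>P\<in>Vd (fst p) (snd p) d. f p = coset (X p) P)"
   unfolding r_coset_poly_space U_UU by (rule ball_cong[OF refl]) (auto simp: Vd_def X_def)
  have 1: "carrier ?W = {f \<in> carrier (M_space i lam). \<forall>(n, l)\<in>?I.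
    \<exists>P\<in>U n (int l). deg2_homogeneous n d P \<and> f (n, l) = Xi_span n (int l) +>\<^bsub>poly_space (U n (int l))\<^esub> P}"
   unfolding M_graded_def by simp
  have 2: "carrier (M_space i lam) = {f \<in> (\<Pi>\<^sub>E p\<in>?I. carrier (case p of (n, l) => M_quot n l)).
    finite {p \<in> ?I. f p ~= \<zero>\<^bsub>case p of (n, l) => M_quot n l\<^esub>}}"
   unfolding M_space_def direct_sum_space_def by simp
  show ?thesis unfolding 1 2 mem_Collect_eq a b c ..
 qed
 have rng: "carrier ?W = range T"
 proof
  show "range T \<subseteq> carrier ?W"
  proof
   fix f assume "f \<in> range T"
   then obtain c where f: "f = T c" by blast
   have "T c \<in> (\<Pi>\<^sub>E p\<in>?I. coset (X p) ` UU (fst p) (snd p))"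
    unfolding T_def using lcV by (intro restrict_PiE_iff[THEN iffD2] ballI imageI) (auto simp: Vd_def)
   moreover have "{p \<in> ?I. T c p ~= coset (X p) 0} \<subseteq> Iset i lam d"
   proof
    fix p assume p: "p \<in> {p \<in> ?I. T c p ~= coset (X p) 0}"
    show "p \<in> Iset i lam d"
    proof (rule ccontr)
     assume "p \<notin> Iset i lam d"
     hence "lc c p = 0" using J0[of p] p by (simp add: lc_def)
     thus False using p Tp[of p c] by simp
    qed
   qed
   hence "finite {p \<in> ?I. T c p ~= coset (X p) 0}" using finite_Iset finite_subset by blast
   moreover have "\<forall>p\<in>?I. \<exists>P\<in>Vd (fst p) (snd p) d. T c p = coset (X p) P" using Tp lcV by blast
   ultimately show "f \<in> carrier ?W" unfolding f cW by blast
  qed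
  show "carrier ?W \<subseteq> range T"
  proof
   fix f assume "f \<in> carrier ?W"
   hence f: "f \<in> (\<Pi>\<^sub>E p\<in>?I. coset (X p) ` UU (fst p) (snd p))" "\<forall>p\<in>?I. \<exists>P\<in>Vd (fst p) (snd p) d. f p = coset (X p) P"
    unfolding cW by blast+
   have "\<exists>c. f p = coset (X p) (\<Sum>x\<in>Jf p. const (c x) * x)" if p: "p \<in> ?I" for p
   proof -
    obtain P where P: "P \<in> Vd (fst p) (snd p) d" "f p = coset (X p) P" using f(2) p by blast
    obtain c where "P - (\<Sum>x\<in>Jf p. const (c x) * x) \<in> X p" using J5[OF p P(1)] by blast
    thus ?thesis unfolding P(2) coset_eq_iff[OF XS[OF p]] by blast
   qed
   hence "\<forall>p\<in>?I. \<exists>c. f p = coset (X p) (\<Sum>x\<in>Jf p. const (c x) * x)" by blast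
   from bchoice[OF this] obtain g where g: "\<forall>p\<in>?I. f p = coset (X p) (\<Sum>x\<in>Jf p. const (g p x) * x)" by blast
   have "f = T (%(p, x). g p x)"
   proof
    fix p
    show "f p = T (%(p, x). g p x) p"
     using g PiE_arb[OF f(1), of p] by (cases "p \<in> ?I") (simp_all add: T_def lc_def)
   qed
   thus "f \<in> range T" by blast
  qed
 qed
 have add: "T c \<oplus>\<^bsub>?W\<^esub> T c' = T (%j. c j + c' j)" for c c'
 proof -
  have "T c \<oplus>\<^bsub>?W\<^esub> T c' = (\<lambda>p\<in>?I. T c p \<oplus>\<^bsub>M_quot (fst p) (snd p)\<^esub> T c' p)"
   by (simp add: M_graded_def M_space_def direct_sum_space_def case_prod_beta)
  also have "... = T (%j. c j + c' j)"
   unfolding T_def[of "%j. c j + c' j"] by (rule restrict_ext) (simp add: Tp qs lc_add)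
  finally show ?thesis .
 qed
 have smult: "k \<odot>\<^bsub>?W\<^esub> T c = T (%j. k * c j)" for k c
 proof -
  have "k \<odot>\<^bsub>?W\<^esub> T c = (\<lambda>p\<in>?I. k \<odot>\<^bsub>M_quot (fst p) (snd p)\<^esub> T c p)"
   by (simp add: M_graded_def M_space_def direct_sum_space_def case_prod_beta)
  also have "... = T (%j. k * c j)"
   unfolding T_def[of "%j. k * c j"] by (rule restrict_ext) (simp add: Tp qs lc_mult)
  finally show ?thesis .
 qed
 have zero: "\<zero>\<^bsub>?W\<^esub> = T (%_. 0)"
 proof -
  have "\<zero>\<^bsub>?W\<^esub> = (\<lambda>p\<in>?I. \<zero>\<^bsub>M_quot (fst p) (snd p)\<^esub>)"
   by (simp add: M_graded_def M_space_def direct_sum_space_def case_prod_beta)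
  also have "... = T (%_. 0)" unfolding T_def by (rule restrict_ext) (simp add: qs lc_0)
  finally show ?thesis .
 qed
 have inj: "c j = 0" if e: "T c = T (%_. 0)" and j: "j \<in> J" for c j
 proof -
  obtain p x where px: "j = (p, x)" "p \<in> ?I" "x \<in> Jf p" using j IJ by (auto simp: J_def)
  have "coset (X p) (lc c p) = coset (X p) 0" using fun_cong[OF e, of p] Tp[OF px(2)] lc_0 by simp
  hence "lc c p \<in> X p" unfolding coset_eq_iff[OF XS[OF px(2)]] by simp
  thus ?thesis using J4[OF px(2), of "%x. c (p, x)" x] px by (simp add: lc_def)
 qed
 have ext: "T c = T c'" if e: "!!j. j \<in> J ==> c j = c' j" for c c' unfolding T_def
 proof (rule restrict_ext)
  fix p assume p: "p \<in> ?I"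
  have "lc c p = lc c' p"
  proof (cases "p \<in> Iset i lam d")
   case True
   thus ?thesis unfolding lc_def using e by (intro sum.cong) (auto simp: J_def)
  next
   case False
   thus ?thesis using J0[OF p] by (simp add: lc_def)
  qed
  thus "coset (X p) (lc c p) = coset (X p) (lc c' p)" by simp
 qed
 have cs: "vectorspace class_ring ?W" "vectorspace.fin_dim class_ring ?W" "vectorspace.dim class_ring ?W = card J"
  by (rule coordinates[OF finJ rng add smult zero]; (erule (1) inj | (rule ext, assumption)))+
 show ?thesis using cs cardJ J3 by (intro exI[of _ "%p. card (Jf p)"]) auto
qed

section \<open>The character\<close>

lemma fps_to_fls_prod: "fps_to_fls (\<Prod>i\<in>A. F i) = (\<Prod>i\<in>A. fps_to_fls (F i) :: 'r::comm_ring_1 fls)"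
 by (induction A rule: infinite_finite_induct) (simp_all add: fls_times_fps_to_fls)

text \<open>Weights are multiplied by 4 because the series variable stands for the fourth root of
  q.\<close>

definition gfps :: "nat => nat => rat fps" where
 "gfps n l = Abs_fps (%k. of_nat (card {m \<in> supp n. (\<Sum>i\<in>{1..n}. 4 * wt l i * m i) = k}))"

text \<open>The weights of the generators are 1, ..., l and 1, ..., n - l, which gives the two
  q-factorials.\<close>

lemma qpoch_gfps:
 assumes l: "l \<le> n"
 shows "qpoch l * qpoch (n - l) * fps_to_fls (gfps n l) = 1"
proof -
 have "qpoch l * qpoch (n - l) = (\<Prod>i\<in>{1..n}. 1 - qvar ^ wt l i)"
 proof -
  have "(\<Prod>i\<in>{1..n}. 1 - qvar ^ wt l i) = (\<Prod>i\<in>{1..l}. 1 - qvar ^ wt l i) * (\<Prod>i\<in>{1..n - l}. 1 - qvar ^ wt l (l + i))"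
   using prod_split[where p = l and q = "n - l" and h = "%i. 1 - qvar ^ wt l i"] l by simp
  also have "(\<Prod>i\<in>{1..l}. 1 - qvar ^ wt l i) = qpoch l"
   unfolding qpoch_def by (rule prod.cong) (auto simp: wt_def)
  also have "(\<Prod>i\<in>{1..n - l}. 1 - qvar ^ wt l (l + i)) = qpoch (n - l)"
   unfolding qpoch_def by (rule prod.cong) (auto simp: wt_def)
  finally show ?thesis by simp
 qed
 also have "... = fps_to_fls (\<Prod>i\<in>{1..n}. 1 - fps_X ^ (4 * wt l i))" unfolding fps_to_fls_prod
  by (rule prod.cong[OF refl]) (simp add: qvar_def fps_to_fls_power power_mult)
 also have "... * fps_to_fls (gfps n l) = fps_to_fls ((\<Prod>i\<in>{1..n}. 1 - fps_X ^ (4 * wt l i)) * gfps n l)"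
  by (simp add: fls_times_fps_to_fls)
 also have "(\<Prod>i\<in>{1..n}. 1 - fps_X ^ (4 * wt l i)) * gfps n l = 1"
  using weighted_gf[of "{1..n}" "%i. 4 * wt l i"] wt_pos[of _ n l] by (simp add: gfps_def supp_def)
 finally show ?thesis by simp
qed

text \<open>The factor (q)_n of the q-binomial coefficient cancels, leaving the character 1 / ((q)_l
  (q)_{n-l}) of the families.\<close>

lemma qbinom_gfps:
 assumes l: "l \<le> n"
 shows "fls_X ^ (n\<^sup>2) / qpoch n * qbinom n (int l) = fls_X ^ (n\<^sup>2) * fps_to_fls (gfps n l)"
proof -
 have "qpoch n ~= 0" using qpoch_gfps[of n n] by auto
 moreover have "qpoch l * qpoch (n - l) ~= 0" using qpoch_gfps[OF l] by auto
 moreover have "fps_to_fls (gfps n l) = 1 / (qpoch l * qpoch (n - l))"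
  using qpoch_gfps[OF l] calculation(2) by (simp add: eq_divide_eq mult.commute)
 ultimately show ?thesis using l by (simp add: qbinom_def)
qed

lemma qbinom_nth:
 assumes l: "l \<le> n"
 shows "fls_nth (fls_X ^ (n\<^sup>2) / qpoch n * qbinom n (int l)) k = of_nat (pcount n l (of_int k / 4))"
proof -
 let ?r = "k - int (n\<^sup>2)"
 have "of_int k / 4 - of_nat (n\<^sup>2) / 4 = (of_int ?r / of_int 4 :: rat)" by (simp add: diff_divide_distrib)
 \<comment> \<open>Integer division realises the floor in \<open>pdeg\<close>; whether the degree is
   attained becomes divisibility by 4.\<close>
 hence e: "pdeg n (of_int k / 4) = ?r div 4" unfolding pdeg_def by (simp only: floor_divide_of_int_eq)
 have "of_nat (n\<^sup>2) / 4 + of_int (?r div 4) = (of_int k / 4 :: rat) \<longleftrightarrow> of_nat (n\<^sup>2) + 4 * of_int (?r div 4) = (of_int k :: rat)"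
  by (intro iffI) linarith+
 also have "... \<longleftrightarrow> (of_int (int (n\<^sup>2) + 4 * (?r div 4)) = (of_int k :: rat))" by simp
 also have "... \<longleftrightarrow> int (n\<^sup>2) + 4 * (?r div 4) = k" by (rule of_int_eq_iff)
 finally have c: "of_nat (n\<^sup>2) / 4 + of_int (?r div 4) = (of_int k / 4 :: rat) \<longleftrightarrow> 4 * (?r div 4) = ?r" by auto
 have pc: "pcount n l (of_int k / 4) = (if 4 * (?r div 4) = ?r then card (Pset n l (?r div 4)) else 0)"
  unfolding pcount_def e c ..
 have s: "(\<Sum>i\<in>{1..n}. 4 * wt l i * m i) = 4 * (\<Sum>i\<in>{1..n}. wt l i * m i)" for m
  by (simp add: sum_distrib_left mult.assoc)
 have "fls_nth (fls_X ^ (n\<^sup>2) * fps_to_fls (gfps n l)) k = fls_nth (fps_to_fls (gfps n l)) ?r"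
  by (simp add: fls_X_power_times_conv_shift(1))
 also have "... = of_nat (pcount n l (of_int k / 4))"
 proof (cases "4 * (?r div 4) = ?r \<and> 0 \<le> ?r")
  case True
  define t where "t = ?r div 4"
  have t: "?r = 4 * t" "0 \<le> t" using True by (auto simp: t_def)
  have "{m \<in> supp n. (\<Sum>i\<in>{1..n}. 4 * wt l i * m i) = nat ?r} = Pset n l t"
   unfolding Pset_def s t(1) using t(2) by (auto simp del: of_nat_sum of_nat_mult)
  thus ?thesis using True t(2) unfolding pc by (simp add: gfps_def t_def)
 next
  case False
  have "pcount n l (of_int k / 4) = 0"
  proof (cases "4 * (?r div 4) = ?r")
   case True
   hence "?r div 4 < 0" using False by linarith
   hence "Pset n l (?r div 4) = {}" by (auto simp: Pset_def simp del: of_nat_sum of_nat_mult)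
   thus ?thesis unfolding pc by simp
  qed (simp add: pc)
  moreover have "fls_nth (fps_to_fls (gfps n l)) ?r = 0"
  proof (cases "?r < 0")
   case r: False
   have "4 * (\<Sum>i\<in>{1..n}. wt l i * m i) ~= nat ?r" for m
   proof
    assume "4 * (\<Sum>i\<in>{1..n}. wt l i * m i) = nat ?r"
    hence "?r = 4 * int (\<Sum>i\<in>{1..n}. wt l i * m i)" using r by linarith
    hence "4 * (?r div 4) = ?r" by simp
    thus False using False r by simp
   qed
   hence "{m \<in> supp n. (\<Sum>i\<in>{1..n}. 4 * wt l i * m i) = nat ?r} = {}" unfolding s by blast
   hence "card {m \<in> supp n. (\<Sum>i\<in>{1..n}. 4 * wt l i * m i) = nat ?r} = 0" by (simp only: card.empty)
   thus ?thesis by (simp add: gfps_def)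
  qed simp
  ultimately show ?thesis by simp
 qed
 finally show ?thesis unfolding qbinom_gfps[OF l] .
qed

lemma term_nth:
 assumes l: "l \<le> n"
 shows "fls_nth (fls_X ^ (n\<^sup>2) / qpoch n * (qbinom n (int l) - qbinom n (int l - 1))) k =
  of_nat (pcount n l (of_int k / 4)) - of_nat (pprev n l (of_int k / 4))"
proof (cases l)
 case 0
 have "qbinom n (int l - 1) = 0" by (simp add: qbinom_def 0)
 thus ?thesis using qbinom_nth[OF l, of k] by (simp add: pprev_def 0)
next
 case (Suc p)
 have "int l - 1 = int p" using Suc by simp
 thus ?thesis using qbinom_nth[OF l, of k] qbinom_nth[of p n k] l Suc by (simp add: pprev_def right_diff_distrib)
qed

text \<open>For a difference of non-negative subdegree, the distance is 1 / 2 to the power of that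
  subdegree, so agreement up to \<open>N\<close> controls it.\<close>

lemma fls_dist_less:
 assumes "!!k. k \<le> int N ==> fls_nth (f :: rat fls) k = fls_nth g k" "(1 / 2) ^ N < e"
 shows "dist f g < e"
proof (cases "f = g")
 case False
 hence "int N < fls_subdegree (f - g)" using assms(1) by (intro fls_subdegree_greaterI) auto
 hence s: "0 \<le> fls_subdegree (f - g)" "N \<le> nat (fls_subdegree (f - g))" by auto
 have "dist f g = (1 / 2) ^ nat (fls_subdegree (f - g))" using False s(1) by (simp add: dist_fls_def power_one_over inverse_eq_divide)
 also have "... \<le> (1 / 2) ^ N" using s(2) by (intro power_decreasing) auto
 finally show ?thesis using assms(2) by simp
next
 case True
 have "0 < e" by (rule less_trans[OF _ assms(2)]) simp
 thus ?thesis using True by simp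
qed

theorem theorem1:
  fixes i lam :: nat
  assumes "i \<in> {0, 1}"
  shows "has_character (M_graded i lam) \<and>
    ((\<lambda>(n, l). fls_X ^ (n\<^sup>2) / qpoch n * (qbinom n (int l) - qbinom n (int l - 1)))
      has_sum character (M_graded i lam)) (weight_indices i lam)"
proof
 let ?M = "M_graded i lam" and ?I = "weight_indices i lam"
 let ?dim = "%k :: int. vectorspace.dim class_ring (?M (of_int k / 4))"
 have neg: "?dim k = 0" if k: "k < 0" for k
 proof -
  have "Iset i lam (of_int k / 4) = {}"
  proof (rule equals0I)
   fix p assume "p \<in> Iset i lam (of_int k / 4)"
   hence "of_nat ((fst p)\<^sup>2) / 4 \<le> (of_int k / 4 :: rat)" by (simp add: Iset_def)
   moreover have "(0 :: rat) \<le> of_nat ((fst p)\<^sup>2) / 4" by simp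
   moreover have "of_int k / 4 < (0 :: rat)" using k by simp
   ultimately show False by linarith
  qed
  thus ?thesis using M_graded_dim[of i lam "of_int k / 4"] by auto
 qed
 show "has_character ?M" unfolding has_character_def
 proof
  show "\<forall>d. vectorspace class_ring (?M d) \<and> vectorspace.fin_dim class_ring (?M d)"
   using M_graded_dim[of i lam] by blast
  show "\<forall>\<^sub>\<infinity>k::nat. vectorspace.dim class_ring (?M (of_int (- int k) / 4)) = 0"
   unfolding MOST_nat by (intro exI[of _ 0] allI impI neg) simp
 qed
 let ?t = "%(n, l). fls_X ^ (n\<^sup>2) / qpoch n * (qbinom n (int l) - qbinom n (int l - 1))"
 have ch: "fls_nth (character ?M) k = of_nat (?dim k)" for k
  unfolding character_def by (rule nth_Abs_fls_ex_lower_bound) (use neg in auto)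
 have mono: "Iset i lam d \<subseteq> Iset i lam d'" if "d \<le> d'" for d d' using that by (auto simp: Iset_def)
 \<comment> \<open>Every index contributing to a coefficient k \<le> N lies in \<open>Iset\<close>
   for degree N / 4, so a finite \<open>F\<close> containing that set already yields these
   coefficients of the character.\<close>
 have nth: "fls_nth (\<Sum>p\<in>F. ?t p) k = fls_nth (character ?M) k"
  if F: "finite F" "F \<subseteq> ?I" "Iset i lam (of_int (int N) / 4) \<subseteq> F" and k: "k \<le> int N" for F k N
 proof -
  let ?d = "of_int k / 4 :: rat"
  obtain jc where dim: "?dim k = (\<Sum>p\<in>Iset i lam ?d. jc p)"
   and jc: "!!p. p \<in> ?I ==> jc p + pprev (fst p) (snd p) ?d = pcount (fst p) (snd p) ?d"
   using M_graded_dim[of i lam ?d] by blast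
  have "?d \<le> of_int (int N) / 4" using k by (simp add: divide_right_mono)
  hence sub: "Iset i lam ?d \<subseteq> F" using mono F(3) by blast
  have tn: "fls_nth (?t p) k = of_nat (jc p)" if p: "p \<in> ?I" for p
  proof -
   obtain n l where nl: "p = (n, l)" by (cases p)
   have l: "l \<le> n" using weight_le p nl by blast
   have "of_nat (pcount n l ?d) = of_nat (jc p) + (of_nat (pprev n l ?d) :: rat)"
    using jc[OF p] nl by (simp flip: of_nat_add)
   thus ?thesis unfolding nl prod.case term_nth[OF l] by simp
  qed
  have "fls_nth (\<Sum>p\<in>F. ?t p) k = (\<Sum>p\<in>F. of_nat (jc p))"
   unfolding fls_nth_sum by (rule sum.cong[OF refl]) (use tn F(2) in blast)
  also have "... = (\<Sum>p\<in>Iset i lam ?d. of_nat (jc p))"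
  proof (rule sum.mono_neutral_right[OF F(1) sub], rule ballI)
   fix p assume p: "p \<in> F - Iset i lam ?d"
   hence "p \<in> ?I" "p \<notin> Iset i lam ?d" using F(2) by auto
   thus "of_nat (jc p) = (0 :: rat)" using jc[of p] pcount_outside[of p i lam ?d "snd p"] by simp
  qed
  also have "... = fls_nth (character ?M) k" unfolding ch dim by simp
  finally show ?thesis .
 qed
 show "(?t has_sum character ?M) ?I" unfolding has_sum_def tendsto_iff
 proof (intro allI impI)
  fix e :: real assume e: "0 < e"
  obtain N where N: "(1 / 2 :: real) ^ N < e" using real_arch_pow_inv[OF e, of "1 / 2"] by auto
  show "\<forall>\<^sub>F F in finite_subsets_at_top ?I. dist (sum ?t F) (character ?M) < e"
   unfolding eventually_finite_subsets_at_top
  proof (intro exI[of _ "Iset i lam (of_int (int N) / 4)"] conjI allI impI finite_Iset)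
   show "Iset i lam (of_int (int N) / 4) \<subseteq> ?I" by (auto simp: Iset_def)
   fix F assume F: "finite F \<and> Iset i lam (of_int (int N) / 4) \<subseteq> F \<and> F \<subseteq> ?I"
   show "dist (sum ?t F) (character ?M) < e" by (rule fls_dist_less[OF _ N]) (use nth[of F N] F in blast)
  qed
 qed
qed

end
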